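(* Let $\alpha\in(0,2)$, let $S\subset\mathbb{R}^d$ be Borel measurable, let $\dot W^\alpha$ be a symmetric $\alpha$-stable Lévy white noise on $S$, and let $\mathcal{L}$ be a partial differential operator on $\mathbb{R}^d$ with a fixed fundamental solution $\rho\in\mathcal{D}'(\mathbb{R}^d)$. Assume that for any $\varphi\in\mathcal{D}(\mathbb{R}^d)$ the convolution $\varphi*\check\rho$ belongs to $L^\alpha(S)$. Let $u_{\text{gen}}$ be the generalized solution to $\mathcal{L}u=\dot W^\alpha$, defined by $\langle u_{\text{gen}},\varphi\rangle=\langle\dot W^\alpha,\varphi*\check\rho\rangle$, $\varphi\in\mathcal{D}(\mathbb{R}^d)$. Suppose that $u_{\text{gen}}$ has a random field representation $Y$, that is, there exists a jointly measurable random field $(Y_t)_{t\in\mathbb{R}^d}$ such that $Y$ has almost surely locally integrable sample paths, and for any $\varphi\in\mathcal{D}(\mathbb{R}^d)$, $$\langle u_{\text{gen}},\varphi\rangle=\int_{\mathbb{R}^d}Y_t\,\varphi(t)\,\mathrm{d}t\qquad\text{a.s.}$$ Then, for almost all $t\in\mathbb{R}^d$, $\rho(t-\cdot)\in L^\alpha(S)$, and for almost all $t\in\mathbb{R}^d$, $$Y_t=\langle\dot W^\alpha,\rho(t-\cdot)\rangle=u_{\text{mild}}(t)\qquad\text{a.s.}$$ Furthermore, for any $\psi\in\mathcal{D}(\mathbb{R}^d)$, with $\mu_\psi(\mathrm{d}t)=|\psi(t)|\,\mathrm{d}t$: if $\alpha>1$, $$\int_{\mathbb{R}^d}\left(\int_S|\rho(t-s)|^\alpha\,\mathrm{d}s\right)^{1/\alpha}\mu_\psi(\mathrm{d}t)<+\infty;$$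 if $\alpha=1$, $$\int_{\mathbb{R}^d}\mu_\psi(\mathrm{d}t)\int_S\mathrm{d}s\,|\rho(t-s)|\left[1+\log_+\left(\frac{|\rho(t-s)|\int_{\mathbb{R}^d}\mu_\psi(\mathrm{d}r)\int_S\mathrm{d}v\,|\rho(r-v)|}{\left(\int_S|\rho(t-v)|\,\mathrm{d}v\right)\left(\int_{\mathbb{R}^d}|\rho(r-s)|\,\mu_\psi(\mathrm{d}r)\right)}\right)\right]<+\infty;$$ if $\alpha<1$, $$\int_S\left(\int_{\mathbb{R}^d}|\rho(t-s)|\,\mu_\psi(\mathrm{d}t)\right)^\alpha\mathrm{d}s<+\infty.$$
   Context: $\mathcal{D}(\mathbb{R}^d)$ is the space of (real-valued) $C^\infty$ compactly supported functions and $\mathcal{D}'(\mathbb{R}^d)$ the space of Schwartz distributions. A fundamental solution of $\mathcal{L}$ is a distribution $\rho\in\mathcal{D}'(\mathbb{R}^d)$ with $\mathcal{L}\rho=\delta_0$; one choice of $\rho$ is fixed. For $\varphi\in\mathcal{D}(\mathbb{R}^d)$, $\check\varphi(t)=\varphi(-t)$, $\langle\check\rho,\varphi\rangle=\langle\rho,\check\varphi\rangle$, and $(\varphi*\check\rho)(s)=\langle\rho,\varphi(s+\cdot)\rangle$, a $C^\infty$ function of $s$ (restricted to $S$ when integrated against the noise). Write $\log_+=\max(\log,0)$. For $\alpha\in(0,2)$, $L^\alpha(S)$ is the set of measurable $f$ with $\int_S|f(s)|^\alpha\,\mathrm{d}s<\infty$. Symmetric $\alpha$-stable Lévy white noise: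 $\dot W^\alpha$ is an independently scattered symmetric $\alpha$-stable random measure on $S$, with characteristic function $\mathbb{E}(e^{iu\dot W^\alpha(A)})=\exp(-\mathrm{Leb}_d(A)|u|^\alpha)$, $u\in\mathbb{R}$, for Borel $A\subset S$ of finite Lebesgue measure; the noise is nontrivial, i.e. $\mathrm{Leb}_d(S)>0$. A deterministic measurable function $f$ is integrable with respect to $\dot W^\alpha$ iff $f\in L^\alpha(S)$; the integral is denoted $\langle\dot W^\alpha,f\rangle$, it is almost surely linear in $f$, and $\mathbb{E}(e^{i\langle\dot W^\alpha,f\rangle})=\exp(-\int_S|f(s)|^\alpha\,\mathrm{d}s)$. The assertion "$\rho(t-\cdot)\in L^\alpha(S)$ for almost all $t$" includes the assertion that the distribution $\rho$ is represented by a (measurable, locally integrable) function on $\mathbb{R}^d$, still denoted $\rho$. The mild solution is $u_{\text{mild}}(t):=\langle\dot W^\alpha,\rho(t-\cdot)\rangle$, for those $t$ with $\rho(t-\cdot)\in L^\alpha(S)$. In the condition for $\alpha=1$, the integrand is taken to be $0$ where $\rho(t-s)=0$. *)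

theory Defs
  imports "HOL-Probability.Probability"
begin

section \<open>Test functions, distributions and differential operators\<close>

text \<open>The Euclidean space is an arbitrary type of class \<^class>\<open>euclidean_space\<close> (for instance
  \<open>real ^ 'd\<close>). A list of basis vectors \<open>[b\<^sub>1, \<dots>, b\<^sub>k]\<close> encodes the iterated partial derivative
  \<open>\<partial>b\<^sub>1 \<dots> \<partial>b\<^sub>k\<close>. It plays the role of a multi-index, since the order is irrelevant for smooth
  functions. \<^const>\<open>frechet_derivative\<close> is arbitrary where the function is not differentiable,
  but \<open>smooth\<close> requires every derivative to exist at every stage.\<close>

fun partials :: "'a::euclidean_space list \<Rightarrow> ('a \<Rightarrow> real) \<Rightarrow> 'a \<Rightarrow> real" where
  "partials [] f = f"
| "partials (b # bs) f = (\<lambda>x. frechet_derivative (partials bs f) (at x) b)"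

definition smooth :: "('a::euclidean_space \<Rightarrow> real) \<Rightarrow> bool" where
  "smooth f \<longleftrightarrow> (\<forall>bs x. set bs \<subseteq> Basis \<longrightarrow> partials bs f differentiable (at x))"

definition test_functions :: "('a::euclidean_space \<Rightarrow> real) set" where
  "test_functions = {\<phi>. smooth \<phi> \<and> compact (closure {x. \<phi> x \<noteq> 0})}"

text \<open>A distribution is a functional whose values matter on \<open>test_functions\<close> only; there
  it is linear and continuous, in the sense of the usual seminorm estimates.
  The suprema are finite, because derivatives of test functions are bounded.\<close>

definition distribution :: "(('a::euclidean_space \<Rightarrow> real) \<Rightarrow> real) \<Rightarrow> bool" where
  "distribution \<rho> \<longleftrightarrow>
     (\<forall>\<phi>\<in>test_functions. \<forall>\<psi>\<in>test_functions. \<rho> (\<lambda>x. \<phi> x + \<psi> x) = \<rho> \<phi> + \<rho> \<psi>) \<and>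
     (\<forall>\<phi>\<in>test_functions. \<forall>c. \<rho> (\<lambda>x. c * \<phi> x) = c * \<rho> \<phi>) \<and>
     (\<forall>K. compact K \<longrightarrow> (\<exists>C k. \<forall>\<phi>\<in>test_functions. closure {x. \<phi> x \<noteq> 0} \<subseteq> K \<longrightarrow>
        \<bar>\<rho> \<phi>\<bar> \<le> C * (\<Sum>bs | set bs \<subseteq> Basis \<and> length bs \<le> k. SUP x. \<bar>partials bs \<phi> x\<bar>)))"

text \<open>The linear operator \<open>L f = (\<Sum>bs\<in>I. a bs * partials bs f)\<close> with smooth coefficients is given by
  its finite index set \<open>I\<close> and its coefficient functions \<open>a\<close>; operators with constant
  coefficients are included.\<close>

definition partial_diff_op :: "'a::euclidean_space list set \<Rightarrow> ('a list \<Rightarrow> 'a \<Rightarrow> real) \<Rightarrow> bool" where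
  "partial_diff_op I a \<longleftrightarrow> finite I \<and> (\<forall>bs\<in>I. set bs \<subseteq> Basis \<and> smooth (a bs))"

definition pdo_transpose ::
    "'a::euclidean_space list set \<Rightarrow> ('a list \<Rightarrow> 'a \<Rightarrow> real) \<Rightarrow> ('a \<Rightarrow> real) \<Rightarrow> 'a \<Rightarrow> real" where
  "pdo_transpose I a \<phi> = (\<lambda>x. \<Sum>bs\<in>I. (- 1) ^ length bs * partials bs (\<lambda>y. a bs y * \<phi> y) x)"

text \<open>The distribution \<open>L \<rho>\<close>, that is, \<open>\<phi> \<mapsto> \<langle>\<rho>, L\<^sup>t \<phi>\<rangle>\<close>.\<close>

definition pdo_distr ::
    "'a::euclidean_space list set \<Rightarrow> ('a list \<Rightarrow> 'a \<Rightarrow> real) \<Rightarrow>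
     (('a \<Rightarrow> real) \<Rightarrow> real) \<Rightarrow> ('a \<Rightarrow> real) \<Rightarrow> real" where
  "pdo_distr I a \<rho> = (\<lambda>\<phi>. \<rho> (pdo_transpose I a \<phi>))"

definition fundamental_solution ::
    "'a::euclidean_space list set \<Rightarrow> ('a list \<Rightarrow> 'a \<Rightarrow> real) \<Rightarrow> (('a \<Rightarrow> real) \<Rightarrow> real) \<Rightarrow> bool" where
  "fundamental_solution I a \<rho> \<longleftrightarrow>
     distribution \<rho> \<and> (\<forall>\<phi>\<in>test_functions. pdo_distr I a \<rho> \<phi> = \<phi> 0)"

text \<open>The function \<open>\<phi> * \<rho>\<^sup>\<or>\<close>, where \<open>\<rho>\<^sup>\<or>\<close> is the reflection of \<open>\<rho>\<close>.\<close>

definition conv_reflected ::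
    "('a::euclidean_space \<Rightarrow> real) \<Rightarrow> (('a \<Rightarrow> real) \<Rightarrow> real) \<Rightarrow> 'a \<Rightarrow> real" where
  "conv_reflected \<phi> \<rho> = (\<lambda>s. \<rho> (\<lambda>r. \<phi> (s + r)))"

definition locally_integrable :: "('a::euclidean_space \<Rightarrow> real) \<Rightarrow> bool" where
  "locally_integrable f \<longleftrightarrow> (\<forall>K. compact K \<longrightarrow> set_integrable lborel K f)"

definition represented_by ::
    "(('a::euclidean_space \<Rightarrow> real) \<Rightarrow> real) \<Rightarrow> ('a \<Rightarrow> real) \<Rightarrow> bool" where
  "represented_by \<rho> r \<longleftrightarrow> r \<in> borel_measurable borel \<and> locally_integrable r \<and>
     (\<forall>\<phi>\<in>test_functions. \<rho> \<phi> = (\<integral>x. r x * \<phi> x \<partial>lborel))"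


section \<open>Symmetric stable noise and its integral\<close>

definition L_space :: "real \<Rightarrow> 'a::euclidean_space set \<Rightarrow> ('a \<Rightarrow> real) set" where
  "L_space \<alpha> S = {f. set_borel_measurable lborel S f \<and>
     (\<integral>\<^sup>+s\<in>S. ennreal (\<bar>f s\<bar> powr \<alpha>) \<partial>lborel) < \<infinity>}"

definition finite_borel_subsets :: "'a::euclidean_space set \<Rightarrow> 'a set set" where
  "finite_borel_subsets S = {A \<in> sets borel. A \<subseteq> S \<and> emeasure lborel A < \<infinity>}"

text \<open>The three conditions after measurability: independent scattering, almost sure countable
  additivity, and the symmetric \<open>\<alpha>\<close>-stable law of each \<open>W A\<close>.\<close>

definition stable_white_noise ::
    "'w measure \<Rightarrow> real \<Rightarrow> 'a::euclidean_space set \<Rightarrow> ('a set \<Rightarrow> 'w \<Rightarrow> real) \<Rightarrow> bool" where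
  "stable_white_noise M \<alpha> S W \<longleftrightarrow>
     (\<forall>A\<in>finite_borel_subsets S. W A \<in> borel_measurable M) \<and>
     (\<forall>A :: nat \<Rightarrow> 'a set. range A \<subseteq> finite_borel_subsets S \<longrightarrow> disjoint_family A \<longrightarrow>
        prob_space.indep_vars M (\<lambda>_. borel) (\<lambda>n. W (A n)) UNIV) \<and>
     (\<forall>A :: nat \<Rightarrow> 'a set. range A \<subseteq> finite_borel_subsets S \<longrightarrow> disjoint_family A \<longrightarrow>
        (\<Union>n. A n) \<in> finite_borel_subsets S \<longrightarrow>
        (AE \<omega> in M. (\<lambda>n. W (A n) \<omega>) sums W (\<Union>n. A n) \<omega>)) \<and>
     (\<forall>A\<in>finite_borel_subsets S. \<forall>u.
        char (distr M borel (W A)) u = complex_of_real (exp (- measure lborel A * \<bar>u\<bar> powr \<alpha>)))"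

text \<open>A list of pairs \<open>(c, A)\<close> stands for the simple function \<open>\<Sum> c 1\<^sub>A\<close>, whose integral
  is \<open>\<Sum> c W A\<close>.\<close>

definition simple_fun :: "(real \<times> 'a set) list \<Rightarrow> 'a \<Rightarrow> real" where
  "simple_fun g = (\<lambda>s. \<Sum>(c, A)\<leftarrow>g. c * indicator A s)"

definition simple_integral ::
    "('a set \<Rightarrow> 'w \<Rightarrow> real) \<Rightarrow> (real \<times> 'a set) list \<Rightarrow> 'w \<Rightarrow> real" where
  "simple_integral W g = (\<lambda>\<omega>. \<Sum>(c, A)\<leftarrow>g. c * W A \<omega>)"

definition tendsto_in_prob :: "'w measure \<Rightarrow> (nat \<Rightarrow> 'w \<Rightarrow> real) \<Rightarrow> ('w \<Rightarrow> real) \<Rightarrow> bool" where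
  "tendsto_in_prob M X Z \<longleftrightarrow>
     (\<forall>\<epsilon>>0. (\<lambda>n. measure M {\<omega> \<in> space M. \<bar>X n \<omega> - Z \<omega>\<bar> > \<epsilon>}) \<longlonglongrightarrow> 0)"

definition has_noise_integral ::
    "'w measure \<Rightarrow> real \<Rightarrow> 'a::euclidean_space set \<Rightarrow> ('a set \<Rightarrow> 'w \<Rightarrow> real) \<Rightarrow>
     ('a \<Rightarrow> real) \<Rightarrow> ('w \<Rightarrow> real) \<Rightarrow> bool" where
  "has_noise_integral M \<alpha> S W f X \<longleftrightarrow>
     f \<in> L_space \<alpha> S \<and> X \<in> borel_measurable M \<and>
     (\<exists>g. (\<forall>n. snd ` set (g n) \<subseteq> finite_borel_subsets S) \<and>
          (\<lambda>n. \<integral>\<^sup>+s\<in>S. ennreal (\<bar>f s - simple_fun (g n) s\<bar> powr \<alpha>) \<partial>lborel) \<longlonglongrightarrow> 0 \<and>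
          tendsto_in_prob M (\<lambda>n. simple_integral W (g n)) X)"

text \<open>The random variable \<open>\<langle>W, f\<rangle>\<close> for \<open>f\<close> in \<open>L_space \<alpha> S\<close>, determined up to
  null sets, of which one version is chosen. It is unspecified for other \<open>f\<close>.\<close>

definition noise_integral ::
    "'w measure \<Rightarrow> real \<Rightarrow> 'a::euclidean_space set \<Rightarrow> ('a set \<Rightarrow> 'w \<Rightarrow> real) \<Rightarrow>
     ('a \<Rightarrow> real) \<Rightarrow> 'w \<Rightarrow> real" where
  "noise_integral M \<alpha> S W f = (SOME X. has_noise_integral M \<alpha> S W f X)"


section \<open>Generalized and mild solutions\<close>

definition gen_solution ::
    "'w measure \<Rightarrow> real \<Rightarrow> 'a::euclidean_space set \<Rightarrow> ('a set \<Rightarrow> 'w \<Rightarrow> real) \<Rightarrow>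
     (('a \<Rightarrow> real) \<Rightarrow> real) \<Rightarrow> ('a \<Rightarrow> real) \<Rightarrow> 'w \<Rightarrow> real" where
  "gen_solution M \<alpha> S W \<rho> \<phi> = noise_integral M \<alpha> S W (conv_reflected \<phi> \<rho>)"

text \<open>Here \<open>r\<close> is a function representing the fundamental solution.\<close>

definition mild_solution ::
    "'w measure \<Rightarrow> real \<Rightarrow> 'a::euclidean_space set \<Rightarrow> ('a set \<Rightarrow> 'w \<Rightarrow> real) \<Rightarrow>
     ('a \<Rightarrow> real) \<Rightarrow> 'a \<Rightarrow> 'w \<Rightarrow> real" where
  "mild_solution M \<alpha> S W r t = noise_integral M \<alpha> S W (\<lambda>s. r (t - s))"

definition random_field_representation ::
    "'w measure \<Rightarrow> (('a::euclidean_space \<Rightarrow> real) \<Rightarrow> 'w \<Rightarrow> real) \<Rightarrow> ('a \<Rightarrow> 'w \<Rightarrow> real) \<Rightarrow> bool" where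
  "random_field_representation M u Y \<longleftrightarrow>
     (\<lambda>(t, \<omega>). Y t \<omega>) \<in> borel_measurable (lborel \<Otimes>\<^sub>M M) \<and>
     (AE \<omega> in M. locally_integrable (\<lambda>t. Y t \<omega>)) \<and>
     (\<forall>\<phi>\<in>test_functions. AE \<omega> in M. u \<phi> \<omega> = (\<integral>t. Y t \<omega> * \<phi> t \<partial>lborel))"


section \<open>Integrability conditions\<close>

definition weighted_lborel :: "('a::euclidean_space \<Rightarrow> real) \<Rightarrow> 'a measure" where
  "weighted_lborel \<psi> = density lborel (\<lambda>t. ennreal \<bar>\<psi> t\<bar>)"

text \<open>Powers with positive exponent on \<open>[0, \<infinity>]\<close>, with \<open>\<infinity>\<close> mapped to \<open>\<infinity>\<close>.\<close>

definition ennreal_powr :: "ennreal \<Rightarrow> real \<Rightarrow> ennreal" where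
  "ennreal_powr x p = (if x = \<infinity> then \<infinity> else ennreal (enn2real x powr p))"

text \<open>Note \<open>ln 0 = 0\<close>, so that \<open>log_plus 0 = 0\<close>.\<close>

definition log_plus :: "ennreal \<Rightarrow> ennreal" where
  "log_plus x = (if x = \<infinity> then \<infinity> else ennreal (max 0 (ln (enn2real x))))"

definition condition_gt_1 ::
    "real \<Rightarrow> 'a::euclidean_space set \<Rightarrow> ('a \<Rightarrow> real) \<Rightarrow> ('a \<Rightarrow> real) \<Rightarrow> bool" where
  "condition_gt_1 \<alpha> S r \<psi> \<longleftrightarrow>
     (\<integral>\<^sup>+t. ennreal_powr (\<integral>\<^sup>+s\<in>S. ennreal (\<bar>r (t - s)\<bar> powr \<alpha>) \<partial>lborel) (1 / \<alpha>) \<partial>weighted_lborel \<psi>) < \<infinity>"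

text \<open>The conventions of \<^typ>\<open>ennreal\<close> for quotients with zero or infinite terms do not affect this
  condition. As the bracket is at least 1, the left-hand side is at least \<open>total\<close>, so it is
  infinite when \<open>total\<close> is. Otherwise both factors of the denominator are finite almost
  everywhere, and where one of them vanishes, \<open>r (t - s) = 0\<close> for almost all \<open>(t, s)\<close>.\<close>

definition condition_eq_1 ::
    "'a::euclidean_space set \<Rightarrow> ('a \<Rightarrow> real) \<Rightarrow> ('a \<Rightarrow> real) \<Rightarrow> bool" where
  "condition_eq_1 S r \<psi> \<longleftrightarrow>
     (let \<mu> = weighted_lborel \<psi>;
          total = (\<integral>\<^sup>+t. (\<integral>\<^sup>+v\<in>S. ennreal \<bar>r (t - v)\<bar> \<partial>lborel) \<partial>\<mu>)
      in (\<integral>\<^sup>+t. (\<integral>\<^sup>+s\<in>S.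
            (if r (t - s) = 0 then 0
             else ennreal \<bar>r (t - s)\<bar> *
               (1 + log_plus ((ennreal \<bar>r (t - s)\<bar> * total) /
                  ((\<integral>\<^sup>+v\<in>S. ennreal \<bar>r (t - v)\<bar> \<partial>lborel) * (\<integral>\<^sup>+x. ennreal \<bar>r (x - s)\<bar> \<partial>\<mu>)))))
          \<partial>lborel) \<partial>\<mu>) < \<infinity>)"

definition condition_lt_1 ::
    "real \<Rightarrow> 'a::euclidean_space set \<Rightarrow> ('a \<Rightarrow> real) \<Rightarrow> ('a \<Rightarrow> real) \<Rightarrow> bool" where
  "condition_lt_1 \<alpha> S r \<psi> \<longleftrightarrow>
     (\<integral>\<^sup>+s\<in>S. ennreal_powr (\<integral>\<^sup>+t. ennreal \<bar>r (t - s)\<bar> \<partial>weighted_lborel \<psi>) \<alpha> \<partial>lborel) < \<infinity>"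

end

theory Submission
  imports Defs
begin

text \<open>Mollifying \<open>Y\<close> by test functions gives fields \<open>Z k t\<close>, continuous in \<open>t\<close>, with \<open>Z k t = \<langle>W, kern k (t - \<cdot>)\<rangle>\<close> for
  every \<open>t\<close>, where \<open>kern k\<close> is the mollified fundamental solution, and \<open>Z k\<close> tends to \<open>Y\<close> locally in \<open>L\<^sup>1\<close>. The norm
  \<open>\<integral>\<bar>Z k t\<bar> \<mu>(dt)\<close> of such a path is a limit of norms of sums of independent symmetric vectors. Flipping signs
  as in Levy's inequality, one sees that the noise contributed near a point \<open>s\<close>, whose size is
  \<open>\<integral>\<bar>kern k (t - s)\<bar> \<mu>(dt)\<close>, is not large if the path norm is not; since stable tails decay like \<open>x powr - \<alpha>\<close>,
  this bounds \<open>\<integral>\<^sub>S (\<integral>\<bar>kern k (t - s)\<bar> \<mu>(dt)) powr \<alpha> ds\<close> by a quantile of the path norm. Applied to increments along a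
  fast subsequence and at one point \<open>s\<close> of the set \<open>S\<close> of positive measure, the bound makes \<open>kern k\<close> converge locally in \<open>L\<^sup>1\<close>,
  to a function \<open>r\<close> that represents \<open>\<rho>\<close>. For almost every \<open>t\<close> the integrals \<open>Z k t\<close> converge in probability to \<open>Y t\<close>,
  so their kernels converge in \<open>L\<^sup>\<alpha>(S)\<close>, necessarily to \<open>r (t - \<cdot>)\<close>.

  The case \<open>\<alpha> < 1\<close> is the limit of the bound above. For \<open>\<alpha> > 1\<close>, on an event of probability close to 1 the path
  norm is bounded, while there \<open>\<bar>Y t\<bar>\<close> still exceeds its scale with probability bounded below, so that the scales
  are \<open>\<mu>\<close>-integrable. For \<open>\<alpha> = 1\<close> one truncates \<open>Y t\<close> in the same way, but the truncated mean now receives a contribution from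
  every \<open>s\<close> whose noise may be as large as the path norm permits, and the range of these values, on a logarithmic
  scale, is the logarithm in the condition.\<close>


section \<open>Smooth bump functions\<close>

text \<open>The representation of \<open>u_gen\<close> by Y holds against each test function outside
  its own null set, and at the start no kernel exists that could be integrated at a fixed t.
  Mollification resolves both difficulties: for continuous fields a countable set of nodes t decides
  everything, and the exchange of noise integral and Lebesgue integral is proved, not assumed, as a
  limit of Riemann sums. Every bound is first shown for finitely many integrals of simple functions
  over one common partition, where the noise has independent values, and is then carried through
  limits in which Fatou's lemma acts on the kernels and convergence in probability on the paths.
  Moments cannot be used: a nonzero stable variable has none of order \<alpha>, and of the path norm
  only finiteness is known. All bounds are therefore conditional on the norm exceeding a level with
  small probability. The constants stem from one identity: averaging a stable characteristic
  function over a Gaussian argument gives the mean of a bounded function of the variable, which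
  yields upper and lower tail bounds without densities.\<close>

definition flat :: "real poly \<Rightarrow> real \<Rightarrow> real" where
  "flat p x = (if 0 < x then poly p (inverse x) * exp (- inverse x) else 0)"

lemma poly_div_exp_tendsto_0: "((\<lambda>x::real. poly p x / exp x) \<longlongrightarrow> 0) at_top"
proof -
  have "((\<lambda>x::real. \<Sum>i\<le>degree p. coeff p i * (x ^ i / exp x)) \<longlongrightarrow> (\<Sum>i\<le>degree p. coeff p i * 0)) at_top"
    by (intro tendsto_sum tendsto_mult tendsto_const tendsto_power_div_exp_0)
  then show ?thesis
    by (simp add: poly_altdef sum_divide_distrib)
qed

lemma flat_tendsto_0: "(flat p \<longlongrightarrow> 0) (at_right 0)"
proof -
  have "((\<lambda>x. poly p (inverse x) / exp (inverse x)) \<longlongrightarrow> 0) (at_right (0::real))"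
    using poly_div_exp_tendsto_0 filterlim_inverse_at_top_right by (rule filterlim_compose)
  moreover have "\<forall>\<^sub>F x in at_right (0::real). poly p (inverse x) / exp (inverse x) = flat p x"
    unfolding eventually_at_right_field flat_def by (intro exI[of _ 1]) (auto simp: exp_minus divide_inverse)
  ultimately show ?thesis
    using filterlim_cong by force
qed

text \<open>The polynomial parameter makes the family closed under differentiation: the derivative
  -1/x^2 of 1/x contributes the factor \<open>[:0, 0, 1:]\<close> in the variable 1/x. At the origin
  the difference quotient from the right is again a member of the family, with polynomial
  \<open>pCons 0 p\<close>, and tends to 0.\<close>

lemma flat_DERIV: "(flat p has_real_derivative flat ([:0, 0, 1:] * (p - pderiv p)) x) (at x)"
proof (cases x "0::real" rule: linorder_cases)
  case less
  have "((\<lambda>x. 0) has_real_derivative 0) (at x)" by simp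
  moreover have "\<forall>\<^sub>F y in nhds x. flat p y = 0"
    using less eventually_nhds_in_open[of "{..<0}" x] by (auto simp: flat_def elim: eventually_mono)
  ultimately show ?thesis
    using less by (subst DERIV_cong_ev[OF refl _ refl, where g = "\<lambda>_. 0"]) (auto simp: flat_def)
next
  case greater
  have "((\<lambda>x. poly p (inverse x) * exp (- inverse x)) has_real_derivative
     flat ([:0, 0, 1:] * (p - pderiv p)) x) (at x)"
    using greater
    by (auto intro!: derivative_eq_intros DERIV_chain'[OF _ poly_DERIV] simp: flat_def algebra_simps power2_eq_square)
  moreover have "\<forall>\<^sub>F y in nhds x. flat p y = poly p (inverse y) * exp (- inverse y)"
    using greater eventually_nhds_in_open[of "{0<..}" x] by (auto simp: flat_def elim: eventually_mono)
  ultimately show ?thesis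
    by (subst DERIV_cong_ev[OF refl _ refl])
next
  case equal
  have "((\<lambda>h. (flat p h - flat p 0) / (h - 0)) \<longlongrightarrow> 0) (at 0)"
  proof (rule filterlim_split_at_real)
    have "((\<lambda>h. 0::real) \<longlongrightarrow> 0) (at_left 0)" by simp
    moreover have "\<forall>\<^sub>F h in at_left (0::real). 0 = (flat p h - flat p 0) / (h - 0)"
      unfolding eventually_at_left_field flat_def by (intro exI[of _ "-1"]) auto
    ultimately show "((\<lambda>h. (flat p h - flat p 0) / (h - 0)) \<longlongrightarrow> 0) (at_left 0)"
      by (rule Lim_transform_eventually)
    have "\<forall>\<^sub>F h in at_right (0::real). flat (pCons 0 p) h = (flat p h - flat p 0) / (h - 0)"
      unfolding eventually_at_right_field flat_def by (intro exI[of _ 1]) (auto simp: field_simps)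
    with flat_tendsto_0 show "((\<lambda>h. (flat p h - flat p 0) / (h - 0)) \<longlongrightarrow> 0) (at_right 0)"
      by (rule Lim_transform_eventually)
  qed
  then show ?thesis
    using equal by (simp add: has_field_derivative_iff) (simp add: flat_def)
qed

text \<open>An algebra of functions that is closed under directional derivatives. Membership
  therefore gives smoothness at once, with no formula for the iterated partial derivatives of a
  product of bumps.\<close>

inductive_set flat_algebra :: "('a::euclidean_space \<Rightarrow> real) set" where
  affine: "(\<lambda>x. flat p (u \<bullet> x + h)) \<in> flat_algebra"
| const: "(\<lambda>x. c) \<in> flat_algebra"
| add: "f \<in> flat_algebra \<Longrightarrow> g \<in> flat_algebra \<Longrightarrow> (\<lambda>x. f x + g x) \<in> flat_algebra"
| mult: "f \<in> flat_algebra \<Longrightarrow> g \<in> flat_algebra \<Longrightarrow> (\<lambda>x. f x * g x) \<in> flat_algebra"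

lemma flat_algebra_prod:
  "finite A \<Longrightarrow> (\<And>i. i \<in> A \<Longrightarrow> f i \<in> flat_algebra) \<Longrightarrow> (\<lambda>x. \<Prod>i\<in>A. f i x) \<in> flat_algebra"
  by (induction A rule: finite_induct) (auto intro: flat_algebra.intros)

lemma flat_algebra_has_derivative:
  "f \<in> flat_algebra \<Longrightarrow>
     \<exists>f'. (\<forall>x. (f has_derivative (\<lambda>v. f' v x)) (at x)) \<and> (\<forall>v. f' v \<in> flat_algebra)"
proof (induction rule: flat_algebra.induct)
  case (affine p u h)
  let ?p' = "[:0, 0, 1:] * (p - pderiv p)"
  have "((\<lambda>x. flat p (u \<bullet> x + h)) has_derivative (\<lambda>v. (u \<bullet> v) * flat ?p' (u \<bullet> x + h))) (at x)" for x
    by (rule DERIV_compose_FDERIV[OF flat_DERIV]) (auto intro!: derivative_eq_intros)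
  moreover have "(\<lambda>x. (u \<bullet> v) * flat ?p' (u \<bullet> x + h)) \<in> flat_algebra" for v
    by (intro flat_algebra.intros)
  ultimately show ?case
    by (intro exI[of _ "\<lambda>v x. (u \<bullet> v) * flat ?p' (u \<bullet> x + h)"]) blast
next
  case (const c)
  show ?case
    by (rule exI[of _ "\<lambda>v x. 0"]) (auto intro: flat_algebra.const)
next
  case (add f g)
  then obtain f' g' where "\<forall>x. (f has_derivative (\<lambda>v. f' v x)) (at x)" "\<forall>v. f' v \<in> flat_algebra"
    "\<forall>x. (g has_derivative (\<lambda>v. g' v x)) (at x)" "\<forall>v. g' v \<in> flat_algebra" by blast
  then show ?case
    by (intro exI[of _ "\<lambda>v x. f' v x + g' v x"]) (auto intro: flat_algebra.add has_derivative_add)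
next
  case (mult f g)
  then obtain f' g' where "\<forall>x. (f has_derivative (\<lambda>v. f' v x)) (at x)" "\<forall>v. f' v \<in> flat_algebra"
    "\<forall>x. (g has_derivative (\<lambda>v. g' v x)) (at x)" "\<forall>v. g' v \<in> flat_algebra" by blast
  with mult.hyps show ?case
    by (intro exI[of _ "\<lambda>v x. f x * g' v x + f' v x * g x"])
      (auto intro!: flat_algebra.add flat_algebra.mult has_derivative_mult)
qed

lemma flat_algebra_smooth:
  assumes "f \<in> flat_algebra"
  shows "smooth f"
proof -
  have "partials bs f \<in> flat_algebra" for bs
  proof (induction bs)
    case (Cons b bs)
    then obtain f' where f': "\<forall>x. (partials bs f has_derivative (\<lambda>v. f' v x)) (at x)" "\<forall>v. f' v \<in> flat_algebra"
      using flat_algebra_has_derivative by blast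
    have "partials (b # bs) f = f' b"
      using fun_cong[OF frechet_derivative_at[OF f'(1)[rule_format]], of b] by (auto simp: fun_eq_iff)
    then show ?case using f' by simp
  qed (use assms in simp)
  then show ?thesis
    unfolding smooth_def differentiable_def using flat_algebra_has_derivative by blast
qed


section \<open>Test functions\<close>

lemma partials_shift:
  assumes "smooth f" "set bs \<subseteq> Basis"
  shows "partials bs (\<lambda>x. f (x + z)) = (\<lambda>x. partials bs f (x + z))"
  using assms(2)
proof (induction bs)
  case (Cons b bs)
  have "((\<lambda>x. partials bs f (x + z)) has_derivative frechet_derivative (partials bs f) (at (x + z))) (at x)" for x
  proof -
    have "(partials bs f has_derivative frechet_derivative (partials bs f) (at (x + z))) (at (x + z))"
      using assms Cons.prems by (auto simp: smooth_def frechet_derivative_works[symmetric])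
    then show ?thesis
      by (intro has_derivative_compose[of "\<lambda>x. x + z" "\<lambda>v. v" x UNIV "partials bs f"])
        (auto intro!: derivative_eq_intros)
  qed
  then have "frechet_derivative (\<lambda>x. partials bs f (x + z)) (at x) = frechet_derivative (partials bs f) (at (x + z))" for x
    by (metis frechet_derivative_at)
  then show ?case using Cons by auto
qed simp

lemma partials_linear_combination:
  assumes "smooth f" "smooth g" "set bs \<subseteq> Basis"
  shows "partials bs (\<lambda>x. c * f x + d * g x) = (\<lambda>x. c * partials bs f x + d * partials bs g x)"
  using assms(3)
proof (induction bs)
  case (Cons b bs)
  have "((\<lambda>x. c * partials bs f x + d * partials bs g x) has_derivative
     (\<lambda>v. c * frechet_derivative (partials bs f) (at x) v + d * frechet_derivative (partials bs g) (at x) v)) (at x)" for x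
    using assms Cons.prems
    by (intro derivative_intros) (auto simp: smooth_def frechet_derivative_works[symmetric])
  then have "frechet_derivative (\<lambda>x. c * partials bs f x + d * partials bs g x) (at x) b =
     c * frechet_derivative (partials bs f) (at x) b + d * frechet_derivative (partials bs g) (at x) b" for x
    by (subst frechet_derivative_at[symmetric, of _ _ x]) auto
  moreover have "partials bs (\<lambda>x. c * f x + d * g x) = (\<lambda>x. c * partials bs f x + d * partials bs g x)"
    using Cons by simp
  ultimately show ?case
    by simp
qed simp

lemma smooth_shift: "smooth f \<Longrightarrow> smooth (\<lambda>x. f (x + z))"
  unfolding smooth_def
proof safe
  fix bs :: "'a list" and x assume *: "\<forall>bs x. set bs \<subseteq> Basis \<longrightarrow> partials bs f differentiable at x" "set bs \<subseteq> Basis"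
  then have "partials bs f differentiable at (x + z)" by auto
  then have "(partials bs f \<circ> (\<lambda>x. x + z)) differentiable at x"
    by (intro differentiable_chain_at) (auto intro: derivative_intros)
  then show "partials bs (\<lambda>x. f (x + z)) differentiable at x"
    using partials_shift[of f bs z] * by (simp add: smooth_def o_def)
qed

lemma smooth_linear_combination:
  assumes "smooth f" "smooth g" shows "smooth (\<lambda>x. c * f x + d * g x)"
  unfolding smooth_def
  using assms by (auto simp: partials_linear_combination smooth_def intro!: derivative_intros)

lemma smooth_isCont_partials: "smooth f \<Longrightarrow> set bs \<subseteq> Basis \<Longrightarrow> continuous_on UNIV (partials bs f)"
  by (auto simp: smooth_def continuous_at_imp_continuous_on differentiable_imp_continuous_within)

lemma smooth_continuous_on: "smooth f \<Longrightarrow> continuous_on UNIV f"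
  using smooth_isCont_partials[of f "[]"] by simp

lemma test_functions_alt:
  "f \<in> test_functions \<longleftrightarrow> smooth f \<and> (\<exists>R. \<forall>x. f x \<noteq> 0 \<longrightarrow> norm x \<le> R)"
proof -
  have "compact (closure {x. f x \<noteq> 0}) \<longleftrightarrow> (\<exists>R. \<forall>x. f x \<noteq> 0 \<longrightarrow> norm x \<le> R)"
    using bounded_closure[of "{x. f x \<noteq> 0}"] bounded_subset[OF _ closure_subset[of "{x. f x \<noteq> 0}"]]
    unfolding compact_eq_bounded_closed bounded_iff by blast
  then show ?thesis by (auto simp: test_functions_def)
qed

lemma test_functions_shift:
  assumes "f \<in> test_functions" shows "(\<lambda>x. f (x + z)) \<in> test_functions"
proof -
  from assms obtain R where "smooth f" and R: "\<And>x. f x \<noteq> 0 \<Longrightarrow> norm x \<le> R"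
    by (auto simp: test_functions_alt)
  have "norm x \<le> R + norm z" if "f (x + z) \<noteq> 0" for x
    using R[OF that] norm_triangle_ineq4[of "x + z" z] by simp
  then show ?thesis
    using \<open>smooth f\<close> by (auto simp: test_functions_alt smooth_shift)
qed

lemma test_functions_linear_combination:
  assumes "f \<in> test_functions" "g \<in> test_functions"
  shows "(\<lambda>x. c * f x + d * g x) \<in> test_functions"
proof -
  from assms obtain R Q where "smooth f" "smooth g" and R: "\<And>x. f x \<noteq> 0 \<Longrightarrow> norm x \<le> R"
    and Q: "\<And>x. g x \<noteq> 0 \<Longrightarrow> norm x \<le> Q"
    by (auto simp: test_functions_alt)
  have "norm x \<le> max R Q" if "c * f x + d * g x \<noteq> 0" for x
    using R[of x] Q[of x] that by (cases "f x = 0") auto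
  then show ?thesis
    using \<open>smooth f\<close> \<open>smooth g\<close> by (auto simp: test_functions_alt smooth_linear_combination)
qed

text \<open>The inequality is strict because the complement of the closed ball is open: f vanishes
  near each of its points, and local vanishing is inherited by derivatives.\<close>

lemma partials_eq_0:
  assumes "\<And>x. f x \<noteq> 0 \<Longrightarrow> norm x \<le> R" "norm x > R"
  shows "partials bs f x = 0"
  using assms(2)
proof (induction bs arbitrary: x)
  case (Cons b bs)
  have "((\<lambda>_. 0) has_derivative (\<lambda>_. 0)) (at x)" by simp
  then have "(partials bs f has_derivative (\<lambda>_. 0)) (at x)"
    by (rule has_derivative_transform_within_open[where s = "{y. R < norm y}"])
      (use Cons in \<open>auto intro!: open_Collect_less continuous_intros\<close>)
  from fun_cong[OF frechet_derivative_at[OF this], of b] show ?case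
    by simp
qed (use assms in fastforce)

lemma test_functions_partials_uniformly_continuous:
  assumes "f \<in> test_functions" "set bs \<subseteq> Basis"
  shows "uniformly_continuous_on UNIV (partials bs f)"
proof -
  from assms obtain R where s: "smooth f" and R: "\<And>x. f x \<noteq> 0 \<Longrightarrow> norm x \<le> R"
    by (auto simp: test_functions_alt)
  let ?f = "partials bs f"
  have "uniformly_continuous_on (cball 0 (R + 1)) ?f"
    using smooth_isCont_partials[OF s assms(2)]
    by (intro compact_uniformly_continuous) (auto intro: continuous_on_subset)
  then have *: "\<exists>d>0. \<forall>x\<in>cball 0 (R+1). \<forall>y\<in>cball 0 (R+1). dist y x < d \<longrightarrow> dist (?f y) (?f x) < e" if "e > 0" for e
    using that unfolding uniformly_continuous_on_def by blast
  show ?thesis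
    unfolding uniformly_continuous_on_def
  proof (intro allI impI)
    fix e :: real assume "e > 0"
    with * obtain d where d: "d > 0" "\<And>x y. x \<in> cball 0 (R+1) \<Longrightarrow> y \<in> cball 0 (R+1) \<Longrightarrow> dist y x < d \<Longrightarrow> dist (?f y) (?f x) < e"
      by meson
    \<comment> \<open>A distance below 1 leaves two cases: both points lie in the ball of radius R +
      1, where compactness gives uniform continuity, or both lie outside the ball of radius R, where
      the derivative vanishes.\<close>
    have "dist (?f y) (?f x) < e" if "dist y x < min d 1" for x y
    proof (cases "norm x \<le> R \<or> norm y \<le> R")
      case True
      then have "x \<in> cball 0 (R+1)" "y \<in> cball 0 (R+1)"
        using that norm_triangle_ineq2[of x y] norm_triangle_ineq2[of y x]
        by (auto simp: dist_norm norm_minus_commute)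
      with d that show ?thesis by auto
    next
      case False
      then have "?f x = 0" "?f y = 0"
        using R by (auto intro!: partials_eq_0)
      with \<open>e > 0\<close> show ?thesis by simp
    qed
    with d(1) show "\<exists>d>0. \<forall>x\<in>UNIV. \<forall>y\<in>UNIV. dist y x < d \<longrightarrow> dist (?f y) (?f x) < e"
      by (intro exI[of _ "min d 1"]) auto
  qed
qed

section \<open>Continuity of a distribution along translates of a test function\<close>

lemma distribution_add:
  "distribution \<rho> \<Longrightarrow> f \<in> test_functions \<Longrightarrow> g \<in> test_functions \<Longrightarrow> \<rho> (\<lambda>x. f x + g x) = \<rho> f + \<rho> g"
  unfolding distribution_def by blast

lemma distribution_scale:
  "distribution \<rho> \<Longrightarrow> f \<in> test_functions \<Longrightarrow> \<rho> (\<lambda>x. c * f x) = c * \<rho> f"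
  unfolding distribution_def by blast

text \<open>At this stage \<rho> is not a function, so continuity rests on the seminorm estimate:
  for w close to z the translates have their supports in one fixed ball, and their difference is
  small in each of finitely many seminorms, since partial derivatives of test functions are
  uniformly continuous. This makes the mollified kernels continuous and later extends an identity
  from almost every translate to every translate.\<close>

lemma distribution_shift_continuous:
  fixes \<rho> :: "('a::euclidean_space \<Rightarrow> real) \<Rightarrow> real"
  assumes \<rho>: "distribution \<rho>" and f: "f \<in> test_functions"
  shows "continuous_on UNIV (\<lambda>z. \<rho> (\<lambda>x. f (x + z)))"
proof -
  from f obtain R where s: "smooth f" and R: "\<And>x. f x \<noteq> 0 \<Longrightarrow> norm x \<le> R"
    by (auto simp: test_functions_alt)
  have "isCont (\<lambda>z. \<rho> (\<lambda>x. f (x + z))) z" for z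
  proof -
    let ?K = "cball (0::'a) (R + norm z + 1)"
    obtain C k where C: "\<And>g. g \<in> test_functions \<Longrightarrow> closure {x. g x \<noteq> 0} \<subseteq> ?K \<Longrightarrow>
        \<bar>\<rho> g\<bar> \<le> C * (\<Sum>bs | set bs \<subseteq> Basis \<and> length bs \<le> k. SUP x. \<bar>partials bs g x\<bar>)"
      using \<rho> unfolding distribution_def by (meson compact_cball)
    let ?B = "{bs. set bs \<subseteq> (Basis::'a set) \<and> length bs \<le> k}"
    have finB: "finite ?B" by (rule finite_lists_length_le) simp
    show ?thesis
      unfolding isCont_def LIM_def
    proof (intro allI impI)
      fix e :: real assume "e > 0"
      \<comment> \<open>C times a sum of \<open>card ?B\<close> suprema, each at most e', must stay
        below e. The summands 1 keep the denominator positive, and the factor 2 makes the final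
        inequality strict.\<close>
      define e' where "e' = e / (2 * (\<bar>C\<bar> + 1) * (card ?B + 1))"
      have "e' > 0" using \<open>e > 0\<close> by (simp add: e'_def)
      have "\<exists>d>0. \<forall>x y. dist y x < d \<longrightarrow> dist (partials bs f y) (partials bs f x) < e'" if "bs \<in> ?B" for bs
        using test_functions_partials_uniformly_continuous[OF f, of bs] that \<open>e' > 0\<close>
        unfolding uniformly_continuous_on_def by auto
      then have "\<exists>D. \<forall>bs\<in>?B. D bs > 0 \<and> (\<forall>x y. dist y x < D bs \<longrightarrow> dist (partials bs f y) (partials bs f x) < e')"
        by (intro bchoice ballI)
      then obtain D where D: "\<And>bs. bs \<in> ?B \<Longrightarrow> D bs > 0"
         "\<And>bs x y. bs \<in> ?B \<Longrightarrow> dist y x < D bs \<Longrightarrow> dist (partials bs f y) (partials bs f x) < e'"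
        by blast
      define d where "d = Min (insert 1 (D ` ?B))"
      have d: "d > 0" "d \<le> 1" "\<And>bs. bs \<in> ?B \<Longrightarrow> d \<le> D bs"
        using finB D(1) by (auto simp: d_def)
      have "dist (\<rho> (\<lambda>x. f (x + w))) (\<rho> (\<lambda>x. f (x + z))) < e" if w: "dist w z < d" for w
      proof -
        let ?g = "\<lambda>x. 1 * f (x + w) + (- 1) * f (x + z)"
        have g: "?g \<in> test_functions"
          by (intro test_functions_linear_combination test_functions_shift f)
        have "(\<lambda>x. (-1) * f (x + z)) \<in> test_functions"
          using test_functions_linear_combination[OF test_functions_shift[OF f, of z] test_functions_shift[OF f, of z], of "-1" 0] by simp
        then have "\<rho> ?g = \<rho> (\<lambda>x. f (x + w)) + \<rho> (\<lambda>x. (-1) * f (x + z))"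
          using distribution_add[OF \<rho> test_functions_shift[OF f, of w], of "\<lambda>x. (-1) * f (x + z)"] by simp
        moreover have "\<rho> (\<lambda>x. (-1) * f (x + z)) = (-1) * \<rho> (\<lambda>x. f (x + z))"
          by (rule distribution_scale[OF \<rho> test_functions_shift[OF f]])
        ultimately have eq: "\<rho> ?g = \<rho> (\<lambda>x. f (x + w)) - \<rho> (\<lambda>x. f (x + z))"
          by simp
        have "norm x \<le> R + norm z + 1" if "?g x \<noteq> 0" for x
        proof -
          have "norm (x + w) \<le> R \<or> norm (x + z) \<le> R" using that R[of "x + w"] R[of "x + z"] by (cases "f (x + w) = 0") auto
          moreover have "norm w \<le> norm z + 1"
            using w d(2) norm_triangle_ineq2[of w z] by (simp add: dist_norm)
          ultimately show ?thesis
            using norm_triangle_ineq4[of "x + w" w] norm_triangle_ineq4[of "x + z" z] by auto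
        qed
        then have "closure {x. ?g x \<noteq> 0} \<subseteq> ?K"
          by (intro closure_minimal) auto
        with g have "\<bar>\<rho> ?g\<bar> \<le> C * (\<Sum>bs\<in>?B. SUP x. \<bar>partials bs ?g x\<bar>)"
          by (rule C)
        also have "\<dots> \<le> \<bar>C\<bar> * (\<Sum>bs\<in>?B. e')"
        proof -
          have bd: "\<bar>partials bs ?g x\<bar> \<le> e'" if "bs \<in> ?B" for bs x
          proof -
            have "dist (x + w) (x + z) < D bs"
              using w d(3)[OF that] by simp
            from D(2)[OF that this] show ?thesis
              using that s by (subst partials_linear_combination)
                 (auto simp: smooth_shift partials_shift dist_real_def)
          qed
          have "(SUP x. \<bar>partials bs ?g x\<bar>) \<le> e'" if "bs \<in> ?B" for bs
            using bd[OF that] by (intro cSUP_least) auto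
          then have "(\<Sum>bs\<in>?B. SUP x. \<bar>partials bs ?g x\<bar>) \<le> (\<Sum>bs\<in>?B. e')"
            by (rule sum_mono)
          moreover have "0 \<le> (SUP x. \<bar>partials bs ?g x\<bar>)" if "bs \<in> ?B" for bs
            using bd[OF that] by (intro cSUP_upper2[where x = 0]) (auto intro!: bdd_aboveI2)
          then have "0 \<le> (\<Sum>bs\<in>?B. SUP x. \<bar>partials bs ?g x\<bar>)"
            by (rule sum_nonneg)
          ultimately show ?thesis
            by (intro mult_mono) auto
        qed
        also have "\<dots> = (\<bar>C\<bar> * card ?B) * e'" by simp
        also have "\<dots> \<le> ((\<bar>C\<bar> + 1) * (card ?B + 1)) * e'"
          using \<open>e' > 0\<close> by (intro mult_right_mono mult_mono) auto
        also have "\<dots> = e / 2"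
        proof -
          have "(\<bar>C\<bar> + 1) * (real (card ?B) + 1) \<noteq> 0" by (auto simp: add_nonneg_eq_0_iff)
          then show ?thesis unfolding e'_def by (simp add: field_simps)
        qed
        also have "\<dots> < e" using \<open>e > 0\<close> by simp
        finally show ?thesis using eq by (simp add: dist_real_def)
      qed
      with d(1) show "\<exists>d>0. \<forall>w. w \<noteq> z \<and> dist w z < d \<longrightarrow> dist (\<rho> (\<lambda>x. f (x + w))) (\<rho> (\<lambda>x. f (x + z))) < e"
        by auto
    qed
  qed
  then show ?thesis by (simp add: continuous_at_imp_continuous_on)
qed

section \<open>Translations and mollification\<close>

lemma lborel_distr_shift: "distr lborel borel (\<lambda>x. x + t) = (lborel :: 'a::euclidean_space measure)"
proof -
  have "(\<lambda>x. x + t) = (+) t" by (simp add: fun_eq_iff add.commute)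
  then show ?thesis by (simp add: lborel_distr_plus)
qed

lemma lborel_distr_reflect: "distr lborel borel (\<lambda>x. t - x) = (lborel :: 'a::euclidean_space measure)"
  using lborel_affine[of "-1" t, symmetric] by (simp add: density_1)

lemma nn_integral_lborel_shift:
  fixes f :: "'a::euclidean_space \<Rightarrow> ennreal"
  assumes [measurable]: "f \<in> borel_measurable borel"
  shows "(\<integral>\<^sup>+x. f (x + t) \<partial>lborel) = (\<integral>\<^sup>+x. f x \<partial>lborel)"
  by (subst (2) lborel_distr_shift[of t, symmetric]) (simp add: nn_integral_distr)

lemma integral_lborel_shift:
  fixes f :: "'a::euclidean_space \<Rightarrow> real"
  assumes [measurable]: "f \<in> borel_measurable borel"
  shows "(\<integral>x. f (x + t) \<partial>lborel) = (\<integral>x. f x \<partial>lborel)"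
  by (subst (2) lborel_distr_shift[of t, symmetric]) (simp add: integral_distr)

lemma integrable_lborel_shift:
  fixes f :: "'a::euclidean_space \<Rightarrow> real"
  assumes "integrable lborel f"
  shows "integrable lborel (\<lambda>x. f (x + t))"
proof -
  have "integrable (distr lborel borel (\<lambda>x. x + t)) f"
    using assms by (simp add: lborel_distr_shift)
  then show ?thesis
    using assms by (subst (asm) integrable_distr_eq) auto
qed

lemma AE_lborel_shift:
  fixes t :: "'a::euclidean_space"
  assumes "AE x in lborel. P x" shows "AE x in lborel. P (x + t)"
proof (rule AE_distrD[of "\<lambda>x. x + t" lborel borel])
  show "AE x in distr lborel borel (\<lambda>x. x + t). P x"
    by (subst lborel_distr_shift) (rule assms)
qed simp

lemma AE_lborel_reflect:
  fixes t :: "'a::euclidean_space"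
  assumes "AE x in lborel. P x" shows "AE x in lborel. P (t - x)"
proof (rule AE_distrD[of "\<lambda>x. t - x" lborel borel])
  show "AE x in distr lborel borel (\<lambda>x. t - x). P x"
    by (subst lborel_distr_reflect) (rule assms)
qed simp

text \<open>The set where f differs from 0 is open, and a nonempty open set is not
  negligible.\<close>

lemma continuous_AE_eq_0:
  fixes f :: "'a::euclidean_space \<Rightarrow> real"
  assumes "continuous_on UNIV f" "AE x in lborel. f x = 0"
  shows "f x = 0"
proof (rule ccontr)
  assume "f x \<noteq> 0"
  have op: "open {x. f x \<noteq> 0}"
    using assms(1) by (intro open_Collect_neq) auto
  then have "emeasure lborel {x. f x \<noteq> 0} = 0"
    using assms(2) by (subst (asm) AE_iff_measurable[where N = "{x. f x \<noteq> 0}"]) auto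
  with op have "{x. f x \<noteq> 0} \<in> null_sets lborel" by auto
  then have "negligible {x. f x \<noteq> 0}"
    by (simp add: negligible_iff_null_sets null_sets_completionI)
  with op show False
    using open_not_negligible \<open>f x \<noteq> 0\<close> by blast
qed

text \<open>A density argument: the claim holds for indicators of open sets of finite measure,
  passes to measurable sets by outer regularity, and extends to integrable functions because it is
  stable under limits in L1, translations being isometries.\<close>

lemma translation_L1_sequentially:
  fixes f :: "'a::euclidean_space \<Rightarrow> real"
  assumes "integrable lborel f" "z \<longlonglongrightarrow> 0"
  shows "(\<lambda>k. \<integral>x. \<bar>f (x + z k) - f x\<bar> \<partial>lborel) \<longlonglongrightarrow> 0"
proof -
  define P where "P = (\<lambda>f::'a\<Rightarrow>real. (\<lambda>k. \<integral>x. \<bar>f (x + z k) - f x\<bar> \<partial>lborel) \<longlonglongrightarrow> 0)"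
  have approx: "P f" if f: "integrable lborel f"
    and g: "\<And>e::real. e > 0 \<Longrightarrow> \<exists>g. integrable lborel g \<and> P g \<and> (\<integral>x. \<bar>f x - g x\<bar> \<partial>lborel) < e" for f
    unfolding P_def LIMSEQ_iff
  proof (intro allI impI)
    fix e :: real assume "e > 0"
    then obtain g where gi: "integrable lborel g" and "P g" and fg: "(\<integral>x. \<bar>f x - g x\<bar> \<partial>lborel) < e / 4"
      using g[of "e / 4"] by auto
    then obtain N where N: "\<And>k. k \<ge> N \<Longrightarrow> \<bar>\<integral>x. \<bar>g (x + z k) - g x\<bar> \<partial>lborel\<bar> < e / 4"
      unfolding P_def LIMSEQ_iff by (metis \<open>e > 0\<close> diff_zero divide_pos_pos real_norm_def zero_less_numeral)
    have "norm ((\<integral>x. \<bar>f (x + z k) - f x\<bar> \<partial>lborel) - 0) < e" if "k \<ge> N" for k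
    proof -
      note i = f gi integrable_lborel_shift[OF f, of "z k"] integrable_lborel_shift[OF gi, of "z k"]
      have "(\<integral>x. \<bar>f (x + z k) - f x\<bar> \<partial>lborel) \<le>
          (\<integral>x. \<bar>f (x + z k) - g (x + z k)\<bar> + \<bar>g (x + z k) - g x\<bar> + \<bar>f x - g x\<bar> \<partial>lborel)"
        using i by (intro integral_mono) auto
      also have "\<dots> = (\<integral>x. \<bar>f (x + z k) - g (x + z k)\<bar> \<partial>lborel) + (\<integral>x. \<bar>g (x + z k) - g x\<bar> \<partial>lborel) + (\<integral>x. \<bar>f x - g x\<bar> \<partial>lborel)"
        using i by simp
      also have "(\<integral>x. \<bar>f (x + z k) - g (x + z k)\<bar> \<partial>lborel) = (\<integral>x. \<bar>f x - g x\<bar> \<partial>lborel)"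
        using integral_lborel_shift[of "\<lambda>x. \<bar>f x - g x\<bar>"] f gi by simp
      finally have "(\<integral>x. \<bar>f (x + z k) - f x\<bar> \<partial>lborel) < e"
        using N[OF that] fg \<open>e > 0\<close> by linarith
      moreover have "0 \<le> (\<integral>x. \<bar>f (x + z k) - f x\<bar> \<partial>lborel)" by simp
      ultimately show ?thesis by simp
    qed
    then show "\<exists>no. \<forall>k\<ge>no. norm ((\<integral>x. \<bar>f (x + z k) - f x\<bar> \<partial>lborel) - 0) < e" by blast
  qed
  have opn: "P (indicat_real U)" if U: "open U" "emeasure lborel U < \<infinity>" for U
  proof -
    have [measurable]: "U \<in> sets borel" using U by simp
    have iU: "integrable lborel (indicat_real U)" using U by simp
    \<comment> \<open>Rewritten through the product of the two indicators because the product
      converges at every point: for x in U by openness, and for x outside U it is 0. The translated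
      indicator alone may fail to converge on the boundary of U.\<close>
    have eq: "(\<integral>x. \<bar>indicat_real U (x + z k) - indicator U x\<bar> \<partial>lborel) =
       2 * (measure lborel U - (\<integral>x. indicator U x * indicator U (x + z k) \<partial>lborel))" for k
    proof -
      have i: "integrable lborel (\<lambda>x. indicat_real U x * indicator U (x + z k))"
        by (rule Bochner_Integration.integrable_bound[OF iU]) (auto simp: indicator_def)
      have "(\<integral>x. \<bar>indicat_real U (x + z k) - indicator U x\<bar> \<partial>lborel) =
        (\<integral>x. indicator U (x + z k) + indicator U x - 2 * (indicator U x * indicator U (x + z k)) \<partial>lborel)"
        by (intro Bochner_Integration.integral_cong) (auto simp: indicator_def)
      also have "\<dots> = (\<integral>x. indicator U (x + z k) \<partial>lborel) + (\<integral>x. indicator U x \<partial>lborel) - 2 * (\<integral>x. indicator U x * indicator U (x + z k) \<partial>lborel)"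
        using i iU integrable_lborel_shift[OF iU, of "z k"] by simp
      also have "(\<integral>x. indicat_real U (x + z k) \<partial>lborel) = (\<integral>x. indicator U x \<partial>lborel)"
        using integral_lborel_shift[of "indicat_real U"] by simp
      finally show ?thesis by simp
    qed
    have "(\<lambda>k. \<integral>x. indicator U x * indicat_real U (x + z k) \<partial>lborel) \<longlonglongrightarrow> (\<integral>x. indicator U x \<partial>lborel)"
    proof (rule integral_dominated_convergence[where w = "indicat_real U"])
      show "AE x in lborel. (\<lambda>k. indicat_real U x * indicator U (x + z k)) \<longlonglongrightarrow> indicator U x"
      proof (rule AE_I2)
        fix x
        show "(\<lambda>k. indicat_real U x * indicator U (x + z k)) \<longlonglongrightarrow> indicator U x"
        proof (cases "x \<in> U")
          case True
          have "(\<lambda>k. x + z k) \<longlonglongrightarrow> x + 0" by (intro tendsto_intros assms)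
          then have "\<forall>\<^sub>F k in sequentially. x + z k \<in> U"
            using True \<open>open U\<close> by (auto intro: topological_tendstoD)
          then have "\<forall>\<^sub>F k in sequentially. 1 = indicat_real U x * indicator U (x + z k)"
            by eventually_elim (use True in auto)
          with tendsto_const show ?thesis
            using True by (auto intro: Lim_transform_eventually)
        qed simp
      qed
    qed (auto simp: iU, auto simp: indicator_def)
    from tendsto_mult[OF tendsto_const[of 2] tendsto_diff[OF tendsto_const[of "measure lborel U"] this]]
    show ?thesis unfolding P_def eq by simp
  qed
  have "P f"
    using assms(1)
  proof (induction f rule: integrable_induct)
    case (base A c)
    have "P (indicat_real A)"
    proof (rule approx)
      show iA: "integrable lborel (indicat_real A)" using base by simp
      fix e :: real assume "e > 0"
      obtain U where U: "open U" "A \<subseteq> U" "emeasure lborel (U - A) < e"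
        using outer_regular_lborel[of A e] base \<open>e > 0\<close> by auto
      have [measurable]: "U \<in> sets borel" "A \<in> sets borel" using U base by auto
      have "emeasure lborel U \<le> emeasure lborel A + emeasure lborel (U - A)"
        using U(2) by (subst plus_emeasure) (auto simp: Un_absorb1)
      also have "\<dots> < \<infinity>" using U(3) base by (auto simp: less_top[symmetric] ennreal_add_eq_top)
      finally have fU: "emeasure lborel U < \<infinity>" .
      have "(\<integral>x. \<bar>indicat_real A x - indicator U x\<bar> \<partial>lborel) = (\<integral>x. indicator (U - A) x \<partial>lborel)"
        using U(2) by (intro Bochner_Integration.integral_cong) (auto simp: indicator_def)
      also have "\<dots> = measure lborel (U - A)" by simp
      also have "\<dots> < e"
        using U(3) \<open>e > 0\<close> by (simp add: measure_def enn2real_less_iff less_top) (metis ennreal_less_top enn2real_less_iff less_top order_less_trans)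
      finally show "\<exists>g. integrable lborel g \<and> P g \<and> (\<integral>x. \<bar>indicat_real A x - g x\<bar> \<partial>lborel) < e"
        using opn[OF U(1) fU] fU by (intro exI[of _ "indicat_real U"]) auto
    qed
    then have "(\<lambda>k. \<bar>c\<bar> * (\<integral>x. \<bar>indicat_real A (x + z k) - indicator A x\<bar> \<partial>lborel)) \<longlonglongrightarrow> \<bar>c\<bar> * 0"
      unfolding P_def by (intro tendsto_intros)
    then show ?case
      unfolding P_def by (simp add: right_diff_distrib[symmetric] left_diff_distrib[symmetric] abs_mult mult.commute[of _ c])
  next
    case (add f g)
    show ?case unfolding P_def
    proof (rule tendsto_sandwich[where f = "\<lambda>_. 0"])
      show "(\<lambda>k. (\<integral>x. \<bar>f (x + z k) - f x\<bar> \<partial>lborel) + (\<integral>x. \<bar>g (x + z k) - g x\<bar> \<partial>lborel)) \<longlonglongrightarrow> 0"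
        using tendsto_add[OF add(3,4)[unfolded P_def]] by simp
      show "\<forall>\<^sub>F k in sequentially. (\<integral>x. \<bar>(f (x + z k) + g (x + z k)) - (f x + g x)\<bar> \<partial>lborel) \<le>
         (\<integral>x. \<bar>f (x + z k) - f x\<bar> \<partial>lborel) + (\<integral>x. \<bar>g (x + z k) - g x\<bar> \<partial>lborel)"
      proof (rule always_eventually, rule allI)
        fix k
        note i = add(1,2) integrable_lborel_shift[OF add(1), of "z k"] integrable_lborel_shift[OF add(2), of "z k"]
        have "(\<integral>x. \<bar>(f (x + z k) + g (x + z k)) - (f x + g x)\<bar> \<partial>lborel) \<le>
           (\<integral>x. \<bar>f (x + z k) - f x\<bar> + \<bar>g (x + z k) - g x\<bar> \<partial>lborel)"
          using i by (intro integral_mono) auto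
        also have "\<dots> = (\<integral>x. \<bar>f (x + z k) - f x\<bar> \<partial>lborel) + (\<integral>x. \<bar>g (x + z k) - g x\<bar> \<partial>lborel)"
          using i by (intro Bochner_Integration.integral_add) auto
        finally show "(\<integral>x. \<bar>(f (x + z k) + g (x + z k)) - (f x + g x)\<bar> \<partial>lborel) \<le>
         (\<integral>x. \<bar>f (x + z k) - f x\<bar> \<partial>lborel) + (\<integral>x. \<bar>g (x + z k) - g x\<bar> \<partial>lborel)" .
      qed
    qed auto
  next
    case (lim f s)
    show ?case
    proof (rule approx[OF lim(4)])
      fix e :: real assume "e > 0"
      have [measurable]: "f \<in> borel_measurable borel" "\<And>i. s i \<in> borel_measurable borel"
        using lim(1,4) by auto
      have "(\<lambda>i. \<integral>x. \<bar>f x - s i x\<bar> \<partial>lborel) \<longlonglongrightarrow> (\<integral>x. 0 \<partial>(lborel :: 'a measure))"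
      proof (rule integral_dominated_convergence[where w = "\<lambda>x. 3 * \<bar>f x\<bar>"])
        show "AE x in lborel. (\<lambda>i. \<bar>f x - s i x\<bar>) \<longlonglongrightarrow> 0"
        proof (rule AE_I2)
          fix x
          have "(\<lambda>i. f x - s i x) \<longlonglongrightarrow> f x - f x"
            using lim(2) by (intro tendsto_intros) auto
          then show "(\<lambda>i. \<bar>f x - s i x\<bar>) \<longlonglongrightarrow> 0"
            by (intro tendsto_rabs_zero) simp
        qed
        show "AE x in lborel. norm \<bar>f x - s i x\<bar> \<le> 3 * \<bar>f x\<bar>" for i
        proof (rule AE_I2)
          fix x
          show "norm \<bar>f x - s i x\<bar> \<le> 3 * \<bar>f x\<bar>"
            using lim(3)[of x i] by simp
        qed
      qed (use lim(4) in auto)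
      then obtain i where "\<bar>\<integral>x. \<bar>f x - s i x\<bar> \<partial>lborel\<bar> < e"
        using \<open>e > 0\<close> unfolding LIMSEQ_iff by fastforce
      then show "\<exists>g. integrable lborel g \<and> P g \<and> (\<integral>x. \<bar>f x - g x\<bar> \<partial>lborel) < e"
        using lim(1,5) by (intro exI[of _ "s i"]) auto
    qed
  qed
  then show ?thesis by (simp add: P_def)
qed

lemma translation_L1_continuous:
  fixes f :: "'a::euclidean_space \<Rightarrow> real"
  assumes f: "integrable lborel f" and "e > 0"
  shows "\<exists>d>0. \<forall>z. norm z < d \<longrightarrow> (\<integral>\<^sup>+x. ennreal \<bar>f (x + z) - f x\<bar> \<partial>lborel) < ennreal e"
proof -
  have "((\<lambda>z. \<integral>x. \<bar>f (x + z) - f x\<bar> \<partial>lborel) \<longlongrightarrow> 0) (at 0)"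
    unfolding tendsto_at_iff_sequentially using translation_L1_sequentially[OF f] by (auto simp: o_def)
  then obtain d where d: "d > 0" "\<And>z. z \<noteq> 0 \<Longrightarrow> norm z < d \<Longrightarrow> \<bar>\<integral>x. \<bar>f (x + z) - f x\<bar> \<partial>lborel\<bar> < e"
    using \<open>e > 0\<close> unfolding LIM_def by (auto simp: dist_norm)
  have "(\<integral>\<^sup>+x. ennreal \<bar>f (x + z) - f x\<bar> \<partial>lborel) < ennreal e" if "norm z < d" for z
  proof -
    have "(\<integral>\<^sup>+x. ennreal \<bar>f (x + z) - f x\<bar> \<partial>lborel) = ennreal (\<integral>x. \<bar>f (x + z) - f x\<bar> \<partial>lborel)"
      using f integrable_lborel_shift[OF f, of z] by (intro nn_integral_eq_integral) auto
    moreover have "\<bar>\<integral>x. \<bar>f (x + z) - f x\<bar> \<partial>lborel\<bar> < e"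
      using d(2)[OF _ that] \<open>e > 0\<close> by (cases "z = 0") auto
    ultimately show ?thesis
      using \<open>e > 0\<close> by (simp add: ennreal_lessI)
  qed
  with d(1) show ?thesis by blast
qed

lemma bounded_if_compact_support:
  fixes f :: "'a::euclidean_space \<Rightarrow> real"
  assumes "continuous_on UNIV f" "\<And>x. f x \<noteq> 0 \<Longrightarrow> norm x \<le> R"
  obtains B where "B > 0" "\<And>x. \<bar>f x\<bar> \<le> B"
proof -
  have "compact (f ` cball 0 R)"
    using assms(1) by (intro compact_continuous_image) (auto intro: continuous_on_subset)
  then obtain B where "B > 0" "\<forall>y\<in>f ` cball 0 R. norm y \<le> B"
    using compact_imp_bounded[of "f ` cball 0 R"] unfolding bounded_pos by blast
  then have "\<bar>f x\<bar> \<le> B" if "norm x \<le> R" for x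
    using that by simp
  then have "\<bar>f x\<bar> \<le> B" for x
    using assms(2)[of x] \<open>B > 0\<close> by (cases "f x = 0") auto
  with \<open>B > 0\<close> show ?thesis by (rule that)
qed

lemma test_functions_continuous: "f \<in> test_functions \<Longrightarrow> continuous_on UNIV f"
  by (simp add: test_functions_alt smooth_continuous_on)

lemma test_functions_measurable: "f \<in> test_functions \<Longrightarrow> f \<in> borel_measurable borel"
  using test_functions_continuous by (rule borel_measurable_continuous_onI)

lemma locally_integrable_mult_test:
  assumes Y: "locally_integrable Y" "Y \<in> borel_measurable borel"
    and f: "f \<in> borel_measurable borel" "\<And>x. f x \<noteq> 0 \<Longrightarrow> norm x \<le> R" "\<And>x. \<bar>f x\<bar> \<le> B"
  shows "integrable lborel (\<lambda>x. Y x * f x)"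
proof (rule Bochner_Integration.integrable_bound)
  show "integrable lborel (\<lambda>x. B * (indicator (cball 0 R) x *\<^sub>R Y x))"
    using Y(1) unfolding locally_integrable_def set_integrable_def by (intro integrable_mult_right) auto
  show "(\<lambda>x. Y x * f x) \<in> borel_measurable lborel"
    using Y f by auto
  have "B \<ge> 0" using f(3)[of 0] by auto
  show "AE x in lborel. norm (Y x * f x) \<le> norm (B * (indicator (cball 0 R) x *\<^sub>R Y x))"
  proof (rule AE_I2)
    fix x
    show "norm (Y x * f x) \<le> norm (B * (indicator (cball 0 R) x *\<^sub>R Y x))"
      using f(2)[of x] mult_left_mono[OF f(3)[of x], of "\<bar>Y x\<bar>"] \<open>B \<ge> 0\<close>
      by (cases "f x = 0") (auto simp: abs_mult mult.commute)
  qed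
qed

lemma conv_test_continuous:
  fixes Y :: "'a::euclidean_space \<Rightarrow> real"
  assumes Y: "locally_integrable Y" "Y \<in> borel_measurable borel" and f: "f \<in> test_functions"
  shows "continuous_on UNIV (\<lambda>z. \<integral>x. Y x * f (x + z) \<partial>lborel)"
proof -
  from f obtain R where s: "smooth f" and R: "\<And>x. f x \<noteq> 0 \<Longrightarrow> norm x \<le> R"
    by (auto simp: test_functions_alt)
  have cf: "continuous_on UNIV f" using f by (rule test_functions_continuous)
  have [measurable]: "f \<in> borel_measurable borel" using f by (rule test_functions_measurable)
  note [measurable] = Y(2)
  obtain B where B: "B > 0" "\<And>x. \<bar>f x\<bar> \<le> B"
    using bounded_if_compact_support[OF cf R] by auto
  have "(\<lambda>k. \<integral>x. Y x * f (x + u k) \<partial>lborel) \<longlonglongrightarrow> (\<integral>x. Y x * f (x + z) \<partial>lborel)" if u: "u \<longlonglongrightarrow> z" for u z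
  proof -
    \<comment> \<open>A convergent sequence of shifts is bounded, so all supports lie in one ball
      and a single integrable majorant suffices.\<close>
    obtain K where K: "\<And>k. norm (u k) \<le> K"
      using convergent_imp_bounded[OF u] by (auto simp: bounded_iff)
    show ?thesis
    proof (rule integral_dominated_convergence[where w = "\<lambda>x. \<bar>B * (indicator (cball 0 (R + K)) x *\<^sub>R Y x)\<bar>"])
      show "integrable lborel (\<lambda>x. \<bar>B * (indicator (cball 0 (R + K)) x *\<^sub>R Y x)\<bar>)"
        using Y(1) unfolding locally_integrable_def set_integrable_def by (intro integrable_abs integrable_mult_right) auto
      show "AE x in lborel. (\<lambda>k. Y x * f (x + u k)) \<longlonglongrightarrow> Y x * f (x + z)"
        using cf u by (intro AE_I2 tendsto_intros) (auto intro!: continuous_on_tendsto_compose[OF cf] tendsto_intros)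
      show "AE x in lborel. norm (Y x * f (x + u k)) \<le> \<bar>B * (indicator (cball 0 (R + K)) x *\<^sub>R Y x)\<bar>" for k
      proof (rule AE_I2)
        fix x
        have "f (x + u k) \<noteq> 0 \<Longrightarrow> norm x \<le> R + K"
          using R[of "x + u k"] K[of k] norm_triangle_ineq4[of "x + u k" "u k"] by simp
        then show "norm (Y x * f (x + u k)) \<le> \<bar>B * (indicator (cball 0 (R + K)) x *\<^sub>R Y x)\<bar>"
          using mult_left_mono[OF B(2)[of "x + u k"], of "\<bar>Y x\<bar>"] B(1)
          by (cases "f (x + u k) = 0") (auto simp: abs_mult mult.commute)
      qed
    qed auto
  qed
  then show ?thesis
    by (auto simp: continuous_on_sequentially o_def)
qed

lemma ennreal_tendsto_0I:
  fixes f :: "nat \<Rightarrow> ennreal"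
  assumes "\<And>e::real. e > 0 \<Longrightarrow> \<forall>\<^sub>F n in sequentially. f n \<le> ennreal e"
  shows "f \<longlonglongrightarrow> 0"
proof (rule order_tendstoI)
  fix a :: ennreal assume "0 < a"
  then obtain e :: real where "0 < e" "ennreal e < a"
  proof (cases a)
    case (real r)
    with \<open>0 < a\<close> show ?thesis
      by (intro that[of "r / 2"]) (auto intro: ennreal_lessI)
  qed (auto intro: that[of 1])
  with assms[of e] show "\<forall>\<^sub>F n in sequentially. f n < a"
    by (auto elim: eventually_mono)
qed simp

text \<open>The mollified function minus Y at t is an average with weight \<open>b n\<close> of
  differences Y (t + z) - Y t. After Fubini its L1 norm on the ball is at most the largest L1
  distance between a function and its small translates.\<close>

lemma mollifier_L1_loc:
  fixes Y :: "'a::euclidean_space \<Rightarrow> real"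
  assumes Y: "locally_integrable Y" "Y \<in> borel_measurable borel"
    and b: "\<And>n. b n \<in> test_functions" "\<And>n x. b n x \<ge> 0" "\<And>n. (\<integral>x. b n x \<partial>lborel) = 1"
      "\<And>n x. b n x \<noteq> 0 \<Longrightarrow> norm x \<le> h n" and h: "h \<longlonglongrightarrow> 0"
  shows "(\<lambda>n. \<integral>\<^sup>+t\<in>cball 0 R. ennreal \<bar>(\<integral>x. Y x * b n (x + - t) \<partial>lborel) - Y t\<bar> \<partial>lborel) \<longlonglongrightarrow> 0"
proof (rule ennreal_tendsto_0I)
  fix e :: real assume "e > 0"
  \<comment> \<open>Y is only locally integrable. For t in the ball of radius R and shifts shorter
    than 1, the cut-off at radius R + 1 leaves all values in question unchanged.\<close>
  let ?f = "\<lambda>x. indicator (cball 0 (R + 1)) x *\<^sub>R Y x"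
  have f: "integrable lborel ?f"
    using Y(1) unfolding locally_integrable_def set_integrable_def by auto
  note [measurable] = Y(2) test_functions_measurable[OF b(1)]
  obtain d where d: "d > 0" "\<And>z. norm z < d \<Longrightarrow> (\<integral>\<^sup>+x. ennreal \<bar>?f (x + z) - ?f x\<bar> \<partial>lborel) < ennreal e"
    using translation_L1_continuous[OF f \<open>e > 0\<close>] by blast
  have "\<forall>\<^sub>F n in sequentially. h n < min d 1"
    using h d(1) by (intro order_tendstoD) auto
  then show "\<forall>\<^sub>F n in sequentially. (\<integral>\<^sup>+t\<in>cball 0 R. ennreal \<bar>(\<integral>x. Y x * b n (x + - t) \<partial>lborel) - Y t\<bar> \<partial>lborel) \<le> ennreal e"
  proof eventually_elim
    case (elim n)
    obtain B where B: "B > 0" "\<And>x. \<bar>b n x\<bar> \<le> B"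
      using bounded_if_compact_support[OF test_functions_continuous[OF b(1)] b(4)] by metis
    have ib: "integrable lborel (b n)"
      using b(3)[of n] not_integrable_integral_eq by fastforce
    have 1: "ennreal \<bar>(\<integral>x. Y x * b n (x + - t) \<partial>lborel) - Y t\<bar> \<le> (\<integral>\<^sup>+z. ennreal (b n z * \<bar>?f (t + z) - ?f t\<bar>) \<partial>lborel)"
      if t: "t \<in> cball 0 R" for t
    proof -
      have nz: "norm x \<le> h n + norm t" if "b n (x + - t) \<noteq> 0" for x
        using b(4)[OF that] norm_triangle_ineq[of "x + - t" t] by simp
      have i: "integrable lborel (\<lambda>x. Y x * b n (x + - t))"
        using B(2) nz by (intro locally_integrable_mult_test[OF Y]) auto
      have "(\<integral>x. Y x * b n (x + - t) \<partial>lborel) - Y t = (\<integral>x. Y x * b n (x + - t) \<partial>lborel) - (\<integral>x. Y t * b n (x + - t) \<partial>lborel)"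
        using integral_lborel_shift[of "b n" "- t"] b(3)[of n] by simp
      also have "\<dots> = (\<integral>x. Y x * b n (x + - t) - Y t * b n (x + - t) \<partial>lborel)"
        using i ib integrable_lborel_shift[OF ib, of "- t"] by (intro Bochner_Integration.integral_diff[symmetric]) auto
      finally have "ennreal \<bar>(\<integral>x. Y x * b n (x + - t) \<partial>lborel) - Y t\<bar> \<le>
         (\<integral>\<^sup>+x. ennreal (norm (Y x * b n (x + - t) - Y t * b n (x + - t))) \<partial>lborel)"
        using integral_norm_bound_ennreal[OF Bochner_Integration.integrable_diff[OF i integrable_mult_right[OF integrable_lborel_shift[OF ib, of "- t"], of "Y t"]]]
        by simp
      also have "\<dots> = (\<integral>\<^sup>+x. ennreal (norm (Y (x + t) * b n (x + t + - t) - Y t * b n (x + t + - t))) \<partial>lborel)"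
        by (rule nn_integral_lborel_shift[symmetric]) simp
      also have "\<dots> = (\<integral>\<^sup>+z. ennreal (b n z * \<bar>?f (t + z) - ?f t\<bar>) \<partial>lborel)"
      proof (intro nn_integral_cong)
        fix z
        have "b n z \<noteq> 0 \<Longrightarrow> norm (t + z) \<le> R + 1"
          using b(4)[of n z] elim t norm_triangle_ineq[of t z] by auto
        then show "ennreal (norm (Y (z + t) * b n (z + t + - t) - Y t * b n (z + t + - t))) = ennreal (b n z * \<bar>?f (t + z) - ?f t\<bar>)"
          using t b(2)[of n z] by (cases "b n z = 0") (auto simp: left_diff_distrib[symmetric] abs_mult add.commute)
      qed
      finally show ?thesis .
    qed
    define F where "F = ?f"
    have [measurable]: "F \<in> borel_measurable borel" 
      using Y(2) unfolding F_def real_scaleR_def by (intro borel_measurable_times borel_measurable_indicator) auto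
    have "(\<lambda>(z, t). ennreal (b n z) * ennreal \<bar>F (t + z) - F t\<bar>) \<in> borel_measurable (lborel \<Otimes>\<^sub>M lborel)"
      by measurable
    then have meas: "(\<lambda>(z, t). ennreal (b n z) * ennreal \<bar>?f (t + z) - ?f t\<bar>) \<in> borel_measurable (lborel \<Otimes>\<^sub>M lborel)"
      by (simp add: F_def)
    have "(\<lambda>t. ennreal \<bar>F (t + z) - F t\<bar>) \<in> borel_measurable lborel" for z
      by measurable
    then have meas': "(\<lambda>t. ennreal \<bar>?f (t + z) - ?f t\<bar>) \<in> borel_measurable lborel" for z
      by (simp add: F_def)
    have "(\<integral>\<^sup>+t\<in>cball 0 R. ennreal \<bar>(\<integral>x. Y x * b n (x + - t) \<partial>lborel) - Y t\<bar> \<partial>lborel) \<le>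
      (\<integral>\<^sup>+t. (\<integral>\<^sup>+z. ennreal (b n z * \<bar>?f (t + z) - ?f t\<bar>) \<partial>lborel) \<partial>lborel)"
      using 1 by (intro nn_integral_mono) (auto simp: indicator_def)
    also have "\<dots> = (\<integral>\<^sup>+z. (\<integral>\<^sup>+t. ennreal (b n z) * ennreal \<bar>?f (t + z) - ?f t\<bar> \<partial>lborel) \<partial>lborel)"
      using meas by (subst lborel_pair.Fubini') (auto simp: ennreal_mult b(2))
    also have "\<dots> = (\<integral>\<^sup>+z. ennreal (b n z) * (\<integral>\<^sup>+t. ennreal \<bar>?f (t + z) - ?f t\<bar> \<partial>lborel) \<partial>lborel)"
      using meas' by (intro nn_integral_cong nn_integral_cmult) auto
    also have "\<dots> \<le> (\<integral>\<^sup>+z. ennreal (b n z) * ennreal e \<partial>lborel)"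
    proof (intro nn_integral_mono)
      fix z
      show "ennreal (b n z) * (\<integral>\<^sup>+t. ennreal \<bar>?f (t + z) - ?f t\<bar> \<partial>lborel) \<le> ennreal (b n z) * ennreal e"
        using d(2)[of z] b(4)[of n z] elim
        by (cases "b n z = 0") (force intro!: mult_left_mono order.strict_implies_order[of "nn_integral _ _"])+
    qed
    also have "\<dots> = ennreal e"
      using ib b(2) b(3)[of n] by (simp add: nn_integral_multc nn_integral_eq_integral)
    finally show ?case .
  qed
qed

lemma mollifier_exists:
  assumes "h > 0"
  shows "\<exists>b::'a::euclidean_space \<Rightarrow> real. b \<in> test_functions \<and> (\<forall>x. b x \<ge> 0) \<and> (\<integral>x. b x \<partial>lborel) = 1 \<and>
    (\<forall>x. b x \<noteq> 0 \<longrightarrow> norm x \<le> h)"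
proof -
  \<comment> \<open>The product lives on the cube with coordinates of modulus at most c. The norm is
    at most the sum of the moduli of the coordinates, so this c keeps the support in the ball of
    radius h.\<close>
  define c where "c = h / DIM('a)"
  have "c > 0" using assms by (simp add: c_def)
  define g where "g = (\<lambda>x::'a. \<Prod>i\<in>Basis. flat 1 (i \<bullet> x + c) * flat 1 ((- i) \<bullet> x + c))"
  have gsm: "smooth g"
    unfolding g_def by (intro flat_algebra_smooth flat_algebra_prod flat_algebra.mult flat_algebra.affine) auto
  have supp: "norm x \<le> h" if "g x \<noteq> 0" for x
  proof -
    have "\<bar>x \<bullet> i\<bar> \<le> c" if "i \<in> Basis" for i
      using \<open>g x \<noteq> 0\<close> that unfolding g_def
      by (auto simp: flat_def abs_le_iff inner_commute split: if_splits)
    then have "(\<Sum>i\<in>Basis. \<bar>x \<bullet> i\<bar>) \<le> (\<Sum>i\<in>(Basis::'a set). c)" by (intro sum_mono)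
    then show ?thesis using norm_le_l1[of x] by (simp add: c_def)
  qed
  have nonneg: "g x \<ge> 0" for x
    unfolding g_def by (intro prod_nonneg) (auto simp: flat_def)
  have "g 0 \<noteq> 0"
    using \<open>c > 0\<close> by (auto simp: g_def flat_def)
  have int: "integrable lborel g"
  proof -
    have "integrable lborel (\<lambda>x. indicator (cball 0 h) x *\<^sub>R g x)"
      using smooth_continuous_on[OF gsm] by (intro borel_integrable_compact) (auto intro: continuous_on_subset)
    also have "(\<lambda>x. indicator (cball 0 h) x *\<^sub>R g x) = g"
      using supp by (auto simp: fun_eq_iff indicator_def)
    finally show ?thesis .
  qed
  have "(\<integral>x. g x \<partial>lborel) \<noteq> 0"
  proof
    assume "(\<integral>x. g x \<partial>lborel) = 0"
    then have "AE x in lborel. g x = 0"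
      using int nonneg by (subst (asm) integral_nonneg_eq_0_iff_AE) auto
    from continuous_AE_eq_0[OF smooth_continuous_on[OF gsm] this, of 0] show False
      using \<open>g 0 \<noteq> 0\<close> by simp
  qed
  moreover have "(\<integral>x. g x \<partial>lborel) \<ge> 0" using nonneg by simp
  ultimately have pos: "(\<integral>x. g x \<partial>lborel) > 0" by simp
  have "g \<in> test_functions" using gsm supp by (auto simp: test_functions_alt)
  then have "(\<lambda>x. inverse (\<integral>x. g x \<partial>lborel) * g x) \<in> test_functions"
    using test_functions_linear_combination[of g g "inverse (\<integral>x. g x \<partial>lborel)" 0] by simp
  then show ?thesis
    using pos nonneg supp by (intro exI[of _ "\<lambda>x. inverse (\<integral>x. g x \<partial>lborel) * g x"]) auto
qed

section \<open>Riemann sums\<close>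

text \<open>The values of \<open>p m\<close> serve as nodes and its fibres as cells of Riemann sums.
  The norm bound keeps the nodes in a bounded set when the measure has bounded support.\<close>

lemma simple_functions_to_identity:
  obtains p :: "nat \<Rightarrow> 'a::euclidean_space \<Rightarrow> 'a"
  where "\<And>m. simple_function borel (p m)" "\<And>x. (\<lambda>m. p m x) \<longlonglongrightarrow> x" "\<And>m x. norm (p m x) \<le> 2 * norm x"
proof -
  have "(\<lambda>x::'a. x) \<in> borel_measurable borel" by simp
  from borel_measurable_implies_sequence_metric[OF this, of 0] show ?thesis
    using that by (auto simp: dist_norm)
qed

lemma integral_simple_compose:
  fixes F :: "'a::euclidean_space \<Rightarrow> real"
  assumes p: "simple_function borel p" and \<mu>: "finite_measure \<mu>" "sets \<mu> = sets borel"
  shows "(\<integral>x. F (p x) \<partial>\<mu>) = (\<Sum>t\<in>range p. measure \<mu> (p -` {t}) * F t)"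
proof -
  interpret finite_measure \<mu> by fact
  have sp: "space \<mu> = UNIV" using sets_eq_imp_space_eq[OF \<mu>(2)] by simp
  have fin: "finite (range p)" using p by (auto simp: simple_function_def)
  have m[measurable]: "p -` {t} \<in> sets \<mu>" for t
    using simple_functionD(2)[OF p, of "{t}"] by (simp add: \<mu>(2))
  have "F (p x) = (\<Sum>t\<in>range p. indicator (p -` {t}) x * F t)" for x
  proof -
    have "(\<Sum>t\<in>range p. indicator (p -` {t}) x * F t) = (\<Sum>t\<in>range p. if t = p x then F t else 0)"
      by (intro sum.cong) (auto simp: indicator_def)
    also have "\<dots> = F (p x)" using fin by (subst sum.delta) auto
    finally show ?thesis by simp
  qed
  then have "(\<integral>x. F (p x) \<partial>\<mu>) = (\<integral>x. (\<Sum>t\<in>range p. indicator (p -` {t}) x * F t) \<partial>\<mu>)" by simp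
  also have "\<dots> = (\<Sum>t\<in>range p. measure \<mu> (p -` {t}) * F t)"
    using fin by (subst Bochner_Integration.integral_sum) (auto simp: sp emeasure_eq_measure intro!: sum.cong)
  finally show ?thesis .
qed

lemma riemann_sums_tendsto:
  fixes F :: "'a::euclidean_space \<Rightarrow> real"
  assumes p: "\<And>m. simple_function borel (p m)" "\<And>x. (\<lambda>m. p m x) \<longlonglongrightarrow> x" "\<And>m x. norm (p m x) \<le> 2 * norm x"
    and \<mu>: "finite_measure \<mu>" "sets \<mu> = sets borel" "AE x in \<mu>. norm x \<le> R" and F: "continuous_on UNIV F"
  shows "(\<lambda>m. \<Sum>t\<in>range (p m). measure \<mu> (p m -` {t}) * F t) \<longlonglongrightarrow> (\<integral>x. F x \<partial>\<mu>)"
proof -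
  interpret finite_measure \<mu> by fact
  have [measurable]: "F \<in> borel_measurable borel" using F by (rule borel_measurable_continuous_onI)
  have [measurable]: "p m \<in> borel_measurable borel" for m using p(1) by (rule borel_measurable_simple_function)
  have "compact (F ` cball 0 (2 * R))"
    using F by (intro compact_continuous_image) (auto intro: continuous_on_subset)
  then obtain B where "\<forall>y\<in>F ` cball 0 (2 * R). norm y \<le> B"
    using compact_imp_bounded[of "F ` cball 0 (2 * R)"] unfolding bounded_pos by blast
  then have B: "\<bar>F x\<bar> \<le> B" if "norm x \<le> 2 * R" for x
    using that by simp
  have "(\<lambda>m. \<integral>x. F (p m x) \<partial>\<mu>) \<longlonglongrightarrow> (\<integral>x. F x \<partial>\<mu>)"
  proof (rule integral_dominated_convergence[where w = "\<lambda>_. B"])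
    show "AE x in \<mu>. (\<lambda>m. F (p m x)) \<longlonglongrightarrow> F x"
      using p(2) by (intro AE_I2 continuous_on_tendsto_compose[OF F]) auto
    show "AE x in \<mu>. norm (F (p m x)) \<le> B" for m
      using \<mu>(3)
    proof eventually_elim
      case (elim x)
      then show ?case using B[of "p m x"] p(3)[of m x] by simp
    qed
  qed (auto simp: measurable_cong_sets[OF \<mu>(2)])
  then show ?thesis
    by (simp add: integral_simple_compose[OF p(1) \<mu>(1,2)])
qed

section \<open>Tails of symmetric stable laws\<close>

text \<open>The parameter s is the \<alpha>-th power of the usual scale. In this normalization it
  adds up over independent summands, and for a noise integral it is the integral of the \<alpha>-th
  power of the modulus of the integrand.\<close>

definition symmetric_stable :: "'w measure \<Rightarrow> real \<Rightarrow> real \<Rightarrow> ('w \<Rightarrow> real) \<Rightarrow> bool" where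
  "symmetric_stable M \<alpha> s X \<longleftrightarrow> X \<in> borel_measurable M \<and> 0 \<le> s \<and>
     (\<forall>u. char (distr M borel X) u = complex_of_real (exp (- s * \<bar>u\<bar> powr \<alpha>)))"

text \<open>For X symmetric stable with parameter s and v > 0, the value at s v^\<alpha> is the mean
  of 1 - exp (-(v X)^2 / 2), a smooth substitute for the probability that \<bar>X\<bar> exceeds 1 /
  v.\<close>

definition gauss_stable :: "real \<Rightarrow> real \<Rightarrow> real" where
  "gauss_stable \<alpha> x = (\<integral>z. 1 - exp (- x * \<bar>z\<bar> powr \<alpha>) \<partial>std_normal_distribution)"

lemma integrable_gauss_stable:
  assumes "x \<ge> 0" shows "integrable std_normal_distribution (\<lambda>z. 1 - exp (- x * \<bar>z\<bar> powr \<alpha>))"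
proof -
  interpret N: real_distribution std_normal_distribution by (rule real_dist_normal_dist)
  show ?thesis
    using assms by (intro N.integrable_const_bound[where B = 1]) auto
qed

lemma std_normal_second_moment:
  "integrable std_normal_distribution (\<lambda>z. z\<^sup>2)" "(\<integral>z. z\<^sup>2 \<partial>std_normal_distribution) = 1"
  using std_normal_distribution_even_moments[of 1] by (simp_all add: fact_numeral power2_eq_square)

text \<open>The constant 2 is the Gaussian mean of 1 + z^2, which dominates the \<alpha>-th power of
  \<bar>z\<bar>.\<close>

lemma gauss_stable_le:
  assumes "0 < \<alpha>" "\<alpha> < 2" "0 \<le> x" shows "gauss_stable \<alpha> x \<le> 2 * x"
proof -
  interpret N: real_distribution std_normal_distribution by (rule real_dist_normal_dist)
  have "gauss_stable \<alpha> x \<le> (\<integral>z. x * (1 + z\<^sup>2) \<partial>std_normal_distribution)"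
    unfolding gauss_stable_def
  proof (intro integral_mono integrable_gauss_stable assms)
    fix z :: real
    have "\<bar>z\<bar> powr \<alpha> \<le> 1 + z\<^sup>2"
    proof (cases "\<bar>z\<bar> \<le> 1")
      case True
      then have "\<bar>z\<bar> powr \<alpha> \<le> 1" using assms by (simp add: powr_le1)
      then show ?thesis using zero_le_power2[of z] by linarith
    next
      case False
      then have "\<bar>z\<bar> powr \<alpha> \<le> \<bar>z\<bar> powr 2" using assms by (intro powr_mono) auto
      then show ?thesis using False by (simp add: powr_numeral)
    qed
    then have "x * \<bar>z\<bar> powr \<alpha> \<le> x * (1 + z\<^sup>2)" using assms by (intro mult_left_mono) auto
    moreover have "1 - exp (- x * \<bar>z\<bar> powr \<alpha>) \<le> x * \<bar>z\<bar> powr \<alpha>"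
      using exp_ge_add_one_self[of "- x * \<bar>z\<bar> powr \<alpha>"] by simp
    ultimately show "1 - exp (- x * \<bar>z\<bar> powr \<alpha>) \<le> x * (1 + z\<^sup>2)" by linarith
  qed (use std_normal_second_moment in auto)
  also have "\<dots> = x * ((\<integral>z. 1 \<partial>std_normal_distribution) + (\<integral>z. z\<^sup>2 \<partial>std_normal_distribution))"
    using std_normal_second_moment by (subst Bochner_Integration.integral_add[symmetric]) auto
  also have "\<dots> = 2 * x"
    using std_normal_second_moment N.prob_space by simp
  finally show ?thesis .
qed

lemma gauss_stable_1_pos: "gauss_stable \<alpha> 1 > 0"
proof -
  interpret N: real_distribution std_normal_distribution by (rule real_dist_normal_dist)
  have "gauss_stable \<alpha> 1 \<noteq> 0"
  proof
    assume "gauss_stable \<alpha> 1 = 0"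
    then have "AE z in std_normal_distribution. 1 - exp (- 1 * \<bar>z\<bar> powr \<alpha>) = 0"
      unfolding gauss_stable_def using integrable_gauss_stable[of 1 \<alpha>]
      by (subst (asm) integral_nonneg_eq_0_iff_AE) auto
    then have "AE z in std_normal_distribution. z\<^sup>2 = 0"
      by eventually_elim auto
    then have "(\<integral>z. z\<^sup>2 \<partial>std_normal_distribution) = (\<integral>z. 0 \<partial>std_normal_distribution)"
      by (intro integral_cong_AE) auto
    then show False using std_normal_second_moment by simp
  qed
  moreover have "gauss_stable \<alpha> 1 \<ge> 0"
    unfolding gauss_stable_def by (intro Bochner_Integration.integral_nonneg) auto
  ultimately show ?thesis by linarith
qed

text \<open>Concavity of 1 - exp (-x y) in x up to x = 1, and monotonicity beyond. This linear lower
  bound is the source of the lower tail estimate.\<close>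

lemma gauss_stable_ge:
  assumes "0 \<le> x" shows "gauss_stable \<alpha> 1 * min 1 x \<le> gauss_stable \<alpha> x"
proof -
  have "gauss_stable \<alpha> 1 * min 1 x = (\<integral>z. (1 - exp (- 1 * \<bar>z\<bar> powr \<alpha>)) * min 1 x \<partial>std_normal_distribution)"
    unfolding gauss_stable_def by simp
  also have "\<dots> \<le> gauss_stable \<alpha> x"
    unfolding gauss_stable_def
  proof (intro integral_mono integrable_gauss_stable integrable_mult_left assms)
    fix z :: real
    define y where "y = \<bar>z\<bar> powr \<alpha>"
    have "y \<ge> 0" by (simp add: y_def)
    have "(1 - exp (- y)) * min 1 x \<le> 1 - exp (- x * y)"
    proof (cases "x \<le> 1")
      case True
      have "exp ((1 - x) *\<^sub>R 0 + x *\<^sub>R (- y)) \<le> (1 - x) * exp 0 + x * exp (- y)"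
        using True assms by (intro convex_onD[OF exp_convex]) auto
      then show ?thesis using True assms by (simp add: algebra_simps)
    next
      case False
      then have "y \<le> x * y" using mult_right_mono[of 1 x y] \<open>y \<ge> 0\<close> by simp
      then show ?thesis using False by simp
    qed
    then show "(1 - exp (- 1 * \<bar>z\<bar> powr \<alpha>)) * min 1 x \<le> 1 - exp (- x * \<bar>z\<bar> powr \<alpha>)"
      by (simp add: y_def)
  qed simp
  finally show ?thesis .
qed

text \<open>exp (-u^2 / 2) is the characteristic function of the standard normal law. Exchanging the
  two expectations turns it into the characteristic function of X at a Gaussian argument.\<close>

lemma (in prob_space) expectation_gauss_stable:
  assumes X: "symmetric_stable M \<alpha> s X" and "v > 0"
  shows "expectation (\<lambda>\<omega>. 1 - exp (- (v * X \<omega>)\<^sup>2 / 2)) = gauss_stable \<alpha> (s * v powr \<alpha>)"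
proof -
  interpret N: real_distribution std_normal_distribution by (rule real_dist_normal_dist)
  interpret P: pair_prob_space M std_normal_distribution ..
  have [measurable]: "X \<in> borel_measurable M" using X by (simp add: symmetric_stable_def)
  have s: "s \<ge> 0" using X by (simp add: symmetric_stable_def)
  have i1: "integrable M (\<lambda>\<omega>. exp (- (v * X \<omega>)\<^sup>2 / 2))"
    by (intro integrable_const_bound[where B = 1]) auto
  have i2: "integrable std_normal_distribution (\<lambda>z. exp (- (s * v powr \<alpha>) * \<bar>z\<bar> powr \<alpha>))"
    using s by (intro N.integrable_const_bound[where B = 1]) auto
  have "complex_of_real (expectation (\<lambda>\<omega>. exp (- (v * X \<omega>)\<^sup>2 / 2))) =
     (CLINT \<omega>|M. char std_normal_distribution (v * X \<omega>))"
    by (simp add: char_std_normal_distribution)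
  also have "\<dots> = (CLINT \<omega>|M. CLINT z|std_normal_distribution. iexp (v * X \<omega> * z))"
    by (simp add: char_def)
  also have "\<dots> = (CLINT z|std_normal_distribution. CLINT \<omega>|M. iexp (v * X \<omega> * z))"
    by (rule P.Fubini_integral[symmetric])
      (auto intro!: P.integrable_const_bound[where B = 1] simp del: of_real_mult)
  also have "\<dots> = (CLINT z|std_normal_distribution. char (distr M borel X) (v * z))"
    by (simp add: char_def integral_distr mult_ac)
  also have "\<dots> = (CLINT z|std_normal_distribution. complex_of_real (exp (- (s * v powr \<alpha>) * \<bar>z\<bar> powr \<alpha>)))"
    using X \<open>v > 0\<close> by (simp add: symmetric_stable_def abs_mult powr_mult mult_ac)
  also have "\<dots> = complex_of_real (\<integral>z. exp (- (s * v powr \<alpha>) * \<bar>z\<bar> powr \<alpha>) \<partial>std_normal_distribution)"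
    by simp
  finally have "expectation (\<lambda>\<omega>. exp (- (v * X \<omega>)\<^sup>2 / 2)) =
     (\<integral>z. exp (- (s * v powr \<alpha>) * \<bar>z\<bar> powr \<alpha>) \<partial>std_normal_distribution)"
    unfolding of_real_eq_iff .
  then show ?thesis
    using i1 i2 prob_space N.prob_space unfolding gauss_stable_def
    by (subst (1 2) Bochner_Integration.integral_diff) auto
qed

lemma (in prob_space) stable_tail_upper:
  assumes \<alpha>: "0 < \<alpha>" "\<alpha> < 2" and X: "symmetric_stable M \<alpha> s X" and "y > 0"
  shows "prob {\<omega>\<in>space M. \<bar>X \<omega>\<bar> \<ge> y} \<le> 6 * (s * y powr - \<alpha>)"
proof -
  have [measurable]: "X \<in> borel_measurable M" and s: "s \<ge> 0" using X by (auto simp: symmetric_stable_def)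
  have "prob {\<omega>\<in>space M. \<bar>X \<omega>\<bar> \<ge> y} = expectation (indicator {\<omega>\<in>space M. \<bar>X \<omega>\<bar> \<ge> y})"
    by simp
  also have "\<dots> \<le> expectation (\<lambda>\<omega>. 3 * (1 - exp (- (inverse y * X \<omega>)\<^sup>2 / 2)))"
  proof (intro integral_mono)
    show "integrable M (\<lambda>\<omega>. 3 * (1 - exp (- (inverse y * X \<omega>)\<^sup>2 / 2)))"
      by (intro integrable_mult_right integrable_const_bound[where B = 1]) auto
    fix \<omega> assume "\<omega> \<in> space M"
    \<comment> \<open>1 - exp (-1/2) is at least 1/3, since exp (1/2) is at least 3/2. With the 2
      from \<open>gauss_stable_le\<close> this gives the 6 in the bound.\<close>
    have "1 \<le> 3 * (1 - exp (- (inverse y * X \<omega>)\<^sup>2 / 2))" if "\<bar>X \<omega>\<bar> \<ge> y"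
    proof -
      have "1 \<le> \<bar>inverse y * X \<omega>\<bar>" using that \<open>y > 0\<close> by (simp add: abs_mult field_simps)
      then have "1 \<le> (inverse y * X \<omega>)\<^sup>2" by (metis abs_le_square_iff abs_numeral abs_one one_power2)
      then have "exp (- (inverse y * X \<omega>)\<^sup>2 / 2) \<le> exp (- (1 / 2))" by simp
      also have "\<dots> \<le> 2 / 3"
        using exp_ge_add_one_self[of "1 / 2"] by (simp add: exp_minus field_simps)
      finally show ?thesis by simp
    qed
    then show "indicator {\<omega>\<in>space M. \<bar>X \<omega>\<bar> \<ge> y} \<omega> \<le> 3 * (1 - exp (- (inverse y * X \<omega>)\<^sup>2 / 2))"
      by (auto simp: indicator_def)
  qed (auto intro!: integrable_const_bound[where B = 1])
  also have "\<dots> = 3 * gauss_stable \<alpha> (s * inverse y powr \<alpha>)"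
    by (simp only: integral_mult_right_zero expectation_gauss_stable[OF X positive_imp_inverse_positive[OF \<open>y > 0\<close>]])
  also have "\<dots> \<le> 3 * (2 * (s * inverse y powr \<alpha>))"
    using s by (intro mult_left_mono gauss_stable_le \<alpha>) auto
  also have "inverse y powr \<alpha> = y powr - \<alpha>"
    using \<open>y > 0\<close> by (simp add: powr_minus inverse_powr)
  finally show ?thesis by simp
qed

text \<open>With h = \<open>tail_shrink \<alpha>\<close>, the number 4 h^(2 - \<alpha>) is at most
  half of \<open>gauss_stable \<alpha> 1\<close>. The part of the mean of 1 - exp (-(X / y)^2 / 2)
  that comes from \<bar>X\<bar> \<le> h y then uses up at most half of the lower bound for this
  mean; the rest must come from the tail. This works because \<alpha> < 2.\<close>

definition tail_shrink :: "real \<Rightarrow> real" where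
  "tail_shrink \<alpha> = min 1 ((gauss_stable \<alpha> 1 / 8) powr (1 / (2 - \<alpha>)))"

definition tail_const :: "real \<Rightarrow> real" where
  "tail_const \<alpha> = min 1 (gauss_stable \<alpha> 1 / 2 * tail_shrink \<alpha> powr \<alpha>)"

lemma tail_shrink: "0 < tail_shrink \<alpha>" "tail_shrink \<alpha> \<le> 1"
  using gauss_stable_1_pos[of \<alpha>] by (auto simp: tail_shrink_def)

lemma tail_const: "0 < tail_const \<alpha>" "tail_const \<alpha> \<le> 1"
  using gauss_stable_1_pos[of \<alpha>] tail_shrink[of \<alpha>] by (auto simp: tail_const_def)

lemma (in prob_space) stable_tail_lower_aux:
  assumes \<alpha>: "0 < \<alpha>" "\<alpha> < 2" and X: "symmetric_stable M \<alpha> s X" and "y > 0" and sy: "s * y powr - \<alpha> \<le> 1"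
  shows "gauss_stable \<alpha> 1 / 2 * (s * y powr - \<alpha>) \<le> prob {\<omega>\<in>space M. \<bar>X \<omega>\<bar> > tail_shrink \<alpha> * y}"
proof -
  define h where "h = tail_shrink \<alpha>"
  have h: "0 < h" "h \<le> 1" using tail_shrink by (auto simp: h_def)
  have [measurable]: "X \<in> borel_measurable M" and s: "s \<ge> 0" using X by (auto simp: symmetric_stable_def)
  have i: "integrable M (\<lambda>\<omega>. 1 - exp (- (v * X \<omega>)\<^sup>2 / 2))" for v
    by (intro integrable_const_bound[where B = 1]) auto
  have "gauss_stable \<alpha> 1 * (s * y powr - \<alpha>) \<le> gauss_stable \<alpha> (s * y powr - \<alpha>)"
    using gauss_stable_ge[of "s * y powr - \<alpha>" \<alpha>] sy s by (simp add: min_def split: if_splits)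
  also have "\<dots> = expectation (\<lambda>\<omega>. 1 - exp (- (inverse y * X \<omega>)\<^sup>2 / 2))"
    using \<open>y > 0\<close> expectation_gauss_stable[OF X, of "inverse y"] by (simp add: powr_minus inverse_powr)
  also have "\<dots> \<le> expectation (\<lambda>\<omega>. indicator {\<omega>\<in>space M. \<bar>X \<omega>\<bar> > h * y} \<omega> +
      2 * h\<^sup>2 * (1 - exp (- (inverse (h * y) * X \<omega>)\<^sup>2 / 2)))"
  proof (intro integral_mono i Bochner_Integration.integrable_add integrable_mult_right)
    fix \<omega> assume \<omega>: "\<omega> \<in> space M"
    define w where "w = (inverse (h * y) * X \<omega>)\<^sup>2 / 2"
    \<comment> \<open>Near 0 the function is quadratic up to constants, so passing from the level y
      to h y gains the factor h^2. The 2 comes from 1 - exp (-w) \<ge> w / 2 for w between 0 and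
      1.\<close>
    have "1 - exp (- (inverse y * X \<omega>)\<^sup>2 / 2) \<le> 2 * h\<^sup>2 * (1 - exp (- w))" if "\<bar>X \<omega>\<bar> \<le> h * y"
    proof -
      have "\<bar>inverse (h * y) * X \<omega>\<bar> \<le> 1"
        using that h \<open>y > 0\<close> by (simp add: abs_mult field_simps)
      then have w: "0 \<le> w" "w \<le> 1" unfolding w_def
        using abs_square_le_1[of "inverse (h * y) * X \<omega>"] zero_le_power2[of "inverse (h * y) * X \<omega>"] by linarith+
      have "exp (- w) \<le> 1 / (1 + w)"
        using exp_ge_add_one_self[of w] w by (simp add: exp_minus field_simps)
      also have "\<dots> \<le> 1 - w / 2"
        using w mult_mono[of w 1 w 1] mult_left_mono[of w 1 w] by (simp add: field_simps)
      finally have "w \<le> 2 * (1 - exp (- w))" by simp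
      then have "h\<^sup>2 * w \<le> h\<^sup>2 * (2 * (1 - exp (- w)))" by (intro mult_left_mono) auto
      moreover have "(inverse y * X \<omega>)\<^sup>2 / 2 = h\<^sup>2 * w"
        using h \<open>y > 0\<close> by (simp add: w_def field_simps)
      moreover have "1 - exp (- (inverse y * X \<omega>)\<^sup>2 / 2) \<le> (inverse y * X \<omega>)\<^sup>2 / 2"
        using exp_ge_add_one_self[of "- (inverse y * X \<omega>)\<^sup>2 / 2"] by simp
      ultimately show ?thesis by linarith
    qed
    moreover define z where "z = 2 * h\<^sup>2 * (1 - exp (- w))"
    moreover have "0 \<le> z" by (simp add: w_def z_def)
    ultimately show "1 - exp (- (inverse y * X \<omega>)\<^sup>2 / 2) \<le> indicator {\<omega>\<in>space M. \<bar>X \<omega>\<bar> > h * y} \<omega> +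
      2 * h\<^sup>2 * (1 - exp (- (inverse (h * y) * X \<omega>)\<^sup>2 / 2))"
      unfolding minus_divide_left[symmetric] w_def[symmetric] z_def[symmetric]
      using \<omega> by (cases "\<bar>X \<omega>\<bar> \<le> h * y") (auto simp: indicator_def intro: order_trans[of _ 0])
  qed (auto intro!: integrable_const_bound[where B = 1])
  also have "\<dots> = prob {\<omega>\<in>space M. \<bar>X \<omega>\<bar> > h * y} + 2 * h\<^sup>2 * gauss_stable \<alpha> (s * inverse (h * y) powr \<alpha>)"
    using i h \<open>y > 0\<close> expectation_gauss_stable[OF X, of "inverse (h * y)"]
    by (subst Bochner_Integration.integral_add) (auto intro!: integrable_const_bound[where B = 1])
  also have "\<dots> \<le> prob {\<omega>\<in>space M. \<bar>X \<omega>\<bar> > h * y} + 2 * h\<^sup>2 * (2 * (s * inverse (h * y) powr \<alpha>))"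
    using s by (intro add_left_mono mult_left_mono gauss_stable_le \<alpha>) auto
  also have "2 * h\<^sup>2 * (2 * (s * inverse (h * y) powr \<alpha>)) = 4 * (h powr (2 - \<alpha>)) * (s * y powr - \<alpha>)"
  proof -
    have "inverse (h * y) powr \<alpha> = h powr - \<alpha> * y powr - \<alpha>"
      using h \<open>y > 0\<close> by (simp add: powr_mult powr_minus inverse_powr)
    moreover have "h powr (2 - \<alpha>) = h\<^sup>2 * h powr - \<alpha>"
      using h by (simp add: powr_diff powr_minus divide_inverse powr_numeral)
    ultimately show ?thesis by simp
  qed
  also have "\<dots> \<le> gauss_stable \<alpha> 1 / 2 * (s * y powr - \<alpha>)"
  proof (intro mult_right_mono)
    have "h powr (2 - \<alpha>) \<le> ((gauss_stable \<alpha> 1 / 8) powr (1 / (2 - \<alpha>))) powr (2 - \<alpha>)"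
      using h \<alpha> by (intro powr_mono2) (auto simp: h_def tail_shrink_def)
    also have "\<dots> = gauss_stable \<alpha> 1 / 8"
      using \<alpha> gauss_stable_1_pos[of \<alpha>] by (simp add: powr_powr)
    finally show "4 * h powr (2 - \<alpha>) \<le> gauss_stable \<alpha> 1 / 2" by simp
  qed (use s in auto)
  finally show ?thesis by (simp add: h_def)
qed

lemma (in prob_space) stable_tail_lower:
  assumes \<alpha>: "0 < \<alpha>" "\<alpha> < 2" and X: "symmetric_stable M \<alpha> s X" and "y > 0"
  shows "tail_const \<alpha> * min 1 (s * y powr - \<alpha>) \<le> prob {\<omega>\<in>space M. \<bar>X \<omega>\<bar> > y}"
proof -
  define h where "h = tail_shrink \<alpha>"
  define g where "g = gauss_stable \<alpha> 1 / 2"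
  have h: "0 < h" "h \<le> 1" "0 < g" using tail_shrink gauss_stable_1_pos[of \<alpha>] by (auto simp: h_def g_def)
  have h\<alpha>: "h powr \<alpha> \<le> 1" using h \<alpha> by (simp add: powr_le1)
  have [measurable]: "X \<in> borel_measurable M" and s: "s \<ge> 0" using X by (auto simp: symmetric_stable_def)
  have t: "tail_const \<alpha> \<le> g * h powr \<alpha>" by (simp add: tail_const_def g_def h_def)
  show ?thesis
  \<comment> \<open>If the level y / h is at least the scale s^(1/\<alpha>), the auxiliary bound
    applies at y / h. Otherwise it applies at the scale w itself, where s w^(-\<alpha>) = 1; then y
    \<le> h w, so the event at level y contains the one at level h w.\<close>
  proof (cases "s * (y / h) powr - \<alpha> \<le> 1")
    case True
    have "tail_const \<alpha> * min 1 (s * y powr - \<alpha>) \<le> (g * h powr \<alpha>) * (s * y powr - \<alpha>)"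
      using t s tail_const(1)[of \<alpha>] by (intro mult_mono) auto
    also have "\<dots> = g * (s * (y / h) powr - \<alpha>)"
      using h \<open>y > 0\<close> by (simp add: powr_divide powr_minus field_simps)
    also have "\<dots> \<le> prob {\<omega>\<in>space M. \<bar>X \<omega>\<bar> > h * (y / h)}"
      unfolding g_def h_def using \<open>y > 0\<close> h True by (intro stable_tail_lower_aux[OF \<alpha> X]) (auto simp: h_def)
    finally show ?thesis using h by simp
  next
    case False
    then have "s > 0" using s by (cases "s = 0") auto
    define w where "w = s powr (1 / \<alpha>)"
    have w: "w > 0" "s * w powr - \<alpha> = 1"
      using \<open>s > 0\<close> \<alpha> by (auto simp: w_def powr_powr powr_minus)
    have "y \<le> h * w"
    proof (rule ccontr)
      assume "\<not> y \<le> h * w"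
      then have "w \<le> y / h" using h by (simp add: field_simps)
      then have "(y / h) powr - \<alpha> \<le> w powr - \<alpha>"
        using \<alpha> w by (intro powr_mono2') auto
      then have "s * (y / h) powr - \<alpha> \<le> s * w powr - \<alpha>"
        using s by (intro mult_left_mono) auto
      with False w show False by simp
    qed
    have "tail_const \<alpha> * min 1 (s * y powr - \<alpha>) \<le> (g * h powr \<alpha>) * 1"
      using t s tail_const(1)[of \<alpha>] by (intro mult_mono) auto
    also have "\<dots> \<le> g * (s * w powr - \<alpha>)" using h\<alpha> h w by simp
    also have "\<dots> \<le> prob {\<omega>\<in>space M. \<bar>X \<omega>\<bar> > h * w}"
      unfolding g_def h_def using w by (intro stable_tail_lower_aux[OF \<alpha> X]) auto
    also have "\<dots> \<le> prob {\<omega>\<in>space M. \<bar>X \<omega>\<bar> > y}"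
      using \<open>y \<le> h * w\<close> by (intro finite_measure_mono) auto
    finally show ?thesis .
  qed
qed

text \<open>At index 1 the tail is at least a constant times s / y, and integrating it over y from U
  to V produces the logarithm. The hypothesis s \<le> U keeps y in the range where the minimum in
  the tail bound is s / y and not 1.\<close>

lemma (in prob_space) stable_truncated_mean:
  assumes X: "symmetric_stable M 1 s X" and "0 < U" "s \<le> U" "0 < V"
  shows "s * (tail_const 1 * ln (V / U) - 6) \<le> expectation (\<lambda>\<omega>. \<bar>X \<omega>\<bar> * indicator {\<omega>. U < \<bar>X \<omega>\<bar> \<and> \<bar>X \<omega>\<bar> \<le> V} \<omega>)"
proof (cases "U \<le> V")
  case False
  then have "ln (V / U) \<le> 0" using assms by (simp add: ln_div)
  then have "tail_const 1 * ln (V / U) - 6 \<le> 0"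
    using tail_const(1)[of 1] by (smt (verit) mult_nonneg_nonpos)
  then have "s * (tail_const 1 * ln (V / U) - 6) \<le> 0"
    using X by (intro mult_nonneg_nonpos) (auto simp: symmetric_stable_def)
  also have "0 \<le> expectation (\<lambda>\<omega>. \<bar>X \<omega>\<bar> * indicator {\<omega>. U < \<bar>X \<omega>\<bar> \<and> \<bar>X \<omega>\<bar> \<le> V} \<omega>)"
    by (intro Bochner_Integration.integral_nonneg) auto
  finally show ?thesis .
next
  case True
  have [measurable]: "X \<in> borel_measurable M" and s: "s \<ge> 0" using X by (auto simp: symmetric_stable_def)
  let ?T = "\<lambda>\<omega>. \<bar>X \<omega>\<bar> * indicator {\<omega>. U < \<bar>X \<omega>\<bar> \<and> \<bar>X \<omega>\<bar> \<le> V} \<omega>"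
  have iT: "integrable M ?T"
    using assms by (intro integrable_const_bound[where B = V]) (auto simp: indicator_def)
  have iV: "integrable M (\<lambda>\<omega>. V * indicator {\<omega>\<in>space M. \<bar>X \<omega>\<bar> > V} \<omega>)"
    by (intro integrable_mult_right integrable_const_bound[where B = 1]) auto
  have "ennreal (s * tail_const 1 * ln (V / U)) = ennreal (s * tail_const 1 * ln V - s * tail_const 1 * ln U)"
    using assms by (simp add: ln_div right_diff_distrib)
  also have "\<dots> = (\<integral>\<^sup>+y. ennreal (s * tail_const 1 / y) * indicator {U .. V} y \<partial>lborel)"
    using assms True s tail_const(1)[of 1]
    by (intro nn_integral_FTC_Icc[symmetric]) (auto intro!: derivative_eq_intros divide_nonneg_pos mult_nonneg_nonneg)
  also have "\<dots> \<le> (\<integral>\<^sup>+y. (\<integral>\<^sup>+\<omega>. indicator {\<omega>\<in>space M. \<bar>X \<omega>\<bar> > y} \<omega> * indicator {U .. V} y \<partial>M) \<partial>lborel)"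
  proof (intro nn_integral_mono)
    fix y :: real
    show "ennreal (s * tail_const 1 / y) * indicator {U .. V} y \<le> (\<integral>\<^sup>+\<omega>. indicator {\<omega>\<in>space M. \<bar>X \<omega>\<bar> > y} \<omega> * indicator {U .. V} y \<partial>M)"
    proof (cases "y \<in> {U..V}")
      case True
      then have y: "y > 0" "s \<le> y" using assms by auto
      have "s * tail_const 1 / y = tail_const 1 * min 1 (s * y powr - 1)"
        using y by (simp add: powr_minus field_simps min_def)
      also have "\<dots> \<le> prob {\<omega>\<in>space M. \<bar>X \<omega>\<bar> > y}"
        by (intro stable_tail_lower[OF _ _ X]) (use y in auto)
      finally show ?thesis using True by (simp add: emeasure_eq_measure ennreal_leI)
    qed simp
  qed
  also have "\<dots> = (\<integral>\<^sup>+\<omega>. (\<integral>\<^sup>+y. indicator {\<omega>\<in>space M. \<bar>X \<omega>\<bar> > y} \<omega> * indicator {U .. V} y \<partial>lborel) \<partial>M)"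
  proof -
    interpret P: pair_sigma_finite lborel M ..
    have "(\<lambda>(y, \<omega>). indicator {\<omega>\<in>space M. \<bar>X \<omega>\<bar> > y} \<omega> * indicator {U .. V} y :: ennreal) \<in> borel_measurable (lborel \<Otimes>\<^sub>M M)"
      unfolding indicator_def by measurable
    then show ?thesis
      by (intro P.Fubini'[symmetric])
  qed
  also have "\<dots> \<le> (\<integral>\<^sup>+\<omega>. ennreal (?T \<omega> + V * indicator {\<omega>\<in>space M. \<bar>X \<omega>\<bar> > V} \<omega>) \<partial>M)"
  proof (intro nn_integral_mono)
    fix \<omega> assume \<omega>: "\<omega> \<in> space M"
    have "(\<integral>\<^sup>+y. indicator {\<omega>\<in>space M. \<bar>X \<omega>\<bar> > y} \<omega> * indicator {U .. V} y \<partial>lborel) \<le>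
      (\<integral>\<^sup>+y. indicator (if \<bar>X \<omega>\<bar> > V then {0..V} else if \<bar>X \<omega>\<bar> > U then {0..\<bar>X \<omega>\<bar>} else {}) y \<partial>lborel)"
      using \<open>0 < U\<close> by (intro nn_integral_mono) (auto simp: indicator_def)
    also have "\<dots> = emeasure lborel (if \<bar>X \<omega>\<bar> > V then {0..V} else if \<bar>X \<omega>\<bar> > U then {0..\<bar>X \<omega>\<bar>} else {})"
      by (rule nn_integral_indicator) simp
    also have "\<dots> \<le> ennreal (?T \<omega> + V * indicator {\<omega>\<in>space M. \<bar>X \<omega>\<bar> > V} \<omega>)"
      using \<omega> assms True by (auto simp: indicator_def)
    finally show "(\<integral>\<^sup>+y. indicator {\<omega>\<in>space M. \<bar>X \<omega>\<bar> > y} \<omega> * indicator {U .. V} y \<partial>lborel) \<le>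
      ennreal (?T \<omega> + V * indicator {\<omega>\<in>space M. \<bar>X \<omega>\<bar> > V} \<omega>)" .
  qed
  also have "\<dots> = ennreal (expectation (\<lambda>\<omega>. ?T \<omega> + V * indicator {\<omega>\<in>space M. \<bar>X \<omega>\<bar> > V} \<omega>))"
    using iT iV \<open>0 < V\<close> by (intro nn_integral_eq_integral) (auto simp: indicator_def)
  finally have "s * tail_const 1 * ln (V / U) \<le> expectation (\<lambda>\<omega>. ?T \<omega> + V * indicator {\<omega>\<in>space M. \<bar>X \<omega>\<bar> > V} \<omega>)"
    using \<open>0 < V\<close> by (subst (asm) ennreal_le_iff) (auto intro!: Bochner_Integration.integral_nonneg simp: indicator_def)
  also have "\<dots> = expectation ?T + V * prob {\<omega>\<in>space M. \<bar>X \<omega>\<bar> > V}"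
    using iT iV by (subst Bochner_Integration.integral_add) auto
  \<comment> \<open>On the event \<bar>X\<bar> > V the integral over y contributes up to V without
    belonging to the truncated mean. The upper tail bound makes this excess at most 6 s, whence the
    subtracted 6.\<close>
  also have "V * prob {\<omega>\<in>space M. \<bar>X \<omega>\<bar> > V} \<le> V * (6 * (s * V powr - 1))"
  proof (intro mult_left_mono)
    have "prob {\<omega>\<in>space M. \<bar>X \<omega>\<bar> > V} \<le> prob {\<omega>\<in>space M. \<bar>X \<omega>\<bar> \<ge> V}"
      by (intro finite_measure_mono) auto
    also have "\<dots> \<le> 6 * (s * V powr - 1)"
      by (intro stable_tail_upper[OF _ _ X]) (use \<open>0 < V\<close> in auto)
    finally show "prob {\<omega>\<in>space M. \<bar>X \<omega>\<bar> > V} \<le> 6 * (s * V powr - 1)" .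
  qed (use \<open>0 < V\<close> in auto)
  also have "V * (6 * (s * V powr - 1)) = 6 * s"
    using \<open>0 < V\<close> by (simp add: powr_minus)
  finally show ?thesis by (simp add: algebra_simps)
qed

lemma (in prob_space) symmetric_stable_uminus:
  assumes X: "symmetric_stable M \<alpha> s X"
  shows "distr M borel (\<lambda>\<omega>. - X \<omega>) = distr M borel X"
proof (rule Levy_uniqueness)
  have [measurable]: "X \<in> borel_measurable M" using X by (auto simp: symmetric_stable_def)
  show "real_distribution (distr M borel (\<lambda>\<omega>. - X \<omega>))" "real_distribution (distr M borel X)"
    by (auto intro!: real_distribution_distr)
  have "char (distr M borel (\<lambda>\<omega>. - X \<omega>)) u = char (distr M borel X) (- u)" for u
    by (simp add: char_def integral_distr)
  then show "char (distr M borel (\<lambda>\<omega>. - X \<omega>)) = char (distr M borel X)"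
    using X by (auto simp: symmetric_stable_def fun_eq_iff)
qed

section \<open>Convergence in probability\<close>

context prob_space
begin

lemma integrable_min_1 [simp]:
  "X \<in> borel_measurable M \<Longrightarrow> integrable M (\<lambda>\<omega>. min 1 \<bar>X \<omega>\<bar>)" for X :: "'a \<Rightarrow> real"
  by (intro integrable_const_bound[where B = 1]) auto

lemma prob_le_expectation_min:
  fixes X :: "'a \<Rightarrow> real"
  assumes [measurable]: "X \<in> borel_measurable M" and "e > 0"
  shows "prob {\<omega>\<in>space M. \<bar>X \<omega>\<bar> > e} \<le> expectation (\<lambda>\<omega>. min 1 \<bar>X \<omega>\<bar>) / min 1 e"
proof -
  have "min 1 e * prob {\<omega>\<in>space M. \<bar>X \<omega>\<bar> > e} = expectation (\<lambda>\<omega>. min 1 e * indicator {\<omega>\<in>space M. \<bar>X \<omega>\<bar> > e} \<omega>)"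
    by simp
  also have "\<dots> \<le> expectation (\<lambda>\<omega>. min 1 \<bar>X \<omega>\<bar>)"
    using \<open>e > 0\<close> by (intro integral_mono integrable_mult_right integrable_const_bound[where B = 1]) (auto simp: indicator_def)
  finally show ?thesis using \<open>e > 0\<close> by (simp add: field_simps min_def split: if_splits)
qed

lemma expectation_min_le_prob:
  fixes X :: "'a \<Rightarrow> real"
  assumes [measurable]: "X \<in> borel_measurable M" and "e \<ge> 0"
  shows "expectation (\<lambda>\<omega>. min 1 \<bar>X \<omega>\<bar>) \<le> e + prob {\<omega>\<in>space M. \<bar>X \<omega>\<bar> > e}"
proof -
  have i: "integrable M (\<lambda>\<omega>. indicat_real {\<omega>\<in>space M. \<bar>X \<omega>\<bar> > e} \<omega>)"
    by (intro integrable_const_bound[where B = 1]) auto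
  have "expectation (\<lambda>\<omega>. min 1 \<bar>X \<omega>\<bar>) \<le> expectation (\<lambda>\<omega>. e + indicator {\<omega>\<in>space M. \<bar>X \<omega>\<bar> > e} \<omega>)"
    using i \<open>e \<ge> 0\<close> by (intro integral_mono Bochner_Integration.integrable_add) (auto simp: indicator_def)
  also have "\<dots> = e + prob {\<omega>\<in>space M. \<bar>X \<omega>\<bar> > e}"
    using i by (subst Bochner_Integration.integral_add) (auto simp: prob_space)
  finally show ?thesis .
qed

text \<open>The mean of \<open>min 1 \<bar>X - Z\<bar>\<close> metrizes convergence in probability.
  In this form the triangle inequality, dominated convergence and the extraction of subsequences
  from L1 convergence apply.\<close>

lemma tendsto_in_prob_iff:
  assumes [measurable]: "\<And>n. X n \<in> borel_measurable M" "Z \<in> borel_measurable M"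
  shows "tendsto_in_prob M X Z \<longleftrightarrow> (\<lambda>n. expectation (\<lambda>\<omega>. min 1 \<bar>X n \<omega> - Z \<omega>\<bar>)) \<longlonglongrightarrow> 0"
proof
  assume L: "tendsto_in_prob M X Z"
  show "(\<lambda>n. expectation (\<lambda>\<omega>. min 1 \<bar>X n \<omega> - Z \<omega>\<bar>)) \<longlonglongrightarrow> 0"
    unfolding LIMSEQ_iff
  proof (intro allI impI)
    fix e :: real assume "e > 0"
    then have "(\<lambda>n. measure M {\<omega> \<in> space M. \<bar>X n \<omega> - Z \<omega>\<bar> > e / 2}) \<longlonglongrightarrow> 0"
      using L unfolding tendsto_in_prob_def using half_gt_zero by blast
    then obtain N where N: "\<And>n. n \<ge> N \<Longrightarrow> measure M {\<omega> \<in> space M. \<bar>X n \<omega> - Z \<omega>\<bar> > e / 2} < e / 2"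
      using order_tendstoD(2)[of _ 0 sequentially "e / 2"] \<open>e > 0\<close> unfolding eventually_sequentially by fastforce
    have "norm (expectation (\<lambda>\<omega>. min 1 \<bar>X n \<omega> - Z \<omega>\<bar>) - 0) < e" if "n \<ge> N" for n
    proof -
      have "expectation (\<lambda>\<omega>. min 1 \<bar>X n \<omega> - Z \<omega>\<bar>) < e"
        using expectation_min_le_prob[of "\<lambda>\<omega>. X n \<omega> - Z \<omega>" "e / 2"] N[OF that] \<open>e > 0\<close> by simp
      moreover have "0 \<le> expectation (\<lambda>\<omega>. min 1 \<bar>X n \<omega> - Z \<omega>\<bar>)" by (intro Bochner_Integration.integral_nonneg) auto
      ultimately show ?thesis by simp
    qed
    then show "\<exists>N. \<forall>n\<ge>N. norm (expectation (\<lambda>\<omega>. min 1 \<bar>X n \<omega> - Z \<omega>\<bar>) - 0) < e" by blast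
  qed
next
  assume R: "(\<lambda>n. expectation (\<lambda>\<omega>. min 1 \<bar>X n \<omega> - Z \<omega>\<bar>)) \<longlonglongrightarrow> 0"
  show "tendsto_in_prob M X Z"
    unfolding tendsto_in_prob_def
  proof (intro allI impI)
    fix e :: real assume "e > 0"
    show "(\<lambda>n. measure M {\<omega> \<in> space M. \<bar>X n \<omega> - Z \<omega>\<bar> > e}) \<longlonglongrightarrow> 0"
    proof (rule tendsto_sandwich[where f = "\<lambda>_. 0"])
      show "(\<lambda>n. expectation (\<lambda>\<omega>. min 1 \<bar>X n \<omega> - Z \<omega>\<bar>) / min 1 e) \<longlonglongrightarrow> 0"
        using tendsto_divide[OF R tendsto_const[of "min 1 e"]] \<open>e > 0\<close> by simp
      show "\<forall>\<^sub>F n in sequentially. measure M {\<omega> \<in> space M. \<bar>X n \<omega> - Z \<omega>\<bar> > e} \<le> expectation (\<lambda>\<omega>. min 1 \<bar>X n \<omega> - Z \<omega>\<bar>) / min 1 e"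
        using prob_le_expectation_min[of "\<lambda>\<omega>. X _ \<omega> - Z \<omega>"] \<open>e > 0\<close> by (auto intro!: always_eventually)
    qed auto
  qed
qed

lemma tendsto_in_prob_AE:
  assumes [measurable]: "\<And>n. X n \<in> borel_measurable M" "Z \<in> borel_measurable M"
    and lim: "AE \<omega> in M. (\<lambda>n. X n \<omega>) \<longlonglongrightarrow> Z \<omega>"
  shows "tendsto_in_prob M X Z"
proof -
  have "(\<lambda>n. expectation (\<lambda>\<omega>. min 1 \<bar>X n \<omega> - Z \<omega>\<bar>)) \<longlonglongrightarrow> expectation (\<lambda>\<omega>. 0)"
  proof (rule integral_dominated_convergence[where w = "\<lambda>_. 1"])
    show "AE \<omega> in M. (\<lambda>n. min 1 \<bar>X n \<omega> - Z \<omega>\<bar>) \<longlonglongrightarrow> 0"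
      using lim
    proof eventually_elim
      case (elim \<omega>)
      then have "(\<lambda>n. min 1 \<bar>X n \<omega> - Z \<omega>\<bar>) \<longlonglongrightarrow> min 1 \<bar>Z \<omega> - Z \<omega>\<bar>"
        by (intro tendsto_intros)
      then show ?case by simp
    qed
  qed auto
  then show ?thesis by (simp add: tendsto_in_prob_iff)
qed

text \<open>The truncated differences tend to 0 in L1, hence almost surely along a subsequence, and
  a truncation at 1 is eventually inactive for a sequence tending to 0.\<close>

lemma tendsto_in_prob_subseq:
  assumes [measurable]: "\<And>n. X n \<in> borel_measurable M" "Z \<in> borel_measurable M"
    and "tendsto_in_prob M X Z"
  obtains r :: "nat \<Rightarrow> nat" where "strict_mono r" "AE \<omega> in M. (\<lambda>n. X (r n) \<omega>) \<longlonglongrightarrow> Z \<omega>"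
proof -
  have "(\<lambda>n. expectation (\<lambda>\<omega>. norm (min 1 \<bar>X n \<omega> - Z \<omega>\<bar>))) \<longlonglongrightarrow> 0"
    using assms tendsto_in_prob_iff[of X Z] by simp
  from tendsto_L1_AE_subseq[OF _ this]
  obtain r where r: "strict_mono r" "AE \<omega> in M. (\<lambda>n. min 1 \<bar>X (r n) \<omega> - Z \<omega>\<bar>) \<longlonglongrightarrow> 0" by auto
  from r(2) have "AE \<omega> in M. (\<lambda>n. X (r n) \<omega>) \<longlonglongrightarrow> Z \<omega>"
  proof eventually_elim
    case (elim \<omega>)
    have "\<forall>\<^sub>F n in sequentially. min 1 \<bar>X (r n) \<omega> - Z \<omega>\<bar> < 1"
      using elim by (intro order_tendstoD) auto
    then have "\<forall>\<^sub>F n in sequentially. min 1 \<bar>X (r n) \<omega> - Z \<omega>\<bar> = \<bar>X (r n) \<omega> - Z \<omega>\<bar>"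
      by eventually_elim auto
    with elim have "(\<lambda>n. \<bar>X (r n) \<omega> - Z \<omega>\<bar>) \<longlonglongrightarrow> 0"
      by (rule Lim_transform_eventually)
    then show ?case by (simp add: tendsto_rabs_zero_iff LIM_zero_iff)
  qed
  with r(1) show ?thesis by (rule that)
qed

lemma tendsto_in_prob_unique:
  assumes [measurable]: "\<And>n. X n \<in> borel_measurable M" "Z \<in> borel_measurable M" "Z' \<in> borel_measurable M"
    and "tendsto_in_prob M X Z" "tendsto_in_prob M X Z'"
  shows "AE \<omega> in M. Z \<omega> = Z' \<omega>"
proof -
  have "(\<lambda>n. expectation (\<lambda>\<omega>. min 1 \<bar>X n \<omega> - Z \<omega>\<bar>) + expectation (\<lambda>\<omega>. min 1 \<bar>X n \<omega> - Z' \<omega>\<bar>)) \<longlonglongrightarrow> 0 + 0"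
    using assms(4,5) by (intro tendsto_add) (auto simp: tendsto_in_prob_iff)
  moreover have "expectation (\<lambda>\<omega>. min 1 \<bar>Z \<omega> - Z' \<omega>\<bar>) \<le> expectation (\<lambda>\<omega>. min 1 \<bar>X n \<omega> - Z \<omega>\<bar>) + expectation (\<lambda>\<omega>. min 1 \<bar>X n \<omega> - Z' \<omega>\<bar>)" for n
  proof -
    have "expectation (\<lambda>\<omega>. min 1 \<bar>Z \<omega> - Z' \<omega>\<bar>) \<le> expectation (\<lambda>\<omega>. min 1 \<bar>X n \<omega> - Z \<omega>\<bar> + min 1 \<bar>X n \<omega> - Z' \<omega>\<bar>)"
      by (intro integral_mono Bochner_Integration.integrable_add integrable_min_1) auto
    also have "\<dots> = expectation (\<lambda>\<omega>. min 1 \<bar>X n \<omega> - Z \<omega>\<bar>) + expectation (\<lambda>\<omega>. min 1 \<bar>X n \<omega> - Z' \<omega>\<bar>)"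
      by (intro Bochner_Integration.integral_add integrable_min_1) auto
    finally show ?thesis .
  qed
  ultimately have "expectation (\<lambda>\<omega>. min 1 \<bar>Z \<omega> - Z' \<omega>\<bar>) \<le> 0"
    by (intro LIMSEQ_le_const[where X = "\<lambda>n. expectation (\<lambda>\<omega>. min 1 \<bar>X n \<omega> - Z \<omega>\<bar>) + expectation (\<lambda>\<omega>. min 1 \<bar>X n \<omega> - Z' \<omega>\<bar>)"]) auto
  moreover have "expectation (\<lambda>\<omega>. min 1 \<bar>Z \<omega> - Z' \<omega>\<bar>) \<ge> 0"
    by (intro Bochner_Integration.integral_nonneg) auto
  ultimately have "expectation (\<lambda>\<omega>. min 1 \<bar>Z \<omega> - Z' \<omega>\<bar>) = 0" by simp
  then have "AE \<omega> in M. min 1 \<bar>Z \<omega> - Z' \<omega>\<bar> = 0"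
    by (subst (asm) integral_nonneg_eq_0_iff_AE) auto
  then show ?thesis by eventually_elim (auto simp: min_def split: if_splits)
qed

lemma tendsto_in_prob_linear:
  assumes [measurable]: "\<And>n. X n \<in> borel_measurable M" "Z \<in> borel_measurable M"
     "\<And>n. X' n \<in> borel_measurable M" "Z' \<in> borel_measurable M"
    and lim: "tendsto_in_prob M X Z" "tendsto_in_prob M X' Z'"
  shows "tendsto_in_prob M (\<lambda>n \<omega>. a * X n \<omega> + b * X' n \<omega>) (\<lambda>\<omega>. a * Z \<omega> + b * Z' \<omega>)"
proof -
  \<comment> \<open>The factor 1 + \<bar>c\<bar> serves small and large c alike: for x \<le> 1 the
    minimum on the right is x, and for larger x the left-hand side is at most 1.\<close>
  have min_mult: "min 1 (\<bar>c\<bar> * x) \<le> (1 + \<bar>c\<bar>) * min 1 x" if "x \<ge> 0" for c x :: real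
  proof (cases "x \<le> 1")
    case True
    then have "min 1 (\<bar>c\<bar> * x) \<le> \<bar>c\<bar> * x" "(1 + \<bar>c\<bar>) * min 1 x = x + \<bar>c\<bar> * x"
      by (simp_all add: distrib_right)
    then show ?thesis using that by linarith
  next
    case False
    then have "min 1 x = 1" "min 1 (\<bar>c\<bar> * x) \<le> 1" by auto
    then show ?thesis using abs_ge_zero[of c] unfolding \<open>min 1 x = 1\<close> mult_1_right by linarith
  qed
  have min_add: "min 1 (x + y) \<le> min 1 x + min 1 y" if "x \<ge> 0" "y \<ge> 0" for x y :: real
    using that by (simp add: min_def)
  let ?e = "\<lambda>X Z n. expectation (\<lambda>\<omega>. min 1 \<bar>X n \<omega> - Z \<omega>\<bar>)"
  have "?e (\<lambda>n \<omega>. a * X n \<omega> + b * X' n \<omega>) (\<lambda>\<omega>. a * Z \<omega> + b * Z' \<omega>) n \<le> (1 + \<bar>a\<bar>) * ?e X Z n + (1 + \<bar>b\<bar>) * ?e X' Z' n" for n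
  proof -
    have "?e (\<lambda>n \<omega>. a * X n \<omega> + b * X' n \<omega>) (\<lambda>\<omega>. a * Z \<omega> + b * Z' \<omega>) n \<le>
      expectation (\<lambda>\<omega>. (1 + \<bar>a\<bar>) * min 1 \<bar>X n \<omega> - Z \<omega>\<bar> + (1 + \<bar>b\<bar>) * min 1 \<bar>X' n \<omega> - Z' \<omega>\<bar>)"
    proof (intro integral_mono Bochner_Integration.integrable_add integrable_mult_right integrable_min_1)
      fix \<omega>
      have "(a * X n \<omega> + b * X' n \<omega>) - (a * Z \<omega> + b * Z' \<omega>) = a * (X n \<omega> - Z \<omega>) + b * (X' n \<omega> - Z' \<omega>)"
        by (simp add: algebra_simps)
      then have "\<bar>(a * X n \<omega> + b * X' n \<omega>) - (a * Z \<omega> + b * Z' \<omega>)\<bar> \<le> \<bar>a\<bar> * \<bar>X n \<omega> - Z \<omega>\<bar> + \<bar>b\<bar> * \<bar>X' n \<omega> - Z' \<omega>\<bar>"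
        using abs_triangle_ineq[of "a * (X n \<omega> - Z \<omega>)" "b * (X' n \<omega> - Z' \<omega>)"] by (simp add: abs_mult)
      then show "min 1 \<bar>(a * X n \<omega> + b * X' n \<omega>) - (a * Z \<omega> + b * Z' \<omega>)\<bar> \<le>
         (1 + \<bar>a\<bar>) * min 1 \<bar>X n \<omega> - Z \<omega>\<bar> + (1 + \<bar>b\<bar>) * min 1 \<bar>X' n \<omega> - Z' \<omega>\<bar>"
        by (rule order_trans[OF min.mono[OF order_refl]
              order_trans[OF min_add add_mono[OF min_mult min_mult]]]) auto
    qed auto
    also have "\<dots> = (1 + \<bar>a\<bar>) * ?e X Z n + (1 + \<bar>b\<bar>) * ?e X' Z' n"
      by (subst Bochner_Integration.integral_add) auto
    finally show ?thesis .
  qed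
  note le = this
  have lim': "(\<lambda>n. (1 + \<bar>a\<bar>) * ?e X Z n + (1 + \<bar>b\<bar>) * ?e X' Z' n) \<longlonglongrightarrow> (1 + \<bar>a\<bar>) * 0 + (1 + \<bar>b\<bar>) * 0"
    using lim by (intro tendsto_intros) (auto simp: tendsto_in_prob_iff)
  have "?e (\<lambda>n \<omega>. a * X n \<omega> + b * X' n \<omega>) (\<lambda>\<omega>. a * Z \<omega> + b * Z' \<omega>) \<longlonglongrightarrow> 0"
  proof (rule tendsto_sandwich[where f = "\<lambda>_. 0"])
    show "\<forall>\<^sub>F n in sequentially. ?e (\<lambda>n \<omega>. a * X n \<omega> + b * X' n \<omega>) (\<lambda>\<omega>. a * Z \<omega> + b * Z' \<omega>) n \<le>
      (1 + \<bar>a\<bar>) * ?e X Z n + (1 + \<bar>b\<bar>) * ?e X' Z' n"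
      by (intro always_eventually allI le)
    show "(\<lambda>n. (1 + \<bar>a\<bar>) * ?e X Z n + (1 + \<bar>b\<bar>) * ?e X' Z' n) \<longlonglongrightarrow> 0"
      using lim' by simp
    show "\<forall>\<^sub>F n in sequentially. 0 \<le> ?e (\<lambda>n \<omega>. a * X n \<omega> + b * X' n \<omega>) (\<lambda>\<omega>. a * Z \<omega> + b * Z' \<omega>) n"
      by (intro always_eventually allI Bochner_Integration.integral_nonneg) auto
  qed simp
  then show ?thesis by (simp add: tendsto_in_prob_iff)
qed

lemma tendsto_in_prob_cong_AE:
  assumes [measurable]: "\<And>n. X n \<in> borel_measurable M" "Z \<in> borel_measurable M"
      "\<And>n. X' n \<in> borel_measurable M" "Z' \<in> borel_measurable M"
    and eq: "\<And>n. AE \<omega> in M. X n \<omega> = X' n \<omega>" "AE \<omega> in M. Z \<omega> = Z' \<omega>"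
    and lim: "tendsto_in_prob M X Z"
  shows "tendsto_in_prob M X' Z'"
proof -
  have "expectation (\<lambda>\<omega>. min 1 \<bar>X n \<omega> - Z \<omega>\<bar>) = expectation (\<lambda>\<omega>. min 1 \<bar>X' n \<omega> - Z' \<omega>\<bar>)" for n
    using eq(1)[of n] eq(2) by (intro integral_cong_AE) auto
  with lim show ?thesis by (simp add: tendsto_in_prob_iff)
qed

section \<open>Symmetric stable laws under scaling, independent sums and limits\<close>

lemma symmetric_stable_cong_AE:
  assumes "symmetric_stable M \<alpha> s X" "X' \<in> borel_measurable M" "AE \<omega> in M. X \<omega> = X' \<omega>"
  shows "symmetric_stable M \<alpha> s X'"
proof -
  have "distr M borel X = distr M borel X'"
    using assms by (intro distr_cong_AE) (auto simp: symmetric_stable_def)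
  then show ?thesis using assms by (simp add: symmetric_stable_def)
qed

lemma symmetric_stable_mult:
  assumes X: "symmetric_stable M \<alpha> s X"
  shows "symmetric_stable M \<alpha> (\<bar>c\<bar> powr \<alpha> * s) (\<lambda>\<omega>. c * X \<omega>)"
proof -
  have [measurable]: "X \<in> borel_measurable M" using X by (simp add: symmetric_stable_def)
  have "char (distr M borel (\<lambda>\<omega>. c * X \<omega>)) u = char (distr M borel X) (c * u)" for u
    by (simp add: char_def integral_distr mult_ac)
  then show ?thesis
    using X by (auto simp: symmetric_stable_def abs_mult powr_mult mult_ac)
qed

lemma symmetric_stable_sum:
  assumes ind: "indep_vars (\<lambda>_. borel) X I" and "finite I" and X: "\<And>i. i \<in> I \<Longrightarrow> symmetric_stable M \<alpha> (s i) (X i)"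
  shows "symmetric_stable M \<alpha> (\<Sum>i\<in>I. s i) (\<lambda>\<omega>. \<Sum>i\<in>I. X i \<omega>)"
proof -
  have [measurable]: "X i \<in> borel_measurable M" if "i \<in> I" for i using X that by (simp add: symmetric_stable_def)
  have "char (distr M borel (\<lambda>\<omega>. \<Sum>i\<in>I. X i \<omega>)) u = (\<Prod>i\<in>I. char (distr M borel (X i)) u)" for u
    by (rule char_distr_sum[OF ind])
  also have "(\<Prod>i\<in>I. char (distr M borel (X i)) u) = complex_of_real (\<Prod>i\<in>I. exp (- s i * \<bar>u\<bar> powr \<alpha>))" for u
    using X by (auto simp: symmetric_stable_def intro!: prod.cong)
  finally show ?thesis
    using X \<open>finite I\<close> by (auto simp: symmetric_stable_def exp_sum[symmetric] sum_distrib_right sum_negf intro!: sum_nonneg)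
qed

text \<open>Along an almost surely convergent subsequence the characteristic functions converge by
  dominated convergence.\<close>

lemma symmetric_stable_limit:
  assumes X: "\<And>n. symmetric_stable M \<alpha> (s n) (X n)" and [measurable]: "Z \<in> borel_measurable M"
    and lim: "tendsto_in_prob M X Z" "s \<longlonglongrightarrow> t"
  shows "symmetric_stable M \<alpha> t Z"
proof -
  have m[measurable]: "X n \<in> borel_measurable M" for n using X by (simp add: symmetric_stable_def)
  obtain r where r: "strict_mono r" "AE \<omega> in M. (\<lambda>n. X (r n) \<omega>) \<longlonglongrightarrow> Z \<omega>"
    using tendsto_in_prob_subseq[OF m _ lim(1)] by auto
  have "char (distr M borel Z) u = complex_of_real (exp (- t * \<bar>u\<bar> powr \<alpha>))" for u
  proof (rule LIMSEQ_unique)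
    have "(\<lambda>n. CLINT \<omega>|M. iexp (u * X (r n) \<omega>)) \<longlonglongrightarrow> (CLINT \<omega>|M. iexp (u * Z \<omega>))"
    proof (rule integral_dominated_convergence[where w = "\<lambda>_. 1"])
      show "AE \<omega> in M. (\<lambda>n. iexp (u * X (r n) \<omega>)) \<longlonglongrightarrow> iexp (u * Z \<omega>)"
        using r(2) by eventually_elim (intro tendsto_intros)
    qed (auto simp del: of_real_mult)
    then show "(\<lambda>n. char (distr M borel (X (r n))) u) \<longlonglongrightarrow> char (distr M borel Z) u"
      by (simp add: char_def integral_distr)
    have "(\<lambda>n. complex_of_real (exp (- s (r n) * \<bar>u\<bar> powr \<alpha>))) \<longlonglongrightarrow> complex_of_real (exp (- t * \<bar>u\<bar> powr \<alpha>))"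
      using LIMSEQ_subseq_LIMSEQ[OF lim(2) r(1)] by (intro tendsto_intros) (auto simp: o_def)
    then show "(\<lambda>n. char (distr M borel (X (r n))) u) \<longlonglongrightarrow> complex_of_real (exp (- t * \<bar>u\<bar> powr \<alpha>))"
      using X by (simp add: symmetric_stable_def)
  qed
  moreover have "t \<ge> 0"
    using X by (intro LIMSEQ_le_const[OF lim(2)]) (auto simp: symmetric_stable_def)
  ultimately show ?thesis by (simp add: symmetric_stable_def)
qed

lemma symmetric_stable_tendsto_0:
  assumes \<alpha>: "0 < \<alpha>" "\<alpha> < 2" and X: "\<And>n. symmetric_stable M \<alpha> (s n) (X n)" and "s \<longlonglongrightarrow> 0"
  shows "tendsto_in_prob M X (\<lambda>_. 0)"
  unfolding tendsto_in_prob_def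
proof (intro allI impI)
  fix e :: real assume "e > 0"
  show "(\<lambda>n. prob {\<omega> \<in> space M. e < \<bar>X n \<omega> - 0\<bar>}) \<longlonglongrightarrow> 0"
  proof (rule tendsto_sandwich[where f = "\<lambda>_. 0"])
    show "(\<lambda>n. 6 * (s n * e powr - \<alpha>)) \<longlonglongrightarrow> 0"
      using assms(4) by (auto intro!: tendsto_eq_intros)
    have "prob {\<omega> \<in> space M. e < \<bar>X n \<omega> - 0\<bar>} \<le> 6 * (s n * e powr - \<alpha>)" for n
    proof -
      have [measurable]: "X n \<in> borel_measurable M" using X by (simp add: symmetric_stable_def)
      have "prob {\<omega> \<in> space M. e < \<bar>X n \<omega> - 0\<bar>} \<le> prob {\<omega> \<in> space M. e \<le> \<bar>X n \<omega>\<bar>}"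
        by (intro finite_measure_mono) auto
      also have "\<dots> \<le> 6 * (s n * e powr - \<alpha>)"
        by (rule stable_tail_upper[OF \<alpha> X \<open>e > 0\<close>])
      finally show ?thesis .
    qed
    then show "\<forall>\<^sub>F n in sequentially. prob {\<omega> \<in> space M. e < \<bar>X n \<omega> - 0\<bar>} \<le> 6 * (s n * e powr - \<alpha>)"
      by simp
  qed auto
qed

end

section \<open>The stable noise integral\<close>

definition step_fun :: "nat \<Rightarrow> (nat \<Rightarrow> 'a set) \<Rightarrow> (nat \<Rightarrow> real) \<Rightarrow> 'a \<Rightarrow> real" where
  "step_fun n B c s = (\<Sum>i<n. c i * indicator (B i) s)"

lemma step_fun_in:
  assumes "disjoint_family_on B {..<n}" "k < n" "s \<in> B k"
  shows "step_fun n B c s = c k"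
proof -
  have "c i * indicator (B i) s = (if i = k then c k else 0)" if "i < n" for i
    using assms that by (auto simp: indicator_def disjoint_family_on_def)
  then have "step_fun n B c s = (\<Sum>i<n. if i = k then c k else 0)"
    unfolding step_fun_def by (intro sum.cong) auto
  then show ?thesis using assms by simp
qed

lemma step_fun_notin: "(\<And>k. k < n \<Longrightarrow> s \<notin> B k) \<Longrightarrow> step_fun n B c s = 0"
  by (simp add: step_fun_def)

text \<open>A nonlinear function of several step functions over one partition acts on their
  coefficients; the condition that F maps the zero family to 0 covers the points outside all cells.
  Powers, weighted norms and the logarithmic integrand are all treated in this way.\<close>

lemma step_fun_map:
  assumes "disjoint_family_on B {..<n}" "F (\<lambda>j. 0) = 0"
  shows "F (\<lambda>j. step_fun n B (c j) s) = step_fun n B (\<lambda>i. F (\<lambda>j. c j i)) s"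
proof (cases "\<exists>k<n. s \<in> B k")
  case True
  then show ?thesis using step_fun_in[OF assms(1)] by auto
next
  case False
  then show ?thesis using step_fun_notin[of n s B] assms(2) by auto
qed

lemma simple_fun_append: "simple_fun (g @ h) s = simple_fun g s + simple_fun h s"
  by (simp add: simple_fun_def)

lemma simple_fun_scale: "simple_fun (map (\<lambda>(c, A). (k * c, A)) g) s = k * simple_fun g s"
  by (induction g) (auto simp: simple_fun_def algebra_simps)

lemma simple_integral_append: "simple_integral W (g @ h) \<omega> = simple_integral W g \<omega> + simple_integral W h \<omega>"
  by (simp add: simple_integral_def)

lemma simple_integral_scale: "simple_integral W (map (\<lambda>(c, A). (k * c, A)) g) \<omega> = k * simple_integral W g \<omega>"
  by (induction g) (auto simp: simple_integral_def algebra_simps)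

text \<open>A substitute for the triangle inequality with one constant for all \<alpha> in (0, 2),
  whether the power is subadditive or convex.\<close>

lemma powr_add_le:
  fixes x y :: real
  assumes "0 < \<alpha>" "\<alpha> < 2"
  shows "\<bar>x + y\<bar> powr \<alpha> \<le> 4 * (\<bar>x\<bar> powr \<alpha> + \<bar>y\<bar> powr \<alpha>)"
proof -
  have "\<bar>x + y\<bar> powr \<alpha> \<le> (2 * max \<bar>x\<bar> \<bar>y\<bar>) powr \<alpha>"
    using assms by (intro powr_mono2) auto
  also have "\<dots> = 2 powr \<alpha> * max \<bar>x\<bar> \<bar>y\<bar> powr \<alpha>"
    by (rule powr_mult)
  also have "\<dots> \<le> 2 powr 2 * (\<bar>x\<bar> powr \<alpha> + \<bar>y\<bar> powr \<alpha>)"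
    using assms by (intro mult_mono powr_mono) (auto simp: max_def)
  finally show ?thesis by simp
qed

locale stable_noise = prob_space M
  for M :: "'w measure" +
  fixes \<alpha> :: real and S :: "'a::euclidean_space set" and W :: "'a set \<Rightarrow> 'w \<Rightarrow> real"
  assumes \<alpha>: "0 < \<alpha>" "\<alpha> < 2"
    and S[measurable]: "S \<in> sets borel"
    and noise: "stable_white_noise M \<alpha> S W"
begin

section \<open>Independence and additivity of the noise on finite families\<close>

lemma W_measurable: "A \<in> finite_borel_subsets S \<Longrightarrow> W A \<in> borel_measurable M"
  using noise unfolding stable_white_noise_def by blast

lemma W_stable: "A \<in> finite_borel_subsets S \<Longrightarrow> symmetric_stable M \<alpha> (measure lborel A) (W A)"
  using noise W_measurable[of A] unfolding stable_white_noise_def symmetric_stable_def by simp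

lemma empty_finite_borel_subset: "{} \<in> finite_borel_subsets S"
  by (simp add: finite_borel_subsets_def)

lemma W_countably_additive:
  fixes A :: "nat \<Rightarrow> 'a set"
  assumes "range A \<subseteq> finite_borel_subsets S" "disjoint_family A" "(\<Union>n. A n) \<in> finite_borel_subsets S"
  shows "AE \<omega> in M. (\<lambda>n. W (A n) \<omega>) sums W (\<Union>n. A n) \<omega>"
  using noise assms unfolding stable_white_noise_def by blast

text \<open>Independent scattering is given for infinite disjoint sequences, so the finite family is
  continued by empty sets.\<close>

lemma W_indep:
  fixes B :: "nat \<Rightarrow> 'a set"
  assumes B: "\<And>i. i < n \<Longrightarrow> B i \<in> finite_borel_subsets S" "disjoint_family_on B {..<n}"
  shows "indep_vars (\<lambda>_. borel) (\<lambda>i. W (B i)) {..<n}"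
proof -
  define C where "C = (\<lambda>i. if i < n then B i else {})"
  have "range C \<subseteq> finite_borel_subsets S" "disjoint_family C"
    using B empty_finite_borel_subset by (auto simp: C_def disjoint_family_on_def)
  then have "indep_vars (\<lambda>_. borel) (\<lambda>i. W (C i)) UNIV"
    using noise unfolding stable_white_noise_def by blast
  then have "indep_vars (\<lambda>_. borel) (\<lambda>i. W (C i)) {..<n}"
    by (rule indep_vars_subset) auto
  then show ?thesis
    by (subst indep_vars_cong[of "{..<n}" "{..<n}" "\<lambda>i. W (B i)" "\<lambda>i. W (C i)" "\<lambda>_. borel" "\<lambda>_. borel"]) (auto simp: C_def)
qed

text \<open>Countable additivity for the constant sequence of empty sets makes a constant series
  converge, so its terms are 0.\<close>

lemma W_empty: "AE \<omega> in M. W {} \<omega> = 0"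
proof -
  have "AE \<omega> in M. (\<lambda>n. W ((\<lambda>n::nat. {}) n) \<omega>) sums W (\<Union>n::nat. {}) \<omega>"
    by (rule W_countably_additive) (auto simp: empty_finite_borel_subset disjoint_family_on_def)
  then show ?thesis
  proof eventually_elim
    case (elim \<omega>)
    then have "(\<lambda>n::nat. W {} \<omega>) \<longlonglongrightarrow> 0"
      by (intro summable_LIMSEQ_zero) (auto dest: sums_summable)
    then show ?case by (simp add: LIMSEQ_const_iff)
  qed
qed

lemma W_finitely_additive:
  fixes B :: "nat \<Rightarrow> 'a set"
  assumes B: "\<And>i. i < n \<Longrightarrow> B i \<in> finite_borel_subsets S" "disjoint_family_on B {..<n}" and I: "I \<subseteq> {..<n}"
    and U: "(\<Union>i\<in>I. B i) \<in> finite_borel_subsets S"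
  shows "AE \<omega> in M. W (\<Union>i\<in>I. B i) \<omega> = (\<Sum>i\<in>I. W (B i) \<omega>)"
proof -
  define C where "C = (\<lambda>i. if i \<in> I then B i else {})"
  have "range C \<subseteq> finite_borel_subsets S" "disjoint_family C"
    using B empty_finite_borel_subset I by (auto simp: C_def disjoint_family_on_def)
  moreover have UC: "(\<Union>i. C i) = (\<Union>i\<in>I. B i)" by (auto simp: C_def split: if_splits)
  ultimately have "AE \<omega> in M. (\<lambda>i. W (C i) \<omega>) sums W (\<Union>i\<in>I. B i) \<omega>"
    using W_countably_additive[of C] U by simp
  then show ?thesis
    using W_empty
  proof eventually_elim
    case (elim \<omega>)
    have "finite I" using I finite_subset by blast
    then have "(\<lambda>i. W (C i) \<omega>) sums (\<Sum>i\<in>I. W (C i) \<omega>)"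
      using elim(2) by (intro sums_finite) (auto simp: C_def)
    then have "W (\<Union>i\<in>I. B i) \<omega> = (\<Sum>i\<in>I. W (C i) \<omega>)"
      using elim(1) sums_unique2 by blast
    then show ?case by (simp add: C_def)
  qed
qed

text \<open>The cells are the atoms of the algebra generated by the family: points are sorted
  according to the members that contain them.\<close>

lemma common_partition:
  assumes "finite \<A>" "\<A> \<subseteq> finite_borel_subsets S"
  obtains n :: nat and B :: "nat \<Rightarrow> 'a set" and T :: "'a set \<Rightarrow> nat set"
  where "\<And>i. i < n \<Longrightarrow> B i \<in> finite_borel_subsets S" "disjoint_family_on B {..<n}"
    "\<And>A. A \<in> \<A> \<Longrightarrow> T A \<subseteq> {..<n} \<and> A = (\<Union>i\<in>T A. B i)"
proof -
  \<comment> \<open>The empty pattern is left out, so that every cell lies in a member of the family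
    and inherits finite measure and inclusion in S. A pattern that does not occur gives an empty
    cell.\<close>
  define P where "P = Pow \<A> - {{}}"
  have "finite P" using assms by (simp add: P_def)
  then obtain h where h: "bij_betw h {0..<card P} P" using ex_bij_betw_nat_finite by blast
  define B where "B = (\<lambda>i. {x. {A\<in>\<A>. x \<in> A} = h i})"
  define T where "T = (\<lambda>A. {i. i < card P \<and> A \<in> h i})"
  have hP: "h i \<in> P" if "i < card P" for i using h that by (auto simp: bij_betw_def)
  have "B i \<in> finite_borel_subsets S" if i: "i < card P" for i
  proof -
    obtain A where A: "A \<in> h i" "A \<in> \<A>" using hP[OF i] by (auto simp: P_def)
    have "B i = {x\<in>space borel. \<forall>A\<in>\<A>. x \<in> A \<longleftrightarrow> A \<in> h i}"
      using hP[OF i] by (auto simp: B_def P_def)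
    also have "\<dots> \<in> sets borel"
    proof (rule sets.sets_Collect_finite_All[OF _ assms(1)])
      fix A assume "A \<in> \<A>"
      then have [measurable]: "A \<in> sets borel" using assms by (auto simp: finite_borel_subsets_def)
      show "{x \<in> space borel. (x \<in> A) = (A \<in> h i)} \<in> sets borel" by measurable
    qed
    finally have [measurable]: "B i \<in> sets borel" .
    have "B i \<subseteq> A" using A by (auto simp: B_def)
    moreover have "A \<in> finite_borel_subsets S" using A assms by auto
    ultimately show ?thesis
      using emeasure_mono[of "B i" A lborel] by (auto simp: finite_borel_subsets_def)
  qed
  moreover have "disjoint_family_on B {..<card P}"
    using h by (auto simp: B_def disjoint_family_on_def bij_betw_def inj_on_def)
  moreover have "T A \<subseteq> {..<card P} \<and> A = (\<Union>i\<in>T A. B i)" if "A \<in> \<A>" for A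
  proof -
    have "x \<in> (\<Union>i\<in>T A. B i)" if "x \<in> A" for x
    proof -
      have "{A\<in>\<A>. x \<in> A} \<in> P" using that \<open>A \<in> \<A>\<close> by (auto simp: P_def)
      then have "{A\<in>\<A>. x \<in> A} \<in> h ` {0..<card P}" using h unfolding bij_betw_def by simp
      then obtain i where i: "i < card P" "{A\<in>\<A>. x \<in> A} = h i" by (elim imageE) simp
      have "A \<in> h i" using that \<open>A \<in> \<A>\<close> unfolding i(2)[symmetric] by simp
      then have "i \<in> T A" using i(1) unfolding T_def by simp
      moreover have "x \<in> B i" unfolding B_def using i(2) by simp
      ultimately show ?thesis by blast
    qed
    then show ?thesis by (auto simp: T_def B_def)
  qed
  ultimately show ?thesis by (rule that)
qed

text \<open>The function and its integral receive the same coefficients over a common partition,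
  which turns statements about finitely many simple integrals into statements about independent
  variables. For the integrals the equality is only almost sure, as is the additivity of the
  noise.\<close>

lemma common_step_representation:
  fixes g :: "'j \<Rightarrow> (real \<times> 'a set) list"
  assumes "finite J" and g: "\<And>j. j \<in> J \<Longrightarrow> snd ` set (g j) \<subseteq> finite_borel_subsets S"
  obtains n :: nat and B :: "nat \<Rightarrow> 'a set" and c :: "'j \<Rightarrow> nat \<Rightarrow> real"
  where "\<And>i. i < n \<Longrightarrow> B i \<in> finite_borel_subsets S" "disjoint_family_on B {..<n}"
    "\<And>j s. j \<in> J \<Longrightarrow> simple_fun (g j) s = step_fun n B (c j) s"
    "\<And>j. j \<in> J \<Longrightarrow> AE \<omega> in M. simple_integral W (g j) \<omega> = (\<Sum>i<n. c j i * W (B i) \<omega>)"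
proof -
  define \<A> where "\<A> = (\<Union>j\<in>J. snd ` set (g j))"
  have "finite \<A>" "\<A> \<subseteq> finite_borel_subsets S" using assms by (auto simp: \<A>_def)
  from common_partition[OF this]
  obtain n :: nat and B :: "nat \<Rightarrow> 'a set" and T :: "'a set \<Rightarrow> nat set"
    where B: "\<And>i. i < n \<Longrightarrow> B i \<in> finite_borel_subsets S" "disjoint_family_on B {..<n}"
    and T: "\<And>A. A \<in> \<A> \<Longrightarrow> T A \<subseteq> {..<n} \<and> A = (\<Union>i\<in>T A. B i)"
    by blast
  define co where "co = (\<lambda>l::(real \<times> 'a set) list. \<lambda>i. \<Sum>(k, A)\<leftarrow>l. if i \<in> T A then k else 0)"
  have 1: "simple_fun l s = step_fun n B (co l) s" if "snd ` set l \<subseteq> \<A>" for l s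
    using that
  proof (induction l)
    case (Cons p l)
    obtain k A where p: "p = (k, A)" by force
    then have A: "A \<in> \<A>" using Cons.prems by auto
    note TA = T[OF A]
    have "indicat_real A s = step_fun n B (\<lambda>i. if i \<in> T A then 1 else 0) s"
    proof (cases "\<exists>i<n. s \<in> B i")
      case True
      then obtain i where i: "i < n" "s \<in> B i" by auto
      have "s \<in> A \<longleftrightarrow> i \<in> T A"
      proof
        assume "s \<in> A"
        then obtain i' where "i' \<in> T A" "s \<in> B i'" using TA by auto
        moreover from this have "i' = i"
          using i TA B(2) by (force simp: disjoint_family_on_def)
        ultimately show "i \<in> T A" by simp
      next
        assume "i \<in> T A" then show "s \<in> A" using TA i by auto
      qed
      then show ?thesis using step_fun_in[OF B(2) i] by (simp add: indicator_def)
    next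
      case False
      then have "s \<notin> A" using TA by (metis UN_E lessThan_iff subsetD)
      then show ?thesis using False by (simp add: step_fun_notin)
    qed
    then have "simple_fun (p # l) s = k * step_fun n B (\<lambda>i. if i \<in> T A then 1 else 0) s + step_fun n B (co l) s"
      using Cons p by (simp add: simple_fun_def)
    also have "\<dots> = step_fun n B (co (p # l)) s"
      unfolding step_fun_def sum_distrib_left sum.distrib[symmetric]
      by (intro sum.cong) (auto simp: co_def p algebra_simps)
    finally show ?case .
  qed (simp add: simple_fun_def step_fun_def co_def)
  have 2: "AE \<omega> in M. simple_integral W l \<omega> = (\<Sum>i<n. co l i * W (B i) \<omega>)" if "snd ` set l \<subseteq> \<A>" for l
    using that
  proof (induction l)
    case (Cons p l)
    obtain k A where p: "p = (k, A)" by force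
    then have A: "A \<in> \<A>" using Cons.prems by auto
    note TA = T[OF A]
    have Af: "A \<in> finite_borel_subsets S" using A \<open>\<A> \<subseteq> finite_borel_subsets S\<close> by auto
    have "AE \<omega> in M. W A \<omega> = (\<Sum>i\<in>T A. W (B i) \<omega>)"
      using W_finitely_additive[OF B, of "T A"] TA Af by simp
    moreover have "AE \<omega> in M. simple_integral W l \<omega> = (\<Sum>i<n. co l i * W (B i) \<omega>)"
      using Cons by auto
    ultimately show ?case
    proof eventually_elim
      case (elim \<omega>)
      have "(\<Sum>i\<in>T A. W (B i) \<omega>) = (\<Sum>i<n. if i \<in> T A then W (B i) \<omega> else 0)"
        using TA by (subst sum.inter_restrict[symmetric]) (auto intro!: sum.cong)
      then have "simple_integral W (p # l) \<omega> = k * (\<Sum>i<n. if i \<in> T A then W (B i) \<omega> else 0) + (\<Sum>i<n. co l i * W (B i) \<omega>)"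
        using elim p by (simp add: simple_integral_def)
      also have "\<dots> = (\<Sum>i<n. co (p # l) i * W (B i) \<omega>)"
        unfolding sum_distrib_left sum.distrib[symmetric]
        by (intro sum.cong) (auto simp: co_def p algebra_simps)
      finally show ?case .
    qed
  qed (simp add: simple_integral_def co_def)
  have "snd ` set (g j) \<subseteq> \<A>" if "j \<in> J" for j using that by (auto simp: \<A>_def)
  then show ?thesis
    by (intro that[of n B "\<lambda>j. co (g j)"] B 1 2)
qed

text \<open>The \<alpha>-th power of the norm or quasi-norm of the space of integrands, and the
  stable parameter of the noise integral.\<close>

definition energy :: "('a \<Rightarrow> real) \<Rightarrow> ennreal" where
  "energy f = (\<integral>\<^sup>+s\<in>S. ennreal (\<bar>f s\<bar> powr \<alpha>) \<partial>lborel)"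

text \<open>An integrand is measurable only as a function on S; its extension by 0 is measurable on
  the whole space and has the same energy.\<close>

definition zero_ext :: "('a \<Rightarrow> real) \<Rightarrow> 'a \<Rightarrow> real" where
  "zero_ext f s = indicator S s * f s"

lemma energy_alt: "energy f = (\<integral>\<^sup>+s. ennreal (\<bar>zero_ext f s\<bar> powr \<alpha>) \<partial>lborel)"
  unfolding energy_def zero_ext_def by (intro nn_integral_cong) (auto simp: indicator_def)

lemma L_space_iff: "f \<in> L_space \<alpha> S \<longleftrightarrow> zero_ext f \<in> borel_measurable borel \<and> energy f < \<infinity>"
  by (simp add: L_space_def energy_def set_borel_measurable_def zero_ext_def[abs_def])

lemma zero_ext_measurable: "f \<in> L_space \<alpha> S \<Longrightarrow> zero_ext f \<in> borel_measurable borel"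
  by (simp add: L_space_iff)

lemma zero_ext_linear: "zero_ext (\<lambda>s. a * f s + b * g s) = (\<lambda>s. a * zero_ext f s + b * zero_ext g s)"
  by (auto simp: zero_ext_def algebra_simps)

lemma energy_linear_le:
  assumes [measurable]: "zero_ext f \<in> borel_measurable borel" "zero_ext g \<in> borel_measurable borel"
  shows "energy (\<lambda>s. a * f s + b * g s) \<le>
    ennreal (4 * \<bar>a\<bar> powr \<alpha>) * energy f + ennreal (4 * \<bar>b\<bar> powr \<alpha>) * energy g"
proof -
  have "energy (\<lambda>s. a * f s + b * g s) \<le> (\<integral>\<^sup>+s. ennreal (4 * \<bar>a\<bar> powr \<alpha>) * ennreal (\<bar>zero_ext f s\<bar> powr \<alpha>) +
      ennreal (4 * \<bar>b\<bar> powr \<alpha>) * ennreal (\<bar>zero_ext g s\<bar> powr \<alpha>) \<partial>lborel)"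
    unfolding energy_alt zero_ext_linear
  proof (intro nn_integral_mono)
    fix s
    have "\<bar>a * zero_ext f s + b * zero_ext g s\<bar> powr \<alpha> \<le> 4 * \<bar>a\<bar> powr \<alpha> * \<bar>zero_ext f s\<bar> powr \<alpha> + 4 * \<bar>b\<bar> powr \<alpha> * \<bar>zero_ext g s\<bar> powr \<alpha>"
      using powr_add_le[OF \<alpha>, of "a * zero_ext f s" "b * zero_ext g s"] by (simp add: abs_mult powr_mult)
    then show "ennreal (\<bar>a * zero_ext f s + b * zero_ext g s\<bar> powr \<alpha>) \<le> ennreal (4 * \<bar>a\<bar> powr \<alpha>) * ennreal (\<bar>zero_ext f s\<bar> powr \<alpha>) +
      ennreal (4 * \<bar>b\<bar> powr \<alpha>) * ennreal (\<bar>zero_ext g s\<bar> powr \<alpha>)"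
      by (simp add: ennreal_mult[symmetric] ennreal_plus[symmetric] ennreal_leI del: ennreal_plus)
  qed
  also have "\<dots> = ennreal (4 * \<bar>a\<bar> powr \<alpha>) * energy f + ennreal (4 * \<bar>b\<bar> powr \<alpha>) * energy g"
    unfolding energy_alt by (subst nn_integral_add) (auto simp: nn_integral_cmult)
  finally show ?thesis .
qed

lemma L_space_linear:
  assumes "f \<in> L_space \<alpha> S" "g \<in> L_space \<alpha> S"
  shows "(\<lambda>s. a * f s + b * g s) \<in> L_space \<alpha> S"
proof -
  have [measurable]: "zero_ext f \<in> borel_measurable borel" "zero_ext g \<in> borel_measurable borel"
    using assms by (auto simp: L_space_iff)
  have "energy (\<lambda>s. a * f s + b * g s) < \<infinity>"
    using energy_linear_le[of f g a b] assms
    by (auto simp: L_space_iff ennreal_mult_less_top intro: order_le_less_trans)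
  then show ?thesis
    unfolding L_space_iff zero_ext_linear by auto
qed

lemma energy_diff_le:
  assumes "zero_ext f \<in> borel_measurable borel" "zero_ext g \<in> borel_measurable borel"
  shows "energy (\<lambda>s. f s - g s) \<le> 4 * energy f + 4 * energy g"
  using energy_linear_le[OF assms, of 1 "-1"] by simp

lemma simple_fun_zero_ext_measurable:
  assumes "snd ` set g \<subseteq> finite_borel_subsets S"
  shows "zero_ext (simple_fun g) \<in> borel_measurable borel"
proof -
  have "simple_fun g \<in> borel_measurable borel"
    using assms
  proof (induction g)
    case (Cons p g)
    then have [measurable]: "snd p \<in> sets borel" "simple_fun g \<in> borel_measurable borel"
      by (auto simp: finite_borel_subsets_def)
    have "simple_fun (p # g) = (\<lambda>s. fst p * indicator (snd p) s + simple_fun g s)"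
      by (auto simp: simple_fun_def fun_eq_iff split: prod.splits)
    then show ?case by simp
  qed (simp add: simple_fun_def[abs_def])
  then show ?thesis unfolding zero_ext_def[abs_def] by simp
qed

lemma simple_integral_measurable:
  assumes "snd ` set g \<subseteq> finite_borel_subsets S"
  shows "simple_integral W g \<in> borel_measurable M"
  using assms
proof (induction g)
  case (Cons p g)
  then have [measurable]: "W (snd p) \<in> borel_measurable M" "simple_integral W g \<in> borel_measurable M"
    by (auto intro: W_measurable)
  have "simple_integral W (p # g) = (\<lambda>\<omega>. fst p * W (snd p) \<omega> + simple_integral W g \<omega>)"
    by (auto simp: simple_integral_def fun_eq_iff split: prod.splits)
  then show ?case by simp
qed (simp add: simple_integral_def[abs_def])

lemma nn_integral_step_fun:
  assumes B: "\<And>i. i < n \<Longrightarrow> B i \<in> finite_borel_subsets S" and b: "\<And>i. i < n \<Longrightarrow> b i \<ge> 0"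
  shows "(\<integral>\<^sup>+s\<in>S. ennreal (step_fun n B b s) \<partial>lborel) = ennreal (\<Sum>i<n. b i * measure lborel (B i))"
proof -
  have fin: "emeasure lborel (B i) = ennreal (measure lborel (B i))" if "i < n" for i
    using B[OF that] by (intro emeasure_eq_ennreal_measure) (auto simp: finite_borel_subsets_def)
  have [measurable]: "B i \<in> sets borel" if "i < n" for i
    using B[OF that] by (simp add: finite_borel_subsets_def)
  have "(\<integral>\<^sup>+s\<in>S. ennreal (step_fun n B b s) \<partial>lborel) = (\<integral>\<^sup>+s. (\<Sum>i<n. ennreal (b i) * indicator (B i) s) \<partial>lborel)"
  proof (intro nn_integral_cong)
    fix s
    have "(\<Sum>i<n. ennreal (b i) * indicator (B i) s) = (\<Sum>i<n. ennreal (b i * indicator (B i) s))"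
      by (intro sum.cong) (auto simp: indicator_def)
    also have "\<dots> = ennreal (step_fun n B b s)"
      unfolding step_fun_def using b by (intro sum_ennreal) auto
    finally have *: "(\<Sum>i<n. ennreal (b i) * indicator (B i) s) = ennreal (step_fun n B b s)" .
    have "s \<notin> S \<Longrightarrow> step_fun n B b s = 0"
      using B by (intro step_fun_notin) (auto simp: finite_borel_subsets_def)
    then show "ennreal (step_fun n B b s) * indicator S s = (\<Sum>i<n. ennreal (b i) * indicator (B i) s)"
      unfolding * by (auto simp: indicator_def)
  qed
  also have "\<dots> = (\<Sum>i<n. ennreal (b i) * emeasure lborel (B i))"
    by (subst nn_integral_sum) (auto simp: nn_integral_cmult)
  also have "\<dots> = (\<Sum>i<n. ennreal (b i * measure lborel (B i)))"
    using b fin by (intro sum.cong) (auto simp: ennreal_mult)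
  also have "\<dots> = ennreal (\<Sum>i<n. b i * measure lborel (B i))"
    using b by (intro sum_ennreal) auto
  finally show ?thesis .
qed

lemma simple_integral_stable:
  assumes g: "snd ` set g \<subseteq> finite_borel_subsets S"
  shows "energy (simple_fun g) < \<infinity>" "symmetric_stable M \<alpha> (enn2real (energy (simple_fun g))) (simple_integral W g)"
proof -
  obtain n B c where B: "\<And>i. i < n \<Longrightarrow> B i \<in> finite_borel_subsets S" "disjoint_family_on B {..<n}"
    and c: "\<And>s. simple_fun g s = step_fun n B c s"
    "AE \<omega> in M. simple_integral W g \<omega> = (\<Sum>i<n. c i * W (B i) \<omega>)"
  proof -
    obtain n B and c :: "unit \<Rightarrow> nat \<Rightarrow> real" where "\<And>i. i < n \<Longrightarrow> B i \<in> finite_borel_subsets S" "disjoint_family_on B {..<n}"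
      "\<And>j s. j \<in> {()} \<Longrightarrow> simple_fun g s = step_fun n B (c j) s"
      "\<And>j. j \<in> {()} \<Longrightarrow> AE \<omega> in M. simple_integral W g \<omega> = (\<Sum>i<n. c j i * W (B i) \<omega>)"
      using common_step_representation[of "{()}" "\<lambda>_. g"] g by auto
    then show ?thesis by (intro that[of n B "c ()"]) auto
  qed
  have "energy (simple_fun g) = (\<integral>\<^sup>+s\<in>S. ennreal (step_fun n B (\<lambda>i. \<bar>c i\<bar> powr \<alpha>) s) \<partial>lborel)"
    unfolding energy_def c(1)
    using step_fun_map[OF B(2), of "\<lambda>f. \<bar>f ()\<bar> powr \<alpha>" "\<lambda>_. c"] \<alpha> by simp
  also have "\<dots> = ennreal (\<Sum>i<n. \<bar>c i\<bar> powr \<alpha> * measure lborel (B i))"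
    by (rule nn_integral_step_fun) (use B in auto)
  finally have e: "energy (simple_fun g) = ennreal (\<Sum>i<n. \<bar>c i\<bar> powr \<alpha> * measure lborel (B i))" .
  then show "energy (simple_fun g) < \<infinity>" by simp
  have "indep_vars (\<lambda>_. borel) (\<lambda>i \<omega>. c i * W (B i) \<omega>) {..<n}"
    using W_indep[OF B] by (rule indep_vars_compose2) auto
  then have "symmetric_stable M \<alpha> (\<Sum>i<n. \<bar>c i\<bar> powr \<alpha> * measure lborel (B i)) (\<lambda>\<omega>. \<Sum>i<n. c i * W (B i) \<omega>)"
    by (rule symmetric_stable_sum) (auto intro!: symmetric_stable_mult W_stable B)
  then have "symmetric_stable M \<alpha> (\<Sum>i<n. \<bar>c i\<bar> powr \<alpha> * measure lborel (B i)) (simple_integral W g)"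
    by (rule symmetric_stable_cong_AE) (use c(2) simple_integral_measurable[OF g] in auto)
  then show "symmetric_stable M \<alpha> (enn2real (energy (simple_fun g))) (simple_integral W g)"
    by (simp add: e sum_nonneg)
qed

text \<open>One sequence converges both pointwise on S and in energy: the former is needed for
  Fatou's lemma applied to functions of the kernels, the latter for the integrals.\<close>

lemma simple_approximation:
  assumes f: "f \<in> L_space \<alpha> S"
  obtains g where "\<And>n. snd ` set (g n) \<subseteq> finite_borel_subsets S" "\<And>s. s \<in> S \<Longrightarrow> (\<lambda>n. simple_fun (g n) s) \<longlonglongrightarrow> f s"
    "(\<lambda>n. energy (\<lambda>s. f s - simple_fun (g n) s)) \<longlonglongrightarrow> 0" "(\<lambda>n. energy (simple_fun (g n))) \<longlonglongrightarrow> energy f"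
proof -
  define F where "F = zero_ext f"
  have F[measurable]: "F \<in> borel_measurable borel" using f by (simp add: F_def L_space_iff)
  from borel_measurable_implies_sequence_metric[OF F, of 0]
  obtain p where p: "\<And>n. simple_function borel (p n)" "\<And>x. (\<lambda>n. p n x) \<longlonglongrightarrow> F x" "\<And>n x. \<bar>p n x\<bar> \<le> 2 * \<bar>F x\<bar>"
    by (auto simp: dist_real_def)
  have [measurable]: "p n \<in> borel_measurable borel" for n using p(1) by (rule borel_measurable_simple_function)
  have finF: "(\<integral>\<^sup>+s. ennreal ((k * \<bar>F s\<bar>) powr \<alpha>) \<partial>lborel) < \<infinity>" if "k \<ge> 0" for k
  proof -
    have "(\<integral>\<^sup>+s. ennreal ((k * \<bar>F s\<bar>) powr \<alpha>) \<partial>lborel) = ennreal (k powr \<alpha>) * energy f"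
      unfolding energy_alt F_def[symmetric] using that
      by (subst nn_integral_cmult[symmetric]) (auto simp: powr_mult ennreal_mult)
    then show ?thesis using f by (simp add: L_space_iff ennreal_mult_less_top)
  qed
  have "\<exists>xs. distinct xs \<and> set xs = range (p n) - {0}" for n
    using p(1)[of n] finite_distinct_list[of "range (p n) - {0}"] by (auto simp: simple_function_def)
  then obtain xs where xs: "\<And>n. distinct (xs n)" "\<And>n. set (xs n) = range (p n) - {0}" by metis
  \<comment> \<open>The value 0 is dropped. As \<open>p n\<close> is bounded by 2 \<bar>F\<bar>,
    every other level set lies in S, and Chebyshev's inequality gives it finite measure.\<close>
  define g where "g = (\<lambda>n. map (\<lambda>c. (c, p n -` {c})) (xs n))"
  have g1: "snd ` set (g n) \<subseteq> finite_borel_subsets S" for n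
  proof -
    have "p n -` {c} \<in> finite_borel_subsets S" if "c \<noteq> 0" for c
    proof -
      have m[measurable]: "p n -` {c} \<in> sets borel" using simple_functionD(2)[OF p(1)[of n], of "{c}"] by simp
      have "p n -` {c} \<subseteq> S"
      proof
        fix x assume "x \<in> p n -` {c}"
        then have "F x \<noteq> 0" using p(3)[of n x] that by auto
        then show "x \<in> S" by (auto simp: F_def zero_ext_def indicator_def split: if_splits)
      qed
      moreover have "emeasure lborel (p n -` {c}) < \<infinity>"
      proof -
        have "ennreal (\<bar>c\<bar> powr \<alpha>) * emeasure lborel (p n -` {c}) = (\<integral>\<^sup>+s. ennreal (\<bar>c\<bar> powr \<alpha>) * indicator (p n -` {c}) s \<partial>lborel)"
          by (simp add: nn_integral_cmult)
        also have "\<dots> \<le> (\<integral>\<^sup>+s. ennreal ((2 * \<bar>F s\<bar>) powr \<alpha>) \<partial>lborel)"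
        proof (intro nn_integral_mono)
          fix s
          show "ennreal (\<bar>c\<bar> powr \<alpha>) * indicator (p n -` {c}) s \<le> ennreal ((2 * \<bar>F s\<bar>) powr \<alpha>)"
            using p(3)[of n s] \<alpha> by (auto simp: indicator_def intro!: ennreal_leI powr_mono2)
        qed
        also have "\<dots> < \<infinity>" by (rule finF) simp
        finally show ?thesis using that by (auto simp: ennreal_mult_less_top)
      qed
      ultimately show ?thesis using m by (simp add: finite_borel_subsets_def)
    qed
    then show ?thesis using xs(2)[of n] by (auto simp: g_def)
  qed
  have g2: "simple_fun (g n) s = p n s" for n s
  proof -
    have "simple_fun (g n) s = (\<Sum>c\<leftarrow>xs n. c * indicator (p n -` {c}) s)"
      by (simp add: simple_fun_def g_def o_def)
    also have "\<dots> = (\<Sum>c\<in>set (xs n). c * indicator (p n -` {c}) s)"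
      using xs(1) by (simp add: sum_list_distinct_conv_sum_set)
    also have "\<dots> = (\<Sum>c\<in>set (xs n). if c = p n s then p n s else 0)"
      by (intro sum.cong) (auto simp: indicator_def)
    also have "\<dots> = p n s"
      using p(1)[of n] by (subst sum.delta) (auto simp: xs(2) simple_function_def)
    finally show ?thesis .
  qed
  have pS: "zero_ext (simple_fun (g n)) s = p n s" for n s
    using p(3)[of n s] by (auto simp: zero_ext_def g2 F_def indicator_def split: if_splits)
  have zd: "zero_ext (\<lambda>s. f s - simple_fun (g n) s) s = F s - p n s" for n s
    using pS[of n s] by (simp add: F_def zero_ext_def right_diff_distrib)
  have lim1: "(\<lambda>n. energy (\<lambda>s. f s - simple_fun (g n) s)) \<longlonglongrightarrow> (\<integral>\<^sup>+s. 0 \<partial>(lborel :: 'a measure))"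
    unfolding energy_alt zd
  proof (rule nn_integral_dominated_convergence[where w = "\<lambda>s. ennreal ((3 * \<bar>F s\<bar>) powr \<alpha>)"])
    show "AE s in lborel. ennreal (\<bar>F s - p n s\<bar> powr \<alpha>) \<le> ennreal ((3 * \<bar>F s\<bar>) powr \<alpha>)" for n
    proof (rule AE_I2)
      fix s show "ennreal (\<bar>F s - p n s\<bar> powr \<alpha>) \<le> ennreal ((3 * \<bar>F s\<bar>) powr \<alpha>)"
        using p(3)[of n s] \<alpha> by (intro ennreal_leI powr_mono2) auto
    qed
    show "AE s in lborel. (\<lambda>n. ennreal (\<bar>F s - p n s\<bar> powr \<alpha>)) \<longlonglongrightarrow> 0"
    proof (rule AE_I2)
      fix s
      have "(\<lambda>n. F s - p n s) \<longlonglongrightarrow> F s - F s" by (intro tendsto_intros p)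
      then have "(\<lambda>n. \<bar>F s - p n s\<bar>) \<longlonglongrightarrow> 0" by (intro tendsto_rabs_zero) simp
      then have "(\<lambda>n. \<bar>F s - p n s\<bar> powr \<alpha>) \<longlonglongrightarrow> 0"
        using \<alpha> by (intro tendsto_zero_powrI[OF _ tendsto_const]) auto
      from tendsto_ennrealI[OF this] show "(\<lambda>n. ennreal (\<bar>F s - p n s\<bar> powr \<alpha>)) \<longlonglongrightarrow> 0" by simp
    qed
    show "(\<integral>\<^sup>+s. ennreal ((3 * \<bar>F s\<bar>) powr \<alpha>) \<partial>lborel) < \<infinity>" by (rule finF) simp
  qed auto
  have lim2: "(\<lambda>n. energy (simple_fun (g n))) \<longlonglongrightarrow> energy f"
    unfolding energy_alt pS F_def[symmetric]
  proof (rule nn_integral_dominated_convergence[where w = "\<lambda>s. ennreal ((2 * \<bar>F s\<bar>) powr \<alpha>)"])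
    show "AE s in lborel. ennreal (\<bar>p n s\<bar> powr \<alpha>) \<le> ennreal ((2 * \<bar>F s\<bar>) powr \<alpha>)" for n
    proof (rule AE_I2)
      fix s show "ennreal (\<bar>p n s\<bar> powr \<alpha>) \<le> ennreal ((2 * \<bar>F s\<bar>) powr \<alpha>)"
        using p(3)[of n s] \<alpha> by (intro ennreal_leI powr_mono2) auto
    qed
    show "AE s in lborel. (\<lambda>n. ennreal (\<bar>p n s\<bar> powr \<alpha>)) \<longlonglongrightarrow> ennreal (\<bar>F s\<bar> powr \<alpha>)"
      using p(2) \<alpha> by (intro AE_I2 tendsto_ennrealI tendsto_powr' tendsto_intros) auto
    show "(\<integral>\<^sup>+s. ennreal ((2 * \<bar>F s\<bar>) powr \<alpha>) \<partial>lborel) < \<infinity>" by (rule finF) simp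
  qed auto
  show ?thesis
  proof (rule that[OF g1])
    show "(\<lambda>n. simple_fun (g n) s) \<longlonglongrightarrow> f s" if "s \<in> S" for s
      using p(2)[of s] that by (simp add: g2 F_def zero_ext_def)
  qed (use lim1 lim2 in auto)
qed

end

lemma finite_ennreal_tendsto_0:
  fixes e :: "nat \<Rightarrow> ennreal"
  assumes "e \<longlonglongrightarrow> 0"
  shows "(\<lambda>n. enn2real (e n)) \<longlonglongrightarrow> 0"
  using assms by (intro tendsto_enn2real) simp_all

text \<open>One direction is the upper tail bound at arbitrarily small levels, the other the lower
  tail bound at level 1. It yields the injectivity of the noise integral.\<close>

lemma (in prob_space) symmetric_stable_AE_0:
  assumes \<alpha>: "0 < \<alpha>" "\<alpha> < 2" and X: "symmetric_stable M \<alpha> s X"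
  shows "s = 0 \<longleftrightarrow> (AE \<omega> in M. X \<omega> = 0)"
proof
  have [measurable]: "X \<in> borel_measurable M" using X by (simp add: symmetric_stable_def)
  {
    assume "s = 0"
    have "AE \<omega> in M. \<not> (\<bar>X \<omega>\<bar> \<ge> inverse (Suc n))" for n
    proof -
      have "prob {\<omega>\<in>space M. \<bar>X \<omega>\<bar> \<ge> inverse (Suc n)} \<le> 0"
        using stable_tail_upper[OF \<alpha> X, of "inverse (Suc n)"] \<open>s = 0\<close> by simp
      then have "prob {\<omega>\<in>space M. \<bar>X \<omega>\<bar> \<ge> inverse (Suc n)} = 0"
        using measure_nonneg[of M "{\<omega>\<in>space M. \<bar>X \<omega>\<bar> \<ge> inverse (Suc n)}"] by linarith
      then show ?thesis
        by (subst AE_iff_measurable[where N = "{\<omega>\<in>space M. \<bar>X \<omega>\<bar> \<ge> inverse (Suc n)}"]) (auto simp: emeasure_eq_measure)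
    qed
    then have "AE \<omega> in M. \<forall>n. \<not> (\<bar>X \<omega>\<bar> \<ge> inverse (Suc n))"
      by (subst AE_all_countable) auto
    then show "AE \<omega> in M. X \<omega> = 0"
    proof eventually_elim
      case (elim \<omega>)
      show ?case
      proof (rule ccontr)
        assume "X \<omega> \<noteq> 0"
        then obtain n where "inverse (Suc n) < \<bar>X \<omega>\<bar>" using reals_Archimedean[of "\<bar>X \<omega>\<bar>"] by auto
        with elim show False by (meson less_imp_le)
      qed
    qed
  }
  assume "AE \<omega> in M. X \<omega> = 0"
  then have "prob {\<omega>\<in>space M. \<bar>X \<omega>\<bar> > 1} = prob {\<omega>\<in>space M. False}"
    by (intro finite_measure_eq_AE) auto
  then have "tail_const \<alpha> * min 1 s \<le> 0"
    using stable_tail_lower[OF \<alpha> X, of 1] by simp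
  moreover have "s \<ge> 0" using X by (simp add: symmetric_stable_def)
  ultimately show "s = 0"
    using tail_const(1)[of \<alpha>] by (auto simp: mult_le_0_iff min_def split: if_splits)
qed

context stable_noise
begin

section \<open>Existence and uniqueness of the noise integral\<close>

lemma energy_linear_tendsto_0:
  assumes "\<And>n. f n \<in> L_space \<alpha> S" "\<And>n. g n \<in> L_space \<alpha> S"
    and lim: "(\<lambda>n. energy (f n)) \<longlonglongrightarrow> 0" "(\<lambda>n. energy (g n)) \<longlonglongrightarrow> 0"
  shows "(\<lambda>n. energy (\<lambda>s. a * f n s + b * g n s)) \<longlonglongrightarrow> 0"
proof (rule tendsto_sandwich[where f = "\<lambda>_. 0"])
  show "\<forall>\<^sub>F n in sequentially. energy (\<lambda>s. a * f n s + b * g n s) \<le>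
    ennreal (4 * \<bar>a\<bar> powr \<alpha>) * energy (f n) + ennreal (4 * \<bar>b\<bar> powr \<alpha>) * energy (g n)"
    by (intro always_eventually allI energy_linear_le zero_ext_measurable assms)
  have "(\<lambda>n. ennreal (4 * \<bar>a\<bar> powr \<alpha>) * energy (f n) + ennreal (4 * \<bar>b\<bar> powr \<alpha>) * energy (g n)) \<longlonglongrightarrow>
    ennreal (4 * \<bar>a\<bar> powr \<alpha>) * 0 + ennreal (4 * \<bar>b\<bar> powr \<alpha>) * 0"
    by (intro tendsto_add ennreal_tendsto_cmult lim) auto
  then show "(\<lambda>n. ennreal (4 * \<bar>a\<bar> powr \<alpha>) * energy (f n) + ennreal (4 * \<bar>b\<bar> powr \<alpha>) * energy (g n)) \<longlonglongrightarrow> 0"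
    by simp
qed auto

lemma simple_fun_in_L_space: "snd ` set g \<subseteq> finite_borel_subsets S \<Longrightarrow> simple_fun g \<in> L_space \<alpha> S"
  using simple_integral_stable(1) simple_fun_zero_ext_measurable by (simp add: L_space_iff)

lemma L_space_diff: "f \<in> L_space \<alpha> S \<Longrightarrow> g \<in> L_space \<alpha> S \<Longrightarrow> (\<lambda>s. f s - g s) \<in> L_space \<alpha> S"
  using L_space_linear[of f g 1 "-1"] by simp

lemma simple_difference:
  assumes "snd ` set g \<subseteq> finite_borel_subsets S" "snd ` set h \<subseteq> finite_borel_subsets S"
  shows "symmetric_stable M \<alpha> (enn2real (energy (\<lambda>s. simple_fun g s - simple_fun h s)))
    (\<lambda>\<omega>. simple_integral W g \<omega> - simple_integral W h \<omega>)"
proof -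
  let ?k = "g @ map (\<lambda>(c, A). (-1 * c, A)) h"
  have k: "snd ` set ?k \<subseteq> finite_borel_subsets S" using assms by force
  have "simple_fun ?k = (\<lambda>s. simple_fun g s - simple_fun h s)"
    "simple_integral W ?k = (\<lambda>\<omega>. simple_integral W g \<omega> - simple_integral W h \<omega>)"
    unfolding fun_eq_iff simple_fun_append simple_integral_append simple_fun_scale simple_integral_scale by simp_all
  with simple_integral_stable(2)[OF k] show ?thesis by simp
qed

lemma has_noise_integral_energy:
  "has_noise_integral M \<alpha> S W f X \<longleftrightarrow> f \<in> L_space \<alpha> S \<and> X \<in> borel_measurable M \<and>
     (\<exists>g. (\<forall>n. snd ` set (g n) \<subseteq> finite_borel_subsets S) \<and>
       (\<lambda>n. energy (\<lambda>s. f s - simple_fun (g n) s)) \<longlonglongrightarrow> 0 \<and> tendsto_in_prob M (\<lambda>n. simple_integral W (g n)) X)"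
  unfolding has_noise_integral_def energy_def by simp

text \<open>A difference of simple integrals is stable with the energy of the difference as
  parameter, so closeness in energy is closeness in probability.\<close>

lemma simple_integrals_same_limit:
  assumes f: "f \<in> L_space \<alpha> S"
    and g: "\<And>n. snd ` set (g n) \<subseteq> finite_borel_subsets S" "(\<lambda>n. energy (\<lambda>s. f s - simple_fun (g n) s)) \<longlonglongrightarrow> 0"
    and h: "\<And>n. snd ` set (h n) \<subseteq> finite_borel_subsets S" "(\<lambda>n. energy (\<lambda>s. f s - simple_fun (h n) s)) \<longlonglongrightarrow> 0"
  shows "tendsto_in_prob M (\<lambda>n \<omega>. simple_integral W (g n) \<omega> - simple_integral W (h n) \<omega>) (\<lambda>_. 0)"
proof (rule symmetric_stable_tendsto_0[OF \<alpha>])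
  show "symmetric_stable M \<alpha> (enn2real (energy (\<lambda>s. simple_fun (g n) s - simple_fun (h n) s)))
    (\<lambda>\<omega>. simple_integral W (g n) \<omega> - simple_integral W (h n) \<omega>)" for n
    by (rule simple_difference[OF g(1) h(1)])
  have "(\<lambda>n. energy (\<lambda>s. 1 * (f s - simple_fun (h n) s) + (-1) * (f s - simple_fun (g n) s))) \<longlonglongrightarrow> 0"
    by (intro energy_linear_tendsto_0 L_space_diff f simple_fun_in_L_space g h)
  then show "(\<lambda>n. enn2real (energy (\<lambda>s. simple_fun (g n) s - simple_fun (h n) s))) \<longlonglongrightarrow> 0"
    by (intro finite_ennreal_tendsto_0) simp
qed

lemma has_noise_integral_simple_limit:
  assumes X: "has_noise_integral M \<alpha> S W f X"
    and g: "\<And>n. snd ` set (g n) \<subseteq> finite_borel_subsets S" "(\<lambda>n. energy (\<lambda>s. f s - simple_fun (g n) s)) \<longlonglongrightarrow> 0"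
  shows "tendsto_in_prob M (\<lambda>n. simple_integral W (g n)) X"
proof -
  from X obtain h where f: "f \<in> L_space \<alpha> S" and [measurable]: "X \<in> borel_measurable M"
    and h: "\<And>n. snd ` set (h n) \<subseteq> finite_borel_subsets S" "(\<lambda>n. energy (\<lambda>s. f s - simple_fun (h n) s)) \<longlonglongrightarrow> 0"
    "tendsto_in_prob M (\<lambda>n. simple_integral W (h n)) X"
    unfolding has_noise_integral_energy by blast
  note [measurable] = simple_integral_measurable[OF g(1)] simple_integral_measurable[OF h(1)]
  have "tendsto_in_prob M (\<lambda>n \<omega>. 1 * (simple_integral W (g n) \<omega> - simple_integral W (h n) \<omega>) + 1 * simple_integral W (h n) \<omega>) (\<lambda>\<omega>. 1 * 0 + 1 * X \<omega>)"
    by (rule tendsto_in_prob_linear[OF _ _ _ _ simple_integrals_same_limit[OF f g h(1,2)] h(3)]) auto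
  then show ?thesis by simp
qed

lemma has_noise_integral_unique:
  assumes "has_noise_integral M \<alpha> S W f X" "has_noise_integral M \<alpha> S W f Y"
  shows "AE \<omega> in M. X \<omega> = Y \<omega>"
proof -
  from assms(2) obtain h where h: "\<And>n. snd ` set (h n) \<subseteq> finite_borel_subsets S" "(\<lambda>n. energy (\<lambda>s. f s - simple_fun (h n) s)) \<longlonglongrightarrow> 0"
    "tendsto_in_prob M (\<lambda>n. simple_integral W (h n)) Y"
    unfolding has_noise_integral_energy by blast
  show ?thesis
    using has_noise_integral_simple_limit[OF assms(1) h(1,2)] h(3) assms
    by (intro tendsto_in_prob_unique[of "\<lambda>n. simple_integral W (h n)"] simple_integral_measurable h(1))
      (auto simp: has_noise_integral_energy)
qed

lemma has_noise_integral_exists: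
  assumes f: "f \<in> L_space \<alpha> S"
  shows "\<exists>X. has_noise_integral M \<alpha> S W f X"
proof -
  obtain g0 where g0: "\<And>n. snd ` set (g0 n) \<subseteq> finite_borel_subsets S"
    "\<And>s. s \<in> S \<Longrightarrow> (\<lambda>n. simple_fun (g0 n) s) \<longlonglongrightarrow> f s"
    "(\<lambda>n. energy (\<lambda>s. f s - simple_fun (g0 n) s)) \<longlonglongrightarrow> 0"
    "(\<lambda>n. energy (simple_fun (g0 n))) \<longlonglongrightarrow> energy f"
    using simple_approximation[OF f] by blast
  \<comment> \<open>At level 2^(-n) the upper tail bound costs the factor (2^n)^\<alpha> \<le> 4^n.
    Energies below 8^(-n) then leave probabilities of order 2^(-n), summable for the Borel-Cantelli
    lemma, at levels that are summable as well.\<close>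
  have "\<exists>k. energy (\<lambda>s. f s - simple_fun (g0 k) s) < ennreal ((1/8) ^ n)" for n
    using order_tendstoD(2)[OF g0(3), of "ennreal ((1/8) ^ n)"] by (auto simp: eventually_sequentially)
  then obtain k where k: "\<And>n. energy (\<lambda>s. f s - simple_fun (g0 (k n)) s) < ennreal ((1/8) ^ n)" by metis
  define g where "g = (\<lambda>n. g0 (k n))"
  have g: "snd ` set (g n) \<subseteq> finite_borel_subsets S" "energy (\<lambda>s. f s - simple_fun (g n) s) < ennreal ((1/8) ^ n)" for n
    using g0(1) k by (auto simp: g_def)
  note [measurable] = simple_integral_measurable[OF g(1)]
  let ?I = "\<lambda>n. simple_integral W (g n)"
  have glim: "(\<lambda>n. energy (\<lambda>s. f s - simple_fun (g n) s)) \<longlonglongrightarrow> 0"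
  proof (rule tendsto_sandwich[where f = "\<lambda>_. 0"])
    show "\<forall>\<^sub>F n in sequentially. energy (\<lambda>s. f s - simple_fun (g n) s) \<le> ennreal ((1/8) ^ n)"
      using g(2) by (auto intro!: always_eventually less_imp_le)
    have "(\<lambda>n. (1/8::real) ^ n) \<longlonglongrightarrow> 0" by (intro LIMSEQ_power_zero) auto
    from tendsto_ennrealI[OF this] show "(\<lambda>n. ennreal ((1/8) ^ n)) \<longlonglongrightarrow> 0" by simp
  qed auto
  have P: "prob {\<omega>\<in>space M. \<bar>?I (Suc n) \<omega> - ?I n \<omega>\<bar> \<ge> (1/2) ^ n} \<le> 48 * (1/2) ^ n" for n
  proof -
    let ?s = "energy (\<lambda>s. simple_fun (g (Suc n)) s - simple_fun (g n) s)"
    have "?s = energy (\<lambda>s. (f s - simple_fun (g n) s) - (f s - simple_fun (g (Suc n)) s))"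
      by simp
    also have "\<dots> \<le> 4 * energy (\<lambda>s. f s - simple_fun (g n) s) + 4 * energy (\<lambda>s. f s - simple_fun (g (Suc n)) s)"
      by (intro energy_diff_le zero_ext_measurable L_space_diff f simple_fun_in_L_space g)
    also have "\<dots> \<le> 4 * ennreal ((1/8) ^ n) + 4 * ennreal ((1/8) ^ Suc n)"
      by (intro add_mono mult_left_mono less_imp_le g) auto
    also have "\<dots> \<le> 4 * ennreal ((1/8) ^ n) + 4 * ennreal ((1/8) ^ n)"
      by (intro add_left_mono mult_left_mono ennreal_leI) auto
    also have "\<dots> = ennreal (8 * (1/8) ^ n)"
    proof -
      have "4 * ennreal ((1/8) ^ n) = ennreal (4 * (1/8) ^ n)"
        by (simp only: ennreal_mult'[of 4, simplified] ennreal_numeral zero_le_numeral)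
      then show ?thesis by (simp only: ennreal_plus[symmetric]) (simp add: ennreal_plus[symmetric] del: ennreal_plus)
    qed
    finally have s: "enn2real ?s \<le> 8 * (1/8) ^ n"
      by (intro enn2real_leI) auto
    have "prob {\<omega>\<in>space M. \<bar>?I (Suc n) \<omega> - ?I n \<omega>\<bar> \<ge> (1/2) ^ n} \<le> 6 * (enn2real ?s * ((1/2) ^ n) powr - \<alpha>)"
      by (intro stable_tail_upper[OF \<alpha> simple_difference] g) simp
    also have "\<dots> \<le> 6 * ((8 * (1/8) ^ n) * ((1/2) ^ n) powr - 2)"
    proof (intro mult_left_mono mult_mono s)
      show "((1/2::real) ^ n) powr - \<alpha> \<le> ((1/2) ^ n) powr - 2"
        using \<alpha> by (intro powr_mono') (auto simp: power_le_one)
    qed auto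
    also have "((1/2::real) ^ n) powr - 2 = 4 ^ n"
      by (simp add: powr_minus powr_numeral power_mult_distrib power_one_over power2_eq_square)
        (simp add: power_mult_distrib[symmetric])
    also have "6 * ((8 * (1/8) ^ n) * 4 ^ n) = 48 * ((1/8 * 4) ^ n :: real)"
      by (simp only: power_mult_distrib)
    finally show ?thesis by simp
  qed
  have "AE \<omega> in M. \<forall>\<^sub>F n in sequentially. \<omega> \<in> space M - {\<omega>\<in>space M. \<bar>?I (Suc n) \<omega> - ?I n \<omega>\<bar> \<ge> (1/2) ^ n}"
  proof (rule borel_cantelli_AE1)
    show "summable (\<lambda>n. prob {\<omega>\<in>space M. \<bar>?I (Suc n) \<omega> - ?I n \<omega>\<bar> \<ge> (1/2) ^ n})"
      by (rule summable_comparison_test'[where g = "\<lambda>n. 48 * (1/2) ^ n" and N = 0])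
        (use P in \<open>auto intro!: summable_mult summable_geometric\<close>)
  qed (auto simp: emeasure_eq_measure)
  then have conv: "AE \<omega> in M. convergent (\<lambda>n. ?I n \<omega>)"
  proof eventually_elim
    case (elim \<omega>)
    then obtain N where N: "\<And>n. n \<ge> N \<Longrightarrow> \<bar>?I (Suc n) \<omega> - ?I n \<omega>\<bar> < (1/2) ^ n"
      by (auto simp: eventually_sequentially not_le)
    have "summable (\<lambda>n. ?I (Suc n) \<omega> - ?I n \<omega>)"
      by (rule summable_comparison_test'[where g = "\<lambda>n. (1/2) ^ n" and N = N])
        (use N in \<open>auto intro!: less_imp_le summable_geometric\<close>)
    then have "convergent (\<lambda>n. \<Sum>i<n. (?I (Suc i) \<omega> - ?I i \<omega>))"
      by (simp add: summable_iff_convergent)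
    moreover have "(\<Sum>i<n. (?I (Suc i) \<omega> - ?I i \<omega>)) = ?I n \<omega> - ?I 0 \<omega>" for n
      by (rule sum_lessThan_telescope)
    ultimately have "convergent (\<lambda>n. ?I n \<omega> - ?I 0 \<omega>)" by simp
    then have "convergent (\<lambda>n. (?I n \<omega> - ?I 0 \<omega>) + ?I 0 \<omega>)"
      by (intro convergent_add convergent_const)
    then show ?case by simp
  qed
  define X where "X = (\<lambda>\<omega>. lim (\<lambda>n. ?I n \<omega>))"
  have [measurable]: "X \<in> borel_measurable M" unfolding X_def by measurable
  have "tendsto_in_prob M ?I X"
    by (rule tendsto_in_prob_AE) (use conv in \<open>auto simp: X_def convergent_LIMSEQ_iff\<close>)
  then show ?thesis
    unfolding has_noise_integral_energy using f g(1) glim \<open>X \<in> borel_measurable M\<close> by blast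
qed

section \<open>Linearity, injectivity and closedness of the noise integral\<close>

abbreviation ni :: "('a \<Rightarrow> real) \<Rightarrow> 'w \<Rightarrow> real" where
  "ni \<equiv> noise_integral M \<alpha> S W"

lemma has_noise_integral_ni: "f \<in> L_space \<alpha> S \<Longrightarrow> has_noise_integral M \<alpha> S W f (ni f)"
  unfolding noise_integral_def using has_noise_integral_exists by (rule someI_ex)

lemma ni_measurable: "f \<in> L_space \<alpha> S \<Longrightarrow> ni f \<in> borel_measurable M"
  using has_noise_integral_ni by (simp add: has_noise_integral_energy)

lemma ni_simple_approximation:
  assumes f: "f \<in> L_space \<alpha> S"
  obtains g where "\<And>n. snd ` set (g n) \<subseteq> finite_borel_subsets S" "\<And>s. s \<in> S \<Longrightarrow> (\<lambda>n. simple_fun (g n) s) \<longlonglongrightarrow> f s"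
    "(\<lambda>n. energy (\<lambda>s. f s - simple_fun (g n) s)) \<longlonglongrightarrow> 0" "(\<lambda>n. energy (simple_fun (g n))) \<longlonglongrightarrow> energy f"
    "tendsto_in_prob M (\<lambda>n. simple_integral W (g n)) (ni f)"
proof -
  from simple_approximation[OF f] obtain g where g: "\<And>n. snd ` set (g n) \<subseteq> finite_borel_subsets S"
    "\<And>s. s \<in> S \<Longrightarrow> (\<lambda>n. simple_fun (g n) s) \<longlonglongrightarrow> f s"
    "(\<lambda>n. energy (\<lambda>s. f s - simple_fun (g n) s)) \<longlonglongrightarrow> 0" "(\<lambda>n. energy (simple_fun (g n))) \<longlonglongrightarrow> energy f"
    by blast
  show ?thesis
    by (rule that[OF g has_noise_integral_simple_limit[OF has_noise_integral_ni[OF f] g(1,3)]])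
qed

lemma ni_stable:
  assumes f: "f \<in> L_space \<alpha> S"
  shows "symmetric_stable M \<alpha> (enn2real (energy f)) (ni f)"
proof -
  obtain g where g: "\<And>n. snd ` set (g n) \<subseteq> finite_borel_subsets S" "\<And>s. s \<in> S \<Longrightarrow> (\<lambda>n. simple_fun (g n) s) \<longlonglongrightarrow> f s"
    "(\<lambda>n. energy (\<lambda>s. f s - simple_fun (g n) s)) \<longlonglongrightarrow> 0" "(\<lambda>n. energy (simple_fun (g n))) \<longlonglongrightarrow> energy f"
    "tendsto_in_prob M (\<lambda>n. simple_integral W (g n)) (ni f)" using ni_simple_approximation[OF f] by blast
  show ?thesis
  proof (rule symmetric_stable_limit[OF _ _ g(5)])
    show "(\<lambda>n. enn2real (energy (simple_fun (g n)))) \<longlonglongrightarrow> enn2real (energy f)"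
      using f g(4) by (intro tendsto_enn2real) (simp add: L_space_iff)+
  qed (use simple_integral_stable(2) g(1) ni_measurable[OF f] in auto)
qed

lemma ni_linear:
  assumes f: "f \<in> L_space \<alpha> S" and h: "h \<in> L_space \<alpha> S"
  shows "AE \<omega> in M. ni (\<lambda>s. a * f s + b * h s) \<omega> = a * ni f \<omega> + b * ni h \<omega>"
proof -
  obtain g where g: "\<And>n. snd ` set (g n) \<subseteq> finite_borel_subsets S" "\<And>s. s \<in> S \<Longrightarrow> (\<lambda>n. simple_fun (g n) s) \<longlonglongrightarrow> f s"
    "(\<lambda>n. energy (\<lambda>s. f s - simple_fun (g n) s)) \<longlonglongrightarrow> 0" "(\<lambda>n. energy (simple_fun (g n))) \<longlonglongrightarrow> energy f"
    "tendsto_in_prob M (\<lambda>n. simple_integral W (g n)) (ni f)" using ni_simple_approximation[OF f] by blast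
  obtain k where k: "\<And>n. snd ` set (k n) \<subseteq> finite_borel_subsets S" "\<And>s. s \<in> S \<Longrightarrow> (\<lambda>n. simple_fun (k n) s) \<longlonglongrightarrow> h s"
    "(\<lambda>n. energy (\<lambda>s. h s - simple_fun (k n) s)) \<longlonglongrightarrow> 0" "(\<lambda>n. energy (simple_fun (k n))) \<longlonglongrightarrow> energy h"
    "tendsto_in_prob M (\<lambda>n. simple_integral W (k n)) (ni h)" using ni_simple_approximation[OF h] by blast
  note [measurable] = simple_integral_measurable[OF g(1)] simple_integral_measurable[OF k(1)]
     ni_measurable[OF f] ni_measurable[OF h]
  define l where "l = (\<lambda>n. map (\<lambda>(c, A). (a * c, A)) (g n) @ map (\<lambda>(c, A). (b * c, A)) (k n))"
  have l1: "snd ` set (l n) \<subseteq> finite_borel_subsets S" for n using g(1)[of n] k(1)[of n] unfolding l_def by force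
  have l2: "simple_fun (l n) s = a * simple_fun (g n) s + b * simple_fun (k n) s" for n s
    unfolding l_def simple_fun_append simple_fun_scale ..
  have l3: "simple_integral W (l n) \<omega> = a * simple_integral W (g n) \<omega> + b * simple_integral W (k n) \<omega>" for n \<omega>
    unfolding l_def simple_integral_append simple_integral_scale ..
  have "has_noise_integral M \<alpha> S W (\<lambda>s. a * f s + b * h s) (\<lambda>\<omega>. a * ni f \<omega> + b * ni h \<omega>)"
    unfolding has_noise_integral_energy
  proof (intro conjI exI[of _ l] allI l1 L_space_linear f h)
    have "(\<lambda>n. energy (\<lambda>s. a * (f s - simple_fun (g n) s) + b * (h s - simple_fun (k n) s))) \<longlonglongrightarrow> 0"
      by (intro energy_linear_tendsto_0 L_space_diff f h simple_fun_in_L_space g(1,3) k(1,3))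
    then show "(\<lambda>n. energy (\<lambda>s. (a * f s + b * h s) - simple_fun (l n) s)) \<longlonglongrightarrow> 0"
      unfolding l2 by (simp add: algebra_simps)
    show "tendsto_in_prob M (\<lambda>n. simple_integral W (l n)) (\<lambda>\<omega>. a * ni f \<omega> + b * ni h \<omega>)"
      using tendsto_in_prob_linear[OF _ _ _ _ g(5) k(5), of a b] by (simp add: l3[abs_def])
  qed auto
  from has_noise_integral_unique[OF has_noise_integral_ni[OF L_space_linear[OF f h]] this] show ?thesis .
qed

lemma ni_diff:
  assumes f: "f \<in> L_space \<alpha> S" and h: "h \<in> L_space \<alpha> S"
  shows "AE \<omega> in M. ni (\<lambda>s. f s - h s) \<omega> = ni f \<omega> - ni h \<omega>"
  using ni_linear[OF f h, of 1 "-1"] by simp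

lemma ni_sum:
  assumes "finite J" "\<And>j. j \<in> J \<Longrightarrow> f j \<in> L_space \<alpha> S"
  shows "(\<lambda>s. \<Sum>j\<in>J. c j * f j s) \<in> L_space \<alpha> S \<and>
    (AE \<omega> in M. ni (\<lambda>s. \<Sum>j\<in>J. c j * f j s) \<omega> = (\<Sum>j\<in>J. c j * ni (f j) \<omega>))"
  using assms
proof (induction J rule: finite_induct)
  case empty
  have 0: "(\<lambda>s. 0) \<in> L_space \<alpha> S"
    using simple_fun_in_L_space[of "[]"] by (simp add: simple_fun_def[abs_def])
  have "AE \<omega> in M. ni (\<lambda>s. 0) \<omega> = 0"
    using symmetric_stable_AE_0[OF \<alpha> ni_stable[OF 0]] by (simp add: energy_def)
  with 0 show ?case by simp
next
  case (insert j J)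
  then have f: "f j \<in> L_space \<alpha> S" and I: "(\<lambda>s. \<Sum>j\<in>J. c j * f j s) \<in> L_space \<alpha> S"
    "AE \<omega> in M. ni (\<lambda>s. \<Sum>j\<in>J. c j * f j s) \<omega> = (\<Sum>j\<in>J. c j * ni (f j) \<omega>)" by auto
  have "(\<lambda>s. c j * f j s + 1 * (\<Sum>j\<in>J. c j * f j s)) \<in> L_space \<alpha> S"
    by (rule L_space_linear[OF f I(1)])
  moreover from ni_linear[OF f I(1), of "c j" 1] I(2)
  have "AE \<omega> in M. ni (\<lambda>s. c j * f j s + 1 * (\<Sum>j\<in>J. c j * f j s)) \<omega> = c j * ni (f j) \<omega> + (\<Sum>j\<in>J. c j * ni (f j) \<omega>)"
    by eventually_elim simp
  ultimately show ?case using insert.hyps by simp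
qed

text \<open>The difference of the integrals is stable with the energy of f - h as parameter, and it
  vanishes exactly if this parameter is 0. A kernel on S is thus identified by its integral.\<close>

lemma ni_eq_AE_iff:
  assumes f: "f \<in> L_space \<alpha> S" and h: "h \<in> L_space \<alpha> S"
  shows "(AE \<omega> in M. ni f \<omega> = ni h \<omega>) \<longleftrightarrow> (AE s in lborel. s \<in> S \<longrightarrow> f s = h s)"
proof -
  have m[measurable]: "zero_ext (\<lambda>s. f s - h s) \<in> borel_measurable borel"
    by (intro zero_ext_measurable L_space_diff f h)
  have fin: "energy (\<lambda>s. f s - h s) < \<infinity>"
    using L_space_diff[OF f h] by (simp add: L_space_iff)
  have "(AE \<omega> in M. ni f \<omega> = ni h \<omega>) \<longleftrightarrow> (AE \<omega> in M. ni (\<lambda>s. f s - h s) \<omega> = 0)"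
  proof
    assume "AE \<omega> in M. ni f \<omega> = ni h \<omega>"
    with ni_diff[OF f h] show "AE \<omega> in M. ni (\<lambda>s. f s - h s) \<omega> = 0" by eventually_elim simp
  next
    assume "AE \<omega> in M. ni (\<lambda>s. f s - h s) \<omega> = 0"
    with ni_diff[OF f h] show "AE \<omega> in M. ni f \<omega> = ni h \<omega>" by eventually_elim simp
  qed
  also have "\<dots> \<longleftrightarrow> enn2real (energy (\<lambda>s. f s - h s)) = 0"
    using symmetric_stable_AE_0[OF \<alpha> ni_stable[OF L_space_diff[OF f h]]] by simp
  also have "\<dots> \<longleftrightarrow> energy (\<lambda>s. f s - h s) = 0"
    using fin by (auto simp: enn2real_eq_0_iff)
  also have "\<dots> \<longleftrightarrow> (AE s in lborel. ennreal (\<bar>zero_ext (\<lambda>s. f s - h s) s\<bar> powr \<alpha>) = 0)"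
    unfolding energy_alt by (subst nn_integral_0_iff_AE) auto
  also have "\<dots> \<longleftrightarrow> (AE s in lborel. s \<in> S \<longrightarrow> f s = h s)"
    by (intro AE_cong) (auto simp: zero_ext_def indicator_def)
  finally show ?thesis .
qed

text \<open>The integral is a closed operator. Integrals that converge in probability are Cauchy;
  the lower tail bound turns this into a Cauchy property in energy, Fatou's lemma replaces one index
  by the pointwise limit h, and the upper tail bound leads back to the integrals. Membership of h in
  the space of integrands is part of what is gained.\<close>

lemma ni_limit:
  assumes f: "\<And>k. f k \<in> L_space \<alpha> S" and Z[measurable]: "Z \<in> borel_measurable M"
    and lim: "tendsto_in_prob M (\<lambda>k. ni (f k)) Z"
    and h[measurable]: "zero_ext h \<in> borel_measurable borel"
    and ae: "AE s in lborel. s \<in> S \<longrightarrow> (\<lambda>k. f k s) \<longlonglongrightarrow> h s"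
  shows "h \<in> L_space \<alpha> S" "AE \<omega> in M. ni h \<omega> = Z \<omega>" "(\<lambda>k. energy (\<lambda>s. f k s - h s)) \<longlonglongrightarrow> 0"
proof -
  note [measurable] = ni_measurable[OF f]
  have cauchy: "\<exists>N. \<forall>k\<ge>N. \<forall>l\<ge>N. energy (\<lambda>s. f k s - f l s) \<le> ennreal e" if "0 < e" "e < 1" for e
  proof -
    \<comment> \<open>Two events of probability below \<open>?c\<close> bound
      \<open>tail_const \<alpha> * min 1 ?s\<close> by \<open>tail_const \<alpha> * e\<close>. Since
      e < 1, the minimum must be the energy itself.\<close>
    let ?c = "tail_const \<alpha> * e / 2"
    have c: "?c > 0" using tail_const(1)[of \<alpha>] that by simp
    have "(\<lambda>n. prob {\<omega>\<in>space M. \<bar>ni (f n) \<omega> - Z \<omega>\<bar> > 1/2}) \<longlonglongrightarrow> 0"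
      using lim unfolding tendsto_in_prob_def by (meson half_gt_zero_iff zero_less_one)
    then obtain N where N: "\<And>n. n \<ge> N \<Longrightarrow> prob {\<omega>\<in>space M. \<bar>ni (f n) \<omega> - Z \<omega>\<bar> > 1/2} < ?c"
      using order_tendstoD(2)[of _ 0 sequentially ?c] c unfolding eventually_sequentially by blast
    have "energy (\<lambda>s. f k s - f l s) \<le> ennreal e" if kl: "k \<ge> N" "l \<ge> N" for k l
    proof -
      let ?s = "enn2real (energy (\<lambda>s. f k s - f l s))"
      note L = L_space_diff[OF f[of k] f[of l]]
      have [measurable]: "ni (\<lambda>s. f k s - f l s) \<in> borel_measurable M" by (rule ni_measurable[OF L])
      have "tail_const \<alpha> * min 1 ?s \<le> prob {\<omega>\<in>space M. \<bar>ni (\<lambda>s. f k s - f l s) \<omega>\<bar> > 1}"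
        using stable_tail_lower[OF \<alpha> ni_stable[OF L], of 1] by simp
      also have "\<dots> = prob {\<omega>\<in>space M. \<bar>ni (f k) \<omega> - ni (f l) \<omega>\<bar> > 1}"
        using ni_diff[OF f[of k] f[of l]] by (intro finite_measure_eq_AE) auto
      also have "\<dots> \<le> prob ({\<omega>\<in>space M. \<bar>ni (f k) \<omega> - Z \<omega>\<bar> > 1/2} \<union> {\<omega>\<in>space M. \<bar>ni (f l) \<omega> - Z \<omega>\<bar> > 1/2})"
      proof (intro finite_measure_mono subsetI)
        fix \<omega> assume "\<omega> \<in> {\<omega>\<in>space M. \<bar>ni (f k) \<omega> - ni (f l) \<omega>\<bar> > 1}"
        then have "\<omega> \<in> space M" "\<bar>ni (f k) \<omega> - Z \<omega>\<bar> > 1/2 \<or> \<bar>ni (f l) \<omega> - Z \<omega>\<bar> > 1/2"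
          by (simp, simp only: mem_Collect_eq, argo)
        then show "\<omega> \<in> {\<omega>\<in>space M. \<bar>ni (f k) \<omega> - Z \<omega>\<bar> > 1/2} \<union> {\<omega>\<in>space M. \<bar>ni (f l) \<omega> - Z \<omega>\<bar> > 1/2}"
          by simp
      qed auto
      also have "\<dots> \<le> prob {\<omega>\<in>space M. \<bar>ni (f k) \<omega> - Z \<omega>\<bar> > 1/2} + prob {\<omega>\<in>space M. \<bar>ni (f l) \<omega> - Z \<omega>\<bar> > 1/2}"
        by (rule measure_Un_le) auto
      also have "\<dots> < tail_const \<alpha> * e"
        using N[OF kl(1)] N[OF kl(2)] by simp
      finally have "min 1 ?s < e" using tail_const(1)[of \<alpha>] by simp
      then have "?s \<le> e" using \<open>e < 1\<close> by auto
      then show ?thesis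
        using L that by (metis L_space_iff ennreal_enn2real ennreal_leI infinity_ennreal_def)
    qed
    then show ?thesis by blast
  qed
  have close: "\<exists>N. \<forall>k\<ge>N. energy (\<lambda>s. f k s - h s) \<le> ennreal e" if "0 < e" "e < 1" for e
  proof -
    from cauchy[OF that] obtain N where N: "\<And>k l. k \<ge> N \<Longrightarrow> l \<ge> N \<Longrightarrow> energy (\<lambda>s. f k s - f l s) \<le> ennreal e" by blast
    have "energy (\<lambda>s. f k s - h s) \<le> ennreal e" if "k \<ge> N" for k
    proof -
      have m[measurable]: "zero_ext (\<lambda>s. f k s - f l s) \<in> borel_measurable borel" for l
        by (intro zero_ext_measurable L_space_diff f)
      have "energy (\<lambda>s. f k s - h s) = (\<integral>\<^sup>+s. liminf (\<lambda>l. ennreal (\<bar>zero_ext (\<lambda>s. f k s - f l s) s\<bar> powr \<alpha>)) \<partial>lborel)"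
        unfolding energy_alt
      proof (intro nn_integral_cong_AE)
        show "AE s in lborel. ennreal (\<bar>zero_ext (\<lambda>s. f k s - h s) s\<bar> powr \<alpha>) =
           liminf (\<lambda>l. ennreal (\<bar>zero_ext (\<lambda>s. f k s - f l s) s\<bar> powr \<alpha>))"
          using ae
        proof eventually_elim
          case (elim s)
          have "(\<lambda>l. zero_ext (\<lambda>s. f k s - f l s) s) \<longlonglongrightarrow> zero_ext (\<lambda>s. f k s - h s) s"
            using elim by (cases "s \<in> S") (auto simp: zero_ext_def intro!: tendsto_intros)
          then have "(\<lambda>l. ennreal (\<bar>zero_ext (\<lambda>s. f k s - f l s) s\<bar> powr \<alpha>)) \<longlonglongrightarrow> ennreal (\<bar>zero_ext (\<lambda>s. f k s - h s) s\<bar> powr \<alpha>)"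
            using \<alpha> by (intro tendsto_ennrealI tendsto_powr' tendsto_intros) auto
          then show ?case by (intro lim_imp_Liminf[symmetric]) simp
        qed
      qed
      also have "\<dots> \<le> liminf (\<lambda>l. energy (\<lambda>s. f k s - f l s))"
        unfolding energy_alt by (rule nn_integral_liminf) measurable
      also have "\<dots> \<le> ennreal e"
        using N[OF that] by (intro Liminf_le) (auto simp: eventually_sequentially)
      finally show ?thesis .
    qed
    then show ?thesis by blast
  qed
  show elim: "(\<lambda>k. energy (\<lambda>s. f k s - h s)) \<longlonglongrightarrow> 0"
  proof (rule ennreal_tendsto_0I)
    fix e :: real assume "e > 0"
    then obtain N where "\<And>k. k \<ge> N \<Longrightarrow> energy (\<lambda>s. f k s - h s) \<le> ennreal (min e (1/2))"
      using close[of "min e (1/2)"] by (auto simp: min_less_iff_disj)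
    moreover have "ennreal (min e (1/2)) \<le> ennreal e" by (intro ennreal_leI) auto
    ultimately show "\<forall>\<^sub>F k in sequentially. energy (\<lambda>s. f k s - h s) \<le> ennreal e"
      unfolding eventually_sequentially by (meson order_trans)
  qed
  from close[of "1/2"] obtain k where k: "energy (\<lambda>s. f k s - h s) \<le> ennreal (1/2)" by auto
  have "zero_ext (\<lambda>s. f k s - h s) \<in> borel_measurable borel"
    using zero_ext_linear[of 1 "f k" "-1" h] zero_ext_measurable[OF f] by simp
  moreover have "energy (\<lambda>s. f k s - h s) < \<infinity>"
    using k by (rule order_le_less_trans) (unfold infinity_ennreal_def, rule ennreal_less_top)
  ultimately have "(\<lambda>s. f k s - h s) \<in> L_space \<alpha> S"
    by (simp add: L_space_iff)
  from L_space_diff[OF f[of k] this] show hL: "h \<in> L_space \<alpha> S" by simp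
  have "tendsto_in_prob M (\<lambda>k. ni (\<lambda>s. f k s - h s)) (\<lambda>_. 0)"
    by (rule symmetric_stable_tendsto_0[OF \<alpha> ni_stable[OF L_space_diff[OF f hL]] finite_ennreal_tendsto_0[OF elim]])
  note [measurable] = ni_measurable[OF hL] ni_measurable[OF L_space_diff[OF f hL]]
  have "tendsto_in_prob M (\<lambda>k \<omega>. ni (f k) \<omega> - ni h \<omega>) (\<lambda>_. 0)"
    by (rule tendsto_in_prob_cong_AE[OF _ _ _ _ ni_diff[OF f hL] _ \<open>tendsto_in_prob M (\<lambda>k. ni (\<lambda>s. f k s - h s)) (\<lambda>_. 0)\<close>]) auto
  then have "tendsto_in_prob M (\<lambda>k. ni (f k)) (ni h)"
    by (simp add: tendsto_in_prob_def)
  from tendsto_in_prob_unique[OF _ _ _ this lim] show "AE \<omega> in M. ni h \<omega> = Z \<omega>"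
    by auto
qed

end

section \<open>Sign changes and the lower bound for path norms\<close>

text \<open>The joint law is a product of symmetric laws, and each factor is unchanged by a change
  of sign.\<close>

lemma (in prob_space) prob_sign_flip:
  fixes X :: "'i \<Rightarrow> 'a \<Rightarrow> real" and \<sigma> :: "'i \<Rightarrow> real"
  assumes ind: "indep_vars (\<lambda>_. borel) X I" and "finite I"
    and sym: "\<And>i. i \<in> I \<Longrightarrow> distr M borel (\<lambda>\<omega>. - X i \<omega>) = distr M borel (X i)"
    and \<sigma>: "\<And>i. i \<in> I \<Longrightarrow> \<sigma> i = 1 \<or> \<sigma> i = -1"
    and A: "A \<in> sets (\<Pi>\<^sub>M i\<in>I. borel)"
  shows "prob {\<omega>\<in>space M. (\<lambda>i\<in>I. \<sigma> i * X i \<omega>) \<in> A} = prob {\<omega>\<in>space M. (\<lambda>i\<in>I. X i \<omega>) \<in> A}"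
proof (cases "I = {}")
  case False
  have m[measurable]: "X i \<in> borel_measurable M" if "i \<in> I" for i
    using ind that by (auto simp: indep_vars_def)
  have ind': "indep_vars (\<lambda>_. borel) (\<lambda>i \<omega>. \<sigma> i * X i \<omega>) I"
    using ind by (rule indep_vars_compose2) auto
  have d: "distr M borel (\<lambda>\<omega>. \<sigma> i * X i \<omega>) = distr M borel (X i)" if "i \<in> I" for i
    using \<sigma>[OF that] sym[OF that] by auto
  have "distr M (\<Pi>\<^sub>M i\<in>I. borel) (\<lambda>\<omega>. \<lambda>i\<in>I. \<sigma> i * X i \<omega>) = (\<Pi>\<^sub>M i\<in>I. distr M borel (\<lambda>\<omega>. \<sigma> i * X i \<omega>))"
    using ind' by (subst (asm) indep_vars_iff_distr_eq_PiM'[OF False]) auto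
  also have "\<dots> = (\<Pi>\<^sub>M i\<in>I. distr M borel (X i))"
    using d by (intro PiM_cong) auto
  also have "\<dots> = distr M (\<Pi>\<^sub>M i\<in>I. borel) (\<lambda>\<omega>. \<lambda>i\<in>I. X i \<omega>)"
    using ind by (subst (asm) indep_vars_iff_distr_eq_PiM'[OF False]) auto
  finally have eq: "distr M (\<Pi>\<^sub>M i\<in>I. borel) (\<lambda>\<omega>. \<lambda>i\<in>I. \<sigma> i * X i \<omega>) = distr M (\<Pi>\<^sub>M i\<in>I. borel) (\<lambda>\<omega>. \<lambda>i\<in>I. X i \<omega>)" .
  have m1: "(\<lambda>\<omega>. \<lambda>i\<in>I. \<sigma> i * X i \<omega>) \<in> measurable M (\<Pi>\<^sub>M i\<in>I. borel)" "(\<lambda>\<omega>. \<lambda>i\<in>I. X i \<omega>) \<in> measurable M (\<Pi>\<^sub>M i\<in>I. borel)"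
    by (auto intro!: measurable_restrict)
  from arg_cong[OF eq, of "\<lambda>\<mu>. measure \<mu> A"] show ?thesis
    using A m1 by (simp add: measure_distr vimage_def Int_def conj_commute)
qed (simp add: restrict_def)

text \<open>A discrete L1 norm. With the nodes of a Riemann sum as J and their weights as w it
  approximates the path norm.\<close>

definition wnorm :: "'j set \<Rightarrow> ('j \<Rightarrow> real) \<Rightarrow> ('j \<Rightarrow> real) \<Rightarrow> real" where
  "wnorm J w x = (\<Sum>j\<in>J. w j * \<bar>x j\<bar>)"

lemma wnorm_nonneg: "(\<And>j. j \<in> J \<Longrightarrow> w j \<ge> 0) \<Longrightarrow> wnorm J w x \<ge> 0"
  unfolding wnorm_def by (intro sum_nonneg) auto

lemma wnorm_add: "(\<And>j. j \<in> J \<Longrightarrow> w j \<ge> 0) \<Longrightarrow> wnorm J w (\<lambda>j. x j + y j) \<le> wnorm J w x + wnorm J w y"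
  unfolding wnorm_def sum.distrib[symmetric]
  by (intro sum_mono) (metis abs_triangle_ineq distrib_left mult_left_mono)

lemma wnorm_scale: "wnorm J w (\<lambda>j. k * x j) = \<bar>k\<bar> * wnorm J w x"
  unfolding wnorm_def sum_distrib_left by (simp add: abs_mult mult_ac)

lemma wnorm_zero: "wnorm J w (\<lambda>j. 0) = 0"
  by (simp add: wnorm_def)

lemma wnorm_ge:
  assumes "finite J" "\<And>j. j \<in> J \<Longrightarrow> w j \<ge> 0" "j \<in> J"
  shows "w j * \<bar>x j\<bar> \<le> wnorm J w x"
  unfolding wnorm_def using assms by (intro member_le_sum) auto

text \<open>A random sum of fixed vectors: the i-th vector has the coordinates \<open>c j i\<close>
  and the random coefficient \<open>X i\<close>, and the space of vectors carries the seminorm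
  \<open>wnorm J w\<close>. Below, \<open>total\<close> is the norm of the sum and
  \<open>coeff_norm i\<close> that of the i-th vector.\<close>

locale independent_symmetric_sum = prob_space M for M :: "'w measure" +
  fixes X :: "nat \<Rightarrow> 'w \<Rightarrow> real" and n :: nat
    and J :: "'j set" and w :: "'j \<Rightarrow> real" and c :: "'j \<Rightarrow> nat \<Rightarrow> real"
  assumes ind: "indep_vars (\<lambda>_. borel) X {..<n}"
    and sym: "\<And>i. i < n \<Longrightarrow> distr M borel (\<lambda>\<omega>. - X i \<omega>) = distr M borel (X i)"
    and J: "finite J" "\<And>j. j \<in> J \<Longrightarrow> w j \<ge> 0"
begin

definition total :: "(nat \<Rightarrow> real) \<Rightarrow> real" where
  "total x = wnorm J w (\<lambda>j. \<Sum>i<n. c j i * x i)"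

definition coeff_norm :: "nat \<Rightarrow> real" where
  "coeff_norm i = wnorm J w (\<lambda>j. c j i)"

lemma X_measurable [measurable]: "i < n \<Longrightarrow> X i \<in> borel_measurable M"
  using ind by (auto simp: indep_vars_def)

lemma coeff_norm_nonneg: "coeff_norm i \<ge> 0"
  unfolding coeff_norm_def using J(2) by (rule wnorm_nonneg)

lemma total_cong: "(\<And>i. i < n \<Longrightarrow> x i = y i) \<Longrightarrow> total x = total y"
  unfolding total_def by simp

lemma total_measurable_PiM [measurable]: "total \<in> borel_measurable (\<Pi>\<^sub>M i\<in>{..<n}. borel)"
  unfolding total_def[abs_def] wnorm_def by measurable

lemma total_X_measurable [measurable]: "(\<lambda>\<omega>. total (\<lambda>i. X i \<omega>)) \<in> borel_measurable M"
  unfolding total_def[abs_def] wnorm_def by measurable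

text \<open>Adding the copy in which all signs but the i-th are changed leaves twice the i-th
  summand.\<close>

lemma total_flip_others:
  assumes i: "i < n"
  shows "2 * (coeff_norm i * \<bar>x i\<bar>) \<le> total x + total (\<lambda>k. (if k = i then 1 else -1) * x k)"
proof -
  have "(\<Sum>k<n. c j k * x k) + (\<Sum>k<n. c j k * ((if k = i then 1 else -1) * x k)) = (2 * x i) * c j i" for j
  proof -
    have "(\<Sum>k<n. c j k * x k) + (\<Sum>k<n. c j k * ((if k = i then 1 else -1) * x k)) = (\<Sum>k<n. if k = i then 2 * (c j i * x i) else 0)"
      unfolding sum.distrib[symmetric] by (intro sum.cong) auto
    then show ?thesis using i by simp
  qed
  then have "wnorm J w (\<lambda>j. (2 * x i) * c j i) \<le> total x + total (\<lambda>k. (if k = i then 1 else -1) * x k)"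
    unfolding total_def using wnorm_add[of J w "\<lambda>j. \<Sum>k<n. c j k * x k" "\<lambda>j. \<Sum>k<n. c j k * ((if k = i then 1 else -1) * x k)", OF J(2)] by simp
  then show ?thesis unfolding wnorm_scale coeff_norm_def by (simp add: mult_ac)
qed

text \<open>Adding the copy in which only the i-th sign is changed doubles the sum of all other
  summands.\<close>

lemma total_flip_one:
  assumes i: "i < n"
  shows "2 * total (x(i := 0)) \<le> total x + total (\<lambda>k. (if k = i then -1 else 1) * x k)"
proof -
  have "(\<Sum>k<n. c j k * x k) + (\<Sum>k<n. c j k * ((if k = i then -1 else 1) * x k)) = 2 * (\<Sum>k<n. c j k * (x(i := 0)) k)" for j
    unfolding sum.distrib[symmetric] sum_distrib_left by (intro sum.cong) auto
  then have "wnorm J w (\<lambda>j. 2 * (\<Sum>k<n. c j k * (x(i := 0)) k)) \<le> total x + total (\<lambda>k. (if k = i then -1 else 1) * x k)"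
    unfolding total_def using wnorm_add[of J w "\<lambda>j. \<Sum>k<n. c j k * x k" "\<lambda>j. \<Sum>k<n. c j k * ((if k = i then -1 else 1) * x k)", OF J(2)] by simp
  then show ?thesis unfolding wnorm_scale total_def by simp
qed

lemma total_split: "i < n \<Longrightarrow> total x \<le> total (x(i := 0)) + coeff_norm i * \<bar>x i\<bar>"
proof -
  assume i: "i < n"
  have "(\<Sum>k<n. c j k * x k) = (\<Sum>k<n. c j k * (x(i := 0)) k) + x i * c j i" for j
  proof -
    have "(\<Sum>k<n. c j k * x k) = (\<Sum>k<n. c j k * (x(i := 0)) k + (if k = i then x i * c j i else 0))"
      by (intro sum.cong) auto
    then show ?thesis using i by (simp add: sum.distrib)
  qed
  then show ?thesis
    using wnorm_add[of J w "\<lambda>j. \<Sum>k<n. c j k * (x(i := 0)) k" "\<lambda>j. x i * c j i", OF J(2)]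
    unfolding total_def coeff_norm_def wnorm_scale by (simp add: mult_ac)
qed

lemma prob_flip:
  assumes \<sigma>: "\<And>i. \<sigma> i = 1 \<or> \<sigma> i = -1" and P: "Measurable.pred (\<Pi>\<^sub>M i\<in>{..<n}. borel) P"
    and cong: "\<And>x y. (\<And>i. i < n \<Longrightarrow> x i = y i) \<Longrightarrow> P x \<longleftrightarrow> P y"
  shows "prob {\<omega>\<in>space M. P (\<lambda>i. \<sigma> i * X i \<omega>)} = prob {\<omega>\<in>space M. P (\<lambda>i. X i \<omega>)}"
proof -
  let ?A = "{x\<in>space (\<Pi>\<^sub>M i\<in>{..<n}. borel). P x}"
  have "{\<omega>\<in>space M. (\<lambda>i\<in>{..<n}. \<sigma> i * X i \<omega>) \<in> ?A} = {\<omega>\<in>space M. P (\<lambda>i. \<sigma> i * X i \<omega>)}" for \<sigma> :: "nat \<Rightarrow> real"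
    using cong[of "\<lambda>i\<in>{..<n}. \<sigma> i * X i _" "\<lambda>i. \<sigma> i * X i _"] by (auto simp: space_PiM)
  from this[of \<sigma>] this[of "\<lambda>_. 1"] show ?thesis
    using prob_sign_flip[of X "{..<n}" \<sigma> ?A] ind sym \<sigma> P by (simp add: pred_def)
qed

text \<open>If the sum without the i-th summand is large, so is the sum or its copy with the i-th
  sign changed, and these two have the same law.\<close>

lemma prob_delete_le:
  assumes "i < n"
  shows "prob {\<omega>\<in>space M. total ((\<lambda>k. X k \<omega>)(i := 0)) \<ge> lam} \<le> 2 * prob {\<omega>\<in>space M. total (\<lambda>k. X k \<omega>) \<ge> lam}"
proof -
  let ?\<sigma> = "\<lambda>k. if k = i then -1 else (1::real)"
  have [measurable]: "(\<lambda>\<omega>. total (\<lambda>k. ?\<sigma> k * X k \<omega>)) \<in> borel_measurable M"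
    unfolding total_def[abs_def] wnorm_def by measurable
  have "prob {\<omega>\<in>space M. total ((\<lambda>k. X k \<omega>)(i := 0)) \<ge> lam} \<le>
    prob ({\<omega>\<in>space M. total (\<lambda>k. X k \<omega>) \<ge> lam} \<union> {\<omega>\<in>space M. total (\<lambda>k. ?\<sigma> k * X k \<omega>) \<ge> lam})"
  proof (intro finite_measure_mono subsetI)
    fix \<omega> assume "\<omega> \<in> {\<omega>\<in>space M. total ((\<lambda>k. X k \<omega>)(i := 0)) \<ge> lam}"
    then show "\<omega> \<in> {\<omega>\<in>space M. total (\<lambda>k. X k \<omega>) \<ge> lam} \<union> {\<omega>\<in>space M. total (\<lambda>k. ?\<sigma> k * X k \<omega>) \<ge> lam}"
      using total_flip_one[OF assms, of "\<lambda>k. X k \<omega>"] by auto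
  qed auto
  also have "\<dots> \<le> prob {\<omega>\<in>space M. total (\<lambda>k. X k \<omega>) \<ge> lam} + prob {\<omega>\<in>space M. total (\<lambda>k. ?\<sigma> k * X k \<omega>) \<ge> lam}"
    by (rule measure_Un_le) auto
  also have "prob {\<omega>\<in>space M. total (\<lambda>k. ?\<sigma> k * X k \<omega>) \<ge> lam} = prob {\<omega>\<in>space M. total (\<lambda>k. X k \<omega>) \<ge> lam}"
    by (rule prob_flip) (auto intro: total_cong cong: total_cong)
  finally show ?thesis by (simp add: fun_upd_def)
qed

text \<open>Levy's inequality: at the first large summand, flip the signs of all the others.\<close>

lemma prob_max_le:
  "prob {\<omega>\<in>space M. \<exists>i<n. coeff_norm i * \<bar>X i \<omega>\<bar> \<ge> lam} \<le> 2 * prob {\<omega>\<in>space M. total (\<lambda>k. X k \<omega>) \<ge> lam}"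
proof -
  \<comment> \<open>Here i is the first index with a large summand. Only absolute values enter, so
    the event survives every change of signs, and the events for different i are disjoint.\<close>
  define F where "F = (\<lambda>i x. coeff_norm i * \<bar>x i\<bar> \<ge> lam \<and> (\<forall>k<i. coeff_norm k * \<bar>x k :: real\<bar> < lam))"
  define E where "E = (\<lambda>i. {\<omega>\<in>space M. F i (\<lambda>k. X k \<omega>)})"
  define T where "T = {\<omega>\<in>space M. total (\<lambda>k. X k \<omega>) \<ge> lam}"
  have [measurable]: "T \<in> events" unfolding T_def by measurable
  have FM: "Measurable.pred M (\<lambda>\<omega>. F i (\<lambda>k. X k \<omega>))" if "i < n" for i
  proof -
    have "Measurable.pred M (\<lambda>\<omega>. \<forall>k\<in>{..<i}. coeff_norm k * \<bar>X k \<omega>\<bar> < lam)"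
      using that by (intro pred_intros_finite) auto
    then show ?thesis using that unfolding F_def Ball_def lessThan_iff by measurable
  qed
  have FP: "Measurable.pred (\<Pi>\<^sub>M i\<in>{..<n}. borel) (F i)" if "i < n" for i
  proof -
    have "Measurable.pred (\<Pi>\<^sub>M i\<in>{..<n}. borel) (\<lambda>x. \<forall>k\<in>{..<i}. coeff_norm k * \<bar>x k\<bar> < lam)"
      using that by (intro pred_intros_finite) auto
    then have q: "Measurable.pred (\<Pi>\<^sub>M i\<in>{..<n}. borel) (\<lambda>x. \<forall>k<i. coeff_norm k * \<bar>x k\<bar> < lam)"
      unfolding Ball_def lessThan_iff .
    have [measurable]: "(\<lambda>x. x i) \<in> borel_measurable (\<Pi>\<^sub>M i\<in>{..<n}. borel)"
      using that by (intro measurable_component_singleton) auto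
    have "Measurable.pred (\<Pi>\<^sub>M i\<in>{..<n}. borel) (\<lambda>x. lam \<le> coeff_norm i * \<bar>x i\<bar>)"
      by measurable
    then show ?thesis unfolding F_def[abs_def] using q by (rule pred_intros_logic)
  qed
  have E[measurable]: "E i \<in> events" if "i < n" for i
    using FM[OF that] unfolding E_def by measurable
  have "(\<exists>i<n. coeff_norm i * \<bar>x i\<bar> \<ge> lam) \<longleftrightarrow> (\<exists>i<n. F i x)" for x :: "nat \<Rightarrow> real"
  proof
    assume "\<exists>i<n. coeff_norm i * \<bar>x i\<bar> \<ge> lam"
    then obtain i where i: "i < n" "coeff_norm i * \<bar>x i\<bar> \<ge> lam" "\<And>k. k < i \<Longrightarrow> \<not> (k < n \<and> coeff_norm k * \<bar>x k\<bar> \<ge> lam)"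
      using exists_least_iff[of "\<lambda>i. i < n \<and> coeff_norm i * \<bar>x i\<bar> \<ge> lam"] by auto
    then have "F i x" unfolding F_def by (auto simp: not_le)
    then show "\<exists>i<n. F i x" using i by auto
  qed (auto simp: F_def)
  then have U: "{\<omega>\<in>space M. \<exists>i<n. coeff_norm i * \<bar>X i \<omega>\<bar> \<ge> lam} = (\<Union>i<n. E i)"
    by (auto simp: E_def)
  have disj: "disjoint_family_on E {..<n}"
    unfolding disjoint_family_on_def E_def F_def by (auto simp: linorder_neq_iff)
  have "prob (E i) \<le> 2 * prob (E i \<inter> T)" if i: "i < n" for i
  proof -
    let ?\<sigma> = "\<lambda>k. if k = i then 1 else (-1::real)"
    have [measurable]: "(\<lambda>\<omega>. total (\<lambda>k. ?\<sigma> k * X k \<omega>)) \<in> borel_measurable M"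
      unfolding total_def[abs_def] wnorm_def by measurable
    have abs_flip: "\<bar>?\<sigma> k * y\<bar> = \<bar>y\<bar>" for k y by simp
    have "prob (E i) \<le> prob ((E i \<inter> T) \<union> {\<omega>\<in>space M. F i (\<lambda>k. ?\<sigma> k * X k \<omega>) \<and> total (\<lambda>k. ?\<sigma> k * X k \<omega>) \<ge> lam})"
    proof (intro finite_measure_mono subsetI)
      fix \<omega> assume \<omega>: "\<omega> \<in> E i"
      then have "coeff_norm i * \<bar>X i \<omega>\<bar> \<ge> lam" by (auto simp: E_def F_def)
      with total_flip_others[OF i, of "\<lambda>k. X k \<omega>"]
      have "total (\<lambda>k. X k \<omega>) \<ge> lam \<or> total (\<lambda>k. ?\<sigma> k * X k \<omega>) \<ge> lam" by linarith
      with \<omega> show "\<omega> \<in> (E i \<inter> T) \<union> {\<omega>\<in>space M. F i (\<lambda>k. ?\<sigma> k * X k \<omega>) \<and> total (\<lambda>k. ?\<sigma> k * X k \<omega>) \<ge> lam}"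
        unfolding E_def T_def F_def abs_flip by auto
    next
      have "Measurable.pred M (\<lambda>\<omega>. F i (\<lambda>k. ?\<sigma> k * X k \<omega>))"
        using FM[OF i] unfolding F_def abs_flip .
      then show "(E i \<inter> T) \<union> {\<omega>\<in>space M. F i (\<lambda>k. ?\<sigma> k * X k \<omega>) \<and> total (\<lambda>k. ?\<sigma> k * X k \<omega>) \<ge> lam} \<in> events"
        using i by measurable
    qed
    also have "\<dots> \<le> prob (E i \<inter> T) + prob {\<omega>\<in>space M. F i (\<lambda>k. ?\<sigma> k * X k \<omega>) \<and> total (\<lambda>k. ?\<sigma> k * X k \<omega>) \<ge> lam}"
    proof (rule measure_Un_le)
      have "Measurable.pred M (\<lambda>\<omega>. F i (\<lambda>k. ?\<sigma> k * X k \<omega>))"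
        using FM[OF i] unfolding F_def abs_flip .
      then show "{\<omega>\<in>space M. F i (\<lambda>k. ?\<sigma> k * X k \<omega>) \<and> total (\<lambda>k. ?\<sigma> k * X k \<omega>) \<ge> lam} \<in> events"
        by measurable
    qed (use i in auto)
    also have "prob {\<omega>\<in>space M. F i (\<lambda>k. ?\<sigma> k * X k \<omega>) \<and> total (\<lambda>k. ?\<sigma> k * X k \<omega>) \<ge> lam} =
       prob {\<omega>\<in>space M. F i (\<lambda>k. X k \<omega>) \<and> total (\<lambda>k. X k \<omega>) \<ge> lam}"
    proof (rule prob_flip[where P = "\<lambda>x. F i x \<and> total x \<ge> lam"])
      show "Measurable.pred (\<Pi>\<^sub>M i\<in>{..<n}. borel) (\<lambda>x. F i x \<and> total x \<ge> lam)"
        using FP[OF i] by measurable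
      show "(F i x \<and> total x \<ge> lam) \<longleftrightarrow> (F i y \<and> total y \<ge> lam)" if "\<And>k. k < n \<Longrightarrow> x k = y k" for x y
        using total_cong[OF that] that i by (auto simp: F_def)
    qed auto
    also have "{\<omega>\<in>space M. F i (\<lambda>k. X k \<omega>) \<and> total (\<lambda>k. X k \<omega>) \<ge> lam} = E i \<inter> T"
      by (auto simp: E_def T_def)
    finally show ?thesis by simp
  qed
  then have "(\<Sum>i<n. prob (E i)) \<le> (\<Sum>i<n. 2 * prob (E i \<inter> T))"
    by (intro sum_mono) auto
  also have "\<dots> = 2 * prob (\<Union>i<n. E i \<inter> T)"
    unfolding sum_distrib_left[symmetric] using disj
    by (subst finite_measure_finite_Union) (auto simp: disjoint_family_on_def)
  also have "\<dots> \<le> 2 * prob T"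
    by (intro mult_left_mono finite_measure_mono) auto
  also have "(\<Sum>i<n. prob (E i)) = prob (\<Union>i<n. E i)"
    using disj by (subst finite_measure_finite_Union) auto
  finally show ?thesis unfolding U T_def .
qed

text \<open>Independence turns the bound 1/4 for the maximum into a bound for the sum of the
  probabilities p i: no summand is large with probability at least 3/4, and this probability is the
  product of the 1 - p i, at most exp of minus the sum.\<close>

lemma sum_prob_le:
  assumes small: "prob {\<omega>\<in>space M. total (\<lambda>k. X k \<omega>) \<ge> lam} \<le> 1 / 8"
  shows "(\<Sum>i<n. prob {\<omega>\<in>space M. coeff_norm i * \<bar>X i \<omega>\<bar> \<ge> lam}) \<le> 1 / 3"
proof (cases "n = 0")
  case False
  define p where "p = (\<lambda>i. prob {\<omega>\<in>space M. coeff_norm i * \<bar>X i \<omega>\<bar> \<ge> lam})"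
  define A where "A = (\<lambda>i. {y::real. coeff_norm i * \<bar>y\<bar> < lam})"
  have [measurable]: "A i \<in> sets borel" for i unfolding A_def by measurable
  have comp: "prob (X i -` A i \<inter> space M) = 1 - p i" if "i < n" for i
  proof -
    have "X i -` A i \<inter> space M = space M - {\<omega>\<in>space M. coeff_norm i * \<bar>X i \<omega>\<bar> \<ge> lam}"
      by (auto simp: A_def)
    then show ?thesis using that unfolding p_def by (simp add: prob_compl)
  qed
  have "3 / 4 \<le> prob (space M - {\<omega>\<in>space M. \<exists>i<n. coeff_norm i * \<bar>X i \<omega>\<bar> \<ge> lam})"
  proof -
    have "{\<omega>\<in>space M. \<exists>i<n. coeff_norm i * \<bar>X i \<omega>\<bar> \<ge> lam} = (\<Union>i<n. {\<omega>\<in>space M. coeff_norm i * \<bar>X i \<omega>\<bar> \<ge> lam})" by auto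
    also have "\<dots> \<in> events" by (intro sets.finite_UN) auto
    finally show ?thesis using prob_max_le[of lam] small by (simp add: prob_compl)
  qed
  also have "space M - {\<omega>\<in>space M. \<exists>i<n. coeff_norm i * \<bar>X i \<omega>\<bar> \<ge> lam} = (\<Inter>i\<in>{..<n}. X i -` A i \<inter> space M)"
    using False by (auto simp: A_def not_le) (meson lessThan_iff linorder_not_less)
  also have "prob \<dots> = (\<Prod>i\<in>{..<n}. prob (X i -` A i \<inter> space M))"
    using False by (intro indep_varsD[OF ind]) auto
  also have "\<dots> = (\<Prod>i<n. 1 - p i)"
    by (intro prod.cong) (auto simp: comp)
  also have "\<dots> \<le> (\<Prod>i<n. exp (- p i))"
    by (intro prod_mono) (use exp_ge_add_one_self[of "- p _"] in \<open>auto simp: p_def\<close>)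
  also have "\<dots> = exp (- (\<Sum>i<n. p i))"
    by (simp add: exp_sum[symmetric] sum_negf)
  finally have "3 / 4 \<le> exp (- (\<Sum>i<n. p i))" .
  then have "exp (\<Sum>i<n. p i) \<le> 4 / 3"
    by (simp add: exp_minus field_simps)
  moreover have "1 + (\<Sum>i<n. p i) \<le> exp (\<Sum>i<n. p i)" by (rule exp_ge_add_one_self)
  ultimately show ?thesis unfolding p_def by linarith
qed simp

end

text \<open>The lower tail bound is applied to each summand. The factor
  \<open>tail_const \<alpha>\<close> in the hypothesis keeps each single probability below
  \<open>tail_const \<alpha>\<close>, so that the minimum in the tail bound is not 1 and the
  parameter of the summand is controlled linearly; the 8 is what \<open>sum_prob_le\<close>
  requires.\<close>

lemma (in independent_symmetric_sum) stable_coeff_bound: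
  assumes \<alpha>: "0 < \<alpha>" "\<alpha> < 2" and X: "\<And>i. i < n \<Longrightarrow> symmetric_stable M \<alpha> (a i) (X i)"
    and small: "prob {\<omega>\<in>space M. total (\<lambda>k. X k \<omega>) \<ge> lam} < tail_const \<alpha> / 8" and "lam > 0"
  shows "(\<Sum>i<n. coeff_norm i powr \<alpha> * a i) \<le> lam powr \<alpha> / tail_const \<alpha>"
proof -
  let ?c = "tail_const \<alpha>"
  have c: "?c > 0" "?c \<le> 1" using tail_const by auto
  define p where "p = (\<lambda>i. prob {\<omega>\<in>space M. coeff_norm i * \<bar>X i \<omega>\<bar> \<ge> lam})"
  define y where "y = (\<lambda>i. coeff_norm i powr \<alpha> * a i * lam powr - \<alpha>)"
  have sp: "(\<Sum>i<n. p i) \<le> 1 / 3"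
    unfolding p_def using small c by (intro sum_prob_le) auto
  have yp: "?c * y i \<le> p i" if i: "i < n" for i
  proof -
    have "?c * min 1 (y i) \<le> prob {\<omega>\<in>space M. \<bar>coeff_norm i * X i \<omega>\<bar> > lam}"
      using stable_tail_lower[OF \<alpha> symmetric_stable_mult[OF X[OF i], of "coeff_norm i"] \<open>lam > 0\<close>] coeff_norm_nonneg[of i]
      by (simp add: y_def)
    also have "\<dots> \<le> p i"
      unfolding p_def using coeff_norm_nonneg[of i] i by (intro finite_measure_mono) (auto simp: abs_mult)
    finally have 1: "?c * min 1 (y i) \<le> p i" .
    have "p i \<le> prob {\<omega>\<in>space M. \<exists>i<n. coeff_norm i * \<bar>X i \<omega>\<bar> \<ge> lam}"
    proof -
      have "{\<omega>\<in>space M. \<exists>i<n. coeff_norm i * \<bar>X i \<omega>\<bar> \<ge> lam} = (\<Union>i<n. {\<omega>\<in>space M. coeff_norm i * \<bar>X i \<omega>\<bar> \<ge> lam})" by auto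
      also have "\<dots> \<in> events" by (intro sets.finite_UN) auto
      finally show ?thesis unfolding p_def using i by (intro finite_measure_mono) auto
    qed
    also have "\<dots> \<le> 2 * prob {\<omega>\<in>space M. total (\<lambda>k. X k \<omega>) \<ge> lam}" by (rule prob_max_le)
    also have "\<dots> < ?c" using small c by simp
    finally have "?c * min 1 (y i) < ?c * 1" using 1 by simp
    then have "y i < 1" using c by (auto simp: min_def split: if_splits)
    with 1 show ?thesis by simp
  qed
  have "?c * (\<Sum>i<n. y i) \<le> (\<Sum>i<n. p i)"
    unfolding sum_distrib_left by (intro sum_mono yp) auto
  then have "(\<Sum>i<n. y i) \<le> 1 / ?c" using sp c by (simp add: field_simps)
  moreover have "(\<Sum>i<n. y i) = (\<Sum>i<n. coeff_norm i powr \<alpha> * a i) * lam powr - \<alpha>"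
    by (simp add: y_def sum_distrib_right)
  ultimately show ?thesis
    using \<open>lam > 0\<close> c by (simp add: powr_minus field_simps)
qed

text \<open>With the i-th coordinate set to 0, the event Q depends on the other variables only, and
  these are independent of \<open>X i\<close>.\<close>

lemma (in independent_symmetric_sum) expectation_split:
  assumes i: "i < n" and \<phi>[measurable]: "\<phi> \<in> borel_measurable borel" and B: "\<And>y. \<bar>\<phi> y\<bar> \<le> B"
    and Q: "Measurable.pred (\<Pi>\<^sub>M i\<in>{..<n}. borel) Q" "\<And>x y. (\<And>k. k < n \<Longrightarrow> x k = y k) \<Longrightarrow> Q x \<longleftrightarrow> Q y"
  shows "expectation (\<lambda>\<omega>. \<phi> (X i \<omega>) * indicator {\<omega>. Q ((\<lambda>k. X k \<omega>)(i := 0))} \<omega>) =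
    expectation (\<lambda>\<omega>. \<phi> (X i \<omega>)) * prob {\<omega>\<in>space M. Q ((\<lambda>k. X k \<omega>)(i := 0))}"
proof -
  let ?B = "{..<n} - {i}"
  let ?ext = "\<lambda>y::nat \<Rightarrow> real. \<lambda>k\<in>{..<n}. if k \<in> ?B then y k else 0"
  have ext: "?ext \<in> measurable (\<Pi>\<^sub>M k\<in>?B. borel) (\<Pi>\<^sub>M k\<in>{..<n}. borel)"
  proof (rule measurable_restrict)
    fix k assume "k \<in> {..<n}"
    show "(\<lambda>y. if k \<in> ?B then y k else 0) \<in> borel_measurable (\<Pi>\<^sub>M k\<in>?B. borel)"
      by (cases "k \<in> ?B") (auto intro!: measurable_component_singleton)
  qed
  have Qe: "Measurable.pred (\<Pi>\<^sub>M k\<in>?B. borel) (\<lambda>y. Q (?ext y))"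
    using measurable_compose[OF ext Q(1)] by simp
  have "indep_var borel (\<phi> \<circ> (\<lambda>y. y i) \<circ> (\<lambda>\<omega>. restrict (\<lambda>k. X k \<omega>) {i}))
     borel ((\<lambda>y. of_bool (Q (?ext y)) :: real) \<circ> (\<lambda>\<omega>. restrict (\<lambda>k. X k \<omega>) ?B))"
  proof (rule indep_var_compose[OF indep_var_restrict[OF ind]])
    show "\<phi> \<circ> (\<lambda>y. y i) \<in> borel_measurable (\<Pi>\<^sub>M i\<in>{i}. borel)"
      by (intro measurable_comp[OF _ \<phi>] measurable_component_singleton) simp
    show "(\<lambda>y. of_bool (Q (?ext y)) :: real) \<in> borel_measurable (\<Pi>\<^sub>M k\<in>?B. borel)"
      using Qe by measurable
  qed (use i in auto)
  moreover have "Q (?ext (restrict (\<lambda>k. X k \<omega>) ?B)) \<longleftrightarrow> Q ((\<lambda>k. X k \<omega>)(i := 0))" for \<omega>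
    by (rule Q(2)) auto
  ultimately have iv: "indep_var borel (\<lambda>\<omega>. \<phi> (X i \<omega>)) borel (\<lambda>\<omega>. of_bool (Q ((\<lambda>k. X k \<omega>)(i := 0))) :: real)"
    by (simp add: o_def)
  have m[measurable]: "(\<lambda>\<omega>. of_bool (Q ((\<lambda>k. X k \<omega>)(i := 0))) :: real) \<in> borel_measurable M"
    using iv by (rule indep_var_rv2)
  have "{\<omega>\<in>space M. Q ((\<lambda>k. X k \<omega>)(i := 0))} = {\<omega>\<in>space M. (of_bool (Q ((\<lambda>k. X k \<omega>)(i := 0))) :: real) = 1}"
    by auto
  also have "\<dots> \<in> events" by measurable
  finally have ev: "{\<omega>\<in>space M. Q ((\<lambda>k. X k \<omega>)(i := 0))} \<in> events" .
  have "expectation (\<lambda>\<omega>. \<phi> (X i \<omega>) * of_bool (Q ((\<lambda>k. X k \<omega>)(i := 0)))) =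
    expectation (\<lambda>\<omega>. \<phi> (X i \<omega>)) * expectation (\<lambda>\<omega>. of_bool (Q ((\<lambda>k. X k \<omega>)(i := 0))))"
    using i B by (intro indep_var_lebesgue_integral[OF iv] integrable_const_bound[where B = B]
       integrable_const_bound[where B = 1]) auto
  also have "expectation (\<lambda>\<omega>. of_bool (Q ((\<lambda>k. X k \<omega>)(i := 0)))) = expectation (indicator {\<omega>\<in>space M. Q ((\<lambda>k. X k \<omega>)(i := 0))})"
    by (intro Bochner_Integration.integral_cong) auto
  also have "\<dots> = prob {\<omega>\<in>space M. Q ((\<lambda>k. X k \<omega>)(i := 0))}"
    using ev by simp
  finally show ?thesis
    by (simp add: indicator_def of_bool_def fun_upd_def)
qed

section \<open>A lower bound with a logarithm at index 1\<close>

definition lnp :: "real \<Rightarrow> real" where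
  "lnp x = max 0 (ln x)"

text \<open>Disjoint events: a single summand \<open>c j\<^sub>0 i * X i\<close> carries the value of the coordinate \<open>j\<^sub>0\<close>, and all the
  others, as well as the total without this summand, are small.\<close>

lemma (in independent_symmetric_sum) stable_log_bound:
  assumes X: "\<And>i. i < n \<Longrightarrow> symmetric_stable M 1 (a i) (X i)"
    and j: "j0 \<in> J" "w j0 > 0"
    and small: "prob {\<omega>\<in>space M. total (\<lambda>k. X k \<omega>) \<ge> lam} < 1 / 16" and "lam > 0"
    and F: "F = (\<Sum>i<n. \<bar>c j0 i\<bar> * a i)"
  shows "tail_const 1 * (\<Sum>i<n. \<bar>c j0 i\<bar> * lnp (lam * \<bar>c j0 i\<bar> / (48 * F * coeff_norm i)) * a i) \<le>
    4 * expectation (\<lambda>\<omega>. \<bar>\<Sum>i<n. c j0 i * X i \<omega>\<bar> * indicator {\<omega>. total (\<lambda>k. X k \<omega>) \<le> 2 * lam} \<omega>) + 6 * F"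
proof (cases "F = 0")
  \<comment> \<open>With F = 0 the quotients are 0 by the convention for division, and
    \<open>lnp\<close> vanishes at 0.\<close>
  case True
  have a: "a i \<ge> 0" if "i < n" for i using X[OF that] by (simp add: symmetric_stable_def)
  have "(\<Sum>i<n. \<bar>c j0 i\<bar> * lnp (lam * \<bar>c j0 i\<bar> / (48 * F * coeff_norm i)) * a i) = 0"
    using True by (simp add: lnp_def)
  moreover have "0 \<le> expectation (\<lambda>\<omega>. \<bar>\<Sum>i<n. c j0 i * X i \<omega>\<bar> * indicator {\<omega>. total (\<lambda>k. X k \<omega>) \<le> 2 * lam} \<omega>)"
    by (intro Bochner_Integration.integral_nonneg) auto
  ultimately show ?thesis using True by simp
next
  case False
  define H where "H = c j0"
  define b where "b = coeff_norm"
  \<comment> \<open>The upper tail bound gives probability at most 6 F / K = 1/8 that some summand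
    of the coordinate reaches K, and at most 12 F / K = 1/4 that the sum of the others reaches K /
    2. Deleting a summand doubles 1/16 to 1/8. The favourable event \<open>R i\<close> is left with
    probability at least 1/2.\<close>
  define K where "K = 48 * F"
  have a: "a i \<ge> 0" if "i < n" for i using X[OF that] by (simp add: symmetric_stable_def)
  have F0: "F > 0"
    using False F a by (smt (verit) lessThan_iff mult_nonneg_nonneg abs_ge_zero sum_nonneg)
  then have K0: "K > 0" by (simp add: K_def)
  have sle: "\<bar>H i\<bar> * a i \<le> F" if "i < n" for i
    unfolding F H_def[symmetric] using that a by (intro member_le_sum) auto
  have st: "symmetric_stable M 1 (\<bar>H i\<bar> * a i) (\<lambda>\<omega>. H i * X i \<omega>)" if "i < n" for i
    using symmetric_stable_mult[OF X[OF that], of "H i"] by simp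
  have bH: "w j0 * \<bar>H i\<bar> \<le> b i" for i
    unfolding b_def coeff_norm_def H_def using wnorm_ge[where J = J and w = w and j = j0 and x = "\<lambda>j. c j i"] J j(1) by simp
  let ?X0 = "\<lambda>\<omega>. \<Sum>i<n. H i * X i \<omega>"
  let ?N = "\<lambda>\<omega>. total (\<lambda>k. X k \<omega>)"
  define V where "V = (\<lambda>i. lam * \<bar>H i\<bar> / b i)"
  define big where "big = (\<lambda>i y. \<bar>H i * y\<bar> * indicator {y. K < \<bar>H i * y\<bar> \<and> b i * \<bar>y\<bar> \<le> lam} y)"
  define Q where "Q = (\<lambda>i x. (\<forall>k\<in>{..<n}. k \<noteq> i \<longrightarrow> \<bar>H k * x k\<bar> \<le> K) \<and> \<bar>\<Sum>k<n. H k * x k\<bar> \<le> K / 2 \<and> total x < lam)"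
  define R where "R = (\<lambda>i. {\<omega>. Q i ((\<lambda>k. X k \<omega>)(i := 0))})"
  have bigM[measurable]: "big i \<in> borel_measurable borel" for i unfolding big_def by measurable
  have QM: "Measurable.pred (\<Pi>\<^sub>M i\<in>{..<n}. borel) (Q i)" for i
  proof -
    have "Measurable.pred (\<Pi>\<^sub>M i\<in>{..<n}. borel) (\<lambda>x. \<forall>k\<in>{..<n}. k \<noteq> i \<longrightarrow> \<bar>H k * x k\<bar> \<le> K)"
      by (intro pred_intros_finite pred_intros_imp') auto
    then show ?thesis unfolding Q_def by measurable
  qed
  have Qcong: "Q i x \<longleftrightarrow> Q i y" if "\<And>k. k < n \<Longrightarrow> x k = y k" for i x y
    using that total_cong[OF that] by (auto simp: Q_def)
  have del: "(\<Sum>k<n. H k * ((\<lambda>k. X k \<omega>)(i := 0)) k) = (\<Sum>k\<in>{..<n} - {i}. H k * X k \<omega>)" if "i < n" for i \<omega>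
    using that by (subst sum.remove[of _ i]) (auto intro!: sum.cong)
  have XdM[measurable]: "(\<lambda>\<omega>. ((\<lambda>k. X k \<omega>)(i := 0)) k) \<in> borel_measurable M" if "k < n" for i k
    using that by (cases "k = i") auto
  have RM: "R i \<inter> space M \<in> events" if "i < n" for i
  proof -
    have 1: "Measurable.pred M (\<lambda>\<omega>. \<forall>k\<in>{..<n}. k \<noteq> i \<longrightarrow> \<bar>H k * ((\<lambda>k. X k \<omega>)(i := 0)) k\<bar> \<le> K)"
      by (intro pred_intros_finite pred_intros_imp') auto
    have 2: "(\<lambda>\<omega>. \<Sum>k<n. H k * ((\<lambda>k. X k \<omega>)(i := 0)) k) \<in> borel_measurable M"
      by (intro borel_measurable_sum borel_measurable_times XdM) auto
    have 3: "(\<lambda>\<omega>. total ((\<lambda>k. X k \<omega>)(i := 0))) \<in> borel_measurable M"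
      unfolding total_def wnorm_def
      by (intro borel_measurable_sum borel_measurable_times borel_measurable_abs XdM borel_measurable_const) auto
    have "Measurable.pred M (\<lambda>\<omega>. Q i ((\<lambda>k. X k \<omega>)(i := 0)))"
      unfolding Q_def
      using 1 borel_measurable_le[OF borel_measurable_abs[OF 2] borel_measurable_const[of "K / 2"]]
        borel_measurable_less[OF 3 borel_measurable_const[of lam]]
      by (intro pred_intros_logic) (simp_all only: pred_def)
    moreover have "R i \<inter> space M = {\<omega>\<in>space M. Q i ((\<lambda>k. X k \<omega>)(i := 0))}" by (auto simp: R_def)
    ultimately show ?thesis by (simp add: pred_def)
  qed
  have PR: "1 / 2 \<le> prob (R i \<inter> space M)" if i: "i < n" for i
  proof -
    let ?E1 = "\<lambda>k. {\<omega>\<in>space M. \<bar>H k * X k \<omega>\<bar> \<ge> K}"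
    let ?E2 = "{\<omega>\<in>space M. \<bar>\<Sum>k\<in>{..<n} - {i}. H k * X k \<omega>\<bar> \<ge> K / 2}"
    let ?E3 = "{\<omega>\<in>space M. total ((\<lambda>k. X k \<omega>)(i := 0)) \<ge> lam}"
    have 3: "(\<lambda>\<omega>. total ((\<lambda>k. X k \<omega>)(i := 0))) \<in> borel_measurable M"
      unfolding total_def wnorm_def
      by (intro borel_measurable_sum borel_measurable_times borel_measurable_abs XdM borel_measurable_const) auto
    have E3: "?E3 \<in> events" using 3 by measurable
    have E2: "?E2 \<in> events" by measurable
    have E1: "(\<Union>k<n. ?E1 k) \<in> events" by (intro sets.finite_UN) auto
    have "space M - R i \<inter> space M \<subseteq> (\<Union>k<n. ?E1 k) \<union> ?E2 \<union> ?E3"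
    proof
      fix \<omega> assume "\<omega> \<in> space M - R i \<inter> space M"
      then have "\<omega> \<in> space M" "\<not> Q i ((\<lambda>k. X k \<omega>)(i := 0))" by (auto simp: R_def)
      then show "\<omega> \<in> (\<Union>k<n. ?E1 k) \<union> ?E2 \<union> ?E3"
        unfolding Q_def del[OF i] by (auto simp: not_le not_less intro: less_imp_le)
    qed
    then have "prob (space M - R i \<inter> space M) \<le> prob ((\<Union>k<n. ?E1 k) \<union> ?E2 \<union> ?E3)"
      using E1 E2 E3 by (intro finite_measure_mono sets.Un)
    also have "\<dots> \<le> (prob (\<Union>k<n. ?E1 k) + prob ?E2) + prob ?E3"
      using E1 E2 E3 by (intro order_trans[OF measure_Un_le] add_right_mono measure_Un_le sets.Un)
    also have "prob (\<Union>k<n. ?E1 k) \<le> (\<Sum>k<n. prob (?E1 k))"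
      by (rule finite_measure_subadditive_finite) auto
    also have "(\<Sum>k<n. prob (?E1 k)) \<le> (\<Sum>k<n. 6 * ((\<bar>H k\<bar> * a k) * K powr - 1))"
      by (intro sum_mono stable_tail_upper[OF _ _ st K0]) auto
    also have "\<dots> = 6 * F * K powr - 1"
      unfolding F H_def by (simp add: sum_distrib_left sum_distrib_right mult_ac)
    also have "\<dots> = 1 / 8" using F0 by (simp add: K_def powr_minus)
    also have "prob ?E2 \<le> 6 * ((\<Sum>k\<in>{..<n} - {i}. \<bar>H k\<bar> * a k) * (K / 2) powr - 1)"
    proof (rule stable_tail_upper)
      show "symmetric_stable M 1 (\<Sum>k\<in>{..<n} - {i}. \<bar>H k\<bar> * a k) (\<lambda>\<omega>. \<Sum>k\<in>{..<n} - {i}. H k * X k \<omega>)"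
      proof (rule symmetric_stable_sum)
        have "indep_vars (\<lambda>_. borel) X ({..<n} - {i})" using ind by (rule indep_vars_subset) auto
        then show "indep_vars (\<lambda>_. borel) (\<lambda>k \<omega>. H k * X k \<omega>) ({..<n} - {i})"
          by (rule indep_vars_compose2) auto
      qed (use st in auto)
    qed (use K0 in auto)
    also have "\<dots> \<le> 6 * (F * (K / 2) powr - 1)"
      unfolding F H_def by (intro mult_left_mono mult_right_mono sum_mono2) (use a in auto)
    also have "\<dots> = 1 / 4" using F0 by (simp add: K_def powr_minus)
    also have "prob ?E3 \<le> 2 * prob {\<omega>\<in>space M. total (\<lambda>k. X k \<omega>) \<ge> lam}"
      by (rule prob_delete_le[OF i])
    also have "\<dots> \<le> 1 / 8" using small by simp
    finally show ?thesis using RM[OF i] by (simp add: prob_compl)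
  qed
  have split: "expectation (\<lambda>\<omega>. big i (X i \<omega>) * indicator (R i) \<omega>) = expectation (\<lambda>\<omega>. big i (X i \<omega>)) * prob (R i \<inter> space M)"
    if i: "i < n" for i
  proof -
    have "\<bar>big i y\<bar> \<le> lam / w j0" for y
    proof (cases "b i * \<bar>y\<bar> \<le> lam")
      case True
      have "w j0 * (\<bar>H i\<bar> * \<bar>y\<bar>) \<le> b i * \<bar>y\<bar>" using mult_right_mono[OF bH[of i], of "\<bar>y\<bar>"] by (simp add: mult_ac)
      then have "\<bar>H i\<bar> * \<bar>y\<bar> \<le> lam / w j0" using True j(2) by (simp add: field_simps)
      then show ?thesis using \<open>lam > 0\<close> j(2) by (auto simp: big_def indicator_def abs_mult)
    qed (use \<open>lam > 0\<close> j(2) in \<open>auto simp: big_def\<close>)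
    from expectation_split[OF i bigM this QM Qcong, of i] show ?thesis
      unfolding R_def by (simp add: Int_def conj_commute)
  qed
  have E: "\<bar>H i\<bar> * a i * (tail_const 1 * lnp (lam * \<bar>H i\<bar> / (K * b i))) \<le> expectation (\<lambda>\<omega>. big i (X i \<omega>)) + 6 * (\<bar>H i\<bar> * a i)"
    if i: "i < n" for i
  proof -
    have e0: "expectation (\<lambda>\<omega>. big i (X i \<omega>)) \<ge> 0"
      by (intro Bochner_Integration.integral_nonneg) (auto simp: big_def)
    have s0: "\<bar>H i\<bar> * a i \<ge> 0" using a[OF i] by simp
    show ?thesis
    proof (cases "H i = 0 \<or> ln (lam * \<bar>H i\<bar> / (K * b i)) \<le> 0")
      case True
      then show ?thesis using e0 s0 by (auto simp: lnp_def)
    next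
      case False
      then have "0 < w j0 * \<bar>H i\<bar>" using j(2) by simp
      also have "\<dots> \<le> b i" by (rule bH)
      finally have b0: "b i > 0" .
      have V0: "V i > 0" using False b0 \<open>lam > 0\<close> by (simp add: V_def)
      have "{y. K < \<bar>H i * y\<bar> \<and> b i * \<bar>y\<bar> \<le> lam} = {y. K < \<bar>H i * y\<bar> \<and> \<bar>H i * y\<bar> \<le> V i}"
        using False b0 by (auto simp: V_def abs_mult field_simps)
      then have beq: "big i y = \<bar>H i * y\<bar> * indicator {y. K < \<bar>H i * y\<bar> \<and> \<bar>H i * y\<bar> \<le> V i} y" for y
        by (simp add: big_def)
      have "\<bar>H i\<bar> * a i * (tail_const 1 * ln (V i / K) - 6) \<le>
        expectation (\<lambda>\<omega>. \<bar>H i * X i \<omega>\<bar> * indicator {\<omega>. K < \<bar>H i * X i \<omega>\<bar> \<and> \<bar>H i * X i \<omega>\<bar> \<le> V i} \<omega>)"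
        using sle[OF i] F0 by (intro stable_truncated_mean st i K0 V0) (simp add: K_def)
      also have "\<dots> = expectation (\<lambda>\<omega>. big i (X i \<omega>))"
        unfolding beq by (intro Bochner_Integration.integral_cong) (auto simp: indicator_def)
      also have "V i / K = lam * \<bar>H i\<bar> / (K * b i)" by (simp add: V_def field_simps)
      also have "ln (lam * \<bar>H i\<bar> / (K * b i)) = lnp (lam * \<bar>H i\<bar> / (K * b i))" using False by (simp add: lnp_def)
      finally show ?thesis by (simp add: algebra_simps)
    qed
  qed
  \<comment> \<open>\<open>R k\<close> bounds every contribution except the k-th by K, so no other
    one can be big.\<close>
  have disj: "big i (X i \<omega>) = 0 \<or> indicator (R k) \<omega> = (0::real) \<or> big k (X k \<omega>) = 0" if "i < n" "i \<noteq> k" for i k \<omega>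
    using that by (auto simp: big_def R_def Q_def indicator_def split: if_splits)
  \<comment> \<open>At most one term of the sum survives. There the other summands contribute at
    most K / 2, less than half of the big one, so the coordinate has at least half its size; and the
    norm of the whole is at most lam for the big summand plus lam for the rest.\<close>
  have pt: "(\<Sum>i<n. big i (X i \<omega>) * indicator (R i) \<omega>) \<le> 2 * (\<bar>?X0 \<omega>\<bar> * indicator {\<omega>. ?N \<omega> \<le> 2 * lam} \<omega>)" for \<omega>
  proof (cases "\<exists>i<n. big i (X i \<omega>) * indicator (R i) \<omega> \<noteq> 0")
    case False
    then have "(\<Sum>i<n. big i (X i \<omega>) * indicator (R i) \<omega>) = 0" by (intro sum.neutral) auto
    then show ?thesis by simp
  next
    case True
    then obtain i where i: "i < n" "big i (X i \<omega>) \<noteq> 0" "\<omega> \<in> R i" by (auto simp: indicator_def split: if_splits)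
    have "(\<Sum>k<n. big k (X k \<omega>) * indicator (R k) \<omega>) = (\<Sum>k<n. if k = i then big i (X i \<omega>) else 0)"
    proof (intro sum.cong refl)
      fix k assume "k \<in> {..<n}"
      then show "big k (X k \<omega>) * indicator (R k) \<omega> = (if k = i then big i (X i \<omega>) else 0)"
        using i disj[of i k \<omega>] by auto
    qed
    also have "\<dots> = big i (X i \<omega>)" using i by simp
    also have "\<dots> = \<bar>H i * X i \<omega>\<bar>" using i by (auto simp: big_def indicator_def)
    finally have eq: "(\<Sum>k<n. big k (X k \<omega>) * indicator (R k) \<omega>) = \<bar>H i * X i \<omega>\<bar>" .
    have l: "K < \<bar>H i * X i \<omega>\<bar>" "b i * \<bar>X i \<omega>\<bar> \<le> lam"
      using i(2) by (auto simp: big_def indicator_def split: if_splits)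
    have r: "\<bar>\<Sum>k\<in>{..<n} - {i}. H k * X k \<omega>\<bar> \<le> K / 2" "total ((\<lambda>k. X k \<omega>)(i := 0)) < lam"
      using i(3) unfolding R_def Q_def mem_Collect_eq del[OF i(1)] by auto
    have "?X0 \<omega> = H i * X i \<omega> + (\<Sum>k\<in>{..<n} - {i}. H k * X k \<omega>)"
      using i(1) by (intro sum.remove) auto
    then have "\<bar>H i * X i \<omega>\<bar> \<le> 2 * \<bar>?X0 \<omega>\<bar>" using l r by linarith
    moreover have "?N \<omega> \<le> 2 * lam"
      using total_split[OF i(1), of "\<lambda>k. X k \<omega>"] l r unfolding b_def by linarith
    ultimately show ?thesis unfolding eq by simp
  qed
  have X0N: "w j0 * \<bar>?X0 \<omega>\<bar> \<le> ?N \<omega>" for \<omega>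
    unfolding total_def H_def using wnorm_ge[where J = J and w = w and j = j0 and x = "\<lambda>j. \<Sum>i<n. c j i * X i \<omega>"] J j(1) by simp
  have iX: "integrable M (\<lambda>\<omega>. \<bar>?X0 \<omega>\<bar> * indicator {\<omega>. ?N \<omega> \<le> 2 * lam} \<omega>)"
  proof (intro integrable_const_bound[where B = "2 * lam / w j0"] AE_I2)
    fix \<omega>
    show "norm (\<bar>?X0 \<omega>\<bar> * indicator {\<omega>. ?N \<omega> \<le> 2 * lam} \<omega>) \<le> 2 * lam / w j0"
      using X0N[of \<omega>] j(2) \<open>lam > 0\<close> by (auto simp: indicator_def field_simps)
  next
    have "(\<lambda>\<omega>. indicator {\<omega>. ?N \<omega> \<le> 2 * lam} \<omega> :: real) \<in> borel_measurable M"
      by (simp add: indicator_def) measurable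
    then show "(\<lambda>\<omega>. \<bar>?X0 \<omega>\<bar> * indicator {\<omega>. ?N \<omega> \<le> 2 * lam} \<omega>) \<in> borel_measurable M"
      by measurable
  qed
  have ib: "integrable M (\<lambda>\<omega>. big i (X i \<omega>) * indicator (R i) \<omega>)" if i: "i < n" for i
  proof (rule Bochner_Integration.integrable_bound[OF integrable_mult_right[OF iX, of 2]])
    have "(\<lambda>\<omega>. big i (X i \<omega>) * indicator (R i \<inter> space M) \<omega>) \<in> borel_measurable M"
      using RM[OF i] i by measurable
    then show "(\<lambda>\<omega>. big i (X i \<omega>) * indicator (R i) \<omega>) \<in> borel_measurable M"
      by (subst measurable_cong[where g = "\<lambda>\<omega>. big i (X i \<omega>) * indicator (R i \<inter> space M) \<omega>"]) (auto simp: indicator_def)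
    show "AE \<omega> in M. norm (big i (X i \<omega>) * indicator (R i) \<omega>) \<le> norm (2 * (\<bar>?X0 \<omega>\<bar> * indicator {\<omega>. ?N \<omega> \<le> 2 * lam} \<omega>))"
    proof (rule AE_I2)
      fix \<omega>
      have nn: "0 \<le> big k (X k \<omega>) * indicator (R k) \<omega>" for k by (auto simp: big_def)
      have "big i (X i \<omega>) * indicator (R i) \<omega> \<le> (\<Sum>i<n. big i (X i \<omega>) * indicator (R i) \<omega>)"
        using i nn by (intro member_le_sum) auto
      with pt[of \<omega>] nn[of i] show "norm (big i (X i \<omega>) * indicator (R i) \<omega>) \<le> norm (2 * (\<bar>?X0 \<omega>\<bar> * indicator {\<omega>. ?N \<omega> \<le> 2 * lam} \<omega>))"
        by (simp add: abs_mult)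
    qed
  qed
  have "(\<Sum>i<n. expectation (\<lambda>\<omega>. big i (X i \<omega>))) \<le> (\<Sum>i<n. 2 * expectation (\<lambda>\<omega>. big i (X i \<omega>) * indicator (R i) \<omega>))"
  proof (intro sum_mono)
    fix i assume "i \<in> {..<n}"
    then have i: "i < n" by simp
    have "expectation (\<lambda>\<omega>. big i (X i \<omega>)) \<ge> 0"
      by (intro Bochner_Integration.integral_nonneg) (auto simp: big_def)
    from mult_left_mono[OF PR[OF i] this] split[OF i]
    show "expectation (\<lambda>\<omega>. big i (X i \<omega>)) \<le> 2 * expectation (\<lambda>\<omega>. big i (X i \<omega>) * indicator (R i) \<omega>)"
      by linarith
  qed
  also have "\<dots> = 2 * expectation (\<lambda>\<omega>. \<Sum>i<n. big i (X i \<omega>) * indicator (R i) \<omega>)"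
    unfolding sum_distrib_left[symmetric] using ib by (subst Bochner_Integration.integral_sum) auto
  also have "\<dots> \<le> 2 * expectation (\<lambda>\<omega>. 2 * (\<bar>?X0 \<omega>\<bar> * indicator {\<omega>. ?N \<omega> \<le> 2 * lam} \<omega>))"
    by (intro mult_left_mono integral_mono pt integrable_mult_right iX Bochner_Integration.integrable_sum ib) auto
  also have "\<dots> = 4 * expectation (\<lambda>\<omega>. \<bar>?X0 \<omega>\<bar> * indicator {\<omega>. ?N \<omega> \<le> 2 * lam} \<omega>)"
    by simp
  finally have S: "(\<Sum>i<n. expectation (\<lambda>\<omega>. big i (X i \<omega>))) \<le> 4 * expectation (\<lambda>\<omega>. \<bar>?X0 \<omega>\<bar> * indicator {\<omega>. ?N \<omega> \<le> 2 * lam} \<omega>)" .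
  have "tail_const 1 * (\<Sum>i<n. \<bar>H i\<bar> * lnp (lam * \<bar>H i\<bar> / (K * b i)) * a i) =
    (\<Sum>i<n. \<bar>H i\<bar> * a i * (tail_const 1 * lnp (lam * \<bar>H i\<bar> / (K * b i))))"
    unfolding sum_distrib_left by (intro sum.cong) (auto simp: mult_ac)
  also have "\<dots> \<le> (\<Sum>i<n. expectation (\<lambda>\<omega>. big i (X i \<omega>)) + 6 * (\<bar>H i\<bar> * a i))"
    by (intro sum_mono E) auto
  also have "\<dots> = (\<Sum>i<n. expectation (\<lambda>\<omega>. big i (X i \<omega>))) + 6 * F"
    unfolding F H_def by (simp add: sum.distrib sum_distrib_left)
  finally show ?thesis using S unfolding H_def K_def b_def by linarith
qed

section \<open>Bounds for limits of weighted sums of noise integrals\<close>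

context prob_space
begin

lemma tendsto_in_prob_abs:
  assumes "tendsto_in_prob M X Z" and [measurable]: "\<And>n. X n \<in> borel_measurable M" "Z \<in> borel_measurable M"
  shows "tendsto_in_prob M (\<lambda>n \<omega>. \<bar>X n \<omega>\<bar>) (\<lambda>\<omega>. \<bar>Z \<omega>\<bar>)"
  unfolding tendsto_in_prob_def
proof (intro allI impI)
  fix e :: real assume "e > 0"
  show "(\<lambda>n. prob {\<omega> \<in> space M. e < \<bar>\<bar>X n \<omega>\<bar> - \<bar>Z \<omega>\<bar>\<bar>}) \<longlonglongrightarrow> 0"
  proof (rule tendsto_sandwich[where f = "\<lambda>_. 0"])
    show "(\<lambda>n. prob {\<omega> \<in> space M. e < \<bar>X n \<omega> - Z \<omega>\<bar>}) \<longlonglongrightarrow> 0"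
      using assms(1) \<open>e > 0\<close> by (simp add: tendsto_in_prob_def)
    show "\<forall>\<^sub>F n in sequentially. prob {\<omega> \<in> space M. e < \<bar>\<bar>X n \<omega>\<bar> - \<bar>Z \<omega>\<bar>\<bar>} \<le> prob {\<omega> \<in> space M. e < \<bar>X n \<omega> - Z \<omega>\<bar>}"
      by (intro always_eventually allI finite_measure_mono) auto
  qed auto
qed

lemma tendsto_in_prob_wnorm:
  assumes "finite J" and lim: "\<And>j. j \<in> J \<Longrightarrow> tendsto_in_prob M (\<lambda>n. X n j) (Z j)"
    and m: "\<And>n j. j \<in> J \<Longrightarrow> X n j \<in> borel_measurable M" "\<And>j. j \<in> J \<Longrightarrow> Z j \<in> borel_measurable M"
  shows "tendsto_in_prob M (\<lambda>n \<omega>. wnorm J w (\<lambda>j. X n j \<omega>)) (\<lambda>\<omega>. wnorm J w (\<lambda>j. Z j \<omega>))"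
  using assms
proof (induction J rule: finite_induct)
  case empty
  then show ?case by (simp add: wnorm_def tendsto_in_prob_def)
next
  case (insert j J)
  have m1[measurable]: "\<And>n. (\<lambda>\<omega>. \<bar>X n j \<omega>\<bar>) \<in> borel_measurable M" "(\<lambda>\<omega>. \<bar>Z j \<omega>\<bar>) \<in> borel_measurable M"
    using insert.prems by auto
  have m2[measurable]: "\<And>n. (\<lambda>\<omega>. wnorm J w (\<lambda>j. X n j \<omega>)) \<in> borel_measurable M" "(\<lambda>\<omega>. wnorm J w (\<lambda>j. Z j \<omega>)) \<in> borel_measurable M"
    unfolding wnorm_def using insert.prems by (auto intro!: borel_measurable_sum borel_measurable_times)
  have "tendsto_in_prob M (\<lambda>n \<omega>. w j * \<bar>X n j \<omega>\<bar> + 1 * wnorm J w (\<lambda>j. X n j \<omega>)) (\<lambda>\<omega>. w j * \<bar>Z j \<omega>\<bar> + 1 * wnorm J w (\<lambda>j. Z j \<omega>))"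
    using insert by (intro tendsto_in_prob_linear tendsto_in_prob_abs m1 m2) auto
  then show ?case using insert.hyps by (simp add: wnorm_def)
qed

text \<open>Convergence in probability need not give convergence of the probability of exceeding a
  fixed level; the gap between x and y absorbs the error.\<close>

lemma eventually_prob_less:
  assumes [measurable]: "\<And>n. N n \<in> borel_measurable M" "N' \<in> borel_measurable M"
    and lim: "tendsto_in_prob M N N'" and d: "prob {\<omega>\<in>space M. N' \<omega> \<ge> x} < d" and "x < y"
  shows "\<forall>\<^sub>F n in sequentially. prob {\<omega>\<in>space M. N n \<omega> \<ge> y} < d"
proof -
  define e where "e = (y - x) / 2"
  have "e > 0" using \<open>x < y\<close> by (simp add: e_def)
  then have "(\<lambda>n. prob {\<omega>\<in>space M. \<bar>N n \<omega> - N' \<omega>\<bar> > e}) \<longlonglongrightarrow> 0"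
    using lim by (simp add: tendsto_in_prob_def)
  then have "\<forall>\<^sub>F n in sequentially. prob {\<omega>\<in>space M. \<bar>N n \<omega> - N' \<omega>\<bar> > e} < d - prob {\<omega>\<in>space M. N' \<omega> \<ge> x}"
    using d by (intro order_tendstoD) auto
  then show ?thesis
  proof eventually_elim
    case (elim n)
    have "prob {\<omega>\<in>space M. N n \<omega> \<ge> y} \<le> prob ({\<omega>\<in>space M. \<bar>N n \<omega> - N' \<omega>\<bar> > e} \<union> {\<omega>\<in>space M. N' \<omega> \<ge> x})"
    proof (intro finite_measure_mono subsetI)
      fix \<omega> assume "\<omega> \<in> {\<omega>\<in>space M. N n \<omega> \<ge> y}"
      then show "\<omega> \<in> {\<omega>\<in>space M. \<bar>N n \<omega> - N' \<omega>\<bar> > e} \<union> {\<omega>\<in>space M. N' \<omega> \<ge> x}"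
        using \<open>x < y\<close> by (cases "N' \<omega> \<ge> x") (auto simp: e_def field_simps)
    qed auto
    also have "\<dots> \<le> prob {\<omega>\<in>space M. \<bar>N n \<omega> - N' \<omega>\<bar> > e} + prob {\<omega>\<in>space M. N' \<omega> \<ge> x}"
      by (rule measure_Un_le) auto
    finally show ?case using elim by linarith
  qed
qed

end

lemma lnp_mono: "x \<le> y \<Longrightarrow> 0 < x \<Longrightarrow> lnp x \<le> lnp y"
  by (auto simp: lnp_def max_def)

lemma lnp_nonneg: "0 \<le> lnp x"
  by (simp add: lnp_def)

lemma tendsto_lnp: "(f \<longlongrightarrow> l) F \<Longrightarrow> 0 < l \<Longrightarrow> ((\<lambda>x. lnp (f x)) \<longlongrightarrow> lnp l) F"
  unfolding lnp_def by (intro tendsto_intros) auto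

lemma lnp_measurable [measurable]: "lnp \<in> borel_measurable borel"
  unfolding lnp_def[abs_def] by measurable

context stable_noise
begin

text \<open>The random variable \<open>N\<close> stands for a path norm \<open>\<integral>\<bar>Z t\<bar> \<mu>(dt)\<close> with \<open>Z t = \<langle>W, D (t - \<cdot>)\<rangle>\<close>, and \<open>G s\<close> for
  \<open>\<integral>\<bar>D (t - s)\<bar> \<mu>(dt)\<close>. In the second bound \<open>X = \<langle>W, h\<rangle>\<close> is one further coordinate of the path.\<close>

definition levy_bound :: "('w \<Rightarrow> real) \<Rightarrow> ('a \<Rightarrow> real) \<Rightarrow> bool" where
  "levy_bound N G \<longleftrightarrow> (\<forall>x>0. prob {\<omega>\<in>space M. N \<omega> \<ge> x} < tail_const \<alpha> / 8 \<longrightarrow>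
     (\<integral>\<^sup>+s\<in>S. ennreal (G s powr \<alpha>) \<partial>lborel) \<le> ennreal (x powr \<alpha> / tail_const \<alpha>))"

definition log_bound :: "('w \<Rightarrow> real) \<Rightarrow> ('a \<Rightarrow> real) \<Rightarrow> ('w \<Rightarrow> real) \<Rightarrow> ('a \<Rightarrow> real) \<Rightarrow> bool" where
  "log_bound X h N G \<longleftrightarrow> (\<forall>x y. 0 < x \<longrightarrow> x < y \<longrightarrow> prob {\<omega>\<in>space M. N \<omega> \<ge> x} < 1 / 16 \<longrightarrow>
     ennreal (tail_const 1) * (\<integral>\<^sup>+s\<in>S. ennreal (\<bar>h s\<bar> * lnp (x * \<bar>h s\<bar> / (48 * enn2real (energy h) * G s))) \<partial>lborel)
      \<le> ennreal (4 * expectation (\<lambda>\<omega>. \<bar>X \<omega>\<bar> * indicator {\<omega>. N \<omega> \<le> 2 * y} \<omega>) + 6 * enn2real (energy h)))"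

lemma restrict_measurable_ennreal:
  assumes G: "zero_ext G \<in> borel_measurable borel" and F[measurable]: "F \<in> borel_measurable borel" and "F 0 = 0"
  shows "(\<lambda>s. ennreal (F (G s)) * indicator S s) \<in> borel_measurable borel"
proof -
  have "(\<lambda>s. ennreal (F (G s)) * indicator S s) = (\<lambda>s. ennreal (F (zero_ext G s)))"
    using \<open>F 0 = 0\<close> by (auto simp: zero_ext_def indicator_def fun_eq_iff)
  then show ?thesis using G by simp
qed

text \<open>Fatou's lemma handles the integral of G. The level for N has first to be raised
  slightly, and is brought back to x by continuity of the right-hand side.\<close>

lemma levy_bound_limit:
  assumes lb: "\<And>m. levy_bound (N m) (G m)"
    and N: "\<And>m. N m \<in> borel_measurable M" "N' \<in> borel_measurable M" "tendsto_in_prob M N N'"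
    and G: "\<And>m. zero_ext (G m) \<in> borel_measurable borel" "\<And>m s. G m s \<ge> 0"
      "AE s in lborel. s \<in> S \<longrightarrow> (\<lambda>m. G m s) \<longlonglongrightarrow> G' s"
  shows "levy_bound N' G'"
  unfolding levy_bound_def
proof (intro allI impI)
  fix x :: real assume "x > 0" and P: "prob {\<omega>\<in>space M. N' \<omega> \<ge> x} < tail_const \<alpha> / 8"
  have *: "(\<integral>\<^sup>+s\<in>S. ennreal (G' s powr \<alpha>) \<partial>lborel) \<le> ennreal (y powr \<alpha> / tail_const \<alpha>)" if "y > x" for y
  proof -
    have "(\<integral>\<^sup>+s\<in>S. ennreal (G' s powr \<alpha>) \<partial>lborel) = (\<integral>\<^sup>+s. liminf (\<lambda>m. ennreal (G m s powr \<alpha>) * indicator S s) \<partial>lborel)"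
    proof (rule nn_integral_cong_AE)
      show "AE s in lborel. ennreal (G' s powr \<alpha>) * indicator S s = liminf (\<lambda>m. ennreal (G m s powr \<alpha>) * indicator S s)"
        using G(3)
      proof eventually_elim
        case (elim s)
        show ?case
        proof (cases "s \<in> S")
          case True
          then have "(\<lambda>m. G m s) \<longlonglongrightarrow> G' s" using elim by simp
          then have "(\<lambda>m. ennreal (G m s powr \<alpha>)) \<longlonglongrightarrow> ennreal (G' s powr \<alpha>)"
            using \<alpha> G(2) by (intro tendsto_ennrealI tendsto_powr' tendsto_const) auto
          from lim_imp_Liminf[OF _ this] show ?thesis using True by simp
        next
          case False
          then show ?thesis by (simp add: Liminf_const)
        qed
      qed
    qed
    also have "\<dots> \<le> liminf (\<lambda>m. \<integral>\<^sup>+s\<in>S. ennreal (G m s powr \<alpha>) \<partial>lborel)"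
      using restrict_measurable_ennreal[OF G(1), of "\<lambda>x. x powr \<alpha>"] by (intro nn_integral_liminf) auto
    also have "\<dots> \<le> ennreal (y powr \<alpha> / tail_const \<alpha>)"
    proof (rule Liminf_le)
      show "\<forall>\<^sub>F m in sequentially. (\<integral>\<^sup>+s\<in>S. ennreal (G m s powr \<alpha>) \<partial>lborel) \<le> ennreal (y powr \<alpha> / tail_const \<alpha>)"
        using eventually_prob_less[OF N P \<open>x < y\<close>]
        by eventually_elim (use lb \<open>x > 0\<close> that in \<open>auto simp: levy_bound_def\<close>)
    qed simp
    finally show ?thesis .
  qed
  have "(\<lambda>n. ennreal ((x + inverse (Suc n)) powr \<alpha> / tail_const \<alpha>)) \<longlonglongrightarrow> ennreal ((x + 0) powr \<alpha> / tail_const \<alpha>)"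
    using \<open>x > 0\<close> tail_const(1)[of \<alpha>]
    by (intro tendsto_ennrealI tendsto_divide tendsto_powr tendsto_add tendsto_const LIMSEQ_inverse_real_of_nat) auto
  then show "(\<integral>\<^sup>+s\<in>S. ennreal (G' s powr \<alpha>) \<partial>lborel) \<le> ennreal (x powr \<alpha> / tail_const \<alpha>)"
    by (intro LIMSEQ_le_const[where X = "\<lambda>n. ennreal ((x + inverse (Suc n)) powr \<alpha> / tail_const \<alpha>)"]) (auto intro!: exI[of _ 0] *)
qed

text \<open>A truncated mean is discontinuous at its cut-off, which is why \<open>log_bound\<close>
  has two levels: a continuous cut-off fits between them. The weight e bounds the coordinate by N /
  e, so the truncated variables are dominated by a constant, and it keeps G' positive where h' is
  not 0, so the quotients converge.\<close>

lemma log_bound_limit: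
  assumes a1: "\<alpha> = 1" and lb: "\<And>m. log_bound (X m) (h m) (N m) (G m)" and e: "e > 0"
    and N: "\<And>m. N m \<in> borel_measurable M" "N' \<in> borel_measurable M" "tendsto_in_prob M N N'"
    and X: "\<And>m. X m \<in> borel_measurable M" "X' \<in> borel_measurable M" "tendsto_in_prob M X X'"
    and XN: "\<And>m \<omega>. \<omega> \<in> space M \<Longrightarrow> e * \<bar>X m \<omega>\<bar> \<le> N m \<omega>" "\<And>\<omega>. \<omega> \<in> space M \<Longrightarrow> e * \<bar>X' \<omega>\<bar> \<le> N' \<omega>"
    and h: "\<And>m. zero_ext (h m) \<in> borel_measurable borel"
      "AE s in lborel. s \<in> S \<longrightarrow> (\<lambda>m. h m s) \<longlonglongrightarrow> h' s" "(\<lambda>m. enn2real (energy (h m))) \<longlonglongrightarrow> enn2real (energy h')"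
    and G: "\<And>m. zero_ext (G m) \<in> borel_measurable borel"
      "AE s in lborel. s \<in> S \<longrightarrow> (\<lambda>m. G m s) \<longlonglongrightarrow> G' s" "\<And>s. s \<in> S \<Longrightarrow> e * \<bar>h' s\<bar> \<le> G' s"
  shows "log_bound X' h' N' G'"
  unfolding log_bound_def
proof (intro allI impI)
  fix x y :: real assume "0 < x" "x < y" and P: "prob {\<omega>\<in>space M. N' \<omega> \<ge> x} < 1 / 16"
  \<comment> \<open>The approximating bounds are used at the levels u and v. The gap from x to u
    absorbs the convergence of N in probability, and the cut-off q falls from 1 at 2 v to 0 at 2
    y.\<close>
  define u where "u = (2 * x + y) / 3"
  define v where "v = (x + 2 * y) / 3"
  have uv: "x < u" "u < v" "v < y" "0 < u" "0 < v" using \<open>0 < x\<close> \<open>x < y\<close> by (auto simp: u_def v_def)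
  define q where "q = (\<lambda>z::real. max 0 (min 1 ((2 * y - z) / (2 * y - 2 * v))))"
  have q: "0 \<le> q z" "q z \<le> 1" "z \<le> 2 * v \<Longrightarrow> q z = 1" "z \<ge> 2 * y \<Longrightarrow> q z = 0" for z
    using uv by (auto simp: q_def field_simps divide_le_0_iff max_def min_def)
  have qcont: "continuous_on UNIV q"
    unfolding q_def using uv by (intro continuous_intros) auto
  have [measurable]: "q \<in> borel_measurable borel" using qcont by (rule borel_measurable_continuous_onI)
  note [measurable] = N(1,2) X(1,2)
  obtain r1 where r1: "strict_mono r1" "AE \<omega> in M. (\<lambda>n. N (r1 n) \<omega>) \<longlonglongrightarrow> N' \<omega>"
    using tendsto_in_prob_subseq[OF N] by blast
  have X_r1: "tendsto_in_prob M (\<lambda>n. X (r1 n)) X'"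
    using X(3) r1(1) LIMSEQ_subseq_LIMSEQ[of _ 0 r1] unfolding tendsto_in_prob_def by (auto simp: o_def)
  obtain r2 where r2: "strict_mono r2" "AE \<omega> in M. (\<lambda>n. X (r1 (r2 n)) \<omega>) \<longlonglongrightarrow> X' \<omega>"
    using tendsto_in_prob_subseq[OF X(1,2) X_r1] by blast
  define r where "r = r1 \<circ> r2"
  have r: "strict_mono r" using r1(1) r2(1) unfolding r_def by (rule strict_mono_o)
  have Nr: "AE \<omega> in M. (\<lambda>n. N (r n) \<omega>) \<longlonglongrightarrow> N' \<omega>"
    using r1(2) by eventually_elim (auto simp: r_def o_def dest: LIMSEQ_subseq_LIMSEQ[OF _ r2(1)])
  have Xr: "AE \<omega> in M. (\<lambda>n. X (r n) \<omega>) \<longlonglongrightarrow> X' \<omega>"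
    using r2(2) by (simp add: r_def)
  have bd: "\<bar>z\<bar> * q n \<le> 2 * y / e" if "e * \<bar>z\<bar> \<le> n" for z n
  proof (cases "n \<ge> 2 * y")
    case True
    then show ?thesis using q(4) e uv by simp
  next
    case False
    then have "\<bar>z\<bar> \<le> 2 * y / e" using that e by (simp add: field_simps)
    moreover have "\<bar>z\<bar> * q n \<le> \<bar>z\<bar> * 1" by (intro mult_left_mono q) auto
    ultimately show ?thesis by simp
  qed
  let ?A = "\<lambda>n. expectation (\<lambda>\<omega>. \<bar>X (r n) \<omega>\<bar> * q (N (r n) \<omega>))"
  let ?A' = "expectation (\<lambda>\<omega>. \<bar>X' \<omega>\<bar> * q (N' \<omega>))"
  have Alim: "?A \<longlonglongrightarrow> ?A'"
  proof (rule integral_dominated_convergence[where w = "\<lambda>_. 2 * y / e"])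
    show "AE \<omega> in M. (\<lambda>n. \<bar>X (r n) \<omega>\<bar> * q (N (r n) \<omega>)) \<longlonglongrightarrow> \<bar>X' \<omega>\<bar> * q (N' \<omega>)"
      using Nr Xr by eventually_elim (auto intro!: tendsto_intros continuous_on_tendsto_compose[OF qcont])
    show "AE \<omega> in M. norm (\<bar>X (r n) \<omega>\<bar> * q (N (r n) \<omega>)) \<le> 2 * y / e" for n
      using bd XN(1) q(1) by (auto simp: abs_mult)
  qed auto
  have A'le: "?A' \<le> expectation (\<lambda>\<omega>. \<bar>X' \<omega>\<bar> * indicator {\<omega>. N' \<omega> \<le> 2 * y} \<omega>)"
  proof (rule integral_mono)
    have "(\<lambda>\<omega>. indicator {\<omega>. N' \<omega> \<le> 2 * y} \<omega> :: real) \<in> borel_measurable M"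
      by (simp add: indicator_def) measurable
    then show "integrable M (\<lambda>\<omega>. \<bar>X' \<omega>\<bar> * indicator {\<omega>. N' \<omega> \<le> 2 * y} \<omega>)"
      using XN(2) e uv by (intro integrable_const_bound[where B = "2 * y / e"])
        (fastforce simp: indicator_def field_simps intro!: AE_I2)+
    show "integrable M (\<lambda>\<omega>. \<bar>X' \<omega>\<bar> * q (N' \<omega>))"
      using bd XN(2) q(1) by (intro integrable_const_bound[where B = "2 * y / e"]) (auto simp: abs_mult)
    show "\<bar>X' \<omega>\<bar> * q (N' \<omega>) \<le> \<bar>X' \<omega>\<bar> * indicator {\<omega>. N' \<omega> \<le> 2 * y} \<omega>" for \<omega>
      using q[of "N' \<omega>"] by (intro mult_left_mono) (auto simp: indicator_def)
  qed
  let ?F = "\<lambda>m. enn2real (energy (h m))" and ?F' = "enn2real (energy h')"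
  let ?I = "\<lambda>m s. ennreal (\<bar>h m s\<bar> * lnp (u * \<bar>h m s\<bar> / (48 * ?F m * G m s))) * indicator S s"
  have meas: "?I m \<in> borel_measurable borel" for m
  proof -
    have "?I m = (\<lambda>s. ennreal (\<bar>zero_ext (h m) s\<bar> * lnp (u * \<bar>zero_ext (h m) s\<bar> / (48 * ?F m * zero_ext (G m) s))))"
      by (auto simp: zero_ext_def indicator_def fun_eq_iff)
    then show ?thesis using h(1)[of m] G(1)[of m] by simp
  qed
  have "(\<integral>\<^sup>+s\<in>S. ennreal (\<bar>h' s\<bar> * lnp (x * \<bar>h' s\<bar> / (48 * ?F' * G' s))) \<partial>lborel) \<le> (\<integral>\<^sup>+s. liminf (\<lambda>n. ?I (r n) s) \<partial>lborel)"
  proof (rule nn_integral_mono_AE)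
    show "AE s in lborel. ennreal (\<bar>h' s\<bar> * lnp (x * \<bar>h' s\<bar> / (48 * ?F' * G' s))) * indicator S s \<le> liminf (\<lambda>n. ?I (r n) s)"
      using h(2) G(2)
    proof eventually_elim
      case (elim s)
      show ?case
      proof (cases "s \<in> S \<and> h' s \<noteq> 0 \<and> ?F' \<noteq> 0")
        case False
        then have "ennreal (\<bar>h' s\<bar> * lnp (x * \<bar>h' s\<bar> / (48 * ?F' * G' s))) * indicator S s = 0"
          by (auto simp: lnp_def indicator_def)
        then show ?thesis by (simp only: zero_le)
      next
        case True
        have hl: "(\<lambda>n. h (r n) s) \<longlonglongrightarrow> h' s" and Gl: "(\<lambda>n. G (r n) s) \<longlonglongrightarrow> G' s"
          using elim True LIMSEQ_subseq_LIMSEQ[OF _ r] by (auto simp: o_def)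
        have Fl: "(\<lambda>n. ?F (r n)) \<longlonglongrightarrow> ?F'" using LIMSEQ_subseq_LIMSEQ[OF h(3) r] by (simp add: o_def)
        have F0: "?F' > 0" using True by (simp add: less_le)
        have G0: "G' s > 0" using G(3)[of s] True e by (smt (verit, best) mult_pos_pos zero_less_abs_iff)
        have "(\<lambda>n. ennreal (\<bar>h (r n) s\<bar> * lnp (u * \<bar>h (r n) s\<bar> / (48 * ?F (r n) * G (r n) s)))) \<longlonglongrightarrow>
          ennreal (\<bar>h' s\<bar> * lnp (u * \<bar>h' s\<bar> / (48 * ?F' * G' s)))"
          using F0 G0 uv True by (intro tendsto_ennrealI tendsto_intros tendsto_lnp hl Fl Gl) auto
        then have "(\<lambda>n. ?I (r n) s) \<longlonglongrightarrow> ennreal (\<bar>h' s\<bar> * lnp (u * \<bar>h' s\<bar> / (48 * ?F' * G' s)))"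
          using True by simp
        then have "liminf (\<lambda>n. ?I (r n) s) = ennreal (\<bar>h' s\<bar> * lnp (u * \<bar>h' s\<bar> / (48 * ?F' * G' s)))"
          by (rule lim_imp_Liminf[rotated]) simp
        moreover have "\<bar>h' s\<bar> * lnp (x * \<bar>h' s\<bar> / (48 * ?F' * G' s)) \<le> \<bar>h' s\<bar> * lnp (u * \<bar>h' s\<bar> / (48 * ?F' * G' s))"
          using F0 G0 uv True \<open>0 < x\<close> by (intro mult_left_mono lnp_mono divide_right_mono mult_right_mono) auto
        ultimately show ?thesis using True by (simp add: ennreal_leI)
      qed
    qed
  qed
  also have "\<dots> \<le> liminf (\<lambda>n. \<integral>\<^sup>+s. ?I (r n) s \<partial>lborel)"
    using meas by (intro nn_integral_liminf) auto
  finally have fatou: "ennreal (tail_const 1) * (\<integral>\<^sup>+s\<in>S. ennreal (\<bar>h' s\<bar> * lnp (x * \<bar>h' s\<bar> / (48 * ?F' * G' s))) \<partial>lborel)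
     \<le> ennreal (tail_const 1) * liminf (\<lambda>n. \<integral>\<^sup>+s. ?I (r n) s \<partial>lborel)"
    by (rule mult_left_mono) simp
  let ?B = "\<lambda>n. ennreal (4 * ?A n + 6 * ?F (r n))"
  have "\<forall>\<^sub>F n in sequentially. prob {\<omega>\<in>space M. N (r n) \<omega> \<ge> u} < 1 / 16"
    using eventually_subseq[OF r eventually_prob_less[OF N P uv(1)]] .
  then have ev: "\<forall>\<^sub>F n in sequentially. ennreal (tail_const 1) * (\<integral>\<^sup>+s. ?I (r n) s \<partial>lborel) \<le> ?B n"
  proof eventually_elim
    case (elim n)
    have "ennreal (tail_const 1) * (\<integral>\<^sup>+s. ?I (r n) s \<partial>lborel) \<le>
       ennreal (4 * expectation (\<lambda>\<omega>. \<bar>X (r n) \<omega>\<bar> * indicator {\<omega>. N (r n) \<omega> \<le> 2 * v} \<omega>) + 6 * ?F (r n))"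
      using lb[of "r n"] elim uv unfolding log_bound_def by blast
    also have "expectation (\<lambda>\<omega>. \<bar>X (r n) \<omega>\<bar> * indicator {\<omega>. N (r n) \<omega> \<le> 2 * v} \<omega>) \<le> ?A n"
    proof (rule integral_mono)
      have "(\<lambda>\<omega>. indicator {\<omega>. N (r n) \<omega> \<le> 2 * v} \<omega> :: real) \<in> borel_measurable M"
        by (simp add: indicator_def) measurable
      then show "integrable M (\<lambda>\<omega>. \<bar>X (r n) \<omega>\<bar> * indicator {\<omega>. N (r n) \<omega> \<le> 2 * v} \<omega>)"
        using XN(1)[of _ "r n"] e uv by (intro integrable_const_bound[where B = "2 * v / e"])
          (fastforce simp: indicator_def field_simps intro!: AE_I2)+
      show "integrable M (\<lambda>\<omega>. \<bar>X (r n) \<omega>\<bar> * q (N (r n) \<omega>))"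
        using bd XN(1) q(1) by (intro integrable_const_bound[where B = "2 * y / e"]) (auto simp: abs_mult)
      show "\<bar>X (r n) \<omega>\<bar> * indicator {\<omega>. N (r n) \<omega> \<le> 2 * v} \<omega> \<le> \<bar>X (r n) \<omega>\<bar> * q (N (r n) \<omega>)" for \<omega>
        using q[of "N (r n) \<omega>"] by (intro mult_left_mono) (auto simp: indicator_def)
    qed
    finally show ?case by (simp add: ennreal_leI)
  qed
  have Blim: "?B \<longlonglongrightarrow> ennreal (4 * ?A' + 6 * ?F')"
    using LIMSEQ_subseq_LIMSEQ[OF h(3) r] unfolding o_def
    by (intro tendsto_ennrealI tendsto_add tendsto_mult tendsto_const Alim)
  have "ennreal (tail_const 1) * liminf (\<lambda>n. \<integral>\<^sup>+s. ?I (r n) s \<partial>lborel) = liminf (\<lambda>n. ennreal (tail_const 1) * (\<integral>\<^sup>+s. ?I (r n) s \<partial>lborel))"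
    by (rule Liminf_compose_continuous_mono[symmetric, of "\<lambda>z. ennreal (tail_const 1) * z"])
      (auto intro!: ennreal_continuous_on_cmult continuous_on_id monoI mult_left_mono)
  also have "\<dots> \<le> liminf ?B"
    using ev by (rule Liminf_mono)
  also have "\<dots> = ennreal (4 * ?A' + 6 * ?F')"
    using Blim by (rule lim_imp_Liminf[rotated]) simp
  also have "\<dots> \<le> ennreal (4 * expectation (\<lambda>\<omega>. \<bar>X' \<omega>\<bar> * indicator {\<omega>. N' \<omega> \<le> 2 * y} \<omega>) + 6 * ?F')"
    using A'le by (intro ennreal_leI) auto
  finally show "ennreal (tail_const 1) * (\<integral>\<^sup>+s\<in>S. ennreal (\<bar>h' s\<bar> * lnp (x * \<bar>h' s\<bar> / (48 * ?F' * G' s))) \<partial>lborel)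
      \<le> ennreal (4 * expectation (\<lambda>\<omega>. \<bar>X' \<omega>\<bar> * indicator {\<omega>. N' \<omega> \<le> 2 * y} \<omega>) + 6 * ?F')"
    using fatou by order
qed

end

section \<open>Both bounds for simple functions\<close>

lemma wnorm_step_fun:
  assumes "disjoint_family_on B {..<n}"
  shows "wnorm J w (\<lambda>j. step_fun n B (c j) s) = step_fun n B (\<lambda>i. wnorm J w (\<lambda>j. c j i)) s"
  using step_fun_map[OF assms, of "wnorm J w" c s] by (simp add: wnorm_zero)

context stable_noise
begin

lemma independent_symmetric_sum_W:
  assumes B: "\<And>i. i < n \<Longrightarrow> B i \<in> finite_borel_subsets S" "disjoint_family_on B {..<n}"
    and J: "finite J" "\<And>j. j \<in> J \<Longrightarrow> w j \<ge> 0"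
  shows "independent_symmetric_sum M (\<lambda>i. W (B i)) n J w"
proof
  show "indep_vars (\<lambda>_. borel) (\<lambda>i. W (B i)) {..<n}" by (rule W_indep[OF B])
  show "distr M borel (\<lambda>\<omega>. - W (B i) \<omega>) = distr M borel (W (B i))" if "i < n" for i
    by (rule symmetric_stable_uminus[OF W_stable[OF B(1)[OF that]]])
qed (use J in auto)

lemma wnorm_measurable:
  "(\<And>j. j \<in> J \<Longrightarrow> X j \<in> borel_measurable M') \<Longrightarrow> (\<lambda>\<omega>. wnorm J w (\<lambda>j. X j \<omega>)) \<in> borel_measurable M'"
  unfolding wnorm_def by (intro borel_measurable_sum borel_measurable_times borel_measurable_abs borel_measurable_const)

text \<open>Over a common partition all the simple integrals are linear combinations of the same
  independent values of the noise, and the sum bounded by \<open>stable_coeff_bound\<close> is the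
  integral over S of a step function.\<close>

lemma levy_bound_simple:
  assumes J: "finite J" "\<And>j. j \<in> J \<Longrightarrow> w j \<ge> 0" and g: "\<And>j. j \<in> J \<Longrightarrow> snd ` set (g j) \<subseteq> finite_borel_subsets S"
  shows "levy_bound (\<lambda>\<omega>. wnorm J w (\<lambda>j. simple_integral W (g j) \<omega>)) (\<lambda>s. wnorm J w (\<lambda>j. simple_fun (g j) s))"
  unfolding levy_bound_def
proof (intro allI impI)
  fix x :: real assume "x > 0"
    and P: "prob {\<omega>\<in>space M. wnorm J w (\<lambda>j. simple_integral W (g j) \<omega>) \<ge> x} < tail_const \<alpha> / 8"
  obtain n B c where B: "\<And>i. i < n \<Longrightarrow> B i \<in> finite_borel_subsets S" "disjoint_family_on B {..<n}"
    and c: "\<And>j s. j \<in> J \<Longrightarrow> simple_fun (g j) s = step_fun n B (c j) s"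
    "\<And>j. j \<in> J \<Longrightarrow> AE \<omega> in M. simple_integral W (g j) \<omega> = (\<Sum>i<n. c j i * W (B i) \<omega>)"
    using common_step_representation[of J g] J(1) g by blast
  interpret I: independent_symmetric_sum M "\<lambda>i. W (B i)" n J w c
    by (rule independent_symmetric_sum_W[OF B J])
  have "AE \<omega> in M. \<forall>j\<in>J. simple_integral W (g j) \<omega> = (\<Sum>i<n. c j i * W (B i) \<omega>)"
    using J(1) c(2) by (intro AE_finite_allI) auto
  then have eq: "AE \<omega> in M. wnorm J w (\<lambda>j. simple_integral W (g j) \<omega>) = I.total (\<lambda>i. W (B i) \<omega>)"
    by eventually_elim (simp add: I.total_def wnorm_def)
  have [measurable]: "(\<lambda>\<omega>. wnorm J w (\<lambda>j. simple_integral W (g j) \<omega>)) \<in> borel_measurable M"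
    using g by (intro wnorm_measurable simple_integral_measurable)
  have "prob {\<omega>\<in>space M. I.total (\<lambda>i. W (B i) \<omega>) \<ge> x} = prob {\<omega>\<in>space M. wnorm J w (\<lambda>j. simple_integral W (g j) \<omega>) \<ge> x}"
    using eq by (intro finite_measure_eq_AE) auto
  with P have *: "(\<Sum>i<n. I.coeff_norm i powr \<alpha> * measure lborel (B i)) \<le> x powr \<alpha> / tail_const \<alpha>"
    using \<open>x > 0\<close> by (intro I.stable_coeff_bound \<alpha> W_stable B) auto
  have "wnorm J w (\<lambda>j. simple_fun (g j) s) = step_fun n B I.coeff_norm s" for s
    using wnorm_step_fun[OF B(2), of J w c s] c(1) by (simp add: wnorm_def I.coeff_norm_def[abs_def])
  moreover have "step_fun n B I.coeff_norm s powr \<alpha> = step_fun n B (\<lambda>i. I.coeff_norm i powr \<alpha>) s" for s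
    using step_fun_map[OF B(2), of "\<lambda>f. f () powr \<alpha>" "\<lambda>_. I.coeff_norm" s] \<alpha> by simp
  ultimately have "(\<integral>\<^sup>+s\<in>S. ennreal (wnorm J w (\<lambda>j. simple_fun (g j) s) powr \<alpha>) \<partial>lborel) =
      ennreal (\<Sum>i<n. I.coeff_norm i powr \<alpha> * measure lborel (B i))"
    using nn_integral_step_fun[of n B "\<lambda>i. I.coeff_norm i powr \<alpha>", OF B(1)] by simp
  then show "(\<integral>\<^sup>+s\<in>S. ennreal (wnorm J w (\<lambda>j. simple_fun (g j) s) powr \<alpha>) \<partial>lborel) \<le> ennreal (x powr \<alpha> / tail_const \<alpha>)"
    using * by (simp add: ennreal_leI)
qed

lemma log_bound_simple:
  assumes a1: "\<alpha> = 1" and J: "finite J" "\<And>j. j \<in> J \<Longrightarrow> w j \<ge> 0" and j0: "j0 \<in> J" "w j0 > 0"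
    and g: "\<And>j. j \<in> J \<Longrightarrow> snd ` set (g j) \<subseteq> finite_borel_subsets S"
  shows "log_bound (simple_integral W (g j0)) (simple_fun (g j0))
    (\<lambda>\<omega>. wnorm J w (\<lambda>j. simple_integral W (g j) \<omega>)) (\<lambda>s. wnorm J w (\<lambda>j. simple_fun (g j) s))"
  unfolding log_bound_def
proof (intro allI impI)
  fix x y :: real assume "0 < x" "x < y"
    and P: "prob {\<omega>\<in>space M. wnorm J w (\<lambda>j. simple_integral W (g j) \<omega>) \<ge> x} < 1 / 16"
  obtain n B c where B: "\<And>i. i < n \<Longrightarrow> B i \<in> finite_borel_subsets S" "disjoint_family_on B {..<n}"
    and c: "\<And>j s. j \<in> J \<Longrightarrow> simple_fun (g j) s = step_fun n B (c j) s"
    "\<And>j. j \<in> J \<Longrightarrow> AE \<omega> in M. simple_integral W (g j) \<omega> = (\<Sum>i<n. c j i * W (B i) \<omega>)"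
    using common_step_representation[of J g] J(1) g by blast
  interpret I: independent_symmetric_sum M "\<lambda>i. W (B i)" n J w c
    by (rule independent_symmetric_sum_W[OF B J])
  have aej: "AE \<omega> in M. \<forall>j\<in>J. simple_integral W (g j) \<omega> = (\<Sum>i<n. c j i * W (B i) \<omega>)"
    using J(1) c(2) by (intro AE_finite_allI) auto
  then have eq: "AE \<omega> in M. wnorm J w (\<lambda>j. simple_integral W (g j) \<omega>) = I.total (\<lambda>i. W (B i) \<omega>)"
    by eventually_elim (simp add: I.total_def wnorm_def)
  have N[measurable]: "(\<lambda>\<omega>. wnorm J w (\<lambda>j. simple_integral W (g j) \<omega>)) \<in> borel_measurable M"
    using g by (intro wnorm_measurable simple_integral_measurable)
  have X[measurable]: "simple_integral W (g j0) \<in> borel_measurable M" using g j0 by (intro simple_integral_measurable)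
  have "prob {\<omega>\<in>space M. I.total (\<lambda>i. W (B i) \<omega>) \<ge> x} = prob {\<omega>\<in>space M. wnorm J w (\<lambda>j. simple_integral W (g j) \<omega>) \<ge> x}"
    using eq by (intro finite_measure_eq_AE) auto
  with P have P': "prob {\<omega>\<in>space M. I.total (\<lambda>i. W (B i) \<omega>) \<ge> x} < 1 / 16" by simp
  define F where "F = (\<Sum>i<n. \<bar>c j0 i\<bar> * measure lborel (B i))"
  have "energy (simple_fun (g j0)) = (\<integral>\<^sup>+s\<in>S. ennreal (\<bar>step_fun n B (c j0) s\<bar> powr \<alpha>) \<partial>lborel)"
    unfolding energy_def c(1)[OF j0(1)] ..
  also have "\<dots> = (\<integral>\<^sup>+s\<in>S. ennreal (step_fun n B (\<lambda>i. \<bar>c j0 i\<bar>) s) \<partial>lborel)"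
  proof -
    have "step_fun n B (\<lambda>i. \<bar>c j0 i\<bar>) s = \<bar>step_fun n B (c j0) s\<bar>" for s
      using step_fun_map[OF B(2), of "\<lambda>f. \<bar>f ()\<bar>" "\<lambda>_. c j0"] by simp
    then show ?thesis unfolding a1 by simp
  qed
  also have "\<dots> = ennreal F"
    unfolding F_def by (rule nn_integral_step_fun[OF B(1)]) auto
  finally have "energy (simple_fun (g j0)) = ennreal F" .
  then have F: "enn2real (energy (simple_fun (g j0))) = F"
    by (simp add: F_def sum_nonneg)
  have wn: "wnorm J w (\<lambda>j. simple_fun (g j) s) = step_fun n B I.coeff_norm s" for s
    using wnorm_step_fun[OF B(2), of J w c s] c(1) by (simp add: wnorm_def I.coeff_norm_def[abs_def])
  define b where "b = (\<lambda>i. \<bar>c j0 i\<bar> * lnp (x * \<bar>c j0 i\<bar> / (48 * F * I.coeff_norm i)))"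
  \<comment> \<open>A family indexed by the booleans lets \<open>step_fun_map\<close> act on two
    step functions at once: the kernel of the distinguished coordinate and the norm of all
    kernels.\<close>
  have "\<bar>simple_fun (g j0) s\<bar> * lnp (x * \<bar>simple_fun (g j0) s\<bar> / (48 * F * wnorm J w (\<lambda>j. simple_fun (g j) s))) = step_fun n B b s" for s
    unfolding wn c(1)[OF j0(1)] b_def
    using step_fun_map[OF B(2), of "\<lambda>f. \<bar>f True\<bar> * lnp (x * \<bar>f True\<bar> / (48 * F * f False))" "\<lambda>k. if k then c j0 else I.coeff_norm" s]
    by simp
  then have lhs: "(\<integral>\<^sup>+s\<in>S. ennreal (\<bar>simple_fun (g j0) s\<bar> * lnp (x * \<bar>simple_fun (g j0) s\<bar> / (48 * F * wnorm J w (\<lambda>j. simple_fun (g j) s)))) \<partial>lborel) =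
      ennreal (\<Sum>i<n. b i * measure lborel (B i))"
    using nn_integral_step_fun[of n B b, OF B(1)] by (simp add: b_def lnp_nonneg)
  have "tail_const 1 * (\<Sum>i<n. b i * measure lborel (B i)) \<le>
     4 * expectation (\<lambda>\<omega>. \<bar>\<Sum>i<n. c j0 i * W (B i) \<omega>\<bar> * indicator {\<omega>. I.total (\<lambda>k. W (B k) \<omega>) \<le> 2 * x} \<omega>) + 6 * F"
    unfolding b_def using \<open>0 < x\<close> P' a1 B W_stable j0
    by (intro I.stable_log_bound) (auto simp: F_def)
  also have "expectation (\<lambda>\<omega>. \<bar>\<Sum>i<n. c j0 i * W (B i) \<omega>\<bar> * indicator {\<omega>. I.total (\<lambda>k. W (B k) \<omega>) \<le> 2 * x} \<omega>) \<le>
     expectation (\<lambda>\<omega>. \<bar>simple_integral W (g j0) \<omega>\<bar> * indicator {\<omega>. wnorm J w (\<lambda>j. simple_integral W (g j) \<omega>) \<le> 2 * y} \<omega>)"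
  proof -
    have XN: "w j0 * \<bar>simple_integral W (g j0) \<omega>\<bar> \<le> wnorm J w (\<lambda>j. simple_integral W (g j) \<omega>)" for \<omega>
      using wnorm_ge[where J = J and w = w and j = j0 and x = "\<lambda>j. simple_integral W (g j) \<omega>"] J j0(1) by simp
    have i: "integrable M (\<lambda>\<omega>. \<bar>simple_integral W (g j0) \<omega>\<bar> * indicator {\<omega>. wnorm J w (\<lambda>j. simple_integral W (g j) \<omega>) \<le> 2 * z} \<omega>)" if "z > 0" for z
    proof (intro integrable_const_bound[where B = "2 * z / w j0"] AE_I2)
      fix \<omega>
      show "norm (\<bar>simple_integral W (g j0) \<omega>\<bar> * indicator {\<omega>. wnorm J w (\<lambda>j. simple_integral W (g j) \<omega>) \<le> 2 * z} \<omega>) \<le> 2 * z / w j0"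
        using XN[of \<omega>] j0(2) that by (auto simp: indicator_def field_simps)
    next
      have "(\<lambda>\<omega>. indicator {\<omega>. wnorm J w (\<lambda>j. simple_integral W (g j) \<omega>) \<le> 2 * z} \<omega> :: real) \<in> borel_measurable M"
        using N by (simp add: indicator_def) measurable
      then show "(\<lambda>\<omega>. \<bar>simple_integral W (g j0) \<omega>\<bar> * indicator {\<omega>. wnorm J w (\<lambda>j. simple_integral W (g j) \<omega>) \<le> 2 * z} \<omega>) \<in> borel_measurable M"
        using X by measurable
    qed
    have "expectation (\<lambda>\<omega>. \<bar>\<Sum>i<n. c j0 i * W (B i) \<omega>\<bar> * indicator {\<omega>. I.total (\<lambda>k. W (B k) \<omega>) \<le> 2 * x} \<omega>) =
      expectation (\<lambda>\<omega>. \<bar>simple_integral W (g j0) \<omega>\<bar> * indicator {\<omega>. wnorm J w (\<lambda>j. simple_integral W (g j) \<omega>) \<le> 2 * x} \<omega>)"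
    proof (rule integral_cong_AE)
      have "(\<lambda>\<omega>. indicator {\<omega>. I.total (\<lambda>k. W (B k) \<omega>) \<le> 2 * x} \<omega> :: real) \<in> borel_measurable M"
        using I.total_X_measurable by (simp add: indicator_def) measurable
      then show "(\<lambda>\<omega>. \<bar>\<Sum>i<n. c j0 i * W (B i) \<omega>\<bar> * indicator {\<omega>. I.total (\<lambda>k. W (B k) \<omega>) \<le> 2 * x} \<omega>) \<in> borel_measurable M"
        using I.X_measurable by (intro borel_measurable_times borel_measurable_abs borel_measurable_sum borel_measurable_const) auto
      show "AE \<omega> in M. \<bar>\<Sum>i<n. c j0 i * W (B i) \<omega>\<bar> * indicator {\<omega>. I.total (\<lambda>k. W (B k) \<omega>) \<le> 2 * x} \<omega> =
        \<bar>simple_integral W (g j0) \<omega>\<bar> * indicator {\<omega>. wnorm J w (\<lambda>j. simple_integral W (g j) \<omega>) \<le> 2 * x} \<omega>"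
        using aej eq by eventually_elim (use j0 in \<open>simp add: indicator_def\<close>)
    qed (use i[OF \<open>0 < x\<close>] in \<open>auto dest: borel_measurable_integrable\<close>)
    also have "\<dots> \<le> expectation (\<lambda>\<omega>. \<bar>simple_integral W (g j0) \<omega>\<bar> * indicator {\<omega>. wnorm J w (\<lambda>j. simple_integral W (g j) \<omega>) \<le> 2 * y} \<omega>)"
      using \<open>0 < x\<close> \<open>x < y\<close> by (intro integral_mono i mult_left_mono) (auto simp: indicator_def)
    finally show ?thesis .
  qed
  finally have "tail_const 1 * (\<Sum>i<n. b i * measure lborel (B i)) \<le>
     4 * expectation (\<lambda>\<omega>. \<bar>simple_integral W (g j0) \<omega>\<bar> * indicator {\<omega>. wnorm J w (\<lambda>j. simple_integral W (g j) \<omega>) \<le> 2 * y} \<omega>) + 6 * F"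
    by simp
  then show "ennreal (tail_const 1) * (\<integral>\<^sup>+s\<in>S. ennreal (\<bar>simple_fun (g j0) s\<bar> * lnp (x * \<bar>simple_fun (g j0) s\<bar> /
        (48 * enn2real (energy (simple_fun (g j0))) * wnorm J w (\<lambda>j. simple_fun (g j) s)))) \<partial>lborel)
    \<le> ennreal (4 * expectation (\<lambda>\<omega>. \<bar>simple_integral W (g j0) \<omega>\<bar> * indicator {\<omega>. wnorm J w (\<lambda>j. simple_integral W (g j) \<omega>) \<le> 2 * y} \<omega>) + 6 * enn2real (energy (simple_fun (g j0))))"
    unfolding F lhs using tail_const(1)[of 1] by (simp add: ennreal_mult'[symmetric] ennreal_leI)
qed

section \<open>From simple functions to general integrands and continuous fields\<close>

lemma zero_ext_wnorm_measurable:
  assumes "\<And>j. j \<in> J \<Longrightarrow> zero_ext (f j) \<in> borel_measurable borel"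
  shows "zero_ext (\<lambda>s. wnorm J w (\<lambda>j. f j s)) \<in> borel_measurable borel"
proof -
  have "zero_ext (\<lambda>s. wnorm J w (\<lambda>j. f j s)) = (\<lambda>s. wnorm J w (\<lambda>j. zero_ext (f j) s))"
    by (auto simp: zero_ext_def wnorm_def indicator_def fun_eq_iff)
  then show ?thesis using wnorm_measurable[OF assms] by simp
qed

lemma wnorm_tendsto:
  "(\<And>j. j \<in> J \<Longrightarrow> (\<lambda>m. f m j) \<longlonglongrightarrow> f' j) \<Longrightarrow> (\<lambda>m. wnorm J w (f m)) \<longlonglongrightarrow> wnorm J w f'"
  unfolding wnorm_def by (intro tendsto_intros)

text \<open>Bundled into one predicate so that a single application of choice provides, for each
  index, one sequence with all the required convergences.\<close>

definition approximated_by :: "('a \<Rightarrow> real) \<Rightarrow> (nat \<Rightarrow> (real \<times> 'a set) list) \<Rightarrow> bool" where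
  "approximated_by f g \<longleftrightarrow> (\<forall>m. snd ` set (g m) \<subseteq> finite_borel_subsets S) \<and> (\<forall>s\<in>S. (\<lambda>m. simple_fun (g m) s) \<longlonglongrightarrow> f s) \<and>
     (\<lambda>m. energy (simple_fun (g m))) \<longlonglongrightarrow> energy f \<and> tendsto_in_prob M (\<lambda>m. simple_integral W (g m)) (ni f)"

lemma approximated_byD:
  assumes "approximated_by f g"
  shows "snd ` set (g m) \<subseteq> finite_borel_subsets S" "s \<in> S \<Longrightarrow> (\<lambda>m. simple_fun (g m) s) \<longlonglongrightarrow> f s"
    "(\<lambda>m. energy (simple_fun (g m))) \<longlonglongrightarrow> energy f" "tendsto_in_prob M (\<lambda>m. simple_integral W (g m)) (ni f)"
  using assms by (auto simp: approximated_by_def)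

lemma approximated_by_exists: "f \<in> L_space \<alpha> S \<Longrightarrow> \<exists>g. approximated_by f g"
  unfolding approximated_by_def by (erule ni_simple_approximation) blast

lemma levy_bound_ni:
  assumes J: "finite J" "\<And>j. j \<in> J \<Longrightarrow> w j \<ge> 0" and f: "\<And>j. j \<in> J \<Longrightarrow> f j \<in> L_space \<alpha> S"
  shows "levy_bound (\<lambda>\<omega>. wnorm J w (\<lambda>j. ni (f j) \<omega>)) (\<lambda>s. wnorm J w (\<lambda>j. f j s))"
proof -
  have "\<forall>j\<in>J. \<exists>g. approximated_by (f j) g"
    by (intro ballI approximated_by_exists f)
  from bchoice[OF this] obtain g where "\<forall>j\<in>J. approximated_by (f j) (g j)" ..
  then have ap: "approximated_by (f j) (g j)" if "j \<in> J" for j using that by blast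
  note g = approximated_byD[OF ap]
  show ?thesis
  proof (rule levy_bound_limit)
    show "levy_bound (\<lambda>\<omega>. wnorm J w (\<lambda>j. simple_integral W (g j m) \<omega>)) (\<lambda>s. wnorm J w (\<lambda>j. simple_fun (g j m) s))" for m
      by (intro levy_bound_simple J g(1))
    show "tendsto_in_prob M (\<lambda>m \<omega>. wnorm J w (\<lambda>j. simple_integral W (g j m) \<omega>)) (\<lambda>\<omega>. wnorm J w (\<lambda>j. ni (f j) \<omega>))"
      by (intro tendsto_in_prob_wnorm J(1) g(4) simple_integral_measurable ni_measurable f g(1))
    show "AE s in lborel. s \<in> S \<longrightarrow> (\<lambda>m. wnorm J w (\<lambda>j. simple_fun (g j m) s)) \<longlonglongrightarrow> wnorm J w (\<lambda>j. f j s)"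
      using g(2) by (intro AE_I2 impI wnorm_tendsto)
  qed (use J f in \<open>auto intro!: wnorm_measurable simple_integral_measurable[OF g(1)] ni_measurable wnorm_nonneg
      zero_ext_wnorm_measurable simple_fun_zero_ext_measurable[OF g(1)]\<close>)
qed

lemma log_bound_ni:
  assumes a1: "\<alpha> = 1" and J: "finite J" "\<And>j. j \<in> J \<Longrightarrow> w j \<ge> 0" and j0: "j0 \<in> J" "w j0 > 0"
    and f: "\<And>j. j \<in> J \<Longrightarrow> f j \<in> L_space \<alpha> S"
  shows "log_bound (ni (f j0)) (f j0) (\<lambda>\<omega>. wnorm J w (\<lambda>j. ni (f j) \<omega>)) (\<lambda>s. wnorm J w (\<lambda>j. f j s))"
proof -
  have "\<forall>j\<in>J. \<exists>g. approximated_by (f j) g"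
    by (intro ballI approximated_by_exists f)
  from bchoice[OF this] obtain g where "\<forall>j\<in>J. approximated_by (f j) (g j)" ..
  then have ap: "approximated_by (f j) (g j)" if "j \<in> J" for j using that by blast
  note g = approximated_byD[OF ap]
  have ge: "w j0 * \<bar>x j0\<bar> \<le> wnorm J w x" for x
    using wnorm_ge[where J = J and w = w and j = j0 and x = x] J j0(1) by simp
  show ?thesis
  proof (rule log_bound_limit[OF a1 _ j0(2)])
    show "log_bound (simple_integral W (g j0 m)) (simple_fun (g j0 m))
      (\<lambda>\<omega>. wnorm J w (\<lambda>j. simple_integral W (g j m) \<omega>)) (\<lambda>s. wnorm J w (\<lambda>j. simple_fun (g j m) s))" for m
      using log_bound_simple[of J w j0 "\<lambda>j. g j m"] a1 J j0 g(1) by simp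
    show "tendsto_in_prob M (\<lambda>m \<omega>. wnorm J w (\<lambda>j. simple_integral W (g j m) \<omega>)) (\<lambda>\<omega>. wnorm J w (\<lambda>j. ni (f j) \<omega>))"
      by (intro tendsto_in_prob_wnorm J(1) g(4) simple_integral_measurable ni_measurable f g(1))
    show "AE s in lborel. s \<in> S \<longrightarrow> (\<lambda>m. wnorm J w (\<lambda>j. simple_fun (g j m) s)) \<longlonglongrightarrow> wnorm J w (\<lambda>j. f j s)"
      using g(2) by (intro AE_I2 impI wnorm_tendsto)
    show "(\<lambda>m. enn2real (energy (simple_fun (g j0 m)))) \<longlonglongrightarrow> enn2real (energy (f j0))"
      using g(3)[OF j0(1)] f[OF j0(1)] by (intro tendsto_enn2real) (simp add: L_space_iff)+
    show "w j0 * \<bar>simple_integral W (g j0 m) \<omega>\<bar> \<le> wnorm J w (\<lambda>j. simple_integral W (g j m) \<omega>)" for m \<omega>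
      using ge[of "\<lambda>j. simple_integral W (g j m) \<omega>"] .
    show "w j0 * \<bar>ni (f j0) \<omega>\<bar> \<le> wnorm J w (\<lambda>j. ni (f j) \<omega>)" for \<omega>
      using ge[of "\<lambda>j. ni (f j) \<omega>"] .
    show "w j0 * \<bar>f j0 s\<bar> \<le> wnorm J w (\<lambda>j. f j s)" for s
      using ge[of "\<lambda>j. f j s"] .
  qed (use j0 J f g(2,4) in \<open>auto intro!: wnorm_measurable simple_integral_measurable[OF g(1)] ni_measurable wnorm_nonneg
      zero_ext_wnorm_measurable simple_fun_zero_ext_measurable[OF g(1)]\<close>)
qed

text \<open>Integrals of continuous fields are limits of weighted sums, with weights and nodes that depend neither
  on \<open>\<omega>\<close> nor on \<open>s\<close>.\<close>

lemma
  fixes D :: "'a \<Rightarrow> real" and Z :: "'a \<Rightarrow> 'w \<Rightarrow> real"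
  assumes D: "continuous_on UNIV D" "\<And>t. (\<lambda>s. D (t - s)) \<in> L_space \<alpha> S"
    and Z: "\<And>\<omega>. \<omega> \<in> space M \<Longrightarrow> continuous_on UNIV (\<lambda>t. Z t \<omega>)" "\<And>t. Z t \<in> borel_measurable M"
      "\<And>t. AE \<omega> in M. ni (\<lambda>s. D (t - s)) \<omega> = Z t \<omega>"
    and \<mu>: "finite_measure \<mu>" "sets \<mu> = sets borel" "AE x in \<mu>. norm x \<le> R"
  shows levy_bound_path: "levy_bound (\<lambda>\<omega>. \<integral>t. \<bar>Z t \<omega>\<bar> \<partial>\<mu>) (\<lambda>s. \<integral>t. \<bar>D (t - s)\<bar> \<partial>\<mu>)"
    and log_bound_path: "\<alpha> = 1 \<Longrightarrow> h \<in> L_space \<alpha> S \<Longrightarrow> e > 0 \<Longrightarrow>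
      log_bound (ni h) h (\<lambda>\<omega>. e * \<bar>ni h \<omega>\<bar> + (\<integral>t. \<bar>Z t \<omega>\<bar> \<partial>\<mu>)) (\<lambda>s. e * \<bar>h s\<bar> + (\<integral>t. \<bar>D (t - s)\<bar> \<partial>\<mu>))"
    and ni_path: "continuous_on UNIV \<phi> \<Longrightarrow> zero_ext (\<lambda>s. \<integral>t. \<phi> t * D (t - s) \<partial>\<mu>) \<in> borel_measurable borel \<Longrightarrow>
      (\<lambda>s. \<integral>t. \<phi> t * D (t - s) \<partial>\<mu>) \<in> L_space \<alpha> S \<and> (AE \<omega> in M. ni (\<lambda>s. \<integral>t. \<phi> t * D (t - s) \<partial>\<mu>) \<omega> = (\<integral>t. \<phi> t * Z t \<omega> \<partial>\<mu>))"
proof -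
  interpret \<mu>: finite_measure \<mu> by fact
  obtain p :: "nat \<Rightarrow> 'a \<Rightarrow> 'a" where p: "\<And>m. simple_function borel (p m)" "\<And>x. (\<lambda>m. p m x) \<longlonglongrightarrow> x" "\<And>m x. norm (p m x) \<le> 2 * norm x"
    using simple_functions_to_identity by blast
  have finr: "finite (range (p m))" for m using p(1)[of m] by (simp add: simple_function_def)
  define w where "w = (\<lambda>m t. measure \<mu> (p m -` {t}))"
  have w0: "w m t \<ge> 0" for m t by (simp add: w_def)
  \<comment> \<open>The nodes of all stages form a countable set, so one null set serves them all.
    Together with the continuity of the paths this replaces an identity holding simultaneously for
    all t.\<close>
  have ae: "AE \<omega> in M. \<forall>m. \<forall>t\<in>range (p m). ni (\<lambda>s. D (t - s)) \<omega> = Z t \<omega>"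
    unfolding AE_all_countable by (intro allI AE_finite_allI finr Z(3))
  have cD: "continuous_on UNIV (\<lambda>t. D (t - s))" for s
    by (rule continuous_on_compose2[OF D(1)]) (auto intro!: continuous_intros)
  have DM[measurable]: "D \<in> borel_measurable borel" using D(1) by (rule borel_measurable_continuous_onI)
  have DL: "zero_ext (\<lambda>s. D (t - s)) \<in> borel_measurable borel" for t
    using D(2) by (rule zero_ext_measurable)
  have niM: "ni (\<lambda>s. D (t - s)) \<in> borel_measurable M" for t
    by (rule ni_measurable[OF D(2)])
  have Nlim: "(\<lambda>m. wnorm (range (p m)) (w m) (\<lambda>t. Z t \<omega>)) \<longlonglongrightarrow> (\<integral>t. \<bar>Z t \<omega>\<bar> \<partial>\<mu>)" if "\<omega> \<in> space M" for \<omega>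
    unfolding wnorm_def w_def using Z(1)[OF that] by (intro riemann_sums_tendsto[OF p \<mu>] continuous_intros)
  have ZM: "(\<lambda>\<omega>. \<integral>t. \<bar>Z t \<omega>\<bar> \<partial>\<mu>) \<in> borel_measurable M"
    by (rule borel_measurable_LIMSEQ_real[OF Nlim]) (auto intro!: wnorm_measurable Z(2))
  have Nlim': "AE \<omega> in M. (\<lambda>m. wnorm (range (p m)) (w m) (\<lambda>t. ni (\<lambda>s. D (t - s)) \<omega>)) \<longlonglongrightarrow> (\<integral>t. \<bar>Z t \<omega>\<bar> \<partial>\<mu>)"
    using ae AE_space
  proof eventually_elim
    case (elim \<omega>)
    then have "wnorm (range (p m)) (w m) (\<lambda>t. ni (\<lambda>s. D (t - s)) \<omega>) = wnorm (range (p m)) (w m) (\<lambda>t. Z t \<omega>)" for m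
      unfolding wnorm_def by (intro sum.cong) auto
    with Nlim elim show ?case by simp
  qed
  have NM: "(\<lambda>\<omega>. wnorm (range (p m)) (w m) (\<lambda>t. ni (\<lambda>s. D (t - s)) \<omega>)) \<in> borel_measurable M" for m
    by (intro wnorm_measurable niM)
  have Ntip: "tendsto_in_prob M (\<lambda>m \<omega>. wnorm (range (p m)) (w m) (\<lambda>t. ni (\<lambda>s. D (t - s)) \<omega>)) (\<lambda>\<omega>. \<integral>t. \<bar>Z t \<omega>\<bar> \<partial>\<mu>)"
    by (rule tendsto_in_prob_AE[OF NM ZM Nlim'])
  have Glim: "(\<lambda>m. wnorm (range (p m)) (w m) (\<lambda>t. D (t - s))) \<longlonglongrightarrow> (\<integral>t. \<bar>D (t - s)\<bar> \<partial>\<mu>)" for s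
    unfolding wnorm_def w_def using cD by (intro riemann_sums_tendsto[OF p \<mu>] continuous_intros)
  show "levy_bound (\<lambda>\<omega>. \<integral>t. \<bar>Z t \<omega>\<bar> \<partial>\<mu>) (\<lambda>s. \<integral>t. \<bar>D (t - s)\<bar> \<partial>\<mu>)"
  proof (rule levy_bound_limit[OF levy_bound_ni NM ZM Ntip])
    show "AE s in lborel. s \<in> S \<longrightarrow> (\<lambda>m. wnorm (range (p m)) (w m) (\<lambda>t. D (t - s))) \<longlonglongrightarrow> (\<integral>t. \<bar>D (t - s)\<bar> \<partial>\<mu>)"
      using Glim by auto
  qed (use finr w0 D(2) DL in \<open>auto intro!: zero_ext_wnorm_measurable wnorm_nonneg\<close>)
  show "log_bound (ni h) h (\<lambda>\<omega>. e * \<bar>ni h \<omega>\<bar> + (\<integral>t. \<bar>Z t \<omega>\<bar> \<partial>\<mu>)) (\<lambda>s. e * \<bar>h s\<bar> + (\<integral>t. \<bar>D (t - s)\<bar> \<partial>\<mu>))"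
    if a1: "\<alpha> = 1" and h: "h \<in> L_space \<alpha> S" and e: "e > 0"
  proof -
    \<comment> \<open>\<open>None\<close> stands for the additional coordinate h with weight e, and
      \<open>Some t\<close> for the nodes of the Riemann sum.\<close>
    define J where "J = (\<lambda>m. insert None (Some ` range (p m)))"
    define v where "v = (\<lambda>m j. case j of None \<Rightarrow> e | Some t \<Rightarrow> w m t)"
    define f where "f = (\<lambda>j. case j of None \<Rightarrow> h | Some t \<Rightarrow> (\<lambda>s. D (t - s)))"
    have fL: "f j \<in> L_space \<alpha> S" for j using h D(2) by (cases j) (auto simp: f_def)
    have J: "wnorm (J m) (v m) x = e * \<bar>x None\<bar> + wnorm (range (p m)) (w m) (\<lambda>t. x (Some t))" for m x
      unfolding J_def wnorm_def using finr[of m] by (subst sum.insert) (auto simp: v_def sum.reindex)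
    have lb: "log_bound (ni (f None)) (f None) (\<lambda>\<omega>. wnorm (J m) (v m) (\<lambda>j. ni (f j) \<omega>)) (\<lambda>s. wnorm (J m) (v m) (\<lambda>j. f j s))" for m
      using finr[of m] w0 e by (intro log_bound_ni a1 fL) (auto simp: J_def v_def)
    have hM: "ni h \<in> borel_measurable M" by (rule ni_measurable[OF h])
    have tip: "tendsto_in_prob M (\<lambda>m \<omega>. e * \<bar>ni h \<omega>\<bar> + wnorm (range (p m)) (w m) (\<lambda>t. ni (\<lambda>s. D (t - s)) \<omega>))
      (\<lambda>\<omega>. e * \<bar>ni h \<omega>\<bar> + (\<integral>t. \<bar>Z t \<omega>\<bar> \<partial>\<mu>))"
      using Ntip by (simp add: tendsto_in_prob_def)
    show ?thesis
    proof (rule log_bound_limit[OF a1 _ e])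
      show "log_bound (ni h) h (\<lambda>\<omega>. e * \<bar>ni h \<omega>\<bar> + wnorm (range (p m)) (w m) (\<lambda>t. ni (\<lambda>s. D (t - s)) \<omega>))
         (\<lambda>s. e * \<bar>h s\<bar> + wnorm (range (p m)) (w m) (\<lambda>t. D (t - s)))" for m
        using lb[of m] unfolding J f_def by simp
      show "tendsto_in_prob M (\<lambda>m. ni h) (ni h)" by (simp add: tendsto_in_prob_def)
      show "AE s in lborel. s \<in> S \<longrightarrow> (\<lambda>m. e * \<bar>h s\<bar> + wnorm (range (p m)) (w m) (\<lambda>t. D (t - s))) \<longlonglongrightarrow> e * \<bar>h s\<bar> + (\<integral>t. \<bar>D (t - s)\<bar> \<partial>\<mu>)"
        using Glim by (intro AE_I2 impI tendsto_intros)
      show "zero_ext (\<lambda>s. e * \<bar>h s\<bar> + wnorm (range (p m)) (w m) (\<lambda>t. D (t - s))) \<in> borel_measurable borel" for m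
      proof -
        have "zero_ext (\<lambda>s. wnorm (J m) (v m) (\<lambda>j. f j s)) \<in> borel_measurable borel"
          using fL by (intro zero_ext_wnorm_measurable zero_ext_measurable)
        then show ?thesis unfolding J f_def by simp
      qed
      show "e * \<bar>h s\<bar> \<le> e * \<bar>h s\<bar> + (\<integral>t. \<bar>D (t - s)\<bar> \<partial>\<mu>)" for s by simp
    qed (use tip hM NM ZM h w0 in \<open>auto intro!: zero_ext_measurable wnorm_nonneg\<close>)
  qed
  show "(\<lambda>s. \<integral>t. \<phi> t * D (t - s) \<partial>\<mu>) \<in> L_space \<alpha> S \<and> (AE \<omega> in M. ni (\<lambda>s. \<integral>t. \<phi> t * D (t - s) \<partial>\<mu>) \<omega> = (\<integral>t. \<phi> t * Z t \<omega> \<partial>\<mu>))"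
    if \<phi>: "continuous_on UNIV \<phi>" and m: "zero_ext (\<lambda>s. \<integral>t. \<phi> t * D (t - s) \<partial>\<mu>) \<in> borel_measurable borel"
  proof -
    define f where "f = (\<lambda>m s. \<Sum>t\<in>range (p m). (w m t * \<phi> t) * D (t - s))"
    have f: "f m \<in> L_space \<alpha> S" "AE \<omega> in M. ni (f m) \<omega> = (\<Sum>t\<in>range (p m). (w m t * \<phi> t) * ni (\<lambda>s. D (t - s)) \<omega>)" for m
      using ni_sum[OF finr[of m], of "\<lambda>t s. D (t - s)" "\<lambda>t. w m t * \<phi> t"] D(2) by (auto simp: f_def)
    have Zl: "(\<lambda>m. \<Sum>t\<in>range (p m). w m t * (\<phi> t * Z t \<omega>)) \<longlonglongrightarrow> (\<integral>t. \<phi> t * Z t \<omega> \<partial>\<mu>)" if "\<omega> \<in> space M" for \<omega>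
      unfolding w_def using Z(1)[OF that] \<phi> by (intro riemann_sums_tendsto[OF p \<mu>] continuous_intros)
    have ZM: "(\<lambda>\<omega>. \<integral>t. \<phi> t * Z t \<omega> \<partial>\<mu>) \<in> borel_measurable M"
      by (rule borel_measurable_LIMSEQ_real[OF Zl])
        (auto intro!: borel_measurable_sum borel_measurable_times Z(2))
    have "AE \<omega> in M. \<forall>m. ni (f m) \<omega> = (\<Sum>t\<in>range (p m). (w m t * \<phi> t) * ni (\<lambda>s. D (t - s)) \<omega>)"
      unfolding AE_all_countable by (intro allI f(2))
    with ae AE_space have "AE \<omega> in M. (\<lambda>m. ni (f m) \<omega>) \<longlonglongrightarrow> (\<integral>t. \<phi> t * Z t \<omega> \<partial>\<mu>)"
    proof eventually_elim
      case (elim \<omega>)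
      then have eq: "ni (f m) \<omega> = (\<Sum>t\<in>range (p m). w m t * (\<phi> t * Z t \<omega>))" for m
        by (auto intro!: sum.cong)
      show ?case unfolding eq using elim by (intro Zl)
    qed
    then have tip: "tendsto_in_prob M (\<lambda>m. ni (f m)) (\<lambda>\<omega>. \<integral>t. \<phi> t * Z t \<omega> \<partial>\<mu>)"
      by (intro tendsto_in_prob_AE ni_measurable f(1) ZM)
    have "(\<lambda>m. f m s) \<longlonglongrightarrow> (\<integral>t. \<phi> t * D (t - s) \<partial>\<mu>)" for s
      unfolding f_def w_def mult.assoc using cD \<phi> by (intro riemann_sums_tendsto[OF p \<mu>] continuous_intros)
    then have "AE s in lborel. s \<in> S \<longrightarrow> (\<lambda>m. f m s) \<longlonglongrightarrow> (\<integral>t. \<phi> t * D (t - s) \<partial>\<mu>)" by auto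
    from ni_limit[OF f(1) ZM tip m this] show ?thesis by auto
  qed
qed

end

section \<open>The kernel of a random field representation\<close>

lemma ennreal_suminf_tendsto_0:
  fixes f :: "nat \<Rightarrow> ennreal"
  assumes "(\<Sum>k. f k) < \<infinity>"
  shows "f \<longlonglongrightarrow> 0"
proof -
  have fin: "f k \<noteq> top" for k
    using ennreal_suminf_lessD[OF assms, of k] by auto
  then have eq: "ennreal (enn2real (f k)) = f k" for k by (simp add: less_top)
  have "summable (\<lambda>k. enn2real (f k))"
    using assms by (intro summable_suminf_not_top) (auto simp: eq)
  then have "(\<lambda>k. ennreal (enn2real (f k))) \<longlonglongrightarrow> ennreal 0"
    by (intro tendsto_ennrealI summable_LIMSEQ_zero)
  then show ?thesis by (simp add: eq)
qed

lemma AE_suminf_finite: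
  fixes f :: "nat \<Rightarrow> 'b \<Rightarrow> ennreal"
  assumes [measurable]: "\<And>k. f k \<in> borel_measurable N" and "(\<Sum>k. \<integral>\<^sup>+x. f k x \<partial>N) < \<infinity>"
  shows "AE x in N. (\<Sum>k. f k x) < \<infinity>"
proof -
  have "(\<integral>\<^sup>+x. (\<Sum>k. f k x) \<partial>N) \<noteq> \<infinity>"
    using assms by (subst nn_integral_suminf) auto
  then have "AE x in N. (\<Sum>k. f k x) \<noteq> \<infinity>"
    by (intro nn_integral_PInf_AE) auto
  then show ?thesis by (simp add: less_top)
qed

lemma suminf_power_finite:
  assumes "0 \<le> C" "0 \<le> q" "q < 1" and f: "\<And>k. f k \<le> ennreal (C * q ^ k)"
  shows "(\<Sum>k. f k) < \<infinity>"
proof -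
  have "(\<Sum>k. f k) \<le> (\<Sum>k. ennreal (C * q ^ k))"
    by (intro suminf_le f) auto
  also have "\<dots> = ennreal (\<Sum>k. C * q ^ k)"
    using assms by (intro suminf_ennreal2 summable_mult summable_geometric) auto
  finally show ?thesis by (rule order_le_less_trans) simp
qed

lemma cball_borel_measurable [measurable]: "cball c R \<in> sets borel"
  by simp

lemma continuous_on_uminus_UNIV: "continuous_on UNIV (\<lambda>x::'a::real_normed_vector. - x)"
  by (intro continuous_intros)

text \<open>Lebesgue measure on a ball as a measure of its own, in the shape of the finite measures
  with bounded support for which the path bounds are stated.\<close>

definition ball_measure :: "real \<Rightarrow> 'a::euclidean_space measure" where
  "ball_measure R = density lborel (indicator (cball 0 R))"

lemma ball_measure:
  "sets (ball_measure R :: 'a::euclidean_space measure) = sets borel" "finite_measure (ball_measure R :: 'a measure)"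
  "AE x in (ball_measure R :: 'a measure). norm x \<le> R"
proof -
  show "sets (ball_measure R :: 'a measure) = sets borel" by (simp add: ball_measure_def)
  have "emeasure (ball_measure R :: 'a measure) (space (ball_measure R)) = emeasure lborel (cball (0::'a) R)"
    by (simp add: ball_measure_def emeasure_density)
  then show "finite_measure (ball_measure R :: 'a measure)"
    using emeasure_lborel_cball_finite[of "0::'a" R] by (intro finite_measureI) (simp add: less_top)
  show "AE x in (ball_measure R :: 'a measure). norm x \<le> R"
    unfolding ball_measure_def by (subst AE_density) (auto simp: indicator_def)
qed

lemma nn_integral_ball_measure:
  "f \<in> borel_measurable borel \<Longrightarrow> (\<integral>\<^sup>+x. f x \<partial>ball_measure R) = (\<integral>\<^sup>+x\<in>cball 0 R. f x \<partial>lborel)"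
  unfolding ball_measure_def by (subst nn_integral_density) (auto simp: mult.commute)

lemma nn_integral_abs_eq_integral:
  assumes "f \<in> borel_measurable N" "(\<integral>\<^sup>+x. ennreal \<bar>f x\<bar> \<partial>N) < \<infinity>"
  shows "(\<integral>\<^sup>+x. ennreal \<bar>f x\<bar> \<partial>N) = ennreal (\<integral>x. \<bar>f x\<bar> \<partial>N)"
  using assms by (intro nn_integral_eq_integral integrable_abs) (auto simp: integrable_iff_bounded)

text \<open>Local integrability is demanded at every \<omega> rather than almost every one, so that
  mollification is defined and continuous on all of \<open>space M\<close>; the final proof arranges
  this by setting the field to 0 on a null set.\<close>

locale random_field_solution = stable_noise M \<alpha> S W
  for M :: "'w measure" and \<alpha> :: real and S :: "'a::euclidean_space set" and W :: "'a set \<Rightarrow> 'w \<Rightarrow> real" +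
  fixes \<rho> :: "('a \<Rightarrow> real) \<Rightarrow> real" and Y :: "'a \<Rightarrow> 'w \<Rightarrow> real"
  assumes S_pos: "emeasure lborel S > 0"
    and \<rho>: "distribution \<rho>"
    and conv: "\<And>\<phi>. \<phi> \<in> test_functions \<Longrightarrow> conv_reflected \<phi> \<rho> \<in> L_space \<alpha> S"
    and Y_pair: "(\<lambda>(t, \<omega>). Y t \<omega>) \<in> borel_measurable (lborel \<Otimes>\<^sub>M M)"
    and Y_loc: "\<And>\<omega>. \<omega> \<in> space M \<Longrightarrow> locally_integrable (\<lambda>t. Y t \<omega>)"
    and Y_rep: "\<And>\<phi>. \<phi> \<in> test_functions \<Longrightarrow> AE \<omega> in M. ni (conv_reflected \<phi> \<rho>) \<omega> = (\<integral>t. Y t \<omega> * \<phi> t \<partial>lborel)"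
begin

lemma Y_measurable [measurable (raw)]:
  assumes f: "f \<in> borel_measurable N" and g: "g \<in> measurable N M"
  shows "(\<lambda>x. Y (f x) (g x)) \<in> borel_measurable N"
proof -
  have "(\<lambda>x. (f x, g x)) \<in> measurable N (lborel \<Otimes>\<^sub>M M)"
    using f g by (intro measurable_Pair) auto
  from measurable_compose[OF this Y_pair] show ?thesis by simp
qed

section \<open>Mollified fields and their kernels\<close>

definition mollify :: "('a \<Rightarrow> real) \<Rightarrow> 'a \<Rightarrow> 'w \<Rightarrow> real" where
  "mollify b t \<omega> = (\<integral>x. Y x \<omega> * b (x + - t) \<partial>lborel)"

definition kernel :: "('a \<Rightarrow> real) \<Rightarrow> 'a \<Rightarrow> real" where
  "kernel b x = \<rho> (\<lambda>r. b (r + - x))"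

lemma mollify_measurable:
  assumes b: "b \<in> test_functions" and f: "f \<in> borel_measurable N" and g: "g \<in> measurable N M"
  shows "(\<lambda>x. mollify b (f x) (g x)) \<in> borel_measurable N"
proof -
  have [measurable]: "b \<in> borel_measurable borel" by (rule test_functions_measurable[OF b])
  note [measurable] = f g
  show ?thesis unfolding mollify_def
    by (intro lborel.borel_measurable_lebesgue_integral) measurable
qed

lemma mollify_continuous:
  assumes b: "b \<in> test_functions" and \<omega>: "\<omega> \<in> space M"
  shows "continuous_on UNIV (\<lambda>t. mollify b t \<omega>)"
proof -
  have "continuous_on UNIV (\<lambda>z. \<integral>x. Y x \<omega> * b (x + z) \<partial>lborel)"
    using \<omega> by (intro conv_test_continuous Y_loc b Y_measurable) auto
  from continuous_on_compose2[OF this continuous_on_uminus_UNIV] show ?thesis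
    unfolding mollify_def by simp
qed

lemma kernel_continuous:
  assumes b: "b \<in> test_functions" shows "continuous_on UNIV (kernel b)"
  using continuous_on_compose2[OF distribution_shift_continuous[OF \<rho> b] continuous_on_uminus_UNIV]
  unfolding kernel_def[abs_def] by simp

text \<open>Translating b by t turns the reflected convolution into s \<mapsto> kernel b (t - s) and
  the tested path into the mollified path at t. The exceptional null set depends on t.\<close>

lemma kernel_noise_integral:
  assumes b: "b \<in> test_functions"
  shows "(\<lambda>s. kernel b (t - s)) \<in> L_space \<alpha> S" "AE \<omega> in M. ni (\<lambda>s. kernel b (t - s)) \<omega> = mollify b t \<omega>"
proof -
  have "conv_reflected (\<lambda>x. b (x + - t)) \<rho> = (\<lambda>s. kernel b (t - s))"
    by (simp add: conv_reflected_def kernel_def fun_eq_iff algebra_simps)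
  then show "(\<lambda>s. kernel b (t - s)) \<in> L_space \<alpha> S" "AE \<omega> in M. ni (\<lambda>s. kernel b (t - s)) \<omega> = mollify b t \<omega>"
    using conv[OF test_functions_shift[OF b, of "- t"]] Y_rep[OF test_functions_shift[OF b, of "- t"]]
    by (simp_all add: mollify_def)
qed

definition mollify_error :: "('a \<Rightarrow> real) \<Rightarrow> real \<Rightarrow> 'w \<Rightarrow> ennreal" where
  "mollify_error b R \<omega> = (\<integral>\<^sup>+t\<in>cball 0 R. ennreal \<bar>mollify b t \<omega> - Y t \<omega>\<bar> \<partial>lborel)"

text \<open>Truncated at 1 so as to have a finite mean. By Fubini a small mean leads to convergence
  in probability at almost every t, whereas the untruncated error controls whole paths.\<close>

definition mollify_error_min :: "('a \<Rightarrow> real) \<Rightarrow> real \<Rightarrow> 'w \<Rightarrow> ennreal" where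
  "mollify_error_min b R \<omega> = (\<integral>\<^sup>+t\<in>cball 0 R. ennreal (min 1 \<bar>mollify b t \<omega> - Y t \<omega>\<bar>) \<partial>lborel)"

lemma mollify_error_measurable:
  assumes b: "b \<in> test_functions"
  shows "mollify_error b R \<in> borel_measurable M" "mollify_error_min b R \<in> borel_measurable M"
proof -
  have [measurable]: "(\<lambda>x. mollify b (snd x) (fst x)) \<in> borel_measurable (M \<Otimes>\<^sub>M lborel)"
    by (intro mollify_measurable b) measurable
  have [measurable]: "cball 0 R \<in> sets (borel :: 'a measure)" by simp
  have "(\<lambda>x. ennreal \<bar>mollify b (snd x) (fst x) - Y (snd x) (fst x)\<bar> * indicator (cball 0 R) (snd x)) \<in> borel_measurable (M \<Otimes>\<^sub>M lborel)"
    by measurable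
  then show "mollify_error b R \<in> borel_measurable M"
    unfolding mollify_error_def[abs_def] by (intro lborel.borel_measurable_nn_integral) (simp add: split_beta')
  have "(\<lambda>x. ennreal (min 1 \<bar>mollify b (snd x) (fst x) - Y (snd x) (fst x)\<bar>) * indicator (cball 0 R) (snd x)) \<in> borel_measurable (M \<Otimes>\<^sub>M lborel)"
    by measurable
  then show "mollify_error_min b R \<in> borel_measurable M"
    unfolding mollify_error_min_def[abs_def] by (intro lborel.borel_measurable_nn_integral) (simp add: split_beta')
qed

lemma good_mollifier_exists:
  fixes e R :: real
  assumes "e > 0"
  shows "\<exists>b\<in>test_functions. emeasure M {\<omega>\<in>space M. mollify_error b R \<omega> \<ge> ennreal e} \<le> ennreal e \<and>
    (\<integral>\<^sup>+\<omega>. mollify_error_min b R \<omega> \<partial>M) \<le> ennreal e"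
proof -
  have "\<exists>b::'a \<Rightarrow> real. b \<in> test_functions \<and> (\<forall>x. b x \<ge> 0) \<and> (\<integral>x. b x \<partial>lborel) = 1 \<and> (\<forall>x. b x \<noteq> 0 \<longrightarrow> norm x \<le> inverse (Suc n))" for n
    by (rule mollifier_exists) simp
  then obtain b :: "nat \<Rightarrow> 'a \<Rightarrow> real" where b: "\<And>n. b n \<in> test_functions" "\<And>n x. b n x \<ge> 0"
      "\<And>n. (\<integral>x. b n x \<partial>lborel) = 1" "\<And>n x. b n x \<noteq> 0 \<Longrightarrow> norm x \<le> inverse (Suc n)"
    by metis
  have lim: "(\<lambda>n. mollify_error (b n) R \<omega>) \<longlonglongrightarrow> 0" if "\<omega> \<in> space M" for \<omega>
    unfolding mollify_error_def mollify_def using that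
    by (intro mollifier_L1_loc[OF Y_loc _ b LIMSEQ_inverse_real_of_nat] Y_measurable) auto
  have "(\<lambda>n. \<integral>\<^sup>+\<omega>. min 1 (mollify_error (b n) R \<omega>) \<partial>M) \<longlonglongrightarrow> (\<integral>\<^sup>+\<omega>. 0 \<partial>M)"
  proof (rule nn_integral_dominated_convergence[where w = "\<lambda>_. 1"])
    show "AE \<omega> in M. (\<lambda>n. min 1 (mollify_error (b n) R \<omega>)) \<longlonglongrightarrow> 0"
    proof (rule AE_I2)
      fix \<omega> assume "\<omega> \<in> space M"
      from tendsto_min[OF tendsto_const[of 1] lim[OF this]] show "(\<lambda>n. min 1 (mollify_error (b n) R \<omega>)) \<longlonglongrightarrow> 0"
        by simp
    qed
    show "(\<integral>\<^sup>+\<omega>. 1 \<partial>M) < \<infinity>" by (simp add: emeasure_space_1)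
  qed (use mollify_error_measurable[OF b(1)] in auto)
  then have "(\<lambda>n. \<integral>\<^sup>+\<omega>. min 1 (mollify_error (b n) R \<omega>) \<partial>M) \<longlonglongrightarrow> 0" by simp
  \<comment> \<open>Markov's inequality for the error truncated at 1 divides by
    \<open>min 1 e\<close>, hence this target for the mean.\<close>
  moreover have "0 < ennreal (min 1 e * e)"
    using \<open>e > 0\<close> unfolding ennreal_less_zero_iff by (intro mult_pos_pos) auto
  ultimately have ev1: "\<forall>\<^sub>F n in sequentially. (\<integral>\<^sup>+\<omega>. min 1 (mollify_error (b n) R \<omega>) \<partial>M) < ennreal (min 1 e * e)"
    by (rule order_tendstoD(2))
  have min_le: "mollify_error_min (b n) R \<omega> \<le> mollify_error (b n) R \<omega>" for n \<omega>
    unfolding mollify_error_def mollify_error_min_def by (intro nn_integral_mono mult_right_mono ennreal_leI) auto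
  have "(\<lambda>n. \<integral>\<^sup>+\<omega>. mollify_error_min (b n) R \<omega> \<partial>M) \<longlonglongrightarrow> (\<integral>\<^sup>+\<omega>. 0 \<partial>M)"
  proof (rule nn_integral_dominated_convergence[where w = "\<lambda>_. emeasure lborel (cball (0::'a) R)"])
    show "AE \<omega> in M. (\<lambda>n. mollify_error_min (b n) R \<omega>) \<longlonglongrightarrow> 0"
    proof (rule AE_I2)
      fix \<omega> assume "\<omega> \<in> space M"
      show "(\<lambda>n. mollify_error_min (b n) R \<omega>) \<longlonglongrightarrow> 0"
        by (rule tendsto_sandwich[OF _ _ tendsto_const lim[OF \<open>\<omega> \<in> space M\<close>]]) (auto simp: min_le)
    qed
    show "AE \<omega> in M. mollify_error_min (b n) R \<omega> \<le> emeasure lborel (cball (0::'a) R)" for n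
    proof (rule AE_I2)
      fix \<omega>
      have "mollify_error_min (b n) R \<omega> \<le> (\<integral>\<^sup>+t. indicator (cball 0 R) t \<partial>(lborel :: 'a measure))"
        unfolding mollify_error_min_def by (intro nn_integral_mono) (auto simp: indicator_def)
      then show "mollify_error_min (b n) R \<omega> \<le> emeasure lborel (cball (0::'a) R)" by simp
    qed
    show "(\<integral>\<^sup>+\<omega>. emeasure lborel (cball (0::'a) R) \<partial>M) < \<infinity>"
      using emeasure_lborel_cball_finite[of "0::'a" R] by (simp add: emeasure_space_1)
  qed (use mollify_error_measurable[OF b(1)] in auto)
  then have "(\<lambda>n. \<integral>\<^sup>+\<omega>. mollify_error_min (b n) R \<omega> \<partial>M) \<longlonglongrightarrow> 0" by simp
  moreover have "0 < ennreal e" using \<open>e > 0\<close> unfolding ennreal_less_zero_iff .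
  ultimately have ev2: "\<forall>\<^sub>F n in sequentially. (\<integral>\<^sup>+\<omega>. mollify_error_min (b n) R \<omega> \<partial>M) < ennreal e"
    by (rule order_tendstoD(2))
  from eventually_happens'[OF _ eventually_conj[OF ev1 ev2]] obtain n where
    n: "(\<integral>\<^sup>+\<omega>. min 1 (mollify_error (b n) R \<omega>) \<partial>M) < ennreal (min 1 e * e)" "(\<integral>\<^sup>+\<omega>. mollify_error_min (b n) R \<omega> \<partial>M) < ennreal e"
    by auto
  have [measurable]: "mollify_error (b n) R \<in> borel_measurable M" by (rule mollify_error_measurable[OF b(1)])
  have "ennreal (min 1 e) * emeasure M {\<omega>\<in>space M. mollify_error (b n) R \<omega> \<ge> ennreal e} =
     (\<integral>\<^sup>+\<omega>. ennreal (min 1 e) * indicator {\<omega>\<in>space M. mollify_error (b n) R \<omega> \<ge> ennreal e} \<omega> \<partial>M)"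
    by (simp add: nn_integral_cmult)
  also have "\<dots> \<le> (\<integral>\<^sup>+\<omega>. min 1 (mollify_error (b n) R \<omega>) \<partial>M)"
  proof (intro nn_integral_mono)
    fix \<omega>
    have "ennreal (min 1 e) \<le> min 1 (ennreal e)" using \<open>e > 0\<close> by (auto simp: min_def ennreal_le_1)
    then show "ennreal (min 1 e) * indicator {\<omega>\<in>space M. mollify_error (b n) R \<omega> \<ge> ennreal e} \<omega> \<le> min 1 (mollify_error (b n) R \<omega>)"
      by (auto simp: indicator_def intro: order_trans)
  qed
  also have "\<dots> \<le> ennreal (min 1 e) * ennreal e"
    using n(1) \<open>e > 0\<close> by (simp add: ennreal_mult'[symmetric] less_imp_le)
  finally have "emeasure M {\<omega>\<in>space M. mollify_error (b n) R \<omega> \<ge> ennreal e} \<le> ennreal e"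
    using \<open>e > 0\<close> by (subst (asm) ennreal_mult_le_mult_iff) auto
  with n(2) b(1) show ?thesis by (intro bexI[of _ "b n"]) auto
qed

text \<open>The index k is also the radius of the ball and fixes the accuracy 4^(-k). The
  exceptional events are then summable, and every bounded set is eventually covered.\<close>

definition bump :: "nat \<Rightarrow> 'a \<Rightarrow> real" where
  "bump k = (SOME b. b \<in> test_functions \<and> emeasure M {\<omega>\<in>space M. mollify_error b k \<omega> \<ge> ennreal ((1/4) ^ k)} \<le> ennreal ((1/4) ^ k) \<and>
    (\<integral>\<^sup>+\<omega>. mollify_error_min b k \<omega> \<partial>M) \<le> ennreal ((1/4) ^ k))"

lemma bump:
  "bump k \<in> test_functions" "emeasure M {\<omega>\<in>space M. mollify_error (bump k) k \<omega> \<ge> ennreal ((1/4) ^ k)} \<le> ennreal ((1/4) ^ k)"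
  "(\<integral>\<^sup>+\<omega>. mollify_error_min (bump k) k \<omega> \<partial>M) \<le> ennreal ((1/4) ^ k)"
proof -
  have "\<exists>b. b \<in> test_functions \<and> emeasure M {\<omega>\<in>space M. mollify_error b k \<omega> \<ge> ennreal ((1/4) ^ k)} \<le> ennreal ((1/4) ^ k) \<and>
    (\<integral>\<^sup>+\<omega>. mollify_error_min b k \<omega> \<partial>M) \<le> ennreal ((1/4) ^ k)"
    using good_mollifier_exists[of "(1/4) ^ k" "real k"] by auto
  from someI_ex[OF this, folded bump_def]
  show "bump k \<in> test_functions" "emeasure M {\<omega>\<in>space M. mollify_error (bump k) k \<omega> \<ge> ennreal ((1/4) ^ k)} \<le> ennreal ((1/4) ^ k)"
    "(\<integral>\<^sup>+\<omega>. mollify_error_min (bump k) k \<omega> \<partial>M) \<le> ennreal ((1/4) ^ k)"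
    by auto
qed

abbreviation Z :: "nat \<Rightarrow> 'a \<Rightarrow> 'w \<Rightarrow> real" where "Z k \<equiv> mollify (bump k)"
abbreviation kern :: "nat \<Rightarrow> 'a \<Rightarrow> real" where "kern k \<equiv> kernel (bump k)"

lemma Z_measurable [measurable (raw)]:
  "f \<in> borel_measurable N \<Longrightarrow> g \<in> measurable N M \<Longrightarrow> (\<lambda>x. Z k (f x) (g x)) \<in> borel_measurable N"
  by (rule mollify_measurable[OF bump(1)])

lemma kern_measurable [measurable]: "kern k \<in> borel_measurable borel"
  by (rule borel_measurable_continuous_onI[OF kernel_continuous[OF bump(1)]])

lemma AE_eventually_mollify_error: "AE \<omega> in M. \<forall>\<^sub>F k in sequentially. mollify_error (bump k) k \<omega> < ennreal ((1/4) ^ k)"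
proof -
  note [measurable] = mollify_error_measurable(1)[OF bump(1)]
  have le: "prob {\<omega>\<in>space M. mollify_error (bump k) k \<omega> \<ge> ennreal ((1/4) ^ k)} \<le> (1/4) ^ k" for k
    using bump(2)[of k] by (simp add: emeasure_eq_measure)
  have "AE \<omega> in M. \<forall>\<^sub>F k in sequentially. \<omega> \<in> space M - {\<omega>\<in>space M. mollify_error (bump k) k \<omega> \<ge> ennreal ((1/4) ^ k)}"
  proof (rule borel_cantelli_AE1)
    show "summable (\<lambda>k. prob {\<omega>\<in>space M. mollify_error (bump k) k \<omega> \<ge> ennreal ((1/4) ^ k)})"
      by (rule summable_comparison_test'[where g = "\<lambda>k. (1/4) ^ k" and N = 0])
        (use le in \<open>auto intro!: summable_geometric\<close>)
  qed (auto simp: emeasure_eq_measure)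
  then show ?thesis
    by eventually_elim (auto elim!: eventually_mono simp: not_le)
qed

lemma AE_mollify_tendsto:
  "AE \<omega> in M. \<forall>R. (\<lambda>k. \<integral>\<^sup>+t\<in>cball 0 R. ennreal \<bar>Z k t \<omega> - Y t \<omega>\<bar> \<partial>lborel) \<longlonglongrightarrow> 0"
  using AE_eventually_mollify_error
proof eventually_elim
  case (elim \<omega>)
  show ?case
  proof
    fix R
    show "(\<lambda>k. \<integral>\<^sup>+t\<in>cball 0 R. ennreal \<bar>Z k t \<omega> - Y t \<omega>\<bar> \<partial>lborel) \<longlonglongrightarrow> 0"
    proof (rule tendsto_sandwich[OF _ _ tendsto_const])
      obtain n :: nat where n: "R \<le> real n" using real_arch_simple by blast
      have "\<forall>\<^sub>F k in sequentially. k \<ge> n" by (rule eventually_ge_at_top)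
      with elim show "\<forall>\<^sub>F k in sequentially. (\<integral>\<^sup>+t\<in>cball 0 R. ennreal \<bar>Z k t \<omega> - Y t \<omega>\<bar> \<partial>lborel) \<le> ennreal ((1/4) ^ k)"
      proof eventually_elim
        case (elim k)
        have "(\<integral>\<^sup>+t\<in>cball 0 R. ennreal \<bar>Z k t \<omega> - Y t \<omega>\<bar> \<partial>lborel) \<le> mollify_error (bump k) k \<omega>"
          unfolding mollify_error_def using elim n by (intro nn_integral_mono mult_left_mono) (auto simp: indicator_def)
        with elim show ?case by simp
      qed
      have "(\<lambda>k. (1/4::real) ^ k) \<longlonglongrightarrow> 0" by (intro LIMSEQ_power_zero) auto
      from tendsto_ennrealI[OF this] show "(\<lambda>k. ennreal ((1/4) ^ k)) \<longlonglongrightarrow> 0" by simp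
    qed auto
  qed
qed

text \<open>The integrals over growing balls of the mean truncated errors are summable, so at almost
  every t the series of these errors is finite; a fixed t is eventually inside the ball.\<close>

lemma AE_mollify_tendsto_in_prob: "AE t in lborel. tendsto_in_prob M (\<lambda>k. Z k t) (Y t)"
proof -
  interpret P: pair_sigma_finite "lborel :: 'a measure" M ..
  define d where "d = (\<lambda>k t. \<integral>\<^sup>+\<omega>. ennreal (min 1 \<bar>Z k t \<omega> - Y t \<omega>\<bar>) \<partial>M)"
  have dM[measurable]: "d k \<in> borel_measurable lborel" for k
    unfolding d_def by measurable
  have "(\<integral>\<^sup>+t. d k t * indicator (cball 0 k) t \<partial>lborel) \<le> ennreal (1 * (1/4) ^ k)" for k
  proof -
    have m: "(\<lambda>(t, \<omega>). ennreal (min 1 \<bar>Z k t \<omega> - Y t \<omega>\<bar>) * indicator (cball 0 k) t) \<in> borel_measurable (lborel \<Otimes>\<^sub>M M)"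
    proof -
      have [measurable]: "cball 0 k \<in> sets (borel :: 'a measure)" by simp
      show ?thesis by measurable
    qed
    have "(\<integral>\<^sup>+t. d k t * indicator (cball 0 k) t \<partial>lborel) = (\<integral>\<^sup>+t. (\<integral>\<^sup>+\<omega>. ennreal (min 1 \<bar>Z k t \<omega> - Y t \<omega>\<bar>) * indicator (cball 0 k) t \<partial>M) \<partial>lborel)"
      unfolding d_def by (intro nn_integral_cong nn_integral_multc[symmetric]) measurable
    also have "\<dots> = (\<integral>\<^sup>+\<omega>. mollify_error_min (bump k) k \<omega> \<partial>M)"
      unfolding mollify_error_min_def using P.Fubini'[OF m] by simp
    finally show ?thesis using bump(3)[of k] by simp
  qed
  then have "(\<Sum>k. \<integral>\<^sup>+t. d k t * indicator (cball 0 k) t \<partial>lborel) < \<infinity>"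
    by (intro suminf_power_finite[where C = 1 and q = "1/4"]) auto
  then have "AE t in lborel. (\<Sum>k. d k t * indicator (cball 0 k) t) < \<infinity>"
    by (intro AE_suminf_finite) measurable
  then show ?thesis
  proof eventually_elim
    case (elim t)
    have "(\<lambda>k. d k t * indicator (cball 0 k) t) \<longlonglongrightarrow> 0"
      using elim by (rule ennreal_suminf_tendsto_0)
    moreover obtain n :: nat where "norm t \<le> n" using real_arch_simple by blast
    then have "\<forall>\<^sub>F k in sequentially. d k t * indicator (cball 0 k) t = d k t"
      unfolding eventually_sequentially by (intro exI[of _ n]) (auto simp: indicator_def)
    ultimately have lim: "d_lim \<longlonglongrightarrow> 0" if "d_lim = (\<lambda>k. d k t)" for d_lim
      unfolding that by (rule Lim_transform_eventually)
    have deq: "d k t = ennreal (expectation (\<lambda>\<omega>. min 1 \<bar>Z k t \<omega> - Y t \<omega>\<bar>))" for k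
      unfolding d_def by (intro nn_integral_eq_integral integrable_min_1) auto
    have "(\<lambda>k. enn2real (d k t)) \<longlonglongrightarrow> 0"
      by (rule finite_ennreal_tendsto_0[OF lim[OF refl]])
    then have "(\<lambda>k. expectation (\<lambda>\<omega>. min 1 \<bar>Z k t \<omega> - Y t \<omega>\<bar>)) \<longlonglongrightarrow> 0"
      unfolding deq by (simp add: Bochner_Integration.integral_nonneg)
    then show ?case by (subst tendsto_in_prob_iff) auto
  qed
qed

section \<open>Increments of the mollified kernels\<close>

definition incr :: "nat \<Rightarrow> 'a \<Rightarrow> real" where
  "incr k x = kern (Suc k) x - kern k x"

lemma incr_continuous: "continuous_on UNIV (incr k)"
  unfolding incr_def[abs_def] by (intro continuous_intros kernel_continuous bump)

lemma incr_measurable [measurable]: "incr k \<in> borel_measurable borel"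
  by (rule borel_measurable_continuous_onI[OF incr_continuous])

lemma incr_levy_bound:
  "levy_bound (\<lambda>\<omega>. \<integral>t. \<bar>Z (Suc k) t \<omega> - Z k t \<omega>\<bar> \<partial>ball_measure k) (\<lambda>s. \<integral>t. \<bar>incr k (t - s)\<bar> \<partial>ball_measure k)"
proof (rule levy_bound_path)
  show "(\<lambda>s. incr k (t - s)) \<in> L_space \<alpha> S" for t
    unfolding incr_def by (intro L_space_diff kernel_noise_integral bump)
  show "AE \<omega> in M. ni (\<lambda>s. incr k (t - s)) \<omega> = Z (Suc k) t \<omega> - Z k t \<omega>" for t
    using ni_diff[OF kernel_noise_integral(1)[OF bump(1)[of "Suc k"]] kernel_noise_integral(1)[OF bump(1)[of k]], of t t]
      kernel_noise_integral(2)[OF bump(1)[of "Suc k"], of t] kernel_noise_integral(2)[OF bump(1)[of k], of t]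
    by eventually_elim (simp add: incr_def)
qed (auto intro!: incr_continuous continuous_intros mollify_continuous bump ball_measure)

text \<open>The step from k to k + 1 is compared with Y on the smaller ball. Since 4^(-k) + 4^(-k-1)
  \<le> 2 * 4^(-k), the same number serves as level and as probability.\<close>

lemma incr_mollify_prob:
  "prob {\<omega>\<in>space M. (\<integral>t. \<bar>Z (Suc k) t \<omega> - Z k t \<omega>\<bar> \<partial>ball_measure k) \<ge> 2 * (1/4) ^ k} \<le> 2 * (1/4) ^ k"
proof -
  note [measurable] = mollify_error_measurable(1)[OF bump(1)]
  let ?E = "\<lambda>k. {\<omega>\<in>space M. mollify_error (bump k) k \<omega> \<ge> ennreal ((1/4) ^ k)}"
  have "\<omega> \<in> ?E k \<union> ?E (Suc k)" if \<omega>: "\<omega> \<in> space M" and ge: "(\<integral>t. \<bar>Z (Suc k) t \<omega> - Z k t \<omega>\<bar> \<partial>ball_measure k) \<ge> 2 * (1/4) ^ k" for \<omega>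
  proof (rule ccontr)
    assume "\<omega> \<notin> ?E k \<union> ?E (Suc k)"
    then have lt: "mollify_error (bump k) k \<omega> < ennreal ((1/4) ^ k)" "mollify_error (bump (Suc k)) (Suc k) \<omega> < ennreal ((1/4) ^ Suc k)"
      using \<omega> by (auto simp: not_le)
    have [measurable]: "(\<lambda>t. Z i t \<omega>) \<in> borel_measurable borel" "(\<lambda>t. Y t \<omega>) \<in> borel_measurable borel" for i
      using \<omega> by measurable
    have "ennreal (\<integral>t. \<bar>Z (Suc k) t \<omega> - Z k t \<omega>\<bar> \<partial>ball_measure k) \<le> (\<integral>\<^sup>+t. ennreal \<bar>Z (Suc k) t \<omega> - Z k t \<omega>\<bar> \<partial>ball_measure k)"
      by (cases "integrable (ball_measure k) (\<lambda>t. \<bar>Z (Suc k) t \<omega> - Z k t \<omega>\<bar>)")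
        (auto simp: nn_integral_eq_integral not_integrable_integral_eq)
    also have "\<dots> = (\<integral>\<^sup>+t\<in>cball 0 k. ennreal \<bar>Z (Suc k) t \<omega> - Z k t \<omega>\<bar> \<partial>lborel)"
      by (rule nn_integral_ball_measure) measurable
    also have "\<dots> \<le> (\<integral>\<^sup>+t. ennreal \<bar>Z (Suc k) t \<omega> - Y t \<omega>\<bar> * indicator (cball 0 (Suc k)) t + ennreal \<bar>Z k t \<omega> - Y t \<omega>\<bar> * indicator (cball 0 k) t \<partial>lborel)"
    proof (intro nn_integral_mono)
      fix t
      have "ennreal \<bar>Z (Suc k) t \<omega> - Z k t \<omega>\<bar> \<le> ennreal \<bar>Z (Suc k) t \<omega> - Y t \<omega>\<bar> + ennreal \<bar>Z k t \<omega> - Y t \<omega>\<bar>"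
      proof -
        have "ennreal \<bar>Z (Suc k) t \<omega> - Z k t \<omega>\<bar> \<le> ennreal (\<bar>Z (Suc k) t \<omega> - Y t \<omega>\<bar> + \<bar>Z k t \<omega> - Y t \<omega>\<bar>)"
          by (intro ennreal_leI) simp
        then show ?thesis by simp
      qed
      then show "ennreal \<bar>Z (Suc k) t \<omega> - Z k t \<omega>\<bar> * indicator (cball 0 k) t \<le>
        ennreal \<bar>Z (Suc k) t \<omega> - Y t \<omega>\<bar> * indicator (cball 0 (Suc k)) t + ennreal \<bar>Z k t \<omega> - Y t \<omega>\<bar> * indicator (cball 0 k) t"
        by (auto simp: indicator_def)
    qed
    also have "\<dots> = mollify_error (bump (Suc k)) (Suc k) \<omega> + mollify_error (bump k) k \<omega>"
      unfolding mollify_error_def by (rule nn_integral_add) measurable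
    also have "\<dots> < ennreal ((1/4) ^ Suc k) + ennreal ((1/4) ^ k)"
      using lt by (intro add_strict_mono)
    also have "\<dots> = ennreal ((1/4) ^ Suc k + (1/4) ^ k)" by (rule ennreal_plus[symmetric]) auto
    also have "\<dots> \<le> ennreal (2 * (1/4) ^ k)" by (intro ennreal_leI) simp
    finally show False using ge by (simp add: ennreal_less_iff Bochner_Integration.integral_nonneg)
  qed
  then have "prob {\<omega>\<in>space M. (\<integral>t. \<bar>Z (Suc k) t \<omega> - Z k t \<omega>\<bar> \<partial>ball_measure k) \<ge> 2 * (1/4) ^ k} \<le> prob (?E k \<union> ?E (Suc k))"
    by (intro finite_measure_mono) auto
  also have "\<dots> \<le> prob (?E k) + prob (?E (Suc k))" by (rule measure_Un_le) auto
  also have "\<dots> \<le> (1/4) ^ k + (1/4) ^ Suc k"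
    using bump(2)[of k] bump(2)[of "Suc k"] by (intro add_mono) (simp_all add: emeasure_eq_measure)
  also have "\<dots> \<le> 2 * (1/4) ^ k" by simp
  finally show ?thesis .
qed

text \<open>This uses that \<open>S\<close> is not a null set: summing the bounds over the steps gives convergence for almost all points of \<open>S\<close>.\<close>

lemma incr_summable_point:
  "\<exists>s0\<in>S. \<exists>k1. \<forall>k\<ge>k1. (\<integral>t. \<bar>incr k (t - s0)\<bar> \<partial>ball_measure k) \<le> (1/2) ^ k"
proof -
  define G where "G = (\<lambda>k s. \<integral>t. \<bar>incr k (t - s)\<bar> \<partial>ball_measure k)"
  have GM[measurable]: "G k \<in> borel_measurable borel" for k
  proof -
    interpret finite_measure "ball_measure k :: 'a measure" by (rule ball_measure)
    have "(\<lambda>(s, t). \<bar>incr k (t - s)\<bar>) \<in> borel_measurable (borel \<Otimes>\<^sub>M (borel :: 'a measure))" by measurable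
    moreover have "sets (borel \<Otimes>\<^sub>M ball_measure k) = sets (borel \<Otimes>\<^sub>M (borel :: 'a measure))"
      by (intro sets_pair_measure_cong ball_measure refl)
    ultimately have "(\<lambda>(s, t). \<bar>incr k (t - s)\<bar>) \<in> borel_measurable (borel \<Otimes>\<^sub>M (ball_measure k :: 'a measure))"
      using measurable_cong_sets[of "borel \<Otimes>\<^sub>M ball_measure k" "borel \<Otimes>\<^sub>M (borel :: 'a measure)" borel borel] by blast
    then show ?thesis
      unfolding G_def by (rule borel_measurable_lebesgue_integral)
  qed
  have G0: "G k s \<ge> 0" for k s unfolding G_def by simp
  have "(\<lambda>k. 2 * (1/4::real) ^ k) \<longlonglongrightarrow> 0"
    by (intro tendsto_mult_right_zero LIMSEQ_power_zero) auto
  from order_tendstoD(2)[OF this, of "tail_const \<alpha> / 8"] obtain k0 where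
    k0: "\<And>k. k \<ge> k0 \<Longrightarrow> 2 * (1/4::real) ^ k < tail_const \<alpha> / 8"
    using tail_const(1)[of \<alpha>] by (auto simp: eventually_sequentially)
  \<comment> \<open>The Levy bound makes the integral of the \<alpha>-th power of \<open>G k\<close>
    of order 4^(-k \<alpha>). A weight 2^k inside the power still leaves a geometric series and
    yields the rate (1/2)^k at almost every point. The shift by k0 starts the series where the
    probability is below the threshold of the bound.\<close>
  let ?f = "\<lambda>k s. ennreal ((2 ^ (k + k0) * G (k + k0) s) powr \<alpha>) * indicator S s"
  have "(\<integral>\<^sup>+s. ?f k s \<partial>lborel) \<le> ennreal ((2 powr \<alpha> / tail_const \<alpha>) * ((1/2) powr \<alpha>) ^ k)" for k
  proof -
    let ?k = "k + k0"
    have "prob {\<omega>\<in>space M. (\<integral>t. \<bar>Z (Suc ?k) t \<omega> - Z ?k t \<omega>\<bar> \<partial>ball_measure ?k) \<ge> 2 * (1/4) ^ ?k} < tail_const \<alpha> / 8"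
      using incr_mollify_prob[of ?k] k0[of ?k] by linarith
    then have *: "(\<integral>\<^sup>+s\<in>S. ennreal (G ?k s powr \<alpha>) \<partial>lborel) \<le> ennreal ((2 * (1/4) ^ ?k) powr \<alpha> / tail_const \<alpha>)"
      using incr_levy_bound[of ?k] unfolding levy_bound_def G_def by simp
    have "(\<integral>\<^sup>+s. ?f k s \<partial>lborel) = (\<integral>\<^sup>+s. ennreal ((2 ^ ?k) powr \<alpha>) * (ennreal (G ?k s powr \<alpha>) * indicator S s) \<partial>lborel)"
      by (intro nn_integral_cong) (simp add: powr_mult ennreal_mult mult.assoc)
    also have "\<dots> = ennreal ((2 ^ ?k) powr \<alpha>) * (\<integral>\<^sup>+s\<in>S. ennreal (G ?k s powr \<alpha>) \<partial>lborel)"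
      by (rule nn_integral_cmult) measurable
    also have "\<dots> \<le> ennreal ((2 ^ ?k) powr \<alpha>) * ennreal ((2 * (1/4) ^ ?k) powr \<alpha> / tail_const \<alpha>)"
      by (intro mult_left_mono *) simp
    also have "\<dots> = ennreal ((2 ^ ?k) powr \<alpha> * ((2 * (1/4) ^ ?k) powr \<alpha> / tail_const \<alpha>))"
      by (rule ennreal_mult'[symmetric]) simp
    also have "(2 ^ ?k) powr \<alpha> * ((2 * (1/4) ^ ?k) powr \<alpha> / tail_const \<alpha>) = (2 * (1/2) ^ ?k) powr \<alpha> / tail_const \<alpha>"
    proof -
      have "(2::real) ^ ?k * (2 * (1/4) ^ ?k) = 2 * (1/2) ^ ?k"
        by (simp add: power_mult_distrib[symmetric])
      then show ?thesis
        using powr_mult[of "2 ^ ?k" "2 * (1/4) ^ ?k" \<alpha>] by (simp only: times_divide_eq_right)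
    qed
    also have "\<dots> \<le> (2 * (1/2) ^ k) powr \<alpha> / tail_const \<alpha>"
      using \<alpha> tail_const(1)[of \<alpha>] by (intro divide_right_mono powr_mono2 mult_left_mono power_decreasing) auto
    also have "(2 * (1/2) ^ k) powr \<alpha> / tail_const \<alpha> = (2 powr \<alpha> / tail_const \<alpha>) * ((1/2) powr \<alpha>) ^ k"
      by (simp add: powr_mult powr_power powr_realpow[symmetric] powr_powr mult.commute)
    finally show ?thesis by (simp add: ennreal_leI)
  qed
  then have "(\<Sum>k. \<integral>\<^sup>+s. ?f k s \<partial>lborel) < \<infinity>"
    using \<alpha> tail_const(1)[of \<alpha>] powr_less_mono2[of \<alpha> "1/2" 1]
    by (intro suminf_power_finite[where C = "2 powr \<alpha> / tail_const \<alpha>" and q = "(1/2) powr \<alpha>"]) auto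
  then have "AE s in lborel. (\<Sum>k. ?f k s) < \<infinity>"
    by (intro AE_suminf_finite) measurable
  moreover have "\<not> (AE s in lborel. s \<notin> S)"
    using S_pos by (subst AE_iff_measurable[where N = S]) auto
  ultimately have "\<exists>s. s \<in> S \<and> (\<Sum>k. ?f k s) < \<infinity>"
    by (metis (mono_tags, lifting) eventually_mono)
  then obtain s0 where s0: "s0 \<in> S" "(\<Sum>k. ?f k s0) < \<infinity>" by blast
  from ennreal_suminf_tendsto_0[OF s0(2)] have "\<forall>\<^sub>F k in sequentially. ?f k s0 < 1"
    by (intro order_tendstoD) auto
  then obtain k2 where k2: "\<And>k. k \<ge> k2 \<Longrightarrow> ?f k s0 < 1" by (auto simp: eventually_sequentially)
  have "G k s0 \<le> (1/2) ^ k" if "k \<ge> k2 + k0" for k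
  proof -
    have "?f (k - k0) s0 < 1" using that by (intro k2) auto
    then have lt: "(2 ^ k * G k s0) powr \<alpha> < 1" using that s0(1) by (simp add: ennreal_less_one_iff)
    have "2 ^ k * G k s0 \<le> 1"
    proof (rule ccontr)
      assume "\<not> 2 ^ k * G k s0 \<le> 1"
      then have "1 \<le> (2 ^ k * G k s0) powr \<alpha>" using \<alpha> by (intro ge_one_powr_ge_zero) auto
      with lt show False by simp
    qed
    then show ?thesis by (simp add: field_simps)
  qed
  then show ?thesis using s0(1) unfolding G_def by blast
qed

end

context random_field_solution
begin

section \<open>A locally integrable majorant of all kernels\<close>

definition majorant :: "'a \<Rightarrow> ennreal" where
  "majorant x = ennreal \<bar>kern 0 x\<bar> + (\<Sum>k. ennreal \<bar>incr k x\<bar>)"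

lemma majorant_measurable [measurable]: "majorant \<in> borel_measurable borel"
  unfolding majorant_def by measurable

lemma continuous_integral_cball_finite:
  fixes f :: "'a \<Rightarrow> real"
  assumes "continuous_on UNIV f"
  shows "(\<integral>\<^sup>+x\<in>cball 0 R. ennreal \<bar>f x\<bar> \<partial>lborel) < \<infinity>"
proof -
  have "integrable lborel (\<lambda>x. indicator (cball 0 R) x *\<^sub>R f x)"
    using assms by (intro borel_integrable_compact) (auto intro: continuous_on_subset)
  then have "(\<integral>\<^sup>+x. ennreal (norm (indicator (cball 0 R) x *\<^sub>R f x)) \<partial>lborel) < \<infinity>"
    by (simp add: integrable_iff_bounded)
  also have "(\<integral>\<^sup>+x. ennreal (norm (indicator (cball 0 R) x *\<^sub>R f x)) \<partial>lborel) = (\<integral>\<^sup>+x\<in>cball 0 R. ennreal \<bar>f x\<bar> \<partial>lborel)"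
    by (intro nn_integral_cong) (auto simp: indicator_def)
  finally show ?thesis .
qed

text \<open>At the single point s0 the increments are controlled at t - s0 for t in balls of growing
  radius, and the translates of these balls by -s0 eventually contain any fixed ball. One point of S
  thus decides integrability on the whole space; the finitely many early increments are
  continuous.\<close>

lemma majorant_finite: "(\<integral>\<^sup>+x\<in>cball 0 R. majorant x \<partial>lborel) < \<infinity>"
proof -
  obtain s0 k1 where s0: "\<And>k. k \<ge> k1 \<Longrightarrow> (\<integral>t. \<bar>incr k (t - s0)\<bar> \<partial>ball_measure k) \<le> (1/2) ^ k"
    using incr_summable_point by blast
  obtain k2 :: nat where k2: "R + norm s0 \<le> k2" using real_arch_simple by blast
  define k0 where "k0 = max k1 k2"
  let ?I = "\<lambda>k. \<integral>\<^sup>+x\<in>cball 0 R. ennreal \<bar>incr k x\<bar> \<partial>lborel"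
  have le: "?I k \<le> ennreal ((1/2) ^ k)" if k: "k \<ge> k0" for k
  proof -
    have cont: "continuous_on UNIV (\<lambda>t. incr k (t - s0))"
      by (rule continuous_on_compose2[OF incr_continuous]) (auto intro!: continuous_intros)
    have "?I k = (\<integral>\<^sup>+x. ennreal \<bar>incr k (x + - s0)\<bar> * indicator (cball 0 R) (x + - s0) \<partial>lborel)"
      by (rule nn_integral_lborel_shift[symmetric]) measurable
    also have "\<dots> \<le> (\<integral>\<^sup>+x\<in>cball 0 k. ennreal \<bar>incr k (x - s0)\<bar> \<partial>lborel)"
    proof (intro nn_integral_mono)
      fix x
      have "norm x \<le> k" if "norm (x - s0) \<le> R"
      proof -
        have "norm x \<le> R + norm s0" using that norm_triangle_sub[of x s0] by simp
        also have "\<dots> \<le> real k" using k k2 by (auto simp: k0_def)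
        finally show ?thesis .
      qed
      then show "ennreal \<bar>incr k (x + - s0)\<bar> * indicator (cball 0 R) (x + - s0) \<le> ennreal \<bar>incr k (x - s0)\<bar> * indicator (cball 0 k) x"
        by (auto simp: indicator_def)
    qed
    also have "\<dots> = (\<integral>\<^sup>+x. ennreal \<bar>incr k (x - s0)\<bar> \<partial>ball_measure k)"
      by (rule nn_integral_ball_measure[symmetric]) measurable
    also have "\<dots> = ennreal (\<integral>x. \<bar>incr k (x - s0)\<bar> \<partial>ball_measure k)"
    proof (rule nn_integral_abs_eq_integral)
      show "(\<lambda>x. incr k (x - s0)) \<in> borel_measurable (ball_measure k)"
        by (simp add: measurable_cong_sets[OF ball_measure(1) refl])
      show "(\<integral>\<^sup>+x. ennreal \<bar>incr k (x - s0)\<bar> \<partial>ball_measure k) < \<infinity>"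
        using continuous_integral_cball_finite[OF cont] by (subst nn_integral_ball_measure) auto
    qed
    also have "\<dots> \<le> ennreal ((1/2) ^ k)"
      using s0[of k] k by (intro ennreal_leI) (auto simp: k0_def)
    finally show ?thesis .
  qed
  have "(\<integral>\<^sup>+x\<in>cball 0 R. majorant x \<partial>lborel) = (\<integral>\<^sup>+x. (ennreal \<bar>kern 0 x\<bar> * indicator (cball 0 R) x + (\<Sum>k. ennreal \<bar>incr k x\<bar> * indicator (cball 0 R) x)) \<partial>lborel)"
    by (intro nn_integral_cong) (simp only: majorant_def distrib_right ennreal_suminf_multc)
  also have "\<dots> = (\<integral>\<^sup>+x\<in>cball 0 R. ennreal \<bar>kern 0 x\<bar> \<partial>lborel) +
      (\<integral>\<^sup>+x. (\<Sum>k. ennreal \<bar>incr k x\<bar> * indicator (cball 0 R) x) \<partial>lborel)"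
    by (rule nn_integral_add) measurable
  also have "(\<integral>\<^sup>+x. (\<Sum>k. ennreal \<bar>incr k x\<bar> * indicator (cball 0 R) x) \<partial>lborel) = (\<Sum>k. ?I k)"
    by (rule nn_integral_suminf) measurable
  also have "(\<integral>\<^sup>+x\<in>cball 0 R. ennreal \<bar>kern 0 x\<bar> \<partial>lborel) + (\<Sum>k. ?I k) < \<infinity>"
  proof -
    have "(\<Sum>k. ?I k) = (\<Sum>k. ?I (k + k0)) + (\<Sum>k<k0. ?I k)"
      by (rule suminf_offset) auto
    moreover have "(\<Sum>k. ?I (k + k0)) < \<infinity>"
    proof (rule suminf_power_finite[where C = 1 and q = "1/2"])
      fix k
      have "?I (k + k0) \<le> ennreal ((1/2) ^ (k + k0))" by (rule le) simp
      also have "\<dots> \<le> ennreal (1 * (1/2) ^ k)" by (intro ennreal_leI) (simp add: power_decreasing)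
      finally show "?I (k + k0) \<le> ennreal (1 * (1/2) ^ k)" .
    qed auto
    moreover have "(\<Sum>k<k0. ?I k) < \<infinity>"
      using continuous_integral_cball_finite[OF incr_continuous] by (simp add: less_top)
    moreover have "(\<integral>\<^sup>+x\<in>cball 0 R. ennreal \<bar>kern 0 x\<bar> \<partial>lborel) < \<infinity>"
      by (rule continuous_integral_cball_finite[OF kernel_continuous[OF bump(1)]])
    ultimately show ?thesis by (simp add: less_top)
  qed
  finally show ?thesis .
qed

lemma AE_majorant_finite: "AE x in lborel. majorant x < \<infinity>"
proof -
  have "AE x in lborel. majorant x * indicator (cball 0 (real n)) x \<noteq> \<infinity>" for n :: nat
    using majorant_finite[of "real n"] by (intro nn_integral_PInf_AE) auto
  then have "AE x in lborel. \<forall>n::nat. majorant x * indicator (cball 0 (real n)) x \<noteq> \<infinity>"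
    by (simp add: AE_all_countable)
  then show ?thesis
  proof eventually_elim
    case (elim x)
    obtain n :: nat where "norm x \<le> n" using real_arch_simple by blast
    with elim[rule_format, of n] show ?case by (simp add: less_top)
  qed
qed

section \<open>The limit kernel and its noise integrals\<close>

definition r :: "'a \<Rightarrow> real" where
  "r x = lim (\<lambda>k. kern k x)"

lemma r_measurable [measurable]: "r \<in> borel_measurable borel"
  unfolding r_def by measurable

lemma kern_le_majorant: "ennreal \<bar>kern k x\<bar> \<le> majorant x"
proof -
  have "kern k x = kern 0 x + (\<Sum>i<k. incr i x)"
    unfolding incr_def by (subst sum_lessThan_telescope) simp
  then have "\<bar>kern k x\<bar> \<le> \<bar>kern 0 x\<bar> + (\<Sum>i<k. \<bar>incr i x\<bar>)"
    using sum_abs[of "\<lambda>i. incr i x" "{..<k}"] by linarith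
  then have "ennreal \<bar>kern k x\<bar> \<le> ennreal (\<bar>kern 0 x\<bar> + (\<Sum>i<k. \<bar>incr i x\<bar>))" by (rule ennreal_leI)
  also have "\<dots> = ennreal \<bar>kern 0 x\<bar> + (\<Sum>i<k. ennreal \<bar>incr i x\<bar>)"
    by (simp add: sum_nonneg)
  also have "\<dots> \<le> majorant x"
    unfolding majorant_def by (intro add_left_mono sum_le_suminf) auto
  finally show ?thesis .
qed

lemma kern_tendsto:
  assumes "majorant x < \<infinity>"
  shows "(\<lambda>k. kern k x) \<longlonglongrightarrow> r x"
proof -
  have "(\<Sum>k. ennreal \<bar>incr k x\<bar>) \<noteq> top" using assms by (auto simp: majorant_def)
  then have "summable (\<lambda>k. \<bar>incr k x\<bar>)" by (intro summable_suminf_not_top) auto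
  then have "summable (\<lambda>k. incr k x)" by (rule summable_rabs_cancel)
  then have "convergent (\<lambda>n. \<Sum>i<n. incr i x)" by (simp add: summable_iff_convergent)
  moreover have "(\<Sum>i<n. incr i x) = kern n x - kern 0 x" for n
    unfolding incr_def by (rule sum_lessThan_telescope)
  ultimately have "convergent (\<lambda>n. kern n x - kern 0 x)" by simp
  then have "convergent (\<lambda>n. (kern n x - kern 0 x) + kern 0 x)" by (intro convergent_add convergent_const)
  then show ?thesis unfolding r_def by (simp add: convergent_LIMSEQ_iff)
qed

lemma AE_kern_tendsto: "AE x in lborel. (\<lambda>k. kern k x) \<longlonglongrightarrow> r x"
  using AE_majorant_finite by eventually_elim (rule kern_tendsto)

lemma r_le_majorant: "majorant x < \<infinity> \<Longrightarrow> ennreal \<bar>r x\<bar> \<le> majorant x"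
  by (rule LIMSEQ_le_const2[OF tendsto_ennrealI[OF tendsto_rabs[OF kern_tendsto]]])
    (auto simp: kern_le_majorant)

lemma r_locally_integrable: "locally_integrable r"
  unfolding locally_integrable_def set_integrable_def
proof (intro allI impI)
  fix K :: "'a set" assume "compact K"
  then obtain R where R: "\<forall>x\<in>K. norm x \<le> R" using compact_imp_bounded bounded_iff by blast
  have [measurable]: "K \<in> sets borel" using \<open>compact K\<close> by (simp add: borel_compact)
  have "(\<integral>\<^sup>+x. ennreal (norm (indicator K x *\<^sub>R r x)) \<partial>lborel) \<le> (\<integral>\<^sup>+x\<in>cball 0 R. majorant x \<partial>lborel)"
  proof (rule nn_integral_mono_AE)
    show "AE x in lborel. ennreal (norm (indicator K x *\<^sub>R r x)) \<le> majorant x * indicator (cball 0 R) x"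
      using AE_majorant_finite by eventually_elim (use R r_le_majorant in \<open>auto simp: indicator_def\<close>)
  qed
  then show "integrable lborel (\<lambda>x. indicator K x *\<^sub>R r x)"
    using majorant_finite[of R] by (intro integrableI_bounded) (auto intro: order_le_less_trans)
qed

lemma zero_ext_r_measurable: "zero_ext (\<lambda>s. r (t - s)) \<in> borel_measurable borel"
  unfolding zero_ext_def[abs_def] by measurable

lemma AE_noise_integral_r:
  "AE t in lborel. (\<lambda>s. r (t - s)) \<in> L_space \<alpha> S \<and> (AE \<omega> in M. ni (\<lambda>s. r (t - s)) \<omega> = Y t \<omega>)"
  using AE_mollify_tendsto_in_prob
proof eventually_elim
  case (elim t)
  have L: "(\<lambda>s. kern k (t - s)) \<in> L_space \<alpha> S" for k by (rule kernel_noise_integral[OF bump(1)])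
  have "tendsto_in_prob M (\<lambda>k. ni (\<lambda>s. kern k (t - s))) (Y t)"
  proof (rule tendsto_in_prob_cong_AE[OF _ _ _ _ _ _ elim])
    show "AE \<omega> in M. Z k t \<omega> = ni (\<lambda>s. kern k (t - s)) \<omega>" for k
      using kernel_noise_integral(2)[OF bump(1)[of k], of t] by eventually_elim simp
  qed (auto intro: ni_measurable[OF L])
  moreover have "AE s in lborel. s \<in> S \<longrightarrow> (\<lambda>k. kern k (t - s)) \<longlonglongrightarrow> r (t - s)"
    using AE_lborel_reflect[OF AE_kern_tendsto, of t] by eventually_elim simp
  moreover have "Y t \<in> borel_measurable M" by measurable
  ultimately show ?case
    using ni_limit[of "\<lambda>k s. kern k (t - s)" "Y t" "\<lambda>s. r (t - s)"] L zero_ext_r_measurable[of t] by auto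
qed

lemma majorant_integrable_dominated:
  assumes \<phi>: "\<phi> \<in> borel_measurable borel" "\<And>x. \<phi> x \<noteq> 0 \<Longrightarrow> norm x \<le> R" "\<And>x. \<bar>\<phi> x\<bar> \<le> B"
  shows "(\<integral>\<^sup>+t. ennreal \<bar>\<phi> t\<bar> * majorant (t - s) \<partial>lborel) < \<infinity>"
proof -
  note [measurable] = \<phi>(1)
  have "(\<integral>\<^sup>+t. ennreal \<bar>\<phi> t\<bar> * majorant (t - s) \<partial>lborel) \<le> (\<integral>\<^sup>+t. ennreal B * (majorant (t + - s) * indicator (cball 0 (R + norm s)) (t + - s)) \<partial>lborel)"
  proof (intro nn_integral_mono)
    fix t
    show "ennreal \<bar>\<phi> t\<bar> * majorant (t - s) \<le> ennreal B * (majorant (t + - s) * indicator (cball 0 (R + norm s)) (t + - s))"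
    proof (cases "\<phi> t = 0")
      case False
      then have "norm (t - s) \<le> R + norm s" using \<phi>(2)[of t] norm_triangle_ineq4[of t s] by simp
      then show ?thesis using \<phi>(3)[of t] by (auto simp: indicator_def intro!: mult_right_mono ennreal_leI)
    qed simp
  qed
  also have "\<dots> = ennreal B * (\<integral>\<^sup>+t. majorant (t + - s) * indicator (cball 0 (R + norm s)) (t + - s) \<partial>lborel)"
    by (rule nn_integral_cmult) measurable
  also have "(\<integral>\<^sup>+t. majorant (t + - s) * indicator (cball 0 (R + norm s)) (t + - s) \<partial>lborel) = (\<integral>\<^sup>+t\<in>cball 0 (R + norm s). majorant t \<partial>lborel)"
    by (rule nn_integral_lborel_shift) measurable
  also have "ennreal B * \<dots> < \<infinity>"
    using majorant_finite[of "R + norm s"] by (simp add: ennreal_mult_less_top)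
  finally show ?thesis .
qed

text \<open>Used with the identity for F, to identify the distribution, and with the absolute value,
  for the norms of the kernels. The majorant dominates in both cases.\<close>

lemma kern_conv_tendsto:
  assumes \<phi>: "\<phi> \<in> borel_measurable borel" "\<And>x. \<phi> x \<noteq> 0 \<Longrightarrow> norm x \<le> R" "\<And>x. \<bar>\<phi> x\<bar> \<le> B"
    and F: "continuous_on UNIV F" "\<And>x. \<bar>F x\<bar> \<le> \<bar>x\<bar>"
  shows "(\<lambda>k. \<integral>t. \<phi> t * F (kern k (t - s)) \<partial>lborel) \<longlonglongrightarrow> (\<integral>t. \<phi> t * F (r (t - s)) \<partial>lborel)"
    "integrable lborel (\<lambda>t. \<phi> t * F (r (t - s)))"
proof -
  note [measurable] = \<phi>(1) borel_measurable_continuous_onI[OF F(1)]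
  let ?w = "\<lambda>t. enn2real (ennreal \<bar>\<phi> t\<bar> * majorant (t - s))"
  have fin: "AE t in lborel. majorant (t - s) < \<infinity>"
    using AE_lborel_shift[OF AE_majorant_finite, of "- s"] by simp
  have weq: "AE t in lborel. ennreal (?w t) = ennreal \<bar>\<phi> t\<bar> * majorant (t - s)"
    using fin by eventually_elim (simp add: ennreal_mult_less_top)
  have "(\<integral>\<^sup>+t. ennreal (?w t) \<partial>lborel) = (\<integral>\<^sup>+t. ennreal \<bar>\<phi> t\<bar> * majorant (t - s) \<partial>lborel)"
    by (rule nn_integral_cong_AE[OF weq])
  then have "(\<integral>\<^sup>+t. ennreal (?w t) \<partial>lborel) < \<infinity>" using majorant_integrable_dominated[OF \<phi>, of s] by simp
  then have iw: "integrable lborel ?w" by (intro integrableI_bounded) auto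
  have bound: "AE t in lborel. norm (\<phi> t * F (kern k (t - s))) \<le> ?w t" for k
    using weq
  proof eventually_elim
    case (elim t)
    have "ennreal (norm (\<phi> t * F (kern k (t - s)))) \<le> ennreal \<bar>\<phi> t\<bar> * ennreal \<bar>kern k (t - s)\<bar>"
      using F(2) by (subst ennreal_mult[symmetric]) (auto simp: abs_mult intro!: ennreal_leI mult_left_mono)
    also have "\<dots> \<le> ennreal (?w t)" unfolding elim by (intro mult_left_mono kern_le_majorant) simp
    finally show ?case by (subst (asm) ennreal_le_iff) auto
  qed
  have lim: "AE t in lborel. (\<lambda>k. \<phi> t * F (kern k (t - s))) \<longlonglongrightarrow> \<phi> t * F (r (t - s))"
    using fin by eventually_elim (auto intro!: tendsto_intros continuous_on_tendsto_compose[OF F(1)] kern_tendsto)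
  show "(\<lambda>k. \<integral>t. \<phi> t * F (kern k (t - s)) \<partial>lborel) \<longlonglongrightarrow> (\<integral>t. \<phi> t * F (r (t - s)) \<partial>lborel)"
    by (rule integral_dominated_convergence[where w = ?w, OF _ _ iw lim bound]) auto
  show "integrable lborel (\<lambda>t. \<phi> t * F (r (t - s)))"
    by (rule integrable_dominated_convergence[where w = ?w, OF _ _ iw lim bound]) auto
qed

lemma integral_ball_measure:
  fixes f :: "'a \<Rightarrow> real"
  assumes [measurable]: "f \<in> borel_measurable borel" and "\<And>x. f x \<noteq> 0 \<Longrightarrow> norm x \<le> R"
  shows "(\<integral>x. f x \<partial>ball_measure R) = (\<integral>x. f x \<partial>lborel)"
proof -
  have "(\<integral>x. f x \<partial>ball_measure R) = (\<integral>x. indicator (cball 0 R) x *\<^sub>R f x \<partial>lborel)"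
    unfolding ball_measure_def by (subst integral_density[symmetric]) (auto simp: ennreal_indicator)
  also have "\<dots> = (\<integral>x. f x \<partial>lborel)"
    using assms(2) by (intro Bochner_Integration.integral_cong) (auto simp: indicator_def)
  finally show ?thesis .
qed

text \<open>The variable tested against \<phi> is the noise integral of two kernels: of the given
  reflected convolution by assumption, and of the convolution with r by passing to the limit in the
  mollified identity. Injectivity of the noise integral identifies the kernels, though only almost
  everywhere on S.\<close>

lemma AE_conv_reflected:
  assumes \<phi>: "\<phi> \<in> test_functions"
  shows "AE s in lborel. s \<in> S \<longrightarrow> conv_reflected \<phi> \<rho> s = (\<integral>t. \<phi> t * r (t - s) \<partial>lborel)"
proof -
  obtain R where sm: "smooth \<phi>" and R: "\<And>x. \<phi> x \<noteq> 0 \<Longrightarrow> norm x \<le> R"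
    using \<phi> by (auto simp: test_functions_alt)
  have c\<phi>: "continuous_on UNIV \<phi>" by (rule test_functions_continuous[OF \<phi>])
  obtain B where B: "B > 0" "\<And>x. \<bar>\<phi> x\<bar> \<le> B" using bounded_if_compact_support[OF c\<phi> R] by auto
  have m[measurable]: "\<phi> \<in> borel_measurable borel" by (rule test_functions_measurable[OF \<phi>])
  \<comment> \<open>As \<phi> vanishes outside the ball, restricting the integral to it changes
    nothing; it supplies the finite measure that \<open>ni_path\<close> requires.\<close>
  define q where "q = (\<lambda>k s. \<integral>t. \<phi> t * kern k (t - s) \<partial>ball_measure R)"
  have q_eq: "q k s = (\<integral>t. \<phi> t * kern k (t - s) \<partial>lborel)" for k s
    unfolding q_def using R by (intro integral_ball_measure) auto
  have qM: "zero_ext (q k) \<in> borel_measurable borel" for k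
    unfolding zero_ext_def[abs_def] q_eq by measurable
  have q: "q k \<in> L_space \<alpha> S \<and> (AE \<omega> in M. ni (q k) \<omega> = (\<integral>t. \<phi> t * Z k t \<omega> \<partial>ball_measure R))" for k
    unfolding q_def
    by (rule ni_path[where R = R])
      (use c\<phi> qM[of k] in \<open>auto intro!: kernel_continuous bump kernel_noise_integral mollify_continuous ball_measure simp: q_def[abs_def]\<close>)
  let ?h = "\<lambda>s. \<integral>t. \<phi> t * r (t - s) \<partial>lborel"
  let ?V = "\<lambda>\<omega>. \<integral>t. Y t \<omega> * \<phi> t \<partial>lborel"
  have hM: "zero_ext ?h \<in> borel_measurable borel"
    unfolding zero_ext_def[abs_def] by measurable
  have VM: "?V \<in> borel_measurable M"
    by measurable
  have qlim: "(\<lambda>k. q k s) \<longlonglongrightarrow> ?h s" for s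
    unfolding q_eq using kern_conv_tendsto(1)[OF m R B(2), of "\<lambda>x. x" s] by simp
  have "AE \<omega> in M. \<forall>k. ni (q k) \<omega> = (\<integral>t. \<phi> t * Z k t \<omega> \<partial>ball_measure R)"
    using q by (simp add: AE_all_countable)
  with AE_mollify_tendsto AE_space have "AE \<omega> in M. (\<lambda>k. ni (q k) \<omega>) \<longlonglongrightarrow> ?V \<omega>"
  proof eventually_elim
    case (elim \<omega>)
    have [measurable]: "(\<lambda>t. Z i t \<omega>) \<in> borel_measurable borel" "(\<lambda>t. Y t \<omega>) \<in> borel_measurable borel" for i
      using elim(2) by measurable
    have iY: "integrable lborel (\<lambda>t. Y t \<omega> * \<phi> t)"
      by (rule locally_integrable_mult_test[OF Y_loc[OF elim(2)] _ m R B(2)]) measurable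
    have iZ: "integrable lborel (\<lambda>t. Z k t \<omega> * \<phi> t)" for k
    proof -
      have "integrable lborel (\<lambda>t. indicator (cball 0 R) t *\<^sub>R (Z k t \<omega> * \<phi> t))"
        using mollify_continuous[OF bump(1) elim(2), of k] c\<phi>
        by (intro borel_integrable_compact) (auto intro!: continuous_intros intro: continuous_on_subset)
      also have "(\<lambda>t. indicator (cball 0 R) t *\<^sub>R (Z k t \<omega> * \<phi> t)) = (\<lambda>t. Z k t \<omega> * \<phi> t)"
        using R by (auto simp: fun_eq_iff indicator_def)
      finally show ?thesis .
    qed
    have eq: "ni (q k) \<omega> = (\<integral>t. Z k t \<omega> * \<phi> t \<partial>lborel)" for k
    proof -
      have "ni (q k) \<omega> = (\<integral>t. \<phi> t * Z k t \<omega> \<partial>ball_measure R)" using elim by simp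
      also have "\<dots> = (\<integral>t. \<phi> t * Z k t \<omega> \<partial>lborel)" using R by (intro integral_ball_measure) auto
      finally show ?thesis by (simp add: mult.commute)
    qed
    let ?E = "\<lambda>k. \<integral>\<^sup>+t\<in>cball 0 R. ennreal \<bar>Z k t \<omega> - Y t \<omega>\<bar> \<partial>lborel"
    have le: "ennreal \<bar>ni (q k) \<omega> - ?V \<omega>\<bar> \<le> ennreal B * ?E k" for k
    proof -
      have "ennreal \<bar>ni (q k) \<omega> - ?V \<omega>\<bar> = ennreal (norm (\<integral>t. Z k t \<omega> * \<phi> t - Y t \<omega> * \<phi> t \<partial>lborel))"
        unfolding eq using iY iZ by simp
      also have "\<dots> \<le> (\<integral>\<^sup>+t. ennreal (norm (Z k t \<omega> * \<phi> t - Y t \<omega> * \<phi> t)) \<partial>lborel)"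
        using iY iZ by (intro integral_norm_bound_ennreal) auto
      also have "\<dots> \<le> (\<integral>\<^sup>+t. ennreal B * (ennreal \<bar>Z k t \<omega> - Y t \<omega>\<bar> * indicator (cball 0 R) t) \<partial>lborel)"
      proof (intro nn_integral_mono)
        fix t
        show "ennreal (norm (Z k t \<omega> * \<phi> t - Y t \<omega> * \<phi> t)) \<le> ennreal B * (ennreal \<bar>Z k t \<omega> - Y t \<omega>\<bar> * indicator (cball 0 R) t)"
        proof (cases "\<phi> t = 0")
          case False
          have "norm (Z k t \<omega> * \<phi> t - Y t \<omega> * \<phi> t) = \<bar>\<phi> t\<bar> * \<bar>Z k t \<omega> - Y t \<omega>\<bar>"
            by (simp add: left_diff_distrib[symmetric] abs_mult)
          also have "\<dots> \<le> B * \<bar>Z k t \<omega> - Y t \<omega>\<bar>" by (intro mult_right_mono B) auto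
          finally show ?thesis using R[OF False] B(1) by (simp add: ennreal_mult[symmetric] ennreal_leI)
        qed simp
      qed
      also have "\<dots> = ennreal B * ?E k" by (rule nn_integral_cmult) measurable
      finally show ?thesis .
    qed
    have "(\<lambda>k. ennreal B * ?E k) \<longlonglongrightarrow> ennreal B * 0"
      using elim by (intro ennreal_tendsto_cmult) auto
    then have "(\<lambda>k. ennreal B * ?E k) \<longlonglongrightarrow> 0" by simp
    then have "(\<lambda>k. ennreal \<bar>ni (q k) \<omega> - ?V \<omega>\<bar>) \<longlonglongrightarrow> 0"
      by (rule tendsto_sandwich[OF _ _ tendsto_const, rotated 2]) (auto simp: le)
    from finite_ennreal_tendsto_0[OF this] show ?case
      by (simp add: tendsto_rabs_zero_iff LIM_zero_iff)
  qed
  then have tip: "tendsto_in_prob M (\<lambda>k. ni (q k)) ?V"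
    using q by (intro tendsto_in_prob_AE VM ni_measurable) auto
  have "AE s in lborel. s \<in> S \<longrightarrow> (\<lambda>k. q k s) \<longlonglongrightarrow> ?h s" using qlim by auto
  from ni_limit[OF _ VM tip hM this] q have h: "?h \<in> L_space \<alpha> S" "AE \<omega> in M. ni ?h \<omega> = ?V \<omega>" by auto
  have "AE \<omega> in M. ni (conv_reflected \<phi> \<rho>) \<omega> = ni ?h \<omega>"
    using h(2) Y_rep[OF \<phi>] by eventually_elim simp
  then show ?thesis using ni_eq_AE_iff[OF conv[OF \<phi>] h(1)] by simp
qed

text \<open>For each test function the identity is known only at almost every s in S, which may be a
  small set. It is applied to all translates of \<phi>; after an exchange of quantifiers it holds at
  one s of S for almost every translate, and these translates sweep out the whole space. Continuity
  of both sides in the translation then gives the untranslated case.\<close>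

theorem represented_by_r: "represented_by \<rho> r"
  unfolding represented_by_def
proof (intro conjI ballI)
  fix \<phi> :: "'a \<Rightarrow> real" assume \<phi>: "\<phi> \<in> test_functions"
  have m[measurable]: "\<phi> \<in> borel_measurable borel" by (rule test_functions_measurable[OF \<phi>])
  define d where "d = (\<lambda>z. \<rho> (\<lambda>x. \<phi> (x + z)) - (\<integral>x. r x * \<phi> (x + z) \<partial>lborel))"
  have dc: "continuous_on UNIV d"
    unfolding d_def by (intro continuous_intros distribution_shift_continuous \<rho> \<phi> conv_test_continuous r_locally_integrable r_measurable)
  have dM[measurable]: "d \<in> borel_measurable borel" using dc by (rule borel_measurable_continuous_onI)
  have "AE s in lborel. s \<in> S \<longrightarrow> d (s - y) = 0" for y
    using AE_conv_reflected[OF test_functions_shift[OF \<phi>, of "- y"]]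
  proof eventually_elim
    case (elim s)
    have "(\<integral>t. \<phi> (t + - y) * r (t - s) \<partial>lborel) = (\<integral>t. \<phi> (t + s + - y) * r (t + s - s) \<partial>lborel)"
      by (rule integral_lborel_shift[symmetric]) measurable
    also have "\<dots> = (\<integral>x. r x * \<phi> (x + (s - y)) \<partial>lborel)"
      by (simp add: algebra_simps)
    finally show ?case
      using elim by (simp add: d_def conv_reflected_def algebra_simps)
  qed
  then have "AE y in lborel. AE s in lborel. s \<in> S \<longrightarrow> d (s - y) = 0" by simp
  moreover have "{p \<in> space (lborel \<Otimes>\<^sub>M lborel). snd p \<in> S \<longrightarrow> d (snd p - fst p) = 0} \<in> sets (lborel \<Otimes>\<^sub>M (lborel :: 'a measure))"
    by measurable
  ultimately have "AE s in lborel. AE y in lborel. s \<in> S \<longrightarrow> d (s - y) = 0"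
    by (subst lborel_pair.AE_commute[symmetric]) auto
  moreover have "\<not> (AE s in lborel. s \<notin> S)"
    using S_pos by (subst AE_iff_measurable[where N = S]) auto
  ultimately have "\<exists>s. s \<in> S \<and> (AE y in lborel. s \<in> S \<longrightarrow> d (s - y) = 0)"
    by (metis (mono_tags, lifting) eventually_mono)
  then obtain s where "AE y in lborel. d (s - y) = 0" by auto
  from AE_lborel_reflect[OF this, of s] have "AE y in lborel. d y = 0" by simp
  from continuous_AE_eq_0[OF dc this, of 0] show "\<rho> \<phi> = (\<integral>x. r x * \<phi> x \<partial>lborel)"
    by (simp add: d_def)
qed (use r_locally_integrable in auto)

end

section \<open>Integrability conditions\<close>

lemma weighted_lborel:
  fixes \<psi> :: "'a::euclidean_space \<Rightarrow> real"
  assumes \<psi>: "\<psi> \<in> test_functions"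
  shows "sets (weighted_lborel \<psi>) = sets borel" "finite_measure (weighted_lborel \<psi>)"
    "\<exists>R. AE x in weighted_lborel \<psi>. norm x \<le> R"
proof -
  obtain R where sm: "smooth \<psi>" and R: "\<And>x. \<psi> x \<noteq> 0 \<Longrightarrow> norm x \<le> R"
    using \<psi> by (auto simp: test_functions_alt)
  have c: "continuous_on UNIV \<psi>" by (rule test_functions_continuous[OF \<psi>])
  have m[measurable]: "\<psi> \<in> borel_measurable borel" by (rule test_functions_measurable[OF \<psi>])
  show "sets (weighted_lborel \<psi>) = sets borel" by (simp add: weighted_lborel_def)
  have "integrable lborel (\<lambda>x. indicator (cball 0 R) x *\<^sub>R \<psi> x)"
    using c by (intro borel_integrable_compact) (auto intro: continuous_on_subset)
  also have "(\<lambda>x. indicator (cball 0 R) x *\<^sub>R \<psi> x) = \<psi>"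
    using R by (auto simp: fun_eq_iff indicator_def)
  finally have "(\<integral>\<^sup>+x. ennreal \<bar>\<psi> x\<bar> \<partial>lborel) < \<infinity>" by (simp add: integrable_iff_bounded)
  then show "finite_measure (weighted_lborel \<psi>)"
    by (intro finite_measureI) (simp add: weighted_lborel_def emeasure_density less_top)
  have "AE x in weighted_lborel \<psi>. norm x \<le> R"
    unfolding weighted_lborel_def using R by (subst AE_density) auto
  then show "\<exists>R. AE x in weighted_lborel \<psi>. norm x \<le> R" ..
qed

lemma lnp_mult_le: "0 < x \<Longrightarrow> 0 < y \<Longrightarrow> lnp (x * y) \<le> lnp x + lnp y"
  by (auto simp: lnp_def ln_mult)

lemma (in prob_space) finite_rv_small_tail:
  fixes N :: "'a \<Rightarrow> real"
  assumes [measurable]: "N \<in> borel_measurable M" and "d > 0"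
  shows "\<exists>x>0. prob {\<omega>\<in>space M. N \<omega> \<ge> x} < d"
proof -
  have "tendsto_in_prob M (\<lambda>n \<omega>. inverse (real (Suc n)) * N \<omega>) (\<lambda>_. 0)"
  proof (rule tendsto_in_prob_AE)
    show "AE \<omega> in M. (\<lambda>n. inverse (real (Suc n)) * N \<omega>) \<longlonglongrightarrow> 0"
      by (intro AE_I2 tendsto_mult_left_zero LIMSEQ_inverse_real_of_nat)
  qed auto
  then have "(\<lambda>n. prob {\<omega>\<in>space M. \<bar>inverse (real (Suc n)) * N \<omega> - 0\<bar> > 1/2}) \<longlonglongrightarrow> 0"
    unfolding tendsto_in_prob_def by (meson half_gt_zero_iff zero_less_one)
  from order_tendstoD(2)[OF this \<open>d > 0\<close>] obtain n where
    n: "prob {\<omega>\<in>space M. \<bar>inverse (real (Suc n)) * N \<omega> - 0\<bar> > 1/2} < d"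
    by (auto simp: eventually_sequentially)
  have "prob {\<omega>\<in>space M. N \<omega> \<ge> real (Suc n)} \<le> prob {\<omega>\<in>space M. \<bar>inverse (real (Suc n)) * N \<omega> - 0\<bar> > 1/2}"
  proof (intro finite_measure_mono subsetI)
    fix \<omega> assume "\<omega> \<in> {\<omega>\<in>space M. N \<omega> \<ge> real (Suc n)}"
    then have "\<omega> \<in> space M" "1 \<le> inverse (real (Suc n)) * N \<omega>" by (auto simp: field_simps)
    then show "\<omega> \<in> {\<omega>\<in>space M. \<bar>inverse (real (Suc n)) * N \<omega> - 0\<bar> > 1/2}" by simp
  qed auto
  with n show ?thesis by (intro exI[of _ "real (Suc n)"]) auto
qed

section \<open>Path norm and kernel norm for a fixed weight\<close>

locale weighted_solution = random_field_solution M \<alpha> S W \<rho> Y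
  for M :: "'w measure" and \<alpha> :: real and S :: "'a::euclidean_space set" and W :: "'a set \<Rightarrow> 'w \<Rightarrow> real"
    and \<rho> :: "('a \<Rightarrow> real) \<Rightarrow> real" and Y :: "'a \<Rightarrow> 'w \<Rightarrow> real" +
  fixes \<psi> :: "'a \<Rightarrow> real"
  assumes \<psi>: "\<psi> \<in> test_functions"
begin

definition R where "R = (SOME R. \<forall>x. \<psi> x \<noteq> 0 \<longrightarrow> norm x \<le> R)"

lemma R: "\<psi> x \<noteq> 0 \<Longrightarrow> norm x \<le> R"
proof -
  have "\<exists>R. \<forall>x. \<psi> x \<noteq> 0 \<longrightarrow> norm x \<le> R" using \<psi> by (auto simp: test_functions_alt)
  from someI_ex[OF this, folded R_def] show "\<psi> x \<noteq> 0 \<Longrightarrow> norm x \<le> R" by blast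
qed

lemma \<psi>_continuous: "continuous_on UNIV \<psi>" by (rule test_functions_continuous[OF \<psi>])

lemma \<psi>_measurable [measurable]: "\<psi> \<in> borel_measurable borel" by (rule test_functions_measurable[OF \<psi>])

lemma \<psi>_bounded: "\<exists>B>0. \<forall>x. \<bar>\<psi> x\<bar> \<le> B"
  using bounded_if_compact_support[OF \<psi>_continuous R] by metis

abbreviation \<mu> :: "'a measure" where "\<mu> \<equiv> weighted_lborel \<psi>"

lemma sets_\<mu> [measurable_cong, simp]: "sets \<mu> = sets borel"
  by (rule weighted_lborel(1)[OF \<psi>])

lemma space_\<mu> [simp]: "space \<mu> = UNIV"
  using sets_eq_imp_space_eq[OF sets_\<mu>] by simp

sublocale \<mu>: finite_measure \<mu>
  by (rule weighted_lborel(2)[OF \<psi>])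

lemma AE_\<mu>: "(AE x in lborel. P x) \<Longrightarrow> AE x in \<mu>. P x"
  unfolding weighted_lborel_def by (subst AE_density) (auto elim: eventually_mono)

lemma nn_integral_\<mu>:
  "f \<in> borel_measurable borel \<Longrightarrow> (\<integral>\<^sup>+x. f x \<partial>\<mu>) = (\<integral>\<^sup>+x. ennreal \<bar>\<psi> x\<bar> * f x \<partial>lborel)"
  unfolding weighted_lborel_def by (subst nn_integral_density) auto

lemma integral_\<mu>:
  fixes f :: "'a \<Rightarrow> real"
  shows "f \<in> borel_measurable borel \<Longrightarrow> (\<integral>x. f x \<partial>\<mu>) = (\<integral>x. \<bar>\<psi> x\<bar> * f x \<partial>lborel)"
  unfolding weighted_lborel_def by (subst integral_density) auto

definition N :: "'w \<Rightarrow> real" where "N \<omega> = (\<integral>t. \<bar>Y t \<omega>\<bar> \<partial>\<mu>)"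
definition G :: "'a \<Rightarrow> real" where "G s = (\<integral>t. \<bar>r (t - s)\<bar> \<partial>\<mu>)"
definition Nk :: "nat \<Rightarrow> 'w \<Rightarrow> real" where "Nk k \<omega> = (\<integral>t. \<bar>Z k t \<omega>\<bar> \<partial>\<mu>)"
definition Gk :: "nat \<Rightarrow> 'a \<Rightarrow> real" where "Gk k s = (\<integral>t. \<bar>kern k (t - s)\<bar> \<partial>\<mu>)"

lemma N_measurable [measurable]: "N \<in> borel_measurable M"
  unfolding N_def by measurable

lemma Nk_measurable [measurable]: "Nk k \<in> borel_measurable M"
  unfolding Nk_def by measurable

lemma G_measurable [measurable]: "G \<in> borel_measurable borel"
  unfolding G_def by measurable

lemma Gk_measurable [measurable]: "Gk k \<in> borel_measurable borel"
  unfolding Gk_def by measurable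

lemma nonneg: "N \<omega> \<ge> 0" "G s \<ge> 0" "Nk k \<omega> \<ge> 0" "Gk k s \<ge> 0"
  by (auto simp: N_def G_def Nk_def Gk_def)

lemma Gk_tendsto: "(\<lambda>k. Gk k s) \<longlonglongrightarrow> G s"
  and G_nn_integral: "(\<integral>\<^sup>+t. ennreal \<bar>r (t - s)\<bar> \<partial>\<mu>) = ennreal (G s)"
proof -
  obtain B where B: "\<And>x. \<bar>\<psi> x\<bar> \<le> B" using \<psi>_bounded by blast
  have c: "continuous_on UNIV (abs :: real \<Rightarrow> real)" by (intro continuous_intros)
  have *: "(\<lambda>k. \<integral>t. \<bar>\<psi> t\<bar> * \<bar>kern k (t - s)\<bar> \<partial>lborel) \<longlonglongrightarrow> (\<integral>t. \<bar>\<psi> t\<bar> * \<bar>r (t - s)\<bar> \<partial>lborel)"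
    "integrable lborel (\<lambda>t. \<bar>\<psi> t\<bar> * \<bar>r (t - s)\<bar>)"
    using kern_conv_tendsto[of "\<lambda>t. \<bar>\<psi> t\<bar>" R B abs s, OF _ _ _ c] R B by auto
  show "(\<lambda>k. Gk k s) \<longlonglongrightarrow> G s"
    unfolding Gk_def G_def using *(1) by (simp add: integral_\<mu>)
  have "(\<integral>\<^sup>+t. ennreal \<bar>r (t - s)\<bar> \<partial>\<mu>) = (\<integral>\<^sup>+t. ennreal (\<bar>\<psi> t\<bar> * \<bar>r (t - s)\<bar>) \<partial>lborel)"
    by (subst nn_integral_\<mu>) (auto simp: ennreal_mult)
  also have "\<dots> = ennreal (\<integral>t. \<bar>\<psi> t\<bar> * \<bar>r (t - s)\<bar> \<partial>lborel)"
    by (intro nn_integral_eq_integral *) auto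
  finally show "(\<integral>\<^sup>+t. ennreal \<bar>r (t - s)\<bar> \<partial>\<mu>) = ennreal (G s)"
    by (simp add: G_def integral_\<mu>)
qed

lemma Y_integrable_\<mu>:
  assumes \<omega>: "\<omega> \<in> space M"
  shows "integrable \<mu> (\<lambda>t. Y t \<omega>)"
proof -
  obtain B where B: "\<And>x. \<bar>\<psi> x\<bar> \<le> B" using \<psi>_bounded by blast
  have [measurable]: "(\<lambda>t. Y t \<omega>) \<in> borel_measurable borel" using \<omega> by measurable
  have "integrable lborel (\<lambda>t. Y t \<omega> * \<bar>\<psi> t\<bar>)"
    using R B by (intro locally_integrable_mult_test[OF Y_loc[OF \<omega>]]) auto
  then show ?thesis
    unfolding weighted_lborel_def by (subst integrable_density) (auto simp: mult.commute)
qed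

lemma N_nn_integral: "\<omega> \<in> space M \<Longrightarrow> (\<integral>\<^sup>+t. ennreal \<bar>Y t \<omega>\<bar> \<partial>\<mu>) = ennreal (N \<omega>)"
  unfolding N_def using Y_integrable_\<mu> by (intro nn_integral_eq_integral integrable_abs) auto

lemma AE_Nk_tendsto: "AE \<omega> in M. (\<lambda>k. Nk k \<omega>) \<longlonglongrightarrow> N \<omega>"
  using AE_mollify_tendsto AE_space
proof eventually_elim
  case (elim \<omega>)
  obtain B where B: "B > 0" "\<And>x. \<bar>\<psi> x\<bar> \<le> B" using \<psi>_bounded by blast
  have [measurable]: "(\<lambda>t. Z i t \<omega>) \<in> borel_measurable borel" "(\<lambda>t. Y t \<omega>) \<in> borel_measurable borel" for i
    using elim(2) by measurable
  let ?E = "\<lambda>k. \<integral>\<^sup>+t\<in>cball 0 R. ennreal \<bar>Z k t \<omega> - Y t \<omega>\<bar> \<partial>lborel"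
  have le1: "(\<integral>\<^sup>+t. ennreal \<bar>Z k t \<omega> - Y t \<omega>\<bar> \<partial>\<mu>) \<le> ennreal B * ?E k" for k
  proof -
    have "(\<integral>\<^sup>+t. ennreal \<bar>Z k t \<omega> - Y t \<omega>\<bar> \<partial>\<mu>) = (\<integral>\<^sup>+t. ennreal \<bar>\<psi> t\<bar> * ennreal \<bar>Z k t \<omega> - Y t \<omega>\<bar> \<partial>lborel)"
      by (rule nn_integral_\<mu>) measurable
    also have "\<dots> \<le> (\<integral>\<^sup>+t. ennreal B * (ennreal \<bar>Z k t \<omega> - Y t \<omega>\<bar> * indicator (cball 0 R) t) \<partial>lborel)"
    proof (intro nn_integral_mono)
      fix t
      show "ennreal \<bar>\<psi> t\<bar> * ennreal \<bar>Z k t \<omega> - Y t \<omega>\<bar> \<le> ennreal B * (ennreal \<bar>Z k t \<omega> - Y t \<omega>\<bar> * indicator (cball 0 R) t)"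
        using R[of t] B(2)[of t] by (cases "\<psi> t = 0") (auto intro!: mult_right_mono ennreal_leI)
    qed
    also have "\<dots> = ennreal B * ?E k" by (rule nn_integral_cmult) measurable
    finally show ?thesis .
  qed
  have "(\<lambda>k. ennreal B * ?E k) \<longlonglongrightarrow> ennreal B * 0"
    using elim by (intro ennreal_tendsto_cmult) auto
  then have lim: "(\<lambda>k. ennreal B * ?E k) \<longlonglongrightarrow> 0" by simp
  have iZ: "integrable \<mu> (\<lambda>t. Z k t \<omega>)" for k
  proof -
    have "integrable lborel (\<lambda>t. indicator (cball 0 R) t *\<^sub>R (\<bar>\<psi> t\<bar> * Z k t \<omega>))"
      using mollify_continuous[OF bump(1) elim(2), of k] \<psi>_continuous
      by (intro borel_integrable_compact) (auto intro!: continuous_intros intro: continuous_on_subset)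
    also have "(\<lambda>t. indicator (cball 0 R) t *\<^sub>R (\<bar>\<psi> t\<bar> * Z k t \<omega>)) = (\<lambda>t. \<bar>\<psi> t\<bar> * Z k t \<omega>)"
      using R by (auto simp: fun_eq_iff indicator_def)
    finally show ?thesis unfolding weighted_lborel_def by (subst integrable_density) auto
  qed
  note iY = Y_integrable_\<mu>[OF elim(2)]
  have le2: "ennreal \<bar>Nk k \<omega> - N \<omega>\<bar> \<le> ennreal B * ?E k" for k
  proof -
    have "\<bar>Nk k \<omega> - N \<omega>\<bar> = \<bar>\<integral>t. \<bar>Z k t \<omega>\<bar> - \<bar>Y t \<omega>\<bar> \<partial>\<mu>\<bar>"
      unfolding Nk_def N_def using iZ iY by simp
    also have "\<dots> \<le> (\<integral>t. \<bar>\<bar>Z k t \<omega>\<bar> - \<bar>Y t \<omega>\<bar>\<bar> \<partial>\<mu>)"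
      by (rule integral_abs_bound)
    also have "\<dots> \<le> (\<integral>t. \<bar>Z k t \<omega> - Y t \<omega>\<bar> \<partial>\<mu>)"
      using iZ iY by (intro integral_mono) auto
    finally have "ennreal \<bar>Nk k \<omega> - N \<omega>\<bar> \<le> ennreal (\<integral>t. \<bar>Z k t \<omega> - Y t \<omega>\<bar> \<partial>\<mu>)" by (rule ennreal_leI)
    also have "\<dots> = (\<integral>\<^sup>+t. ennreal \<bar>Z k t \<omega> - Y t \<omega>\<bar> \<partial>\<mu>)"
      using iZ iY by (intro nn_integral_eq_integral[symmetric]) auto
    also note le1
    finally show ?thesis .
  qed
  have "(\<lambda>k. ennreal \<bar>Nk k \<omega> - N \<omega>\<bar>) \<longlonglongrightarrow> 0"
    by (rule tendsto_sandwich[OF _ _ tendsto_const lim]) (auto simp: le2)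
  from finite_ennreal_tendsto_0[OF this] show ?case
    by (simp add: tendsto_rabs_zero_iff LIM_zero_iff)
qed

lemma Nk_tendsto_in_prob: "tendsto_in_prob M Nk N"
  by (rule tendsto_in_prob_AE[OF _ _ AE_Nk_tendsto]) auto

lemma zero_ext_measurable_of: "f \<in> borel_measurable borel \<Longrightarrow> zero_ext f \<in> borel_measurable borel"
  unfolding zero_ext_def[abs_def] by measurable

lemma Gk_levy: "levy_bound (Nk k) (Gk k)"
proof -
  obtain R' where R': "AE x in \<mu>. norm x \<le> R'" using weighted_lborel(3)[OF \<psi>] by blast
  show ?thesis
    unfolding Nk_def Gk_def
    by (rule levy_bound_path[OF _ _ _ _ _ _ _ R'])
      (auto intro!: kernel_continuous bump kernel_noise_integral mollify_continuous \<mu>.finite_measure_axioms)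
qed

lemma levy_bound_solution: "levy_bound N G"
  by (rule levy_bound_limit[OF Gk_levy _ _ Nk_tendsto_in_prob])
    (auto intro!: zero_ext_measurable_of nonneg Gk_tendsto)

text \<open>A finite random variable exceeds some level with probability below any given threshold,
  so the conditional bound becomes an unconditional one.\<close>

lemma condition_lt_1_solution: "condition_lt_1 \<alpha> S r \<psi>"
proof -
  obtain x where x: "x > 0" "prob {\<omega>\<in>space M. N \<omega> \<ge> x} < tail_const \<alpha> / 8"
    using finite_rv_small_tail[OF N_measurable, of "tail_const \<alpha> / 8"] tail_const(1)[of \<alpha>] by auto
  have "(\<integral>\<^sup>+s\<in>S. ennreal_powr (\<integral>\<^sup>+t. ennreal \<bar>r (t - s)\<bar> \<partial>\<mu>) \<alpha> \<partial>lborel) = (\<integral>\<^sup>+s\<in>S. ennreal (G s powr \<alpha>) \<partial>lborel)"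
    unfolding G_nn_integral by (simp add: ennreal_powr_def nonneg)
  also have "\<dots> \<le> ennreal (x powr \<alpha> / tail_const \<alpha>)"
    using levy_bound_solution x unfolding levy_bound_def by blast
  also have "\<dots> < \<infinity>" by simp
  finally show ?thesis unfolding condition_lt_1_def .
qed

section \<open>Scales and truncated means\<close>

definition good :: "'a \<Rightarrow> bool" where
  "good t \<longleftrightarrow> (\<lambda>s. r (t - s)) \<in> L_space \<alpha> S \<and> (AE \<omega> in M. ni (\<lambda>s. r (t - s)) \<omega> = Y t \<omega>)"

lemma AE_good: "AE t in \<mu>. good t"
  using AE_\<mu>[OF AE_noise_integral_r] unfolding good_def .

text \<open>Outside an event of small probability the stable variable \<open>Y t\<close> still exceeds its scale with a probability
  that does not depend on \<open>t\<close>.\<close>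

lemma scale_le:
  assumes "good t" and small: "prob {\<omega>\<in>space M. N \<omega> \<ge> x} < tail_const \<alpha> / 8"
  shows "ennreal (enn2real (energy (\<lambda>s. r (t - s))) powr (1 / \<alpha>)) \<le>
    ennreal (2 / tail_const \<alpha>) * (\<integral>\<^sup>+\<omega>. ennreal \<bar>Y t \<omega>\<bar> * indicator {\<omega>. N \<omega> < x} \<omega> \<partial>M)"
proof -
  define sg where "sg = enn2real (energy (\<lambda>s. r (t - s)))"
  define u where "u = sg powr (1 / \<alpha>)"
  have c: "tail_const \<alpha> > 0" by (rule tail_const)
  have [measurable]: "Y t \<in> borel_measurable M" by measurable
  show ?thesis
  proof (cases "sg = 0")
    case False
    then have "sg > 0" by (simp add: sg_def less_le)
    then have u: "u > 0" "sg * u powr - \<alpha> = 1" using \<alpha> by (auto simp: u_def powr_powr powr_minus)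
    have st: "symmetric_stable M \<alpha> sg (Y t)"
      unfolding sg_def using assms(1) unfolding good_def
      by (intro symmetric_stable_cong_AE[OF ni_stable]) auto
    have "tail_const \<alpha> \<le> prob {\<omega>\<in>space M. \<bar>Y t \<omega>\<bar> > u}"
      using stable_tail_lower[OF \<alpha> st u(1)] u(2) by simp
    also have "\<dots> \<le> prob ({\<omega>\<in>space M. \<bar>Y t \<omega>\<bar> > u \<and> N \<omega> < x} \<union> {\<omega>\<in>space M. N \<omega> \<ge> x})"
      by (intro finite_measure_mono) auto
    also have "\<dots> \<le> prob {\<omega>\<in>space M. \<bar>Y t \<omega>\<bar> > u \<and> N \<omega> < x} + prob {\<omega>\<in>space M. N \<omega> \<ge> x}"
      by (rule measure_Un_le) auto
    \<comment> \<open>Removing an event of probability below \<open>tail_const \<alpha> / 8\<close>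
      from a tail of at least \<open>tail_const \<alpha>\<close> leaves more than half of
      it.\<close>
    finally have "tail_const \<alpha> / 2 \<le> prob {\<omega>\<in>space M. \<bar>Y t \<omega>\<bar> > u \<and> N \<omega> < x}"
      using small c by linarith
    then have "u * (tail_const \<alpha> / 2) \<le> u * prob {\<omega>\<in>space M. \<bar>Y t \<omega>\<bar> > u \<and> N \<omega> < x}"
      using u by (intro mult_left_mono) auto
    then have "ennreal (u * (tail_const \<alpha> / 2)) \<le> ennreal (u * prob {\<omega>\<in>space M. \<bar>Y t \<omega>\<bar> > u \<and> N \<omega> < x})"
      by (rule ennreal_leI)
    also have "\<dots> = (\<integral>\<^sup>+\<omega>. ennreal u * indicator {\<omega>\<in>space M. \<bar>Y t \<omega>\<bar> > u \<and> N \<omega> < x} \<omega> \<partial>M)"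
      using u by (subst nn_integral_cmult_indicator) (auto simp: emeasure_eq_measure ennreal_mult)
    also have "\<dots> \<le> (\<integral>\<^sup>+\<omega>. ennreal \<bar>Y t \<omega>\<bar> * indicator {\<omega>. N \<omega> < x} \<omega> \<partial>M)"
      by (intro nn_integral_mono) (auto simp: indicator_def intro!: ennreal_leI)
    finally have "ennreal (2 / tail_const \<alpha>) * ennreal (u * (tail_const \<alpha> / 2)) \<le>
        ennreal (2 / tail_const \<alpha>) * (\<integral>\<^sup>+\<omega>. ennreal \<bar>Y t \<omega>\<bar> * indicator {\<omega>. N \<omega> < x} \<omega> \<partial>M)"
      by (intro mult_left_mono) auto
    also have "ennreal (2 / tail_const \<alpha>) * ennreal (u * (tail_const \<alpha> / 2)) = ennreal u"
      using c u by (subst ennreal_mult[symmetric]) auto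
    finally show ?thesis unfolding u_def sg_def .
  qed (use \<alpha> in \<open>simp add: sg_def[symmetric]\<close>)
qed

text \<open>Exchanging the integrals leaves the mean over A of the path norm, which is at most x
  there. The restriction to A makes the mean finite although Y t itself may have none.\<close>

lemma integral_truncated_le:
  assumes A: "\<And>\<omega>. \<omega> \<in> space M \<Longrightarrow> \<omega> \<in> A \<Longrightarrow> N \<omega> \<le> x" and A': "A \<inter> space M \<in> events" and "0 \<le> x"
  shows "(\<integral>\<^sup>+t. (\<integral>\<^sup>+\<omega>. ennreal \<bar>Y t \<omega>\<bar> * indicator A \<omega> \<partial>M) \<partial>\<mu>) \<le> ennreal x"
    "(\<lambda>t. \<integral>\<^sup>+\<omega>. ennreal \<bar>Y t \<omega>\<bar> * indicator A \<omega> \<partial>M) \<in> borel_measurable borel"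
proof -
  interpret P: pair_sigma_finite \<mu> M ..
  have eq: "(\<integral>\<^sup>+\<omega>. ennreal \<bar>Y t \<omega>\<bar> * indicator A \<omega> \<partial>M) = (\<integral>\<^sup>+\<omega>. ennreal \<bar>Y t \<omega>\<bar> * indicator (A \<inter> space M) \<omega> \<partial>M)" for t
    by (intro nn_integral_cong) (auto simp: indicator_def)
  note [measurable] = A'
  have m: "(\<lambda>(t, \<omega>). ennreal \<bar>Y t \<omega>\<bar> * indicator (A \<inter> space M) \<omega>) \<in> borel_measurable (\<mu> \<Otimes>\<^sub>M M)"
    by measurable
  show "(\<lambda>t. \<integral>\<^sup>+\<omega>. ennreal \<bar>Y t \<omega>\<bar> * indicator A \<omega> \<partial>M) \<in> borel_measurable borel"
    unfolding eq by measurable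
  have "(\<integral>\<^sup>+t. (\<integral>\<^sup>+\<omega>. ennreal \<bar>Y t \<omega>\<bar> * indicator A \<omega> \<partial>M) \<partial>\<mu>) = (\<integral>\<^sup>+\<omega>. (\<integral>\<^sup>+t. ennreal \<bar>Y t \<omega>\<bar> * indicator (A \<inter> space M) \<omega> \<partial>\<mu>) \<partial>M)"
    unfolding eq using P.Fubini'[OF m] by simp
  also have "\<dots> \<le> (\<integral>\<^sup>+\<omega>. ennreal x \<partial>M)"
  proof (intro nn_integral_mono)
    fix \<omega> assume \<omega>: "\<omega> \<in> space M"
    have [measurable]: "(\<lambda>t. Y t \<omega>) \<in> borel_measurable borel" using \<omega> by measurable
    have "(\<integral>\<^sup>+t. ennreal \<bar>Y t \<omega>\<bar> * indicator (A \<inter> space M) \<omega> \<partial>\<mu>) = ennreal (N \<omega>) * indicator (A \<inter> space M) \<omega>"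
      using N_nn_integral[OF \<omega>] by (subst nn_integral_multc) auto
    also have "\<dots> \<le> ennreal x"
      using A[OF \<omega>] by (auto simp: indicator_def intro!: ennreal_leI)
    finally show "(\<integral>\<^sup>+t. ennreal \<bar>Y t \<omega>\<bar> * indicator (A \<inter> space M) \<omega> \<partial>\<mu>) \<le> ennreal x" .
  qed
  also have "\<dots> = ennreal x" by (simp add: emeasure_space_1)
  finally show "(\<integral>\<^sup>+t. (\<integral>\<^sup>+\<omega>. ennreal \<bar>Y t \<omega>\<bar> * indicator A \<omega> \<partial>M) \<partial>\<mu>) \<le> ennreal x" .
qed

text \<open>The integral over t of the bound in \<open>scale_le\<close>. At \<alpha> = 1 the
  conclusion is the finiteness of the total integral of the kernel, and it is used in this form for
  the logarithmic condition.\<close>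

lemma condition_gt_1_solution: "condition_gt_1 \<alpha> S r \<psi>"
proof -
  obtain x where x: "x > 0" "prob {\<omega>\<in>space M. N \<omega> \<ge> x} < tail_const \<alpha> / 8"
    using finite_rv_small_tail[OF N_measurable, of "tail_const \<alpha> / 8"] tail_const(1)[of \<alpha>] by auto
  have ev: "{\<omega>. N \<omega> < x} \<inter> space M \<in> events"
  proof -
    have "{\<omega>. N \<omega> < x} \<inter> space M = {\<omega>\<in>space M. N \<omega> < x}" by auto
    then show ?thesis by simp
  qed
  let ?h = "\<lambda>t. \<integral>\<^sup>+\<omega>. ennreal \<bar>Y t \<omega>\<bar> * indicator {\<omega>. N \<omega> < x} \<omega> \<partial>M"
  have h: "(\<integral>\<^sup>+t. ?h t \<partial>\<mu>) \<le> ennreal x" and [measurable]: "?h \<in> borel_measurable borel"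
    using integral_truncated_le[OF _ ev, of x] x by auto
  have "(\<integral>\<^sup>+t. ennreal_powr (\<integral>\<^sup>+s\<in>S. ennreal (\<bar>r (t - s)\<bar> powr \<alpha>) \<partial>lborel) (1 / \<alpha>) \<partial>\<mu>) \<le> (\<integral>\<^sup>+t. ennreal (2 / tail_const \<alpha>) * ?h t \<partial>\<mu>)"
  proof (rule nn_integral_mono_AE)
    show "AE t in \<mu>. ennreal_powr (\<integral>\<^sup>+s\<in>S. ennreal (\<bar>r (t - s)\<bar> powr \<alpha>) \<partial>lborel) (1 / \<alpha>) \<le> ennreal (2 / tail_const \<alpha>) * ?h t"
      using AE_good
    proof eventually_elim
      case (elim t)
      then have "energy (\<lambda>s. r (t - s)) < \<infinity>" by (simp add: good_def L_space_iff)
      then have "ennreal_powr (energy (\<lambda>s. r (t - s))) (1 / \<alpha>) = ennreal (enn2real (energy (\<lambda>s. r (t - s))) powr (1 / \<alpha>))"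
        by (simp add: ennreal_powr_def)
      with scale_le[OF elim x(2)] show ?case by (simp add: energy_def)
    qed
  qed
  also have "\<dots> = ennreal (2 / tail_const \<alpha>) * (\<integral>\<^sup>+t. ?h t \<partial>\<mu>)"
    by (rule nn_integral_cmult) measurable
  also have "\<dots> < \<infinity>"
    using h by (auto simp: ennreal_mult_less_top intro: order_le_less_trans)
  finally show ?thesis unfolding condition_gt_1_def .
qed

end

text \<open>The argument factors into 48 T / x, whose logarithm depends on neither t nor s, and the
  argument of the logarithm in \<open>log_bound\<close>.\<close>

lemma log_plus_quotient_le:
  fixes F G T x z :: real
  assumes "0 < F" "0 < G" "0 \<le> T" "0 < x" "0 < z"
  shows "log_plus ((ennreal z * ennreal T) / (ennreal F * ennreal G)) \<le>
    ennreal (lnp (48 * T / x)) + ennreal (lnp (x * z / (48 * F * G)))"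
proof -
  have "(ennreal z * ennreal T) / (ennreal F * ennreal G) = ennreal (z * T / (F * G))"
    using assms by (simp add: ennreal_mult[symmetric] divide_ennreal)
  then have "log_plus ((ennreal z * ennreal T) / (ennreal F * ennreal G)) = ennreal (lnp (z * T / (F * G)))"
    using assms by (simp add: log_plus_def lnp_def)
  also have "lnp (z * T / (F * G)) \<le> lnp (48 * T / x) + lnp (x * z / (48 * F * G))"
  proof (cases "T = 0")
    case True
    then show ?thesis using lnp_nonneg by (simp add: lnp_def)
  next
    case False
    then have "lnp (48 * T / x * (x * z / (48 * F * G))) \<le> lnp (48 * T / x) + lnp (x * z / (48 * F * G))"
      using assms by (intro lnp_mult_le) auto
    moreover have "48 * T / x * (x * z / (48 * F * G)) = z * T / (F * G)"
      using assms by (simp add: field_simps)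
    ultimately show ?thesis by simp
  qed
  also have "ennreal (lnp (48 * T / x) + lnp (x * z / (48 * F * G))) =
      ennreal (lnp (48 * T / x)) + ennreal (lnp (x * z / (48 * F * G)))"
    by (intro ennreal_plus lnp_nonneg)
  finally show ?thesis by (simp add: ennreal_leI)
qed

context weighted_solution
begin

text \<open>A single t has no mass under \<mu>, so N does not dominate the coordinate at t. Adding
  this coordinate with weight e amounts to a point mass at t, to be removed by letting e tend to
  0.\<close>

lemma log_bound_regularized:
  assumes "\<alpha> = 1" "(\<lambda>s. r (t - s)) \<in> L_space \<alpha> S" "e > 0"
  shows "log_bound (ni (\<lambda>s. r (t - s))) (\<lambda>s. r (t - s))
    (\<lambda>\<omega>. e * \<bar>ni (\<lambda>s. r (t - s)) \<omega>\<bar> + N \<omega>) (\<lambda>s. e * \<bar>r (t - s)\<bar> + G s)"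
proof -
  let ?h = "\<lambda>s. r (t - s)"
  obtain R' where R': "AE x in \<mu>. norm x \<le> R'" using weighted_lborel(3)[OF \<psi>] by blast
  note [measurable] = ni_measurable[OF assms(2)]
  have lb: "log_bound (ni ?h) ?h (\<lambda>\<omega>. e * \<bar>ni ?h \<omega>\<bar> + Nk k \<omega>) (\<lambda>s. e * \<bar>?h s\<bar> + Gk k s)" for k
    unfolding Nk_def Gk_def
    by (rule log_bound_path[OF _ _ _ _ _ _ _ R' assms])
      (auto intro!: kernel_continuous bump kernel_noise_integral mollify_continuous \<mu>.finite_measure_axioms)
  have tip: "tendsto_in_prob M (\<lambda>k \<omega>. e * \<bar>ni ?h \<omega>\<bar> + Nk k \<omega>) (\<lambda>\<omega>. e * \<bar>ni ?h \<omega>\<bar> + N \<omega>)"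
    using Nk_tendsto_in_prob unfolding tendsto_in_prob_def by simp
  show ?thesis
  proof (rule log_bound_limit[OF assms(1) lb assms(3) _ _ tip])
    show "tendsto_in_prob M (\<lambda>m. ni ?h) (ni ?h)" by (simp add: tendsto_in_prob_def)
    show "AE s in lborel. s \<in> S \<longrightarrow> (\<lambda>m. e * \<bar>?h s\<bar> + Gk m s) \<longlonglongrightarrow> e * \<bar>?h s\<bar> + G s"
      by (intro AE_I2 impI tendsto_intros Gk_tendsto)
  qed (auto intro!: zero_ext_measurable_of simp: nonneg)
qed

lemma logarithmic_energy_le:
  assumes "\<alpha> = 1" "good t" "x > 0" and N: "prob {\<omega>\<in>space M. N \<omega> \<ge> x / 2} < 1 / 32"
  shows "ennreal (tail_const 1) * (\<integral>\<^sup>+s\<in>S. ennreal (\<bar>r (t - s)\<bar> *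
      lnp (x * \<bar>r (t - s)\<bar> / (48 * enn2real (energy (\<lambda>s. r (t - s))) * G s))) \<partial>lborel) \<le>
    4 * (\<integral>\<^sup>+\<omega>. ennreal \<bar>Y t \<omega>\<bar> * indicator {\<omega>. N \<omega> \<le> 4 * x} \<omega> \<partial>M) + 6 * energy (\<lambda>s. r (t - s))"
proof -
  let ?h = "\<lambda>s. r (t - s)"
  let ?F = "enn2real (energy ?h)"
  let ?B = "\<integral>\<^sup>+\<omega>. ennreal \<bar>Y t \<omega>\<bar> * indicator {\<omega>. N \<omega> \<le> 4 * x} \<omega> \<partial>M"
  have h: "?h \<in> L_space \<alpha> S" and hY: "AE \<omega> in M. ni ?h \<omega> = Y t \<omega>"
    using assms(2) by (auto simp: good_def)
  have [measurable]: "ni ?h \<in> borel_measurable M" by (rule ni_measurable[OF h])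
  have F: "ennreal ?F = energy ?h" using h by (simp add: L_space_iff less_top)
  obtain K where K: "K > 0" "prob {\<omega>\<in>space M. \<bar>ni ?h \<omega>\<bar> \<ge> K} < 1 / 32"
    using finite_rv_small_tail[of "\<lambda>\<omega>. \<bar>ni ?h \<omega>\<bar>" "1 / 32"] by auto
  \<comment> \<open>Outside an event of probability below 1/32 the additional term is at most x / 2.
    The regularized norm then reaches x with probability below 1/32 + 1/32 = 1/16, the threshold of
    \<open>log_bound\<close>, for every n.\<close>
  define e where "e = (\<lambda>n. x / (2 * K) * inverse (real (Suc n)))"
  have e0: "e n > 0" for n using K \<open>x > 0\<close> by (simp add: e_def)
  have e_lim: "e \<longlonglongrightarrow> 0"
    unfolding e_def by (rule tendsto_mult_right_zero[OF LIMSEQ_inverse_real_of_nat])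
  let ?I = "\<lambda>n s. ennreal (\<bar>?h s\<bar> * lnp (x * \<bar>?h s\<bar> / (48 * ?F * (e n * \<bar>?h s\<bar> + G s)))) * indicator S s"
  have S': "S \<in> sets borel" by (rule S)
  note [measurable] = S'
  have step: "ennreal (tail_const 1) * (\<integral>\<^sup>+s. ?I n s \<partial>lborel) \<le> 4 * ?B + 6 * energy ?h" for n
  proof -
    have "prob {\<omega>\<in>space M. e n * \<bar>ni ?h \<omega>\<bar> + N \<omega> \<ge> x} \<le>
        prob ({\<omega>\<in>space M. \<bar>ni ?h \<omega>\<bar> \<ge> K} \<union> {\<omega>\<in>space M. N \<omega> \<ge> x / 2})"
    proof (intro finite_measure_mono subsetI)
      fix \<omega> assume "\<omega> \<in> {\<omega>\<in>space M. e n * \<bar>ni ?h \<omega>\<bar> + N \<omega> \<ge> x}"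
      then have \<omega>: "\<omega> \<in> space M" "e n * \<bar>ni ?h \<omega>\<bar> + N \<omega> \<ge> x" by auto
      have "e n * K \<le> x / 2"
      proof -
        have "e n * K = (x / 2) * inverse (real (Suc n))" using K by (simp add: e_def)
        also have "\<dots> \<le> (x / 2) * 1"
          using \<open>x > 0\<close> by (intro mult_left_mono) (auto simp: inverse_le_1_iff)
        finally show ?thesis by simp
      qed
      moreover have "e n * \<bar>ni ?h \<omega>\<bar> \<le> e n * K" if "\<bar>ni ?h \<omega>\<bar> < K"
        using that e0[of n] by (intro mult_left_mono) auto
      ultimately show "\<omega> \<in> {\<omega>\<in>space M. \<bar>ni ?h \<omega>\<bar> \<ge> K} \<union> {\<omega>\<in>space M. N \<omega> \<ge> x / 2}"
        using \<omega> by fastforce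
    qed auto
    also have "\<dots> \<le> prob {\<omega>\<in>space M. \<bar>ni ?h \<omega>\<bar> \<ge> K} + prob {\<omega>\<in>space M. N \<omega> \<ge> x / 2}"
      by (rule measure_Un_le) auto
    also have "\<dots> < 1 / 16" using K(2) N by linarith
    finally have P: "prob {\<omega>\<in>space M. e n * \<bar>ni ?h \<omega>\<bar> + N \<omega> \<ge> x} < 1 / 16" .
    \<comment> \<open>\<open>log_bound\<close> is used with the levels x and 2 x, so the norm is
      truncated at 4 x.\<close>
    let ?T = "\<lambda>\<omega>. \<bar>ni ?h \<omega>\<bar> * indicator {\<omega>. e n * \<bar>ni ?h \<omega>\<bar> + N \<omega> \<le> 2 * (2 * x)} \<omega>"
    have lb: "ennreal (tail_const 1) * (\<integral>\<^sup>+s. ?I n s \<partial>lborel) \<le> ennreal (4 * expectation ?T + 6 * ?F)"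
      by (rule log_bound_regularized[OF assms(1) h e0[of n], unfolded log_bound_def, rule_format])
        (use P \<open>x > 0\<close> in simp_all)
    have [measurable]: "?T \<in> borel_measurable M"
      by (simp add: indicator_def) measurable
    have "ennreal (expectation ?T) \<le> (\<integral>\<^sup>+\<omega>. ennreal (?T \<omega>) \<partial>M)"
    proof -
      have "expectation ?T = enn2real (\<integral>\<^sup>+\<omega>. ennreal (?T \<omega>) \<partial>M)"
        by (rule integral_eq_nn_integral) auto
      then show ?thesis by (cases "\<integral>\<^sup>+\<omega>. ennreal (?T \<omega>) \<partial>M") auto
    qed
    also have "\<dots> \<le> ?B"
    proof (rule nn_integral_mono_AE)
      show "AE \<omega> in M. ennreal (?T \<omega>) \<le> ennreal \<bar>Y t \<omega>\<bar> * indicator {\<omega>. N \<omega> \<le> 4 * x} \<omega>"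
        using hY
      proof eventually_elim
        case (elim \<omega>)
        have "0 \<le> e n * \<bar>ni ?h \<omega>\<bar>" using e0[of n] by simp
        then show ?case using elim by (auto simp: indicator_def)
      qed
    qed
    finally have T: "ennreal (expectation ?T) \<le> ?B" .
    have "expectation ?T \<ge> 0" by (intro integral_nonneg_AE) auto
    then have "ennreal (4 * expectation ?T + 6 * ?F) = 4 * ennreal (expectation ?T) + 6 * energy ?h"
      by (simp add: ennreal_plus ennreal_mult F)
    also have "\<dots> \<le> 4 * ?B + 6 * energy ?h"
      using T by (intro add_right_mono mult_left_mono) auto
    finally show ?thesis using lb by order
  qed
  have "(\<integral>\<^sup>+s\<in>S. ennreal (\<bar>?h s\<bar> * lnp (x * \<bar>?h s\<bar> / (48 * ?F * G s))) \<partial>lborel) \<le> (\<integral>\<^sup>+s. liminf (\<lambda>n. ?I n s) \<partial>lborel)"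
  proof (rule nn_integral_mono)
    fix s
    show "ennreal (\<bar>?h s\<bar> * lnp (x * \<bar>?h s\<bar> / (48 * ?F * G s))) * indicator S s \<le> liminf (\<lambda>n. ?I n s)"
    \<comment> \<open>In the excluded cases the left-hand side is 0, by a vanishing factor or by the
      convention for division by 0. In the remaining one the denominator is positive and the
      regularized quotients converge.\<close>
    proof (cases "s \<in> S \<and> ?h s \<noteq> 0 \<and> ?F \<noteq> 0 \<and> G s \<noteq> 0")
      case False
      then have "ennreal (\<bar>?h s\<bar> * lnp (x * \<bar>?h s\<bar> / (48 * ?F * G s))) * indicator S s = 0"
        by (auto simp: lnp_def indicator_def)
      then show ?thesis by (simp only: zero_le)
    next
      case True
      have F0: "?F > 0" and G0: "G s > 0" using True nonneg by (auto simp: less_le)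
      have "(\<lambda>n. ennreal (\<bar>?h s\<bar> * lnp (x * \<bar>?h s\<bar> / (48 * ?F * (e n * \<bar>?h s\<bar> + G s))))) \<longlonglongrightarrow>
          ennreal (\<bar>?h s\<bar> * lnp (x * \<bar>?h s\<bar> / (48 * ?F * (0 * \<bar>?h s\<bar> + G s))))"
        using F0 G0 \<open>x > 0\<close> True by (intro tendsto_ennrealI tendsto_intros tendsto_lnp e_lim) auto
      then have "(\<lambda>n. ?I n s) \<longlonglongrightarrow> ennreal (\<bar>?h s\<bar> * lnp (x * \<bar>?h s\<bar> / (48 * ?F * G s)))"
        using True by simp
      then have "liminf (\<lambda>n. ?I n s) = ennreal (\<bar>?h s\<bar> * lnp (x * \<bar>?h s\<bar> / (48 * ?F * G s)))"
        by (rule lim_imp_Liminf[rotated]) simp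
      then show ?thesis using True by simp
    qed
  qed
  also have "\<dots> \<le> liminf (\<lambda>n. \<integral>\<^sup>+s. ?I n s \<partial>lborel)"
    by (intro nn_integral_liminf) measurable
  finally have "ennreal (tail_const 1) * (\<integral>\<^sup>+s\<in>S. ennreal (\<bar>?h s\<bar> * lnp (x * \<bar>?h s\<bar> / (48 * ?F * G s))) \<partial>lborel)
     \<le> ennreal (tail_const 1) * liminf (\<lambda>n. \<integral>\<^sup>+s. ?I n s \<partial>lborel)"
    by (rule mult_left_mono) simp
  also have "\<dots> = liminf (\<lambda>n. ennreal (tail_const 1) * (\<integral>\<^sup>+s. ?I n s \<partial>lborel))"
    by (rule Liminf_compose_continuous_mono[symmetric, of "\<lambda>z. ennreal (tail_const 1) * z"])
      (auto intro!: ennreal_continuous_on_cmult continuous_on_id monoI mult_left_mono)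
  also have "\<dots> \<le> liminf (\<lambda>n::nat. 4 * ?B + 6 * energy ?h)"
    using step by (intro Liminf_mono always_eventually) simp
  also have "\<dots> = 4 * ?B + 6 * energy ?h" by (simp add: Liminf_const)
  finally show ?thesis .
qed

text \<open>Where G s vanishes, r (t - s) is 0 for \<mu>-almost every t; Fubini exchanges the roles
  of t and s. So this factor of the denominator is positive wherever the integrand counts.\<close>

lemma AE_G_pos: "AE t in \<mu>. AE s in lborel. r (t - s) = 0 \<or> G s > 0"
proof -
  interpret P: pair_sigma_finite \<mu> lborel ..
  have "AE s in lborel. AE t in \<mu>. r (t - s) = 0 \<or> G s > 0"
  proof (rule AE_I2)
    fix s
    show "AE t in \<mu>. r (t - s) = 0 \<or> G s > 0"
    proof (cases "G s = 0")
      case True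
      then have "(\<integral>\<^sup>+t. ennreal \<bar>r (t - s)\<bar> \<partial>\<mu>) = 0" by (simp add: G_nn_integral)
      then have "AE t in \<mu>. ennreal \<bar>r (t - s)\<bar> = 0"
        by (subst (asm) nn_integral_0_iff_AE) auto
      then show ?thesis by eventually_elim auto
    qed (use nonneg(2)[of s] in auto)
  qed
  moreover have "{x \<in> space (\<mu> \<Otimes>\<^sub>M lborel). r (fst x - snd x) = 0 \<or> G (snd x) > 0} \<in> sets (\<mu> \<Otimes>\<^sub>M lborel)"
    by measurable
  ultimately show ?thesis by (subst P.AE_commute)
qed

lemma condition_eq_1_solution:
  assumes a1: "\<alpha> = 1"
  shows "condition_eq_1 S r \<psi>"
proof -
  define F where "F = (\<lambda>t. \<integral>\<^sup>+v\<in>S. ennreal \<bar>r (t - v)\<bar> \<partial>lborel)"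
  define T where "T = (\<integral>\<^sup>+t. F t \<partial>\<mu>)"
  have S': "S \<in> sets borel" by (rule S)
  note [measurable] = S'
  have energy: "energy (\<lambda>s. r (t - s)) = F t" for t
    unfolding energy_def F_def using a1 by simp
  have F_measurable[measurable]: "F \<in> borel_measurable borel"
    unfolding F_def by measurable
  \<comment> \<open>The condition for \<alpha> > 1 read at exponent 1, where the outer power is the
    identity.\<close>
  have T: "T < \<infinity>"
  proof -
    have p1: "ennreal_powr z 1 = z" for z by (cases z) (auto simp: ennreal_powr_def)
    show ?thesis
      using condition_gt_1_solution unfolding condition_gt_1_def T_def F_def a1 by (simp add: p1)
  qed
  obtain x where x: "x > 0" "prob {\<omega>\<in>space M. N \<omega> \<ge> x / 2} < 1 / 32"
  proof -
    obtain z where "z > 0" "prob {\<omega>\<in>space M. N \<omega> \<ge> z} < 1 / 32"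
      using finite_rv_small_tail[OF N_measurable, of "1 / 32"] by auto
    then show thesis by (intro that[of "2 * z"]) auto
  qed
  have ev: "{\<omega>. N \<omega> \<le> 4 * x} \<inter> space M \<in> events"
  proof -
    have "{\<omega>. N \<omega> \<le> 4 * x} \<inter> space M = {\<omega>\<in>space M. N \<omega> \<le> 4 * x}" by auto
    then show ?thesis by simp
  qed
  define B where "B = (\<lambda>t. \<integral>\<^sup>+\<omega>. ennreal \<bar>Y t \<omega>\<bar> * indicator {\<omega>. N \<omega> \<le> 4 * x} \<omega> \<partial>M)"
  have B: "(\<integral>\<^sup>+t. B t \<partial>\<mu>) \<le> ennreal (4 * x)" and [measurable]: "B \<in> borel_measurable borel"
    using integral_truncated_le[OF _ ev, of "4 * x"] x unfolding B_def by auto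
  define c where "c = tail_const 1"
  have c: "c > 0" unfolding c_def by (rule tail_const)
  define L where "L = (\<lambda>t s. ennreal (\<bar>r (t - s)\<bar> * lnp (x * \<bar>r (t - s)\<bar> / (48 * enn2real (F t) * G s))))"
  define b where "b = ennreal (lnp (48 * enn2real T / x))"
  let ?J = "\<lambda>t s. (if r (t - s) = 0 then 0 else ennreal \<bar>r (t - s)\<bar> *
      (1 + log_plus ((ennreal \<bar>r (t - s)\<bar> * T) / (F t * (\<integral>\<^sup>+x. ennreal \<bar>r (x - s)\<bar> \<partial>\<mu>)))))"
  have bound: "AE t in \<mu>. (\<integral>\<^sup>+s\<in>S. ?J t s \<partial>lborel) \<le> (1 + b) * F t + ennreal (1 / c) * (4 * B t + 6 * F t)"
    using AE_good AE_G_pos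
  proof eventually_elim
    case (elim t)
    have Ft: "F t < \<infinity>" using elim(1) by (simp add: good_def L_space_iff energy)
    have [measurable]: "L t \<in> borel_measurable borel" unfolding L_def by measurable
    \<comment> \<open>The counterpart of \<open>AE_G_pos\<close> for the other factor of the
      denominator: if F t vanishes, then r (t - s) is 0 for almost every s in S.\<close>
    have F0: "AE s in lborel. s \<in> S \<longrightarrow> r (t - s) = 0 \<or> F t \<noteq> 0"
    proof (cases "F t = 0")
      case True
      then have "AE s in lborel. ennreal \<bar>r (t - s)\<bar> * indicator S s = 0"
        unfolding F_def by (subst (asm) nn_integral_0_iff_AE) auto
      then show ?thesis by eventually_elim (auto simp: indicator_def)
    qed auto
    have "(\<integral>\<^sup>+s\<in>S. ?J t s \<partial>lborel) \<le> (\<integral>\<^sup>+s. (1 + b) * (ennreal \<bar>r (t - s)\<bar> * indicator S s) + L t s * indicator S s \<partial>lborel)"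
    proof (rule nn_integral_mono_AE)
      show "AE s in lborel. ?J t s * indicator S s \<le> (1 + b) * (ennreal \<bar>r (t - s)\<bar> * indicator S s) + L t s * indicator S s"
        using F0 elim(2)
      proof eventually_elim
        case (elim s)
        show ?case
        proof (cases "s \<in> S \<and> r (t - s) \<noteq> 0")
          case True
          then have G0: "G s > 0" and F1: "enn2real (F t) > 0"
            using elim Ft by (auto simp: enn2real_positive_iff zero_less_iff_neq_zero)
          have "log_plus ((ennreal \<bar>r (t - s)\<bar> * T) / (F t * ennreal (G s))) =
              log_plus ((ennreal \<bar>r (t - s)\<bar> * ennreal (enn2real T)) / (ennreal (enn2real (F t)) * ennreal (G s)))"
            using Ft T by (simp add: less_top)
          also have "\<dots> \<le> b + ennreal (lnp (x * \<bar>r (t - s)\<bar> / (48 * enn2real (F t) * G s)))"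
            unfolding b_def using True by (intro log_plus_quotient_le F1 G0 x enn2real_nonneg) auto
          finally have "ennreal \<bar>r (t - s)\<bar> * (1 + log_plus ((ennreal \<bar>r (t - s)\<bar> * T) / (F t * ennreal (G s)))) \<le>
              ennreal \<bar>r (t - s)\<bar> * (1 + (b + ennreal (lnp (x * \<bar>r (t - s)\<bar> / (48 * enn2real (F t) * G s)))))"
            by (intro mult_left_mono add_left_mono) auto
          also have "\<dots> = (1 + b) * ennreal \<bar>r (t - s)\<bar> + L t s"
            unfolding L_def by (simp add: ennreal_mult lnp_nonneg distrib_left distrib_right mult.commute add.assoc)
          finally show ?thesis using True by (simp add: G_nn_integral)
        qed auto
      qed
    qed
    also have "\<dots> = (\<integral>\<^sup>+s. (1 + b) * (ennreal \<bar>r (t - s)\<bar> * indicator S s) \<partial>lborel) + (\<integral>\<^sup>+s\<in>S. L t s \<partial>lborel)"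
      by (rule nn_integral_add) measurable
    also have "(\<integral>\<^sup>+s. (1 + b) * (ennreal \<bar>r (t - s)\<bar> * indicator S s) \<partial>lborel) = (1 + b) * F t"
      unfolding F_def by (rule nn_integral_cmult) measurable
    also have "(\<integral>\<^sup>+s\<in>S. L t s \<partial>lborel) \<le> ennreal (1 / c) * (4 * B t + 6 * F t)"
    proof -
      have "ennreal c * (\<integral>\<^sup>+s\<in>S. L t s \<partial>lborel) \<le> 4 * B t + 6 * F t"
        using logarithmic_energy_le[OF a1 elim(1) x] unfolding energy c_def L_def B_def .
      then have "ennreal (1 / c) * (ennreal c * (\<integral>\<^sup>+s\<in>S. L t s \<partial>lborel)) \<le> ennreal (1 / c) * (4 * B t + 6 * F t)"
        by (rule mult_left_mono) simp
      moreover have "ennreal (1 / c) * (ennreal c * z) = z" for z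
        using c by (simp add: mult.assoc[symmetric] ennreal_mult[symmetric])
      ultimately show ?thesis by simp
    qed
    finally show ?case by (simp add: add_left_mono)
  qed
  have "(\<integral>\<^sup>+t. (\<integral>\<^sup>+s\<in>S. ?J t s \<partial>lborel) \<partial>\<mu>) \<le> (\<integral>\<^sup>+t. (1 + b) * F t + ennreal (1 / c) * (4 * B t + 6 * F t) \<partial>\<mu>)"
    by (rule nn_integral_mono_AE[OF bound])
  also have "\<dots> = (1 + b) * T + ennreal (1 / c) * (4 * (\<integral>\<^sup>+t. B t \<partial>\<mu>) + 6 * T)"
    unfolding T_def by (simp add: nn_integral_add nn_integral_cmult)
  also have "\<dots> < \<infinity>"
    using T B order_le_less_trans[OF B ennreal_less_top]
    by (simp add: ennreal_mult_less_top ennreal_add_less_top b_def)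
  finally show ?thesis
    unfolding condition_eq_1_def Let_def T_def F_def .
qed

end

theorem theorem5p1:
  fixes M :: "'w measure"
    and \<alpha> :: real
    and S :: "'a::euclidean_space set"
    and W :: "'a set \<Rightarrow> 'w \<Rightarrow> real"
    and I :: "'a list set" and a :: "'a list \<Rightarrow> 'a \<Rightarrow> real"
    and \<rho> :: "('a \<Rightarrow> real) \<Rightarrow> real"
    and Y :: "'a \<Rightarrow> 'w \<Rightarrow> real"
  assumes "prob_space M"
    and "0 < \<alpha>" and "\<alpha> < 2"
    and "S \<in> sets borel" and "emeasure lborel S > 0"
    and "stable_white_noise M \<alpha> S W"
    and "partial_diff_op I a"
    and "fundamental_solution I a \<rho>"
    and "\<forall>\<phi>\<in>test_functions. conv_reflected \<phi> \<rho> \<in> L_space \<alpha> S"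
    and "random_field_representation M (gen_solution M \<alpha> S W \<rho>) Y"
  shows "\<exists>r. represented_by \<rho> r \<and>
    (AE t in lborel. (\<lambda>s. r (t - s)) \<in> L_space \<alpha> S) \<and>
    (AE t in lborel. AE \<omega> in M. Y t \<omega> = mild_solution M \<alpha> S W r t \<omega>) \<and>
    (\<forall>\<psi>\<in>test_functions.
       (\<alpha> > 1 \<longrightarrow> condition_gt_1 \<alpha> S r \<psi>) \<and>
       (\<alpha> = 1 \<longrightarrow> condition_eq_1 S r \<psi>) \<and>
       (\<alpha> < 1 \<longrightarrow> condition_lt_1 \<alpha> S r \<psi>))"
proof -
  interpret prob_space M by fact
  note rep = assms(10)[unfolded random_field_representation_def gen_solution_def]
  obtain N0 where N0: "{\<omega>\<in>space M. \<not> locally_integrable (\<lambda>t. Y t \<omega>)} \<subseteq> N0" "N0 \<in> null_sets M"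
    using rep by (auto elim: AE_E simp: null_sets_def)
  \<comment> \<open>Setting the field to 0 on the null set N0 makes it locally integrable at every
    \<omega>. Joint measurability is kept because N0 is measurable, and for each t the two fields
    agree almost surely.\<close>
  define Y' where "Y' = (\<lambda>t \<omega>. indicator (space M - N0) \<omega> * Y t \<omega>)"
  have [measurable]: "N0 \<in> sets M" using N0(2) by auto
  have ae: "AE \<omega> in M. \<omega> \<in> space M - N0"
    using AE_not_in[OF N0(2)] AE_space by eventually_elim auto
  interpret stable_noise M \<alpha> S W
    by unfold_locales (use assms in auto)
  interpret random_field_solution M \<alpha> S W \<rho> Y'
  proof
    show "emeasure lborel S > 0" by fact
    show "distribution \<rho>" using assms(8) by (simp add: fundamental_solution_def)
    show "\<phi> \<in> test_functions \<Longrightarrow> conv_reflected \<phi> \<rho> \<in> L_space \<alpha> S" for \<phi> using assms(9) by blast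
    have [measurable]: "(\<lambda>p. Y (fst p) (snd p)) \<in> borel_measurable (lborel \<Otimes>\<^sub>M M)"
      using rep by (simp add: case_prod_beta')
    show "(\<lambda>(t, \<omega>). Y' t \<omega>) \<in> borel_measurable (lborel \<Otimes>\<^sub>M M)"
      unfolding Y'_def case_prod_beta' by measurable
    show "locally_integrable (\<lambda>t. Y' t \<omega>)" if "\<omega> \<in> space M" for \<omega>
    proof (cases "\<omega> \<in> N0")
      case True
      then show ?thesis by (simp add: Y'_def locally_integrable_def set_integrable_def)
    next
      case False
      then show ?thesis using that N0(1) by (auto simp: Y'_def)
    qed
    show "AE \<omega> in M. ni (conv_reflected \<phi> \<rho>) \<omega> = (\<integral>t. Y' t \<omega> * \<phi> t \<partial>lborel)" if "\<phi> \<in> test_functions" for \<phi>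
    proof -
      have "AE \<omega> in M. ni (conv_reflected \<phi> \<rho>) \<omega> = (\<integral>t. Y t \<omega> * \<phi> t \<partial>lborel)"
        using rep that by blast
      then show ?thesis using ae by eventually_elim (simp add: Y'_def)
    qed
  qed
  have YY': "AE \<omega> in M. Y' t \<omega> = Y t \<omega>" for t
    using ae by eventually_elim (simp add: Y'_def)
  show ?thesis
  proof (intro exI[of _ r] conjI ballI impI)
    show "represented_by \<rho> r" by (rule represented_by_r)
    show "AE t in lborel. (\<lambda>s. r (t - s)) \<in> L_space \<alpha> S"
      using AE_noise_integral_r by eventually_elim simp
    show "AE t in lborel. AE \<omega> in M. Y t \<omega> = mild_solution M \<alpha> S W r t \<omega>"
      using AE_noise_integral_r
    proof eventually_elim
      case (elim t)
      then have "AE \<omega> in M. ni (\<lambda>s. r (t - s)) \<omega> = Y' t \<omega>" by blast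
      then show ?case using YY'[of t] by eventually_elim (simp add: mild_solution_def)
    qed
    fix \<psi> :: "'a \<Rightarrow> real" assume "\<psi> \<in> test_functions"
    then interpret weighted_solution M \<alpha> S W \<rho> Y' \<psi> by unfold_locales
    show "condition_gt_1 \<alpha> S r \<psi>" by (rule condition_gt_1_solution)
    show "\<alpha> = 1 \<Longrightarrow> condition_eq_1 S r \<psi>" by (rule condition_eq_1_solution)
    show "condition_lt_1 \<alpha> S r \<psi>" by (rule condition_lt_1_solution)
  qed
qed

end
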